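(* Let $\mathcal{U}$ be a free ultrafilter on $\mathbb{N}$ and let $\mathcal{Q} = \prod_{n \to \mathcal{U}} M_n(\mathbb{C})$. Then $h^{\mathcal{U}}(\mathcal{Q}:\mathcal{Q}) = \infty$ and $\operatorname{Ent}^{\mathcal{U}}(\mathcal{Q}:\mathcal{Q}) = \infty$. Hence, $\mathcal{Q}$ is not strongly $1$-bounded.
   Context: **Basics.** A tracial $\mathrm{W}^*$-algebra $\mathcal{M}=(M,\tau)$ is a $\mathrm{W}^*$-algebra with a faithful normal tracial state; $L^\infty(\mathcal{M}):=M$, $\|x\|_2=\tau(x^*x)^{1/2}$, $d^{\mathcal{M}}(x,y)=\|x-y\|_2$, and $D_r^{\mathcal{M}}$ is the closed operator-norm ball of radius $r$. $M_n(\mathbb{C})$ carries the normalized trace. Subalgebras are unital with the restricted trace; $\mathrm{W}^*(\mathbf{X})$ is the $\mathrm{W}^*$-subalgebra generated by $\mathbf{X}$. $\prod_{n\to\mathcal{U}}M_n(\mathbb{C})$ is the tracial ultraproduct. Convention: $\log 0=-\infty$. **Orbital covering numbers.** For an index set $I$, $\Omega\subseteq M_n(\mathbb{C})^I$, finite $F\subseteq I$ and $\epsilon>0$, $K^{\mathrm{orb}}_{F,\epsilon}(\Omega)$ is the minimal cardinality of a set $\Omega'\subseteq M_n(\mathbb{C})^I$ such that for every $\mathbf{Y}\in\Omega$ there are a unitary $U\in M_n(\mathbb{C})$ and $\mathbf{X}\in\Omega'$ with $\|Y_i-UX_iU^*\|_2<\epsilon$ for all $i\in F$. **$1$-bounded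 entropy in the presence (Hayes).** Let $\mathbf{X}\in L^\infty(\mathcal{M})^I$, $\mathbf{Y}\in L^\infty(\mathcal{M})^J$ ($I,J$ arbitrary index sets), $\mathbf{r}\in(0,\infty)^I$, $\mathbf{r}'\in(0,\infty)^J$ with $\|X_i\|\le r_i$, $\|Y_j\|\le r_j'$. The non-commutative law of a tuple is the map $p\mapsto\tau(p(\text{tuple}))$ on non-commutative $*$-polynomials. Let $\Sigma_{\mathbf{r},\mathbf{r}'}$ be the set of laws of tuples in $\prod_{i\in I} D_{r_i}\times\prod_{j\in J} D_{r_j'}$ of tracial $\mathrm{W}^*$-algebras, with the topology of pointwise convergence on $*$-polynomials. For $\mathcal{O}\subseteq\Sigma_{\mathbf{r},\mathbf{r}'}$ let $\Gamma^{(n)}_{\mathbf{r},\mathbf{r}'}(\mathcal{O})$ be the set of tuples in $\prod_i D_{r_i}^{M_n(\mathbb{C})}\times\prod_j D_{r_j'}^{M_n(\mathbb{C})}$ whose law lies in $\mathcal{O}$, and let $p$ be the projection onto the $I$-coordinates. Put $$h^{\mathcal{U}}_{\mathbf{r},\mathbf{r}'}(\mathbf{X}:\mathbf{Y})=\sup_{\epsilon>0}\ \sup_{F\subseteq I\text{ finite}}\ \inf_{\mathcal{O}}\ \lim_{n\to\mathcal{U}}\frac1{n^2}\log K^{\mathrm{orb}}_{F,\epsilon}\big(p[\Gamma^{(n)}_{\mathbf{r},\mathbf{r}'}(\mathcal{O})]\big),$$ with $\mathcal{O}$ ranging over neighborhoods of the law of $(\mathbf{X},\mathbf{Y})$. For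 $\mathcal{N}\subseteq\mathcal{M}$, $h^{\mathcal{U}}(\mathcal{N}:\mathcal{M}):=h^{\mathcal{U}}_{\mathbf{r},\mathbf{r}'}(\mathbf{X}:\mathbf{Y})$ for any $\mathbf{X},\mathbf{Y}$ with $\mathrm{W}^*(\mathbf{X})=\mathcal{N}$, $\mathrm{W}^*(\mathbf{X},\mathbf{Y})=\mathcal{M}$ (the value does not depend on the choices). $h(\mathcal{M})$ is the supremum of $h^{\mathcal{V}}(\mathcal{M}:\mathcal{M})$ over free ultrafilters $\mathcal{V}$ on $\mathbb{N}$, and $\mathcal{M}$ is strongly $1$-bounded if $h(\mathcal{M})<\infty$. **Types.** Formulas (in the language of tracial $\mathrm{W}^*$-algebras) are obtained from the basic formulas $\operatorname{Re}\operatorname{tr}(p)$, $\operatorname{Im}\operatorname{tr}(p)$ ($p$ a non-commutative $*$-polynomial in finitely many variables) by iterating: applying continuous functions $\mathbb{R}^k\to\mathbb{R}$, and taking $\inf_{x\in D_r}$ or $\sup_{x\in D_r}$ ($0<r<\infty$) in one variable. A formula $\phi$ with free variables among $(x_j)_{j\in\mathbb{N}}$ has the obvious interpretation $\phi^{\mathcal{M}}:L^\infty(\mathcal{M})^{\mathbb{N}}\to\mathbb{R}$. The type of $\mathbf{X}\in L^\infty(\mathcal{M})^{\mathbb{N}}$ is the map $\operatorname{tp}^{\mathcal{M}}(\mathbf{X}):\phi\mapsto\phi^{\mathcal{M}}(\mathbf{X})$. $\mathbb{S}(\mathrm{T}_{\mathrm{tr}})$ is the set of all types of $\mathbb{N}$-tuples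 in tracial $\mathrm{W}^*$-algebras; for $\mathbf{r}\in(0,\infty)^{\mathbb{N}}$, $\mathbb{S}_{\mathbf{r}}(\mathrm{T}_{\mathrm{tr}})$ is the set of types of tuples in $\prod_j D_{r_j}$, with the topology of pointwise convergence on formulas. $\mathcal{O}\subseteq\mathbb{S}(\mathrm{T}_{\mathrm{tr}})$ is open iff $\mathcal{O}\cap\mathbb{S}_{\mathbf{r}}(\mathrm{T}_{\mathrm{tr}})$ is open in $\mathbb{S}_{\mathbf{r}}(\mathrm{T}_{\mathrm{tr}})$ for every $\mathbf{r}$. **Covering entropy.** For $\mathcal{K}\subseteq\mathbb{S}(\mathrm{T}_{\mathrm{tr}})$, $\Gamma^{(n)}_{\mathbf{r}}(\mathcal{K})=\{\mathbf{X}\in\prod_jD_{r_j}^{M_n(\mathbb{C})}:\operatorname{tp}^{M_n(\mathbb{C})}(\mathbf{X})\in\mathcal{K}\}$, $$\operatorname{Ent}^{\mathcal{U}}_{\mathbf{r},F,\epsilon}(\mathcal{K})=\inf_{\text{open }\mathcal{O}\supseteq\mathcal{K}}\lim_{n\to\mathcal{U}}\frac1{n^2}\log K^{\mathrm{orb}}_{F,\epsilon}(\Gamma^{(n)}_{\mathbf{r}}(\mathcal{O})),\qquad \operatorname{Ent}^{\mathcal{U}}(\mathcal{K})=\sup_{\mathbf{r},F,\epsilon}\operatorname{Ent}^{\mathcal{U}}_{\mathbf{r},F,\epsilon}(\mathcal{K}),$$ (over $\mathbf{r}\in(0,\infty)^{\mathbb{N}}$, finite $F\subseteq\mathbb{N}$,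 $\epsilon>0$), $\operatorname{Ent}^{\mathcal{U}}(\mu)=\operatorname{Ent}^{\mathcal{U}}(\{\mu\})$, and for $\mathcal{N}\subseteq\mathcal{M}$, $\operatorname{Ent}^{\mathcal{U}}(\mathcal{N}:\mathcal{M})=\sup_{\mathbf{X}\in L^\infty(\mathcal{N})^{\mathbb{N}}}\operatorname{Ent}^{\mathcal{U}}(\operatorname{tp}^{\mathcal{M}}(\mathbf{X}))$. *)

theory Defs
  imports
    "HOL-Analysis.Abstract_Euclidean_Space"
    "HOL-Analysis.Function_Topology"
    "HOL-Library.Extended_Real"
    "HOL-Library.Poly_Mapping"
    "HOL-Library.FuncSet"
    "Jordan_Normal_Form.Schur_Decomposition"
begin

section \<open>Tracial W*-algebras\<close>

text \<open>The norm and the trace are part of the structure, so that one record type serves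
  abstract algebras, matrix algebras and ultraproducts.\<close>

record 'a star_alg = "'a ring" +
  scal :: "complex \<Rightarrow> 'a \<Rightarrow> 'a"
  star :: "'a \<Rightarrow> 'a"
  cnorm :: "'a \<Rightarrow> real"
  tr :: "'a \<Rightarrow> complex"

locale cstar_algebra = ring M for M :: "'a star_alg" (structure) +
  assumes scal_closed: "x \<in> carrier M \<Longrightarrow> scal M c x \<in> carrier M"
    and scal_add_right: "x \<in> carrier M \<Longrightarrow> y \<in> carrier M \<Longrightarrow>
      scal M c (x \<oplus> y) = scal M c x \<oplus> scal M c y"
    and scal_add_left: "x \<in> carrier M \<Longrightarrow> scal M (c + d) x = scal M c x \<oplus> scal M d x"
    and scal_scal: "x \<in> carrier M \<Longrightarrow> scal M c (scal M d x) = scal M (c * d) x"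
    and scal_one: "x \<in> carrier M \<Longrightarrow> scal M 1 x = x"
    and scal_mult_left: "x \<in> carrier M \<Longrightarrow> y \<in> carrier M \<Longrightarrow>
      scal M c x \<otimes> y = scal M c (x \<otimes> y)"
    and scal_mult_right: "x \<in> carrier M \<Longrightarrow> y \<in> carrier M \<Longrightarrow>
      x \<otimes> scal M c y = scal M c (x \<otimes> y)"
    and star_closed: "x \<in> carrier M \<Longrightarrow> star M x \<in> carrier M"
    and star_add: "x \<in> carrier M \<Longrightarrow> y \<in> carrier M \<Longrightarrow> star M (x \<oplus> y) = star M x \<oplus> star M y"
    and star_scal: "x \<in> carrier M \<Longrightarrow> star M (scal M c x) = scal M (cnj c) (star M x)"
    and star_mult: "x \<in> carrier M \<Longrightarrow> y \<in> carrier M \<Longrightarrow> star M (x \<otimes> y) = star M y \<otimes> star M x"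
    and star_star: "x \<in> carrier M \<Longrightarrow> star M (star M x) = x"
    and cnorm_nonneg: "x \<in> carrier M \<Longrightarrow> 0 \<le> cnorm M x"
    and cnorm_eq_0: "x \<in> carrier M \<Longrightarrow> cnorm M x = 0 \<longleftrightarrow> x = \<zero>"
    and cnorm_triangle: "x \<in> carrier M \<Longrightarrow> y \<in> carrier M \<Longrightarrow> cnorm M (x \<oplus> y) \<le> cnorm M x + cnorm M y"
    and cnorm_scal: "x \<in> carrier M \<Longrightarrow> cnorm M (scal M c x) = cmod c * cnorm M x"
    and cnorm_mult: "x \<in> carrier M \<Longrightarrow> y \<in> carrier M \<Longrightarrow> cnorm M (x \<otimes> y) \<le> cnorm M x * cnorm M y"
    and cstar_identity: "x \<in> carrier M \<Longrightarrow> cnorm M (star M x \<otimes> x) = (cnorm M x)\<^sup>2"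
    and cnorm_complete: "(\<And>n. s n \<in> carrier M) \<Longrightarrow>
      (\<forall>e>0. \<exists>n0::nat. \<forall>m\<ge>n0. \<forall>n\<ge>n0. cnorm M (s m \<ominus> s n) < e) \<Longrightarrow>
      \<exists>x\<in>carrier M. (\<lambda>n. cnorm M (s n \<ominus> x)) \<longlonglongrightarrow> 0"

definition linear_functional :: "'a star_alg \<Rightarrow> ('a \<Rightarrow> complex) \<Rightarrow> bool" where
  "linear_functional M \<phi> \<longleftrightarrow>
     (\<forall>x\<in>carrier M. \<forall>y\<in>carrier M. \<phi> (x \<oplus>\<^bsub>M\<^esub> y) = \<phi> x + \<phi> y) \<and>
     (\<forall>x\<in>carrier M. \<forall>c. \<phi> (scal M c x) = c * \<phi> x)"

text \<open>The Banach space dual; functionals are extensional outside the carrier so that they are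
  determined by their values on the algebra.\<close>

definition dual :: "'a star_alg \<Rightarrow> ('a \<Rightarrow> complex) set" where
  "dual M = {\<phi> \<in> extensional (carrier M).
     linear_functional M \<phi> \<and> (\<exists>C. \<forall>x\<in>carrier M. cmod (\<phi> x) \<le> C * cnorm M x)}"

definition dual_norm :: "'a star_alg \<Rightarrow> ('a \<Rightarrow> complex) \<Rightarrow> real" where
  "dual_norm M \<phi> = Sup {cmod (\<phi> x) | x. x \<in> carrier M \<and> cnorm M x \<le> 1}"

text \<open>A predual, realised inside the dual: a norm-closed subspace \<open>P\<close> for which the evaluation map
  from \<open>M\<close> to the Banach space dual of \<open>P\<close> is an isometric bijection. Any isometric isomorphism of
  \<open>M\<close> with the dual of a Banach space \<open>E\<close> yields such a \<open>P\<close>, namely the canonical image of \<open>E\<close> in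
  the bidual of \<open>E\<close>, so the existence of \<open>P\<close> is Sakai's definition of a W*-algebra.\<close>

definition predual :: "'a star_alg \<Rightarrow> ('a \<Rightarrow> complex) set \<Rightarrow> bool" where
  "predual M P \<longleftrightarrow>
     P \<subseteq> dual M \<and>
     (\<lambda>x\<in>carrier M. 0) \<in> P \<and>
     (\<forall>\<phi>\<in>P. \<forall>\<psi>\<in>P. (\<lambda>x\<in>carrier M. \<phi> x + \<psi> x) \<in> P) \<and>
     (\<forall>\<phi>\<in>P. \<forall>c. (\<lambda>x\<in>carrier M. c * \<phi> x) \<in> P) \<and>
     (\<forall>\<phi>\<in>dual M. (\<forall>e>0. \<exists>\<psi>\<in>P. dual_norm M (\<lambda>x\<in>carrier M. \<phi> x - \<psi> x) < e) \<longrightarrow> \<phi> \<in> P) \<and>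
     (\<forall>x\<in>carrier M. cnorm M x = Sup {cmod (\<phi> x) | \<phi>. \<phi> \<in> P \<and> dual_norm M \<phi> \<le> 1}) \<and>
     (\<forall>f :: ('a \<Rightarrow> complex) \<Rightarrow> complex.
        (\<forall>\<phi>\<in>P. \<forall>\<psi>\<in>P. f (\<lambda>x\<in>carrier M. \<phi> x + \<psi> x) = f \<phi> + f \<psi>) \<and>
        (\<forall>\<phi>\<in>P. \<forall>c. f (\<lambda>x\<in>carrier M. c * \<phi> x) = c * f \<phi>) \<and>
        (\<exists>C. \<forall>\<phi>\<in>P. cmod (f \<phi>) \<le> C * dual_norm M \<phi>) \<longrightarrow>
        (\<exists>x\<in>carrier M. \<forall>\<phi>\<in>P. f \<phi> = \<phi> x))"

definition self_adjoints :: "'a star_alg \<Rightarrow> 'a set" where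
  "self_adjoints M = {x \<in> carrier M. star M x = x}"

definition op_le :: "'a star_alg \<Rightarrow> 'a \<Rightarrow> 'a \<Rightarrow> bool" where
  "op_le M x y \<longleftrightarrow> (\<exists>z\<in>carrier M. y \<ominus>\<^bsub>M\<^esub> x = star M z \<otimes>\<^bsub>M\<^esub> z)"

definition increasing_net_sup :: "'a star_alg \<Rightarrow> 'a set \<Rightarrow> 'a \<Rightarrow> bool" where
  "increasing_net_sup M D s \<longleftrightarrow>
     D \<noteq> {} \<and> D \<subseteq> self_adjoints M \<and> s \<in> self_adjoints M \<and>
     (\<forall>x\<in>D. \<forall>y\<in>D. \<exists>z\<in>D. op_le M x z \<and> op_le M y z) \<and>
     (\<forall>x\<in>D. op_le M x s) \<and>
     (\<forall>u\<in>self_adjoints M. (\<forall>x\<in>D. op_le M x u) \<longrightarrow> op_le M s u)"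

definition normal_functional :: "'a star_alg \<Rightarrow> ('a \<Rightarrow> complex) \<Rightarrow> bool" where
  "normal_functional M \<phi> \<longleftrightarrow>
     linear_functional M \<phi> \<and> (\<exists>C. \<forall>x\<in>carrier M. cmod (\<phi> x) \<le> C * cnorm M x) \<and>
     (\<forall>D s. increasing_net_sup M D s \<longrightarrow>
        (\<forall>e>0. \<exists>x\<in>D. \<forall>y\<in>D. op_le M x y \<longrightarrow> cmod (\<phi> y - \<phi> s) < e))"

definition wstar_algebra :: "'a star_alg \<Rightarrow> bool" where
  "wstar_algebra M \<longleftrightarrow> cstar_algebra M \<and> (\<exists>P. predual M P)"

definition faithful_normal_tracial_state :: "'a star_alg \<Rightarrow> ('a \<Rightarrow> complex) \<Rightarrow> bool" where
  "faithful_normal_tracial_state M \<tau> \<longleftrightarrow>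
     normal_functional M \<tau> \<and>
     \<tau> \<one>\<^bsub>M\<^esub> = 1 \<and>
     (\<forall>x\<in>carrier M. Im (\<tau> (star M x \<otimes>\<^bsub>M\<^esub> x)) = 0 \<and> 0 \<le> Re (\<tau> (star M x \<otimes>\<^bsub>M\<^esub> x))) \<and>
     (\<forall>x\<in>carrier M. \<forall>y\<in>carrier M. \<tau> (x \<otimes>\<^bsub>M\<^esub> y) = \<tau> (y \<otimes>\<^bsub>M\<^esub> x)) \<and>
     (\<forall>x\<in>carrier M. \<tau> (star M x \<otimes>\<^bsub>M\<^esub> x) = 0 \<longrightarrow> x = \<zero>\<^bsub>M\<^esub>)"

definition tracial_wstar_algebra :: "'a star_alg \<Rightarrow> bool" where
  "tracial_wstar_algebra M \<longleftrightarrow> wstar_algebra M \<and> faithful_normal_tracial_state M (tr M)"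

definition norm2 :: "'a star_alg \<Rightarrow> 'a \<Rightarrow> real" where
  "norm2 M x = sqrt (Re (tr M (star M x \<otimes>\<^bsub>M\<^esub> x)))"

definition op_ball :: "'a star_alg \<Rightarrow> real \<Rightarrow> 'a set" where
  "op_ball M r = {x \<in> carrier M. cnorm M x \<le> r}"

text \<open>The topology induced by the normal functionals, that is, the weak-* topology of the (unique)
  predual.\<close>

definition ultraweak :: "'a star_alg \<Rightarrow> 'a topology" where
  "ultraweak M = topology_generated_by
     {{x \<in> carrier M. \<phi> x \<in> V} | \<phi> V. normal_functional M \<phi> \<and> open V}"

definition wstar_subalgebra :: "'a star_alg \<Rightarrow> 'a set \<Rightarrow> bool" where
  "wstar_subalgebra M N \<longleftrightarrow>
     N \<subseteq> carrier M \<and> \<one>\<^bsub>M\<^esub> \<in> N \<and>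
     (\<forall>x\<in>N. \<forall>y\<in>N. x \<oplus>\<^bsub>M\<^esub> y \<in> N \<and> x \<otimes>\<^bsub>M\<^esub> y \<in> N) \<and>
     (\<forall>x\<in>N. \<forall>c. scal M c x \<in> N) \<and>
     (\<forall>x\<in>N. star M x \<in> N) \<and>
     closedin (ultraweak M) N"

definition wstar_generated :: "'a star_alg \<Rightarrow> 'a set \<Rightarrow> 'a set" where
  "wstar_generated M S = \<Inter>{N. wstar_subalgebra M N \<and> S \<subseteq> N}"


section \<open>Matrix algebras and tracial ultraproducts\<close>

definition vec_norm2 :: "complex vec \<Rightarrow> real" where
  "vec_norm2 v = sqrt (Re (v \<bullet>c v))"

definition mat_op_norm :: "nat \<Rightarrow> complex mat \<Rightarrow> real" where
  "mat_op_norm n A = Sup {vec_norm2 (A *\<^sub>v v) | v. v \<in> carrier_vec n \<and> vec_norm2 v \<le> 1}"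

text \<open>For \<open>n = 0\<close> this is the zero algebra, which has no tracial state; a free ultrafilter
  ignores this index.\<close>

definition mat_alg :: "nat \<Rightarrow> complex mat star_alg" where
  "mat_alg n = \<lparr>
     carrier = carrier_mat n n,
     monoid.mult = (*),
     one = 1\<^sub>m n,
     zero = 0\<^sub>m n n,
     add = (+),
     scal = (\<lambda>c A. c \<cdot>\<^sub>m A),
     star = mat_adjoint,
     cnorm = mat_op_norm n,
     tr = (\<lambda>A. (\<Sum>i<n. A $$ (i, i)) / of_nat n)\<rparr>"

definition unitaries :: "nat \<Rightarrow> complex mat set" where
  "unitaries n = {V \<in> carrier_mat n n. mat_adjoint V * V = 1\<^sub>m n \<and> V * mat_adjoint V = 1\<^sub>m n}"

definition free_ultrafilter :: "nat filter \<Rightarrow> bool" where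
  "free_ultrafilter U \<longleftrightarrow>
     U \<noteq> bot \<and>
     (\<forall>P. eventually P U \<or> eventually (\<lambda>n. \<not> P n) U) \<and>
     (\<forall>k. eventually (\<lambda>n. n \<noteq> k) U)"

definition bounded_seqs :: "(nat \<Rightarrow> 'a star_alg) \<Rightarrow> (nat \<Rightarrow> 'a) set" where
  "bounded_seqs M = {x. (\<forall>n. x n \<in> carrier (M n)) \<and> (\<exists>C. \<forall>n. cnorm (M n) (x n) \<le> C)}"

definition ultra_class :: "nat filter \<Rightarrow> (nat \<Rightarrow> 'a star_alg) \<Rightarrow> (nat \<Rightarrow> 'a) \<Rightarrow> (nat \<Rightarrow> 'a) set" where
  "ultra_class U M x =
     {y \<in> bounded_seqs M. ((\<lambda>n. norm2 (M n) (x n \<ominus>\<^bsub>M n\<^esub> y n)) \<longlongrightarrow> 0) U}"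

definition representative :: "(nat \<Rightarrow> 'a) set \<Rightarrow> nat \<Rightarrow> 'a" where
  "representative A = (SOME x. x \<in> A)"

text \<open>The quotient of the bounded sequences by those with 2-norm tending to 0 along the ultrafilter,
  with the pointwise operations, the quotient norm and the limit trace.\<close>

definition tracial_ultraproduct ::
    "nat filter \<Rightarrow> (nat \<Rightarrow> 'a star_alg) \<Rightarrow> (nat \<Rightarrow> 'a) set star_alg" where
  "tracial_ultraproduct U M = \<lparr>
     carrier = ultra_class U M ` bounded_seqs M,
     monoid.mult = (\<lambda>A B. ultra_class U M (\<lambda>n. representative A n \<otimes>\<^bsub>M n\<^esub> representative B n)),
     one = ultra_class U M (\<lambda>n. \<one>\<^bsub>M n\<^esub>),
     zero = ultra_class U M (\<lambda>n. \<zero>\<^bsub>M n\<^esub>),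
     add = (\<lambda>A B. ultra_class U M (\<lambda>n. representative A n \<oplus>\<^bsub>M n\<^esub> representative B n)),
     scal = (\<lambda>c A. ultra_class U M (\<lambda>n. scal (M n) c (representative A n))),
     star = (\<lambda>A. ultra_class U M (\<lambda>n. star (M n) (representative A n))),
     cnorm = (\<lambda>A. INF x\<in>A. SUP n. cnorm (M n) (x n)),
     tr = (\<lambda>A. Lim U (\<lambda>n. tr (M n) (representative A n)))\<rparr>"

abbreviation matrix_ultraproduct :: "nat filter \<Rightarrow> (nat \<Rightarrow> complex mat) set star_alg" where
  "matrix_ultraproduct U \<equiv> tracial_ultraproduct U mat_alg"


section \<open>Non-commutative laws\<close>

text \<open>A word is a list of letters \<open>(i, b)\<close>, standing for the variable \<open>i\<close> if \<open>b\<close> is false and for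
  its adjoint if \<open>b\<close> is true; a *-polynomial is a finitely supported function from words to
  coefficients.\<close>

type_synonym 'i nc_poly = "('i \<times> bool) list \<Rightarrow>\<^sub>0 complex"

definition nc_polys :: "'i set \<Rightarrow> 'i nc_poly set" where
  "nc_polys I = {p. \<forall>w\<in>Poly_Mapping.keys p. fst ` set w \<subseteq> I}"

definition eval_word :: "'a star_alg \<Rightarrow> ('i \<Rightarrow> 'a) \<Rightarrow> ('i \<times> bool) list \<Rightarrow> 'a" where
  "eval_word M X w =
     foldr (\<lambda>(i, b) a. (if b then star M (X i) else X i) \<otimes>\<^bsub>M\<^esub> a) w \<one>\<^bsub>M\<^esub>"

definition eval_poly :: "'a star_alg \<Rightarrow> ('i \<Rightarrow> 'a) \<Rightarrow> 'i nc_poly \<Rightarrow> 'a" where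
  "eval_poly M X p =
     (\<Oplus>\<^bsub>M\<^esub>w\<in>Poly_Mapping.keys p. scal M (Poly_Mapping.lookup p w) (eval_word M X w))"

definition law :: "'i set \<Rightarrow> 'a star_alg \<Rightarrow> ('i \<Rightarrow> 'a) \<Rightarrow> 'i nc_poly \<Rightarrow> complex" where
  "law I M X = (\<lambda>p\<in>nc_polys I. tr M (eval_poly M X p))"

text \<open>HOL cannot quantify over the tracial W*-algebras on all types at once. The algebras on the
  following type nevertheless realise every law of a tuple with indices in \<open>'i\<close>: each element of the
  W*-algebra generated by such a tuple is the 2-norm limit of a sequence of *-polynomials in the
  tuple, so this algebra embeds in sequences of *-polynomials. For \<open>'i = nat\<close> they also realise
  every type (in the model-theoretic sense) of a sequence: by the downward Loewenheim-Skolem theorem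
  it is realised in a separable tracial W*-algebra, which has at most continuum many elements.\<close>

type_synonym 'i universe = "nat \<Rightarrow> 'i nc_poly"

definition laws :: "'i set \<Rightarrow> ('i \<Rightarrow> real) \<Rightarrow> ('i nc_poly \<Rightarrow> complex) set" where
  "laws I r = {law I M X | (M :: 'i universe star_alg) X.
     tracial_wstar_algebra M \<and> (\<forall>i\<in>I. X i \<in> op_ball M (r i))}"

definition law_topology :: "'i set \<Rightarrow> ('i \<Rightarrow> real) \<Rightarrow> ('i nc_poly \<Rightarrow> complex) topology" where
  "law_topology I r = subtopology (product_topology (\<lambda>_. euclidean) (nc_polys I)) (laws I r)"

definition neighborhoods :: "'b topology \<Rightarrow> 'b \<Rightarrow> 'b set set" where
  "neighborhoods T x = {A. A \<subseteq> topspace T \<and> (\<exists>V. openin T V \<and> x \<in> V \<and> V \<subseteq> A)}"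

definition law_microstates ::
    "nat \<Rightarrow> 'i set \<Rightarrow> ('i \<Rightarrow> real) \<Rightarrow> ('i nc_poly \<Rightarrow> complex) set \<Rightarrow> ('i \<Rightarrow> complex mat) set" where
  "law_microstates n I r A =
     {Z \<in> (\<Pi>\<^sub>E i\<in>I. op_ball (mat_alg n) (r i)). law I (mat_alg n) Z \<in> A}"


section \<open>Orbital covering numbers\<close>

text \<open>Infinite cardinalities are all identified with \<open>\<infinity>\<close>.\<close>

definition orbital_covering ::
    "nat \<Rightarrow> 'i set \<Rightarrow> 'i set \<Rightarrow> real \<Rightarrow> ('i \<Rightarrow> complex mat) set \<Rightarrow> enat" where
  "orbital_covering n I F \<epsilon> \<Omega> = Inf {enat (card \<Omega>') | \<Omega>'.
     finite \<Omega>' \<and> \<Omega>' \<subseteq> (\<Pi>\<^sub>E i\<in>I. carrier_mat n n) \<and>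
     (\<forall>Y\<in>\<Omega>. \<exists>V\<in>unitaries n. \<exists>X\<in>\<Omega>'. \<forall>i\<in>F.
        norm2 (mat_alg n) (Y i - V * X i * mat_adjoint V) < \<epsilon>)}"

fun log_card :: "enat \<Rightarrow> ereal" where
  "log_card (enat k) = (if k = 0 then - \<infinity> else ereal (ln (real k)))"
| "log_card \<infinity> = \<infinity>"

definition growth_rate :: "nat filter \<Rightarrow> (nat \<Rightarrow> enat) \<Rightarrow> ereal" where
  "growth_rate U K = Lim U (\<lambda>n. ereal (1 / (real n)\<^sup>2) * log_card (K n))"


section \<open>1-bounded entropy in the presence\<close>

text \<open>The tuple \<open>(X, Y)\<close> is indexed by the disjoint union of the index sets.\<close>

definition h_tuple :: "nat filter \<Rightarrow> 'a star_alg \<Rightarrow> 'i set \<Rightarrow> 'j set \<Rightarrow> ('i \<Rightarrow> real) \<Rightarrow> ('j \<Rightarrow> real) \<Rightarrow>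
    ('i \<Rightarrow> 'a) \<Rightarrow> ('j \<Rightarrow> 'a) \<Rightarrow> ereal" where
  "h_tuple U M I J r r' X Y =
     (SUP \<epsilon>\<in>{0<..}. SUP F\<in>{F. finite F \<and> F \<subseteq> I}.
      INF A\<in>neighborhoods (law_topology (I <+> J) (case_sum r r')) (law (I <+> J) M (case_sum X Y)).
        growth_rate U (\<lambda>n. orbital_covering n I F \<epsilon>
          ((\<lambda>Z. \<lambda>i\<in>I. Z (Inl i)) ` law_microstates n (I <+> J) (case_sum r r') A)))"

definition radii :: "'a star_alg \<Rightarrow> 'i set \<Rightarrow> ('i \<Rightarrow> 'a) \<Rightarrow> ('i \<Rightarrow> real) \<Rightarrow> bool" where
  "radii M I X r \<longleftrightarrow> (\<forall>i\<in>I. 0 < r i \<and> X i \<in> op_ball M (r i))"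

text \<open>The value of \<open>h_tuple\<close> common to all choices of generators and radii. Index sets are taken
  inside the type \<open>'a\<close>, which is large enough for \<open>N\<close> and \<open>M\<close> to be indexed by their own elements;
  hence at least one choice exists, and the description is meaningful because, by Hayes's theorem,
  the value is the same for all of them.\<close>

definition h_presence :: "nat filter \<Rightarrow> 'a set \<Rightarrow> 'a star_alg \<Rightarrow> ereal" where
  "h_presence U N M = (THE v. \<forall>(I :: 'a set) (J :: 'a set) X Y r r'.
     radii M I X r \<and> radii M J Y r' \<and>
     wstar_generated M (X ` I) = N \<and> wstar_generated M (X ` I \<union> Y ` J) = carrier M \<longrightarrow>
     h_tuple U M I J r r' X Y = v)"

definition h_total :: "'a star_alg \<Rightarrow> ereal" where
  "h_total M = (SUP V\<in>{V. free_ultrafilter V}. h_presence V (carrier M) M)"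

definition strongly_1_bounded :: "'a star_alg \<Rightarrow> bool" where
  "strongly_1_bounded M \<longleftrightarrow> h_total M < \<infinity>"


section \<open>Formulas and types\<close>

text \<open>\<open>Connective f \<phi>s\<close> applies \<open>f\<close>, regarded as a function on \<open>\<real>\<^sup>k\<close> with \<open>k = length \<phi>s\<close>; as in
  \<open>Euclidean_space k\<close>, points of \<open>\<real>\<^sup>k\<close> are sequences vanishing from \<open>k\<close> on. \<open>Inf_ball j r \<phi>\<close> and
  \<open>Sup_ball j r \<phi>\<close> bind the variable with index \<open>j\<close>.\<close>

datatype formula =
    Re_tr "nat nc_poly"
  | Im_tr "nat nc_poly"
  | Connective "(nat \<Rightarrow> real) \<Rightarrow> real" "formula list"
  | Inf_ball nat real formula
  | Sup_ball nat real formula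

fun well_formed :: "formula \<Rightarrow> bool" where
  "well_formed (Re_tr p) \<longleftrightarrow> True"
| "well_formed (Im_tr p) \<longleftrightarrow> True"
| "well_formed (Connective f \<phi>s) \<longleftrightarrow>
     continuous_map (Euclidean_space (length \<phi>s)) euclideanreal f \<and> (\<forall>\<phi>\<in>set \<phi>s. well_formed \<phi>)"
| "well_formed (Inf_ball j r \<phi>) \<longleftrightarrow> 0 < r \<and> well_formed \<phi>"
| "well_formed (Sup_ball j r \<phi>) \<longleftrightarrow> 0 < r \<and> well_formed \<phi>"

fun interp :: "'a star_alg \<Rightarrow> formula \<Rightarrow> (nat \<Rightarrow> 'a) \<Rightarrow> real" where
  "interp M (Re_tr p) X = Re (tr M (eval_poly M X p))"
| "interp M (Im_tr p) X = Im (tr M (eval_poly M X p))"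
| "interp M (Connective f \<phi>s) X =
     f (\<lambda>i. if i < length \<phi>s then map (\<lambda>\<phi>. interp M \<phi> X) \<phi>s ! i else 0)"
| "interp M (Inf_ball j r \<phi>) X = (INF a\<in>op_ball M r. interp M \<phi> (X(j := a)))"
| "interp M (Sup_ball j r \<phi>) X = (SUP a\<in>op_ball M r. interp M \<phi> (X(j := a)))"

definition tp :: "'a star_alg \<Rightarrow> (nat \<Rightarrow> 'a) \<Rightarrow> formula \<Rightarrow> real" where
  "tp M X = (\<lambda>\<phi>\<in>{\<phi>. well_formed \<phi>}. interp M \<phi> X)"

definition types :: "(formula \<Rightarrow> real) set" where
  "types = {tp M X | (M :: nat universe star_alg) X.
     tracial_wstar_algebra M \<and> (\<forall>j. X j \<in> carrier M)}"

definition types_bounded :: "(nat \<Rightarrow> real) \<Rightarrow> (formula \<Rightarrow> real) set" where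
  "types_bounded r = {tp M X | (M :: nat universe star_alg) X.
     tracial_wstar_algebra M \<and> (\<forall>j. X j \<in> op_ball M (r j))}"

definition type_topology :: "(nat \<Rightarrow> real) \<Rightarrow> (formula \<Rightarrow> real) topology" where
  "type_topology r =
     subtopology (product_topology (\<lambda>_. euclideanreal) {\<phi>. well_formed \<phi>}) (types_bounded r)"

definition open_types :: "(formula \<Rightarrow> real) set \<Rightarrow> bool" where
  "open_types A \<longleftrightarrow> A \<subseteq> types \<and>
     (\<forall>r. (\<forall>j. 0 < r j) \<longrightarrow> openin (type_topology r) (A \<inter> types_bounded r))"


section \<open>Covering entropy\<close>

definition type_microstates ::
    "nat \<Rightarrow> (nat \<Rightarrow> real) \<Rightarrow> (formula \<Rightarrow> real) set \<Rightarrow> (nat \<Rightarrow> complex mat) set" where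
  "type_microstates n r A = {X. (\<forall>j. X j \<in> op_ball (mat_alg n) (r j)) \<and> tp (mat_alg n) X \<in> A}"

definition Ent_at ::
    "nat filter \<Rightarrow> (nat \<Rightarrow> real) \<Rightarrow> nat set \<Rightarrow> real \<Rightarrow> (formula \<Rightarrow> real) set \<Rightarrow> ereal" where
  "Ent_at U r F \<epsilon> K = (INF A\<in>{A. open_types A \<and> K \<subseteq> A}.
     growth_rate U (\<lambda>n. orbital_covering n UNIV F \<epsilon> (type_microstates n r A)))"

definition Ent_set :: "nat filter \<Rightarrow> (formula \<Rightarrow> real) set \<Rightarrow> ereal" where
  "Ent_set U K =
     (SUP r\<in>{r. \<forall>j. 0 < r j}. SUP F\<in>{F. finite F}. SUP \<epsilon>\<in>{0<..}. Ent_at U r F \<epsilon> K)"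

definition Ent :: "nat filter \<Rightarrow> 'a set \<Rightarrow> 'a star_alg \<Rightarrow> ereal" where
  "Ent U N M = (SUP X\<in>{X. \<forall>j. X j \<in> N}. Ent_set U {tp M X})"

end

theory Submission
  imports
    Defs
    "HOL-Analysis.Function_Metric"
    "HOL-Analysis.Extended_Real_Limits"
    "HOL-Library.Nat_Bijection"
begin

text \<open>A counting argument gives, for each \<open>n\<close>, about \<open>2\<^bsup>m n\<^sup>2\<^esup>\<close> tuples of \<open>m\<close> rescaled sign
  matrices of operator norm at most 1, while a ball of small radius around a unitary orbit contains
  at most \<open>2\<^bsup>(m/2 + c) n\<^sup>2\<^esup>\<close> of them. Up to a precision that is allowed to improve slowly with
  \<open>n\<close>, the type of a tuple is one of finitely many, and the number of possibilities depends on the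
  precision but not on \<open>n\<close>. By the pigeonhole principle a proportion of at least \<open>1/n\<close> of these
  tuples have the same approximate type as one fixed tuple \<open>Z\<^sub>n\<close> among them. Let \<open>Z\<close> be the
  element of the ultraproduct represented by \<open>(Z\<^sub>n)\<close>. By Los's theorem every neighborhood of the type
  of \<open>Z\<close> contains all these tuples for most \<open>n\<close>, so the covering entropy of that type is at least
  of order \<open>m\<close>, and \<open>m\<close> is arbitrary.

  For generators \<open>X\<close> of the ultraproduct, \<open>Z\<close> is 2-norm close to *-polynomials in finitely many
  entries of \<open>X\<close>. Since each of the tuples \<open>W\<close> above has almost the same type as \<open>Z\<^sub>n\<close>, finitely
  many entries of \<open>X\<close> (and \<open>Y\<close>) have counterparts over \<open>W\<close>, and these are microstates of the
  law of \<open>(X, Y)\<close> from which \<open>W\<close> is recovered by the same *-polynomials. Hence \<open>h\<close> is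
  infinite as well.\<close>

text \<open>The order of quantifiers in \<open>h_tuple\<close> shapes the argument. The finite set
  and the tolerance stand outside the infimum over neighborhoods, so the polynomials that recover Z
  from X are fixed before the neighborhood is known. The neighborhood then involves further entries
  of X and Y, whose number g is not bounded in advance. Moments of W close to those of Z would not
  produce counterparts of these entries over W. A code of depth g does, one entry per level, as in
  an Ehrenfeucht-Fraisse game; hence the depth must tend to infinity along the ultrafilter. The
  count succeeds because the unitary group has dimension n^2 for every m: discretizing it costs the
  fixed exponent 1206 n^2, which a large m outweighs. For the ultraproduct the properties in
  \<open>pretracial\<close> are verified. They make 2-norm bounded functionals normal, so 2-norm
  closed subspaces are ultraweakly closed, and generators approximate every element in the
  2-norm.\<close>

unbundle no vec_syntax and no inner_syntax

section \<open>Matrices and the operator norm\<close>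

lemma sq_mult_carrier [simp]: "A \<in> carrier_mat n n \<Longrightarrow> B \<in> carrier_mat n n \<Longrightarrow> A * B \<in> carrier_mat n n"
  by simp

lemma sq_mult_vec_carrier [simp]: "A \<in> carrier_mat n n \<Longrightarrow> v \<in> carrier_vec n \<Longrightarrow> A *\<^sub>v v \<in> carrier_vec n"
  by simp

lemma mat_adjoint_index [simp]:
  fixes A :: "complex mat"
  assumes "i < dim_col A" "j < dim_row A"
  shows "mat_adjoint A $$ (i, j) = cnj (A $$ (j, i))"
  using assms by (simp add: mat_adjoint_def mat_of_rows_def)

lemma mat_adjoint_dim [simp]:
  fixes A :: "complex mat"
  shows "dim_row (mat_adjoint A) = dim_col A" "dim_col (mat_adjoint A) = dim_row A"
  by (simp_all add: mat_adjoint_def)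

lemma mat_adjoint_carrier [simp]:
  fixes A :: "complex mat"
  shows "A \<in> carrier_mat n m \<Longrightarrow> mat_adjoint A \<in> carrier_mat m n"
  by (rule carrier_matI) simp_all

lemma mat_adjoint_adjoint [simp]: "mat_adjoint (mat_adjoint A) = (A :: complex mat)"
  by (rule eq_matI) simp_all

lemma mat_adjoint_mult:
  fixes A B :: "complex mat"
  assumes "A \<in> carrier_mat n m" "B \<in> carrier_mat m k"
  shows "mat_adjoint (A * B) = mat_adjoint B * mat_adjoint A"
  using assms by (intro eq_matI) (auto simp: scalar_prod_def mult.commute intro!: sum.cong)

lemma mat_adjoint_add:
  fixes A B :: "complex mat"
  assumes "A \<in> carrier_mat n m" "B \<in> carrier_mat n m"
  shows "mat_adjoint (A + B) = mat_adjoint A + mat_adjoint B"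
  using assms by (intro eq_matI) auto

lemma mat_adjoint_minus:
  fixes A B :: "complex mat"
  assumes "A \<in> carrier_mat n m" "B \<in> carrier_mat n m"
  shows "mat_adjoint (A - B) = mat_adjoint A - mat_adjoint B"
  using assms by (intro eq_matI) auto

lemma mat_adjoint_smult [simp]: "mat_adjoint (c \<cdot>\<^sub>m (A :: complex mat)) = cnj c \<cdot>\<^sub>m mat_adjoint A"
  by (intro eq_matI) auto

lemma mat_adjoint_one [simp]: "mat_adjoint (1\<^sub>m n :: complex mat) = 1\<^sub>m n"
  by (intro eq_matI) auto

lemma mat_adjoint_zero [simp]: "mat_adjoint (0\<^sub>m n m :: complex mat) = 0\<^sub>m m n"
  by (intro eq_matI) auto

lemma cscalar_prod_adjoint:
  fixes A :: "complex mat"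
  assumes "A \<in> carrier_mat n m" "v \<in> carrier_vec m" "w \<in> carrier_vec n"
  shows "(A *\<^sub>v v) \<bullet>c w = v \<bullet>c (mat_adjoint A *\<^sub>v w)"
proof -
  have "(A *\<^sub>v v) \<bullet>c w = (\<Sum>i<n. (\<Sum>j<m. A $$ (i, j) * v $ j) * cnj (w $ i))"
    using assms by (auto simp: scalar_prod_def atLeast0LessThan intro!: sum.cong)
  also have "\<dots> = (\<Sum>j<m. \<Sum>i<n. A $$ (i, j) * v $ j * cnj (w $ i))"
    by (subst sum.swap) (simp add: sum_distrib_right)
  also have "\<dots> = v \<bullet>c (mat_adjoint A *\<^sub>v w)"
    using assms by (auto simp: scalar_prod_def atLeast0LessThan sum_distrib_left algebra_simps intro!: sum.cong)
  finally show ?thesis .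
qed

lemma vec_norm2_L2: "vec_norm2 v = L2_set (\<lambda>i. cmod (v $ i)) {..<dim_vec v}"
proof -
  have "Re (v \<bullet>c v) = (\<Sum>i<dim_vec v. (cmod (v $ i))\<^sup>2)"
    by (simp add: scalar_prod_def atLeast0LessThan Re_sum del: times_complex.sel)
       (simp add: cmod_def power2_eq_square)
  then show ?thesis by (simp add: vec_norm2_def L2_set_def)
qed

lemma vec_norm2_nonneg [simp]: "0 \<le> vec_norm2 v"
  by (simp add: vec_norm2_L2)

lemma vec_norm2_square:
  assumes "v \<in> carrier_vec n"
  shows "v \<bullet>c v = complex_of_real ((vec_norm2 v)\<^sup>2)"
  using assms by (simp add: vec_norm2_L2 L2_set_def sum_nonneg scalar_prod_def atLeast0LessThan
      flip: complex_norm_square)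

lemma vec_norm2_zero [simp]: "vec_norm2 (0\<^sub>v n) = 0"
  by (simp add: vec_norm2_L2 L2_set_eq_0_iff)

lemma vec_norm2_eq_0: "v \<in> carrier_vec n \<Longrightarrow> vec_norm2 v = 0 \<longleftrightarrow> v = 0\<^sub>v n"
  by (auto simp: vec_norm2_L2 L2_set_eq_0_iff)

lemma vec_norm2_triangle:
  assumes "v \<in> carrier_vec n" "w \<in> carrier_vec n"
  shows "vec_norm2 (v + w) \<le> vec_norm2 v + vec_norm2 w"
proof -
  have "vec_norm2 (v + w) \<le> L2_set (\<lambda>i. cmod (v $ i) + cmod (w $ i)) {..<n}"
    using assms by (auto simp: vec_norm2_L2 norm_triangle_ineq intro!: L2_set_mono)
  also have "\<dots> \<le> vec_norm2 v + vec_norm2 w"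
    using assms by (auto simp: vec_norm2_L2 intro!: L2_set_triangle_ineq)
  finally show ?thesis .
qed

lemma vec_norm2_smult: "vec_norm2 (c \<cdot>\<^sub>v v) = cmod c * vec_norm2 v"
  by (auto simp: vec_norm2_L2 L2_set_right_distrib norm_mult intro!: L2_set_cong)

lemma vec_norm2_Cauchy_Schwarz:
  assumes "v \<in> carrier_vec n" "w \<in> carrier_vec n"
  shows "cmod (v \<bullet>c w) \<le> vec_norm2 v * vec_norm2 w"
proof -
  have "cmod (v \<bullet>c w) \<le> (\<Sum>i<n. cmod (v $ i) * cmod (w $ i))"
    using assms by (auto simp: scalar_prod_def atLeast0LessThan norm_mult intro!: sum_norm_le)
  also have "\<dots> \<le> vec_norm2 v * vec_norm2 w"
    using L2_set_mult_ineq[of "\<lambda>i. cmod (v $ i)" "\<lambda>i. cmod (w $ i)"] assms by (simp add: vec_norm2_L2)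
  finally show ?thesis .
qed

lemma vec_norm2_unit_vec [simp]: "i < n \<Longrightarrow> vec_norm2 (unit_vec n i) = 1"
proof -
  assume i: "i < n"
  have "(\<Sum>j<n. (cmod (if j = i then 1 else 0))\<^sup>2) = (\<Sum>j<n. if j = i then 1 else 0)"
    by (intro sum.cong) auto
  then show ?thesis
    using i by (simp add: vec_norm2_L2 L2_set_def unit_vec_def)
qed

text \<open>The unnormalized Hilbert-Schmidt norm. It dominates the operator norm and so bounds the
  set whose supremum is \<open>mat_op_norm\<close>; divided by \<surd>n it is the 2-norm of the
  normalized trace.\<close>

definition frob :: "nat \<Rightarrow> complex mat \<Rightarrow> real" where
  "frob n A = L2_set (\<lambda>p. cmod (A $$ p)) ({..<n} \<times> {..<n})"

lemma frob_square: "(frob n A)\<^sup>2 = (\<Sum>i<n. \<Sum>j<n. (cmod (A $$ (i, j)))\<^sup>2)"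
  by (simp add: frob_def L2_set_def sum_nonneg sum.cartesian_product)

lemma frob_nonneg [simp]: "0 \<le> frob n A"
  by (simp add: frob_def)

lemma mult_mat_vec_index:
  assumes "A \<in> carrier_mat n m" "v \<in> carrier_vec m" "i < n"
  shows "(A *\<^sub>v v) $ i = (\<Sum>j<m. A $$ (i, j) * v $ j)"
  using assms by (simp add: scalar_prod_def atLeast0LessThan)

lemma vec_norm2_mult_mat_vec_frob:
  assumes A: "A \<in> carrier_mat n n" and v: "v \<in> carrier_vec n"
  shows "vec_norm2 (A *\<^sub>v v) \<le> frob n A * vec_norm2 v"
proof (rule power2_le_imp_le)
  have "(vec_norm2 (A *\<^sub>v v))\<^sup>2 = (\<Sum>i<n. (cmod (row A i \<bullet>c conjugate v))\<^sup>2)"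
    using A v by (auto simp: vec_norm2_L2 L2_set_def sum_nonneg)
  also have "\<dots> \<le> (\<Sum>i<n. (vec_norm2 (row A i) * vec_norm2 v)\<^sup>2)"
  proof (intro sum_mono power_mono)
    fix i assume "i \<in> {..<n}"
    then have "cmod (row A i \<bullet>c conjugate v) \<le> vec_norm2 (row A i) * vec_norm2 (conjugate v)"
      using A v by (intro vec_norm2_Cauchy_Schwarz[where n=n]) auto
    also have "vec_norm2 (conjugate v) = vec_norm2 v"
      by (auto simp: vec_norm2_L2 intro!: L2_set_cong)
    finally show "cmod (row A i \<bullet>c conjugate v) \<le> vec_norm2 (row A i) * vec_norm2 v" .
  qed simp
  also have "\<dots> = (\<Sum>i<n. (vec_norm2 (row A i))\<^sup>2) * (vec_norm2 v)\<^sup>2"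
    by (simp add: power_mult_distrib sum_distrib_right)
  also have "(\<Sum>i<n. (vec_norm2 (row A i))\<^sup>2) = (frob n A)\<^sup>2"
    unfolding frob_square
  proof (rule sum.cong)
    fix i assume "i \<in> {..<n}"
    then show "(vec_norm2 (row A i))\<^sup>2 = (\<Sum>j<n. (cmod (A $$ (i, j)))\<^sup>2)"
      using A by (simp add: vec_norm2_L2 L2_set_def sum_nonneg)
  qed simp
  also have "(frob n A)\<^sup>2 * (vec_norm2 v)\<^sup>2 = (frob n A * vec_norm2 v)\<^sup>2"
    by (simp add: power_mult_distrib)
  finally show "(vec_norm2 (A *\<^sub>v v))\<^sup>2 \<le> (frob n A * vec_norm2 v)\<^sup>2" .
qed simp

lemma mat_op_norm_bdd:
  assumes "A \<in> carrier_mat n n"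
  shows "bdd_above {vec_norm2 (A *\<^sub>v v) | v. v \<in> carrier_vec n \<and> vec_norm2 v \<le> 1}"
proof (rule bdd_aboveI[where M = "frob n A"], clarify)
  fix v :: "complex vec" assume v: "v \<in> carrier_vec n" "vec_norm2 v \<le> 1"
  show "vec_norm2 (A *\<^sub>v v) \<le> frob n A"
    using vec_norm2_mult_mat_vec_frob[OF assms v(1)] v(2) mult_left_le[of "vec_norm2 v" "frob n A"] by simp
qed

lemma mat_op_norm_nonneg [simp]:
  assumes "A \<in> carrier_mat n n"
  shows "0 \<le> mat_op_norm n A"
proof -
  have "vec_norm2 (A *\<^sub>v 0\<^sub>v n) \<le> mat_op_norm n A"
    unfolding mat_op_norm_def
    by (rule cSup_upper[OF _ mat_op_norm_bdd[OF assms]]) (rule CollectI, rule exI[of _ "0\<^sub>v n"], simp)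
  then show ?thesis using vec_norm2_nonneg order_trans by blast
qed

lemma mat_op_norm_bound:
  assumes A: "A \<in> carrier_mat n n" and v: "v \<in> carrier_vec n"
  shows "vec_norm2 (A *\<^sub>v v) \<le> mat_op_norm n A * vec_norm2 v"
proof (cases "vec_norm2 v = 0")
  case True
  then have "v = 0\<^sub>v n" using v by (simp add: vec_norm2_eq_0)
  moreover have "A *\<^sub>v 0\<^sub>v n = 0\<^sub>v n" using A by (intro eq_vecI) auto
  ultimately show ?thesis by simp
next
  case False
  define c where "c = vec_norm2 v"
  have c: "c > 0" using False vec_norm2_nonneg[of v] by (simp add: c_def less_le)
  define w where "w = complex_of_real (1 / c) \<cdot>\<^sub>v v"
  have w: "w \<in> carrier_vec n" "vec_norm2 w = 1"
    using v c by (auto simp: w_def vec_norm2_smult c_def norm_divide)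
  have "vec_norm2 (A *\<^sub>v w) \<le> mat_op_norm n A"
    unfolding mat_op_norm_def
    by (rule cSup_upper[OF _ mat_op_norm_bdd[OF A]]) (use w in auto)
  also have "A *\<^sub>v w = complex_of_real (1 / c) \<cdot>\<^sub>v (A *\<^sub>v v)"
    using A v by (simp add: w_def mult_mat_vec)
  finally show ?thesis using c by (simp add: vec_norm2_smult norm_divide field_simps c_def)
qed

lemma mat_op_norm_le:
  assumes "\<And>v. v \<in> carrier_vec n \<Longrightarrow> vec_norm2 v \<le> 1 \<Longrightarrow> vec_norm2 (A *\<^sub>v v) \<le> c"
  shows "mat_op_norm n A \<le> c"
  unfolding mat_op_norm_def by (rule cSup_least) (auto intro: assms exI[of _ "0\<^sub>v n"])

lemma mat_op_norm_le':
  assumes "\<And>v. v \<in> carrier_vec n \<Longrightarrow> vec_norm2 (A *\<^sub>v v) \<le> c * vec_norm2 v" "0 \<le> c"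
  shows "mat_op_norm n A \<le> c"
proof (rule mat_op_norm_le)
  fix v :: "complex vec" assume v: "v \<in> carrier_vec n" "vec_norm2 v \<le> 1"
  show "vec_norm2 (A *\<^sub>v v) \<le> c"
    using assms(1)[OF v(1)] mult_left_le[OF v(2) assms(2)] by linarith
qed

lemma mat_op_norm_le_frob: "A \<in> carrier_mat n n \<Longrightarrow> mat_op_norm n A \<le> frob n A"
  by (rule mat_op_norm_le') (auto simp: vec_norm2_mult_mat_vec_frob)

lemma mat_op_norm_triangle:
  assumes A: "A \<in> carrier_mat n n" and B: "B \<in> carrier_mat n n"
  shows "mat_op_norm n (A + B) \<le> mat_op_norm n A + mat_op_norm n B"
proof (rule mat_op_norm_le')
  fix v :: "complex vec" assume v: "v \<in> carrier_vec n"
  have "vec_norm2 ((A + B) *\<^sub>v v) \<le> vec_norm2 (A *\<^sub>v v) + vec_norm2 (B *\<^sub>v v)"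
    using vec_norm2_triangle[of "A *\<^sub>v v" n "B *\<^sub>v v"] A B v by (simp add: add_mult_distrib_mat_vec)
  also have "\<dots> \<le> (mat_op_norm n A + mat_op_norm n B) * vec_norm2 v"
    using mat_op_norm_bound[OF A v] mat_op_norm_bound[OF B v] by (simp add: distrib_right)
  finally show "vec_norm2 ((A + B) *\<^sub>v v) \<le> (mat_op_norm n A + mat_op_norm n B) * vec_norm2 v" .
qed (use assms in simp)

lemma mat_op_norm_mult:
  assumes A: "A \<in> carrier_mat n n" and B: "B \<in> carrier_mat n n"
  shows "mat_op_norm n (A * B) \<le> mat_op_norm n A * mat_op_norm n B"
proof (rule mat_op_norm_le')
  fix v :: "complex vec" assume v: "v \<in> carrier_vec n"
  have "vec_norm2 ((A * B) *\<^sub>v v) \<le> mat_op_norm n A * vec_norm2 (B *\<^sub>v v)"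
    using mat_op_norm_bound[OF A, of "B *\<^sub>v v"] A B v by simp
  also have "\<dots> \<le> mat_op_norm n A * (mat_op_norm n B * vec_norm2 v)"
    by (intro mult_left_mono mat_op_norm_bound A B v mat_op_norm_nonneg)
  finally show "vec_norm2 ((A * B) *\<^sub>v v) \<le> mat_op_norm n A * mat_op_norm n B * vec_norm2 v"
    by (simp add: mult.assoc)
qed (use assms in simp)

lemma mat_op_norm_zero [simp]: "mat_op_norm n (0\<^sub>m n n) = 0"
proof (rule antisym)
  show "mat_op_norm n (0\<^sub>m n n) \<le> 0"
  proof (rule mat_op_norm_le')
    fix v :: "complex vec" assume v: "v \<in> carrier_vec n"
    have "0\<^sub>m n n *\<^sub>v v = 0\<^sub>v n" using v by (intro eq_vecI) auto
    then show "vec_norm2 (0\<^sub>m n n *\<^sub>v v) \<le> 0 * vec_norm2 v" by simp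
  qed simp
qed simp

lemma mat_op_norm_one: "mat_op_norm n (1\<^sub>m n) \<le> 1"
  by (rule mat_op_norm_le') auto

lemma mat_op_norm_smult_le:
  assumes A: "A \<in> carrier_mat n n"
  shows "mat_op_norm n (c \<cdot>\<^sub>m A) \<le> cmod c * mat_op_norm n A"
proof (rule mat_op_norm_le')
  fix v :: "complex vec" assume v: "v \<in> carrier_vec n"
  have "(c \<cdot>\<^sub>m A) *\<^sub>v v = c \<cdot>\<^sub>v (A *\<^sub>v v)"
    using A v by (intro eq_vecI) auto
  then show "vec_norm2 ((c \<cdot>\<^sub>m A) *\<^sub>v v) \<le> cmod c * mat_op_norm n A * vec_norm2 v"
    using mat_op_norm_bound[OF A v] by (simp add: vec_norm2_smult mult.assoc mult_left_mono)
qed (use assms in simp)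

lemma mat_op_norm_smult:
  assumes A: "A \<in> carrier_mat n n"
  shows "mat_op_norm n (c \<cdot>\<^sub>m A) = cmod c * mat_op_norm n A"
proof (cases "c = 0")
  case True
  then have "c \<cdot>\<^sub>m A = 0\<^sub>m n n" using A by (intro eq_matI) auto
  then show ?thesis using True by simp
next
  case False
  have "A = (1 / c) \<cdot>\<^sub>m (c \<cdot>\<^sub>m A)" using A False by (intro eq_matI) auto
  then have "mat_op_norm n A \<le> cmod (1 / c) * mat_op_norm n (c \<cdot>\<^sub>m A)"
    using mat_op_norm_smult_le[of "c \<cdot>\<^sub>m A" n "1 / c"] A by auto
  then have "cmod c * mat_op_norm n A \<le> mat_op_norm n (c \<cdot>\<^sub>m A)"
    using False by (simp add: norm_divide field_simps)
  then show ?thesis using mat_op_norm_smult_le[OF A, of c] by simp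
qed

lemma mat_op_norm_eq_0:
  assumes A: "A \<in> carrier_mat n n"
  shows "mat_op_norm n A = 0 \<longleftrightarrow> A = 0\<^sub>m n n"
proof
  assume z: "mat_op_norm n A = 0"
  show "A = 0\<^sub>m n n"
  proof (rule eq_matI)
    fix i j assume "i < dim_row (0\<^sub>m n n :: complex mat)" "j < dim_col (0\<^sub>m n n :: complex mat)"
    then have ij: "i < n" "j < n" by auto
    have "vec_norm2 (A *\<^sub>v unit_vec n j) = 0"
      using mat_op_norm_bound[OF A, of "unit_vec n j"] z ij vec_norm2_nonneg[of "A *\<^sub>v unit_vec n j"] by auto
    then have "A *\<^sub>v unit_vec n j = 0\<^sub>v n"
      using A by (subst (asm) vec_norm2_eq_0[where n=n]) auto
    then have "(A *\<^sub>v unit_vec n j) $ i = 0" using ij by simp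
    then show "A $$ (i, j) = 0\<^sub>m n n $$ (i, j)"
      using A ij by simp
  qed (use A in auto)
qed simp

text \<open>Cauchy-Schwarz for |A v|^2 = <v, A* A v>. With submultiplicativity this half of the
  C*-identity shows that the adjoint is isometric, and from that follows the other half.\<close>

lemma mat_op_norm_sq_le:
  assumes A: "A \<in> carrier_mat n n"
  shows "(mat_op_norm n A)\<^sup>2 \<le> mat_op_norm n (mat_adjoint A * A)"
proof -
  define c where "c = mat_op_norm n (mat_adjoint A * A)"
  have c: "0 \<le> c" unfolding c_def using A by (intro mat_op_norm_nonneg mult_carrier_mat[where n=n]) simp_all
  have "mat_op_norm n A \<le> sqrt c"
  proof (rule mat_op_norm_le)
    fix v :: "complex vec" assume v: "v \<in> carrier_vec n" "vec_norm2 v \<le> 1"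
    have "complex_of_real ((vec_norm2 (A *\<^sub>v v))\<^sup>2) = v \<bullet>c (mat_adjoint A *\<^sub>v (A *\<^sub>v v))"
      using cscalar_prod_adjoint[OF A v(1), of "A *\<^sub>v v"] vec_norm2_square[of "A *\<^sub>v v" n] A v by auto
    then have "(vec_norm2 (A *\<^sub>v v))\<^sup>2 = cmod (v \<bullet>c (mat_adjoint A *\<^sub>v (A *\<^sub>v v)))"
      by (metis norm_of_real abs_of_nonneg zero_le_power2)
    also have "\<dots> \<le> vec_norm2 v * vec_norm2 ((mat_adjoint A * A) *\<^sub>v v)"
      using vec_norm2_Cauchy_Schwarz[of v n "(mat_adjoint A * A) *\<^sub>v v"] A v
        assoc_mult_mat_vec[of "mat_adjoint A" n n A n v] by fastforce
    also have "\<dots> \<le> 1 * (c * vec_norm2 v)"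
      unfolding c_def using v A by (intro mult_mono mat_op_norm_bound) auto
    also have "\<dots> \<le> c" using mult_left_le[OF v(2) c] by simp
    finally show "vec_norm2 (A *\<^sub>v v) \<le> sqrt c" by (rule real_le_rsqrt)
  qed
  then have "(mat_op_norm n A)\<^sup>2 \<le> (sqrt c)\<^sup>2"
    using A by (intro power_mono) auto
  then show ?thesis using c by (simp add: c_def)
qed

lemma mat_op_norm_adjoint_le:
  assumes A: "A \<in> carrier_mat n n"
  shows "mat_op_norm n A \<le> mat_op_norm n (mat_adjoint A)"
proof (cases "mat_op_norm n A = 0")
  case False
  then have pos: "mat_op_norm n A > 0" using mat_op_norm_nonneg[OF A] by simp
  have "mat_op_norm n A * mat_op_norm n A \<le> mat_op_norm n (mat_adjoint A) * mat_op_norm n A"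
    using mat_op_norm_sq_le[OF A] mat_op_norm_mult[of "mat_adjoint A" n A] A by (simp add: power2_eq_square)
  then show ?thesis using pos by simp
qed (use A in simp)

lemma mat_op_norm_adjoint:
  assumes "A \<in> carrier_mat n n"
  shows "mat_op_norm n (mat_adjoint A) = mat_op_norm n A"
  using mat_op_norm_adjoint_le[OF assms] mat_op_norm_adjoint_le[of "mat_adjoint A" n] assms by auto

lemma mat_op_norm_cstar:
  assumes A: "A \<in> carrier_mat n n"
  shows "mat_op_norm n (mat_adjoint A * A) = (mat_op_norm n A)\<^sup>2"
  using mat_op_norm_sq_le[OF A] mat_op_norm_mult[of "mat_adjoint A" n A] mat_op_norm_adjoint[OF A] A
  by (simp add: power2_eq_square)

lemma entry_le_mat_op_norm:
  assumes A: "A \<in> carrier_mat n n" and ij: "i < n" "j < n"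
  shows "cmod (A $$ (i, j)) \<le> mat_op_norm n A"
proof -
  have "cmod ((A *\<^sub>v unit_vec n j) $ i) \<le> vec_norm2 (A *\<^sub>v unit_vec n j)"
    using A ij member_le_L2_set[of "{..<n}" i "\<lambda>i. cmod ((A *\<^sub>v unit_vec n j) $ i)"] by (simp add: vec_norm2_L2)
  also have "\<dots> \<le> mat_op_norm n A" using mat_op_norm_bound[OF A, of "unit_vec n j"] ij by simp
  finally show ?thesis using A ij by simp
qed

lemma mat_alg_simps [simp]:
  "carrier (mat_alg n) = carrier_mat n n"
  "monoid.mult (mat_alg n) = (*)"
  "one (mat_alg n) = 1\<^sub>m n"
  "zero (mat_alg n) = 0\<^sub>m n n"
  "add (mat_alg n) = (+)"
  "scal (mat_alg n) = (\<lambda>c A. c \<cdot>\<^sub>m A)"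
  "star (mat_alg n) = mat_adjoint"
  "cnorm (mat_alg n) = mat_op_norm n"
  by (simp_all add: mat_alg_def)

declare minus_carrier_mat [simp]

text \<open>\<open>mat_alg n\<close> has the fields of \<open>ring_mat\<close> with the further
  operations in the extension slot, so the ring axioms are inherited.\<close>

lemma ring_mat_alg: "ring (mat_alg n)"
proof -
  have "mat_alg n = ring_mat TYPE(complex) n (ring.more (mat_alg n))"
    by (simp add: mat_alg_def ring_mat_def)
  then show ?thesis using ring_mat by metis
qed

lemma a_minus_mat_alg [simp]:
  assumes "A \<in> carrier_mat n n" "B \<in> carrier_mat n n"
  shows "A \<ominus>\<^bsub>mat_alg n\<^esub> B = A - B"
proof -
  interpret ring "mat_alg n" by (rule ring_mat_alg)
  have "\<ominus>\<^bsub>mat_alg n\<^esub> B = - B"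
    by (rule minus_equality) (use assms in auto)
  then show ?thesis using assms by (simp add: a_minus_def add_uminus_minus_mat)
qed

section \<open>The normalized trace and the 2-norm\<close>

definition mtr :: "nat \<Rightarrow> complex mat \<Rightarrow> complex" where
  "mtr n A = (\<Sum>i<n. A $$ (i, i)) / of_nat n"

lemma tr_mat_alg [simp]: "tr (mat_alg n) = mtr n"
  by (auto simp: mat_alg_def mtr_def)

definition mn2 :: "nat \<Rightarrow> complex mat \<Rightarrow> real" where
  "mn2 n A = frob n A / sqrt n"

lemma mtr_add: "A \<in> carrier_mat n n \<Longrightarrow> B \<in> carrier_mat n n \<Longrightarrow> mtr n (A + B) = mtr n A + mtr n B"
  by (simp add: mtr_def sum.distrib add_divide_distrib)

lemma mtr_minus: "A \<in> carrier_mat n n \<Longrightarrow> B \<in> carrier_mat n n \<Longrightarrow> mtr n (A - B) = mtr n A - mtr n B"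
  by (simp add: mtr_def sum_subtractf diff_divide_distrib)

lemma mtr_smult: "A \<in> carrier_mat n n \<Longrightarrow> mtr n (c \<cdot>\<^sub>m A) = c * mtr n A"
  by (simp add: mtr_def sum_distrib_left)

lemma mtr_one: "n > 0 \<Longrightarrow> mtr n (1\<^sub>m n) = 1"
  by (simp add: mtr_def)

lemma mtr_zero [simp]: "mtr n (0\<^sub>m n n) = 0"
  by (simp add: mtr_def)

lemma mat_mult_index:
  "A \<in> carrier_mat n m \<Longrightarrow> B \<in> carrier_mat m k \<Longrightarrow> i < n \<Longrightarrow> j < k \<Longrightarrow>
    (A * B) $$ (i, j) = (\<Sum>l<m. A $$ (i, l) * B $$ (l, j))"
  by (simp add: scalar_prod_def atLeast0LessThan)

lemma mtr_comm:
  assumes "A \<in> carrier_mat n n" "B \<in> carrier_mat n n"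
  shows "mtr n (A * B) = mtr n (B * A)"
proof -
  have "(\<Sum>i<n. (A * B) $$ (i, i)) = (\<Sum>i<n. \<Sum>l<n. A $$ (i, l) * B $$ (l, i))"
    using assms by (intro sum.cong refl mat_mult_index[where n=n]) auto
  also have "\<dots> = (\<Sum>l<n. \<Sum>i<n. B $$ (l, i) * A $$ (i, l))"
    by (subst sum.swap) (simp add: mult.commute)
  also have "\<dots> = (\<Sum>i<n. (B * A) $$ (i, i))"
    using assms by (intro sum.cong refl mat_mult_index[where n=n, symmetric]) auto
  finally show ?thesis by (simp add: mtr_def)
qed

lemma mtr_adjoint_mult:
  assumes "A \<in> carrier_mat n n" "B \<in> carrier_mat n n"
  shows "mtr n (mat_adjoint A * B) = (\<Sum>i<n. \<Sum>j<n. cnj (A $$ (i, j)) * B $$ (i, j)) / of_nat n"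
proof -
  have "(\<Sum>j<n. (mat_adjoint A * B) $$ (j, j)) = (\<Sum>j<n. \<Sum>i<n. mat_adjoint A $$ (j, i) * B $$ (i, j))"
    using assms by (intro sum.cong refl mat_mult_index[where n=n]) auto
  also have "\<dots> = (\<Sum>j<n. \<Sum>i<n. cnj (A $$ (i, j)) * B $$ (i, j))"
    using assms by (intro sum.cong refl) auto
  also have "\<dots> = (\<Sum>i<n. \<Sum>j<n. cnj (A $$ (i, j)) * B $$ (i, j))"
    by (rule sum.swap)
  finally show ?thesis by (simp add: mtr_def)
qed

lemma mtr_adjoint_self:
  assumes "A \<in> carrier_mat n n"
  shows "mtr n (mat_adjoint A * A) = complex_of_real ((mn2 n A)\<^sup>2)"
  by (simp add: mtr_adjoint_mult[OF assms assms] mn2_def power_divide frob_square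
      complex_norm_square mult.commute del: of_real_power)

lemma norm2_mat_alg [simp]:
  assumes "A \<in> carrier_mat n n"
  shows "norm2 (mat_alg n) A = mn2 n A"
  using assms by (simp add: norm2_def mtr_adjoint_self real_sqrt_abs mn2_def flip: of_real_power)

lemma mn2_nonneg [simp]: "0 \<le> mn2 n A"
  by (simp add: mn2_def)

lemma mn2_zero [simp]: "mn2 n (0\<^sub>m n n) = 0"
  by (simp add: mn2_def frob_def L2_set_eq_0_iff)

lemma frob_triangle:
  assumes "A \<in> carrier_mat n n" "B \<in> carrier_mat n n"
  shows "frob n (A + B) \<le> frob n A + frob n B"
proof -
  have "frob n (A + B) \<le> L2_set (\<lambda>p. cmod (A $$ p) + cmod (B $$ p)) ({..<n} \<times> {..<n})"
    unfolding frob_def using assms by (intro L2_set_mono) (auto simp: norm_triangle_ineq)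
  also have "\<dots> \<le> frob n A + frob n B"
    unfolding frob_def by (rule L2_set_triangle_ineq)
  finally show ?thesis .
qed

lemma mn2_triangle:
  assumes "A \<in> carrier_mat n n" "B \<in> carrier_mat n n"
  shows "mn2 n (A + B) \<le> mn2 n A + mn2 n B"
  using frob_triangle[OF assms] by (simp add: mn2_def divide_right_mono flip: add_divide_distrib)

lemma frob_smult: "A \<in> carrier_mat n n \<Longrightarrow> frob n (c \<cdot>\<^sub>m A) = cmod c * frob n A"
  by (auto simp: frob_def L2_set_right_distrib norm_mult intro!: L2_set_cong)

lemma mn2_smult: "A \<in> carrier_mat n n \<Longrightarrow> mn2 n (c \<cdot>\<^sub>m A) = cmod c * mn2 n A"
  by (simp add: mn2_def frob_smult)

lemma mn2_minus_commute:
  assumes "A \<in> carrier_mat n n" "B \<in> carrier_mat n n"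
  shows "mn2 n (A - B) = mn2 n (B - A)"
proof -
  have "A - B = (-1) \<cdot>\<^sub>m (B - A)" using assms by (intro eq_matI) auto
  then show ?thesis using assms by (simp add: mn2_smult)
qed

lemma mn2_triangle_minus:
  assumes "A \<in> carrier_mat n n" "B \<in> carrier_mat n n" "C \<in> carrier_mat n n"
  shows "mn2 n (A - C) \<le> mn2 n (A - B) + mn2 n (B - C)"
proof -
  have "A - C = (A - B) + (B - C)" using assms by (intro eq_matI) auto
  then show ?thesis using mn2_triangle[of "A - B" n "B - C"] assms by auto
qed

lemma mtr_adjoint_mult_le:
  assumes "A \<in> carrier_mat n n" "B \<in> carrier_mat n n"
  shows "cmod (mtr n (mat_adjoint A * B)) \<le> mn2 n A * mn2 n B"
proof -
  have "cmod (\<Sum>i<n. \<Sum>j<n. cnj (A $$ (i, j)) * B $$ (i, j)) \<le> (\<Sum>i<n. \<Sum>j<n. cmod (A $$ (i, j)) * cmod (B $$ (i, j)))"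
    by (intro sum_norm_le) (simp add: norm_mult)
  also have "\<dots> = (\<Sum>p\<in>{..<n}\<times>{..<n}. \<bar>cmod (A $$ p)\<bar> * \<bar>cmod (B $$ p)\<bar>)"
    by (simp add: sum.cartesian_product)
  also have "\<dots> \<le> frob n A * frob n B"
    unfolding frob_def by (rule L2_set_mult_ineq)
  finally have "cmod (mtr n (mat_adjoint A * B)) \<le> frob n A * frob n B / real n"
    unfolding mtr_adjoint_mult[OF assms] by (simp add: norm_divide divide_right_mono)
  then show ?thesis by (simp add: mn2_def)
qed

lemma mn2_adjoint: "A \<in> carrier_mat n n \<Longrightarrow> mn2 n (mat_adjoint A) = mn2 n A"
proof -
  assume A: "A \<in> carrier_mat n n"
  have "(frob n (mat_adjoint A))\<^sup>2 = (\<Sum>i<n. \<Sum>j<n. (cmod (A $$ (j, i)))\<^sup>2)"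
    unfolding frob_square using A by (intro sum.cong refl) auto
  also have "\<dots> = (frob n A)\<^sup>2"
    unfolding frob_square by (rule sum.swap)
  finally show ?thesis by (simp add: mn2_def)
qed

lemma frob_square_cols:
  assumes "A \<in> carrier_mat n n"
  shows "(frob n A)\<^sup>2 = (\<Sum>j<n. (vec_norm2 (col A j))\<^sup>2)"
  unfolding frob_square using assms
  by (subst sum.swap) (intro sum.cong refl, simp add: vec_norm2_L2 L2_set_def sum_nonneg)

text \<open>The columns of \<open>A * B\<close> are the images under \<open>A\<close> of the columns
  of \<open>B\<close>, and the square of the Hilbert-Schmidt norm is the sum of the squared column
  norms.\<close>

lemma mn2_mult_le:
  assumes A: "A \<in> carrier_mat n n" and B: "B \<in> carrier_mat n n"
  shows "mn2 n (A * B) \<le> mat_op_norm n A * mn2 n B"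
proof -
  have "(frob n (A * B))\<^sup>2 = (\<Sum>j<n. (vec_norm2 (A *\<^sub>v col B j))\<^sup>2)"
    unfolding frob_square_cols[OF sq_mult_carrier[OF A B]]
    using A B by (intro sum.cong refl) (simp add: col_mult2[of A n n B n] del: col_mult)
  also have "\<dots> \<le> (\<Sum>j<n. (mat_op_norm n A * vec_norm2 (col B j))\<^sup>2)"
    using A B by (intro sum_mono power_mono mat_op_norm_bound) auto
  also have "\<dots> = (mat_op_norm n A * frob n B)\<^sup>2"
    by (simp add: power_mult_distrib frob_square_cols[OF B] sum_distrib_left)
  finally have "frob n (A * B) \<le> mat_op_norm n A * frob n B"
    by (rule power2_le_imp_le) (use A in simp)
  then show ?thesis by (simp add: mn2_def divide_right_mono)
qed

lemma mn2_mult_le':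
  assumes A: "A \<in> carrier_mat n n" and B: "B \<in> carrier_mat n n"
  shows "mn2 n (A * B) \<le> mn2 n A * mat_op_norm n B"
proof -
  have "mn2 n (A * B) = mn2 n (mat_adjoint B * mat_adjoint A)"
    using mn2_adjoint[of "A * B" n] A B mat_adjoint_mult[OF A B] by simp
  also have "\<dots> \<le> mat_op_norm n B * mn2 n A"
    using mn2_mult_le[of "mat_adjoint B" n "mat_adjoint A"] A B by (simp add: mn2_adjoint mat_op_norm_adjoint)
  finally show ?thesis by (simp add: mult.commute)
qed

text \<open>An inequality because the left side is 0 at \<open>n = 0\<close>; in this form the
  comparisons of norms hold for every \<open>n\<close>.\<close>

lemma mn2_one: "mn2 n (1\<^sub>m n) \<le> 1"
proof (cases "n = 0")
  case False
  have "complex_of_real ((mn2 n (1\<^sub>m n))\<^sup>2) = 1"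
    using mtr_adjoint_self[of "1\<^sub>m n" n] mtr_one[of n] False by simp
  then have "(mn2 n (1\<^sub>m n))\<^sup>2 = 1" by (simp only: of_real_eq_1_iff)
  then show ?thesis by (metis abs_le_square_iff abs_of_nonneg mn2_nonneg one_power2 order_refl abs_one)
qed (simp add: mn2_def)

lemma mn2_le_op_norm: "A \<in> carrier_mat n n \<Longrightarrow> mn2 n A \<le> mat_op_norm n A"
  using mn2_mult_le[of A n "1\<^sub>m n"] mn2_one[of n] mult_left_le[of "mn2 n (1\<^sub>m n)" "mat_op_norm n A"] by auto

lemma mtr_le_mn2: "A \<in> carrier_mat n n \<Longrightarrow> cmod (mtr n A) \<le> mn2 n A"
  using mtr_adjoint_mult_le[of "1\<^sub>m n" n A] mn2_one[of n] mult_left_le_one_le[of "mn2 n A" "mn2 n (1\<^sub>m n)"] by auto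

lemma mn2_eq_0: "A \<in> carrier_mat n n \<Longrightarrow> mn2 n A = 0 \<longleftrightarrow> A = 0\<^sub>m n n"
  by (cases "n = 0") (auto simp: mn2_def frob_def L2_set_eq_0_iff intro!: eq_matI)

section \<open>Unitary conjugation\<close>

lemma unitaries_carrier: "V \<in> unitaries n \<Longrightarrow> V \<in> carrier_mat n n"
  by (simp add: unitaries_def)

lemma unitaries_norm: "V \<in> unitaries n \<Longrightarrow> mat_op_norm n V \<le> 1"
proof -
  assume V: "V \<in> unitaries n"
  then have "(mat_op_norm n V)\<^sup>2 \<le> 1"
    using mat_op_norm_cstar[of V n] mat_op_norm_one[of n] by (simp add: unitaries_def)
  then show ?thesis by (simp add: power_le_one_iff[of _ 2] abs_square_le_1)
qed

lemma unitaries_adjoint: "V \<in> unitaries n \<Longrightarrow> mat_adjoint V \<in> unitaries n"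
  by (auto simp: unitaries_def)

lemma unitaries_mult:
  assumes "V \<in> unitaries n" "W \<in> unitaries n"
  shows "V * W \<in> unitaries n"
proof -
  have V: "V \<in> carrier_mat n n" "mat_adjoint V * V = 1\<^sub>m n" "V * mat_adjoint V = 1\<^sub>m n"
    and W: "W \<in> carrier_mat n n" "mat_adjoint W * W = 1\<^sub>m n" "W * mat_adjoint W = 1\<^sub>m n"
    using assms by (auto simp: unitaries_def)
  have "mat_adjoint W * mat_adjoint V * (V * W) = mat_adjoint W * (mat_adjoint V * V) * W"
    using V(1) W(1) by (simp add: assoc_mult_mat[where n\<^sub>1=n and n\<^sub>2=n and n\<^sub>3=n and n\<^sub>4=n])
  moreover have "V * W * (mat_adjoint W * mat_adjoint V) = V * (W * mat_adjoint W) * mat_adjoint V"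
    using V(1) W(1) by (simp add: assoc_mult_mat[where n\<^sub>1=n and n\<^sub>2=n and n\<^sub>3=n and n\<^sub>4=n])
  ultimately show ?thesis
    using V W by (simp add: unitaries_def mat_adjoint_mult[where n=n and m=n and k=n] right_mult_one_mat[where nr=n and nc=n])
qed

definition conj_by :: "complex mat \<Rightarrow> complex mat \<Rightarrow> complex mat" where
  "conj_by V A = V * A * mat_adjoint V"

lemma conj_by_carrier [simp]: "V \<in> unitaries n \<Longrightarrow> A \<in> carrier_mat n n \<Longrightarrow> conj_by V A \<in> carrier_mat n n"
  by (simp add: conj_by_def unitaries_carrier)

lemma sq_assoc: "A \<in> carrier_mat n n \<Longrightarrow> B \<in> carrier_mat n n \<Longrightarrow> C \<in> carrier_mat n n \<Longrightarrow> A * B * C = A * (B * C)"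
  by (rule assoc_mult_mat)

lemma conj_by_minus:
  assumes "V \<in> unitaries n" "A \<in> carrier_mat n n" "B \<in> carrier_mat n n"
  shows "conj_by V (A - B) = conj_by V A - conj_by V B"
  using assms unitaries_carrier[OF assms(1)]
  by (simp add: conj_by_def mult_minus_distrib_mat[where nr=n and n=n and nc=n]
      minus_mult_distrib_mat[where nr=n and n=n and nc=n])

lemma conj_by_add:
  assumes "V \<in> unitaries n" "A \<in> carrier_mat n n" "B \<in> carrier_mat n n"
  shows "conj_by V (A + B) = conj_by V A + conj_by V B"
  using assms unitaries_carrier[OF assms(1)]
  by (simp add: conj_by_def mult_add_distrib_mat[where nr=n and n=n and nc=n]
      add_mult_distrib_mat[where nr=n and n=n and nc=n])

lemma conj_by_mult:
  assumes "V \<in> unitaries n" "A \<in> carrier_mat n n" "B \<in> carrier_mat n n"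
  shows "conj_by V (A * B) = conj_by V A * conj_by V B"
proof -
  have V: "V \<in> carrier_mat n n" "mat_adjoint V * V = 1\<^sub>m n" using assms by (auto simp: unitaries_def)
  have "conj_by V A * conj_by V B = V * A * ((mat_adjoint V * V) * B * mat_adjoint V)"
    using V(1) assms by (simp add: conj_by_def sq_assoc[where n=n])
  then show ?thesis using V assms by (simp add: conj_by_def sq_assoc[where n=n])
qed

lemma conj_by_conj_by:
  assumes "V \<in> unitaries n" "W \<in> unitaries n" "A \<in> carrier_mat n n"
  shows "conj_by V (conj_by W A) = conj_by (V * W) A"
  using assms unitaries_carrier[of V n] unitaries_carrier[of W n]
  by (simp add: conj_by_def mat_adjoint_mult[where n=n and m=n and k=n] sq_assoc[where n=n])

lemma conj_by_adjoint:
  assumes "V \<in> unitaries n" "A \<in> carrier_mat n n"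
  shows "conj_by V (mat_adjoint A) = mat_adjoint (conj_by V A)"
  using assms unitaries_carrier[of V n]
  by (simp add: conj_by_def mat_adjoint_mult[where n=n and m=n and k=n] sq_assoc[where n=n])

lemma conj_by_smult:
  assumes "V \<in> unitaries n" "A \<in> carrier_mat n n"
  shows "conj_by V (c \<cdot>\<^sub>m A) = c \<cdot>\<^sub>m conj_by V A"
  using assms unitaries_carrier[of V n]
  by (simp add: conj_by_def mult_smult_distrib[where nr=n and n=n and nc=n] mult_smult_assoc_mat[where nr=n and n=n and nc=n])

lemma conj_by_one [simp]: "V \<in> unitaries n \<Longrightarrow> conj_by V (1\<^sub>m n) = 1\<^sub>m n"
  using unitaries_carrier[of V n] by (simp add: conj_by_def unitaries_def right_mult_one_mat[where nr=n and nc=n])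

lemma conj_by_id [simp]: "A \<in> carrier_mat n n \<Longrightarrow> conj_by (1\<^sub>m n) A = A"
  by (simp add: conj_by_def)

lemma conj_by_zero [simp]: "V \<in> unitaries n \<Longrightarrow> conj_by V (0\<^sub>m n n) = 0\<^sub>m n n"
  using unitaries_carrier[of V n] by (simp add: conj_by_def)

lemma conj_by_inverse:
  assumes "V \<in> unitaries n" "A \<in> carrier_mat n n"
  shows "conj_by (mat_adjoint V) (conj_by V A) = A" "conj_by V (conj_by (mat_adjoint V) A) = A"
  using assms by (simp_all add: conj_by_conj_by[where n=n] unitaries_adjoint) (simp_all add: unitaries_def)

lemma mn2_conj_le:
  assumes "V \<in> unitaries n" "A \<in> carrier_mat n n"
  shows "mn2 n (conj_by V A) \<le> mn2 n A"
proof -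
  have V: "V \<in> carrier_mat n n" "mat_op_norm n V \<le> 1" using assms unitaries_carrier unitaries_norm by auto
  have "mn2 n (conj_by V A) \<le> mn2 n (V * A) * mat_op_norm n (mat_adjoint V)"
    unfolding conj_by_def using V assms by (intro mn2_mult_le') auto
  also have "\<dots> \<le> mn2 n (V * A) * 1"
    using V by (intro mult_left_mono) (auto simp: mat_op_norm_adjoint)
  also have "\<dots> \<le> mat_op_norm n V * mn2 n A"
    using mn2_mult_le[OF V(1) assms(2)] by simp
  also have "\<dots> \<le> mn2 n A"
    using V mult_left_le_one_le[of "mn2 n A" "mat_op_norm n V"] by simp
  finally show ?thesis .
qed

lemma mn2_conj:
  assumes "V \<in> unitaries n" "A \<in> carrier_mat n n"
  shows "mn2 n (conj_by V A) = mn2 n A"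
  using mn2_conj_le[OF assms] mn2_conj_le[of "mat_adjoint V" n "conj_by V A"] assms
  by (simp add: unitaries_adjoint conj_by_inverse)

section \<open>Normality of functionals bounded in the 2-norm\<close>

text \<open>The properties of a tracial W*-algebra that can be verified for the ultraproduct by hand and that
  suffice for normality; the last one says that 2-norm Cauchy sequences of positive elements below a
  fixed element converge to a positive element.\<close>

locale pretracial = ring M for M :: "'a star_alg" (structure) +
  assumes sclosed: "x \<in> carrier M \<Longrightarrow> star M x \<in> carrier M"
    and sadd: "x \<in> carrier M \<Longrightarrow> y \<in> carrier M \<Longrightarrow> star M (x \<oplus> y) = star M x \<oplus> star M y"
    and smult: "x \<in> carrier M \<Longrightarrow> y \<in> carrier M \<Longrightarrow> star M (x \<otimes> y) = star M y \<otimes> star M x"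
    and sstar: "x \<in> carrier M \<Longrightarrow> star M (star M x) = x"
    and tadd: "x \<in> carrier M \<Longrightarrow> y \<in> carrier M \<Longrightarrow> tr M (x \<oplus> y) = tr M x + tr M y"
    and tcomm: "x \<in> carrier M \<Longrightarrow> y \<in> carrier M \<Longrightarrow> tr M (x \<otimes> y) = tr M (y \<otimes> x)"
    and tpos: "x \<in> carrier M \<Longrightarrow> 0 \<le> Re (tr M (star M x \<otimes> x))"
    and norm2_faithful: "x \<in> carrier M \<Longrightarrow> norm2 M x = 0 \<Longrightarrow> x = \<zero>"
    and norm2_triangle: "x \<in> carrier M \<Longrightarrow> y \<in> carrier M \<Longrightarrow> norm2 M (x \<oplus> y) \<le> norm2 M x + norm2 M y"
    and norm2_mult: "x \<in> carrier M \<Longrightarrow> y \<in> carrier M \<Longrightarrow> norm2 M (x \<otimes> y) \<le> cnorm M x * norm2 M y"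
    and norm2_cnorm: "x \<in> carrier M \<Longrightarrow> norm2 M x \<le> cnorm M x"
    and tr_norm2: "x \<in> carrier M \<Longrightarrow> cmod (tr M x) \<le> norm2 M x"
    and monotone_complete: "\<lbrakk>d \<in> carrier M; \<And>k. c k \<in> carrier M; \<And>k. e k \<in> carrier M;
        \<And>k::nat. (star M (c k) \<otimes> c k) \<oplus> (star M (e k) \<otimes> e k) = star M d \<otimes> d;
        \<And>\<epsilon>. \<epsilon> > 0 \<Longrightarrow> \<exists>N. \<forall>k\<ge>N. \<forall>l\<ge>N. norm2 M ((star M (c k) \<otimes> c k) \<ominus> (star M (c l) \<otimes> c l)) < \<epsilon>\<rbrakk> \<Longrightarrow>
        \<exists>c'\<in>carrier M. (\<lambda>k. norm2 M ((star M (c k) \<otimes> c k) \<ominus> (star M c' \<otimes> c'))) \<longlonglongrightarrow> 0"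
begin

definition sq :: "'a \<Rightarrow> 'a" where "sq x = star M x \<otimes> x"

lemma sq_closed [simp]: "x \<in> carrier M \<Longrightarrow> sq x \<in> carrier M"
  by (simp add: sq_def sclosed)

lemma szero: "star M \<zero> = \<zero>"
  using sadd[of \<zero> \<zero>] sclosed[of \<zero>] by (metis add.r_cancel_one zero_closed l_zero)

lemma sneg: "x \<in> carrier M \<Longrightarrow> star M (\<ominus> x) = \<ominus> (star M x)"
  using sadd[of "\<ominus> x" x] szero sclosed by (metis a_inv_closed l_neg minus_equality)

lemma sminus: "x \<in> carrier M \<Longrightarrow> y \<in> carrier M \<Longrightarrow> star M (x \<ominus> y) = star M x \<ominus> star M y"
  by (simp add: a_minus_def sadd sneg)

lemma tminus:
  assumes "x \<in> carrier M" "y \<in> carrier M"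
  shows "tr M (x \<ominus> y) = tr M x - tr M y"
proof -
  have "(x \<ominus> y) \<oplus> y = x" using assms by (simp add: a_minus_def a_assoc l_neg)
  then show ?thesis using tadd[of "x \<ominus> y" y] assms by simp
qed

lemma norm2_nonneg: "x \<in> carrier M \<Longrightarrow> 0 \<le> norm2 M x"
  using tpos by (simp add: norm2_def)

lemma norm2_square: "x \<in> carrier M \<Longrightarrow> (norm2 M x)\<^sup>2 = Re (tr M (star M x \<otimes> x))"
  using tpos by (simp add: norm2_def)

lemma norm2_neg: "x \<in> carrier M \<Longrightarrow> norm2 M (\<ominus> x) = norm2 M x"
  by (simp add: norm2_def sneg sclosed l_minus r_minus)

lemma norm2_minus_commute: "x \<in> carrier M \<Longrightarrow> y \<in> carrier M \<Longrightarrow> norm2 M (x \<ominus> y) = norm2 M (y \<ominus> x)"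
  using norm2_neg[of "y \<ominus> x"] by (simp add: a_minus_def minus_add a_comm)

lemma minus_split: "x \<in> carrier M \<Longrightarrow> y \<in> carrier M \<Longrightarrow> z \<in> carrier M \<Longrightarrow> x \<ominus> z = (y \<ominus> z) \<oplus> (x \<ominus> y)"
  by algebra

lemma norm2_triangle_minus:
  assumes "x \<in> carrier M" "y \<in> carrier M" "z \<in> carrier M"
  shows "norm2 M (x \<ominus> z) \<le> norm2 M (x \<ominus> y) + norm2 M (y \<ominus> z)"
  using norm2_triangle[of "y \<ominus> z" "x \<ominus> y"] minus_split[OF assms] assms by simp

lemma norm2_star: "x \<in> carrier M \<Longrightarrow> norm2 M (star M x) = norm2 M x"
  using tcomm[of x "star M x"] by (simp add: norm2_def sstar sclosed)

lemma op_leD: "op_le M x y \<Longrightarrow> \<exists>z\<in>carrier M. y \<ominus> x = sq z"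
  by (auto simp: op_le_def sq_def)

lemma tsq_nonneg: "z \<in> carrier M \<Longrightarrow> 0 \<le> Re (tr M (sq z))"
  using tpos by (simp add: sq_def)

lemma op_le_tr: "x \<in> carrier M \<Longrightarrow> y \<in> carrier M \<Longrightarrow> op_le M x y \<Longrightarrow> Re (tr M x) \<le> Re (tr M y)"
  using op_leD[of x y] tsq_nonneg tminus[of y x] by force

lemma tr_conj_sq_nonneg:
  assumes "f \<in> carrier M" "p \<in> carrier M"
  shows "0 \<le> Re (tr M (f \<otimes> sq p \<otimes> star M f))"
proof -
  have "f \<otimes> sq p \<otimes> star M f = sq (p \<otimes> star M f)"
    using assms by (simp add: sq_def smult sstar sclosed m_assoc)
  then show ?thesis using tsq_nonneg[of "p \<otimes> star M f"] assms sclosed by simp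
qed

text \<open>The estimate \<open>tr (f f\<^sup>* f f\<^sup>*) \<le> tr (f d\<^sup>* d f\<^sup>*)\<close> for \<open>f\<^sup>* f \<le> d\<^sup>* d\<close> avoids square
  roots of positive elements.\<close>

lemma norm2_sq_le:
  assumes car: "d \<in> carrier M" "f \<in> carrier M" "p \<in> carrier M" "q \<in> carrier M"
    and eq: "sq d = sq f \<oplus> (sq p \<oplus> sq q)"
  shows "(norm2 M (sq f))\<^sup>2 \<le> (cnorm M d)\<^sup>2 * Re (tr M (sq f))"
proof -
  note [simp] = car sclosed
  have cnd: "0 \<le> cnorm M d" using norm2_cnorm[of d] norm2_nonneg[of d] by simp
  have "star M (sq f) = sq f" by (simp add: sq_def smult sstar)
  then have "(norm2 M (sq f))\<^sup>2 = Re (tr M (sq f \<otimes> sq f))" by (simp add: norm2_square)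
  also have "tr M (sq f \<otimes> sq f) = tr M (star M f \<otimes> (f \<otimes> sq f))"
    by (simp add: sq_def m_assoc)
  also have "\<dots> = tr M (f \<otimes> sq f \<otimes> star M f)" by (rule tcomm) simp_all
  also have "Re (tr M (f \<otimes> sq f \<otimes> star M f)) \<le> Re (tr M (f \<otimes> sq d \<otimes> star M f))"
  proof -
    have "f \<otimes> sq d \<otimes> star M f = f \<otimes> sq f \<otimes> star M f \<oplus> (f \<otimes> sq p \<otimes> star M f \<oplus> f \<otimes> sq q \<otimes> star M f)"
      unfolding eq by (simp add: l_distr r_distr)
    then show ?thesis using tr_conj_sq_nonneg[of f p] tr_conj_sq_nonneg[of f q] by (simp add: tadd)
  qed
  also have "f \<otimes> sq d \<otimes> star M f = star M (d \<otimes> star M f) \<otimes> (d \<otimes> star M f)"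
    by (simp add: sq_def smult sstar m_assoc)
  also have "Re (tr M \<dots>) = (norm2 M (d \<otimes> star M f))\<^sup>2"
    by (simp add: norm2_square)
  also have "\<dots> \<le> (cnorm M d * norm2 M (star M f))\<^sup>2"
    by (intro power_mono norm2_mult norm2_nonneg) simp_all
  also have "\<dots> = (cnorm M d)\<^sup>2 * Re (tr M (sq f))"
    by (simp add: power_mult_distrib norm2_star norm2_square sq_def)
  finally show ?thesis .
qed

text \<open>In an increasing net choose a sequence along which the trace tends to its supremum. It is
  2-norm Cauchy, and its limit is an upper bound with the same trace; hence the net converges in the
  2-norm to its supremum.\<close>

lemma normal_of_norm2_bounded:
  assumes lin: "linear_functional M \<phi>"
    and bd: "\<And>v. v \<in> carrier M \<Longrightarrow> cmod (\<phi> v) \<le> C * norm2 M v"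
  shows "normal_functional M \<phi>"
proof -
  \<comment> \<open>\<open>C\<close> may be zero or negative, while the final estimate divides by
    the constant.\<close>
  define C' where "C' = \<bar>C\<bar> + 1"
  have C': "C' > 0" by (simp add: C'_def)
  have bd': "cmod (\<phi> v) \<le> C' * norm2 M v" if "v \<in> carrier M" for v
    using bd[OF that] mult_right_mono[of C C' "norm2 M v"] norm2_nonneg[OF that] by (force simp: C'_def)
  have bdc: "\<exists>C. \<forall>x\<in>carrier M. cmod (\<phi> x) \<le> C * cnorm M x"
    by (intro exI[of _ C'] ballI order_trans[OF bd'] mult_left_mono norm2_cnorm) (use C' in auto)
  have phi_minus: "\<phi> (x \<ominus> y) = \<phi> x - \<phi> y" if "x \<in> carrier M" "y \<in> carrier M" for x y
  proof -
    have "(x \<ominus> y) \<oplus> y = x" using that by (simp add: a_minus_def a_assoc l_neg)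
    moreover have "\<phi> ((x \<ominus> y) \<oplus> y) = \<phi> (x \<ominus> y) + \<phi> y" using lin that by (simp add: linear_functional_def)
    ultimately show ?thesis by simp
  qed
  have net: "\<exists>x\<in>D. \<forall>y\<in>D. op_le M x y \<longrightarrow> cmod (\<phi> y - \<phi> s) < \<epsilon>"
    if D: "increasing_net_sup M D s" and eps: "\<epsilon> > 0" for D s and \<epsilon> :: real
  proof -
    have Dne: "D \<noteq> {}" and Dsa: "D \<subseteq> self_adjoints M" and ssa: "s \<in> self_adjoints M"
      and dir: "\<And>x y. x \<in> D \<Longrightarrow> y \<in> D \<Longrightarrow> \<exists>z\<in>D. op_le M x z \<and> op_le M y z"
      and ub: "\<And>x. x \<in> D \<Longrightarrow> op_le M x s"
      and least: "\<And>u. u \<in> self_adjoints M \<Longrightarrow> (\<And>x. x \<in> D \<Longrightarrow> op_le M x u) \<Longrightarrow> op_le M s u"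
      using D unfolding increasing_net_sup_def by blast+
    have Dc: "x \<in> carrier M" if "x \<in> D" for x using that Dsa by (auto simp: self_adjoints_def)
    have sc: "s \<in> carrier M" using ssa by (simp add: self_adjoints_def)
    obtain x0 where x0: "x0 \<in> D" using Dne by blast
    obtain d where d: "d \<in> carrier M" "s \<ominus> x0 = sq d" using op_leD[OF ub[OF x0]] by blast
    \<comment> \<open>Differences of net elements beyond \<open>x0\<close> lie below
      \<open>s \<ominus> x0\<close>, so this one constant serves in every application of
      \<open>norm2_sq_le\<close>.\<close>
    define K where "K = (cnorm M d)\<^sup>2"
    have K: "0 \<le> K" by (simp add: K_def)
    define t where "t = Sup ((\<lambda>x. Re (tr M x)) ` D)"
    have bddt: "bdd_above ((\<lambda>x. Re (tr M x)) ` D)"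
      by (rule bdd_aboveI[where M = "Re (tr M s)"]) (auto intro: op_le_tr Dc sc ub)
    have le_t: "Re (tr M x) \<le> t" if "x \<in> D" for x
      unfolding t_def by (rule cSup_upper[OF _ bddt]) (use that in auto)
    have near_t: "\<exists>u\<in>D. t - \<delta> < Re (tr M u)" if "\<delta> > 0" for \<delta>
      using less_cSupD[of "(\<lambda>x. Re (tr M x)) ` D" "t - \<delta>"] that Dne by (auto simp: t_def)
    have est1: "(norm2 M (w \<ominus> y))\<^sup>2 \<le> K * (Re (tr M w) - Re (tr M y))"
      if a: "y \<in> D" "w \<in> D" "op_le M x0 y" "op_le M y w" for y w
    proof -
      obtain f where f: "f \<in> carrier M" "w \<ominus> y = sq f" using op_leD[OF a(4)] by blast
      obtain p where p: "p \<in> carrier M" "y \<ominus> x0 = sq p" using op_leD[OF a(3)] by blast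
      obtain q where q: "q \<in> carrier M" "s \<ominus> w = sq q" using op_leD[OF ub[OF a(2)]] by blast
      have "s \<ominus> x0 = (w \<ominus> y) \<oplus> ((y \<ominus> x0) \<oplus> (s \<ominus> w))"
        using Dc[OF a(1)] Dc[OF a(2)] Dc[OF x0] sc by algebra
      then have "sq d = sq f \<oplus> (sq p \<oplus> sq q)" using d f p q by simp
      from norm2_sq_le[OF d(1) f(1) p(1) q(1) this] show ?thesis
        using f(2) tminus[OF Dc[OF a(2)] Dc[OF a(1)]] by (simp add: K_def)
    qed
    have est2: "(norm2 M (s \<ominus> y))\<^sup>2 \<le> K * (Re (tr M s) - Re (tr M y))"
      if a: "y \<in> D" "w \<in> D" "op_le M x0 w" "op_le M w y" for y w
    proof -
      obtain f where f: "f \<in> carrier M" "s \<ominus> y = sq f" using op_leD[OF ub[OF a(1)]] by blast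
      obtain p where p: "p \<in> carrier M" "w \<ominus> x0 = sq p" using op_leD[OF a(3)] by blast
      obtain q where q: "q \<in> carrier M" "y \<ominus> w = sq q" using op_leD[OF a(4)] by blast
      have "s \<ominus> x0 = (s \<ominus> y) \<oplus> ((w \<ominus> x0) \<oplus> (y \<ominus> w))"
        using Dc[OF a(1)] Dc[OF a(2)] Dc[OF x0] sc by algebra
      then have "sq d = sq f \<oplus> (sq p \<oplus> sq q)" using d f p q by simp
      from norm2_sq_le[OF d(1) f(1) p(1) q(1) this] show ?thesis
        using f(2) tminus[OF sc Dc[OF a(1)]] by (simp add: K_def)
    qed
    have "\<exists>y\<in>D. op_le M x0 y \<and> t - 1 / real (Suc k) < Re (tr M y)" for k
    proof -
      obtain u where u: "u \<in> D" "t - 1 / real (Suc k) < Re (tr M u)" using near_t[of "1 / real (Suc k)"] by auto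
      obtain y where "y \<in> D" "op_le M x0 y" "op_le M u y" using dir[OF x0 u(1)] by blast
      then show ?thesis using u op_le_tr[of u y] Dc by fastforce
    qed
    then obtain y where y: "\<And>k. y k \<in> D" "\<And>k. op_le M x0 (y k)"
        "\<And>k. t - 1 / real (Suc k) < Re (tr M (y k))" by metis
    have yc: "y k \<in> carrier M" for k using y Dc by blast
    have x0c: "x0 \<in> carrier M" using x0 Dc by blast
    have est3: "(norm2 M (w \<ominus> y k))\<^sup>2 \<le> K / real (Suc k)" if "w \<in> D" "op_le M (y k) w" for w k
    proof -
      have "(norm2 M (w \<ominus> y k))\<^sup>2 \<le> K * (Re (tr M w) - Re (tr M (y k)))" using est1 y that by blast
      also have "\<dots> \<le> K * (1 / real (Suc k))" using le_t[OF that(1)] y(3)[of k] K by (intro mult_left_mono) auto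
      finally show ?thesis by simp
    qed
    have est3': "norm2 M (w \<ominus> y k) \<le> sqrt (K / real (Suc k))" if "w \<in> D" "op_le M (y k) w" for w k
      using est3[OF that] by (rule real_le_rsqrt)
    have lim0: "(\<lambda>k. sqrt (K / real (Suc k))) \<longlonglongrightarrow> 0"
      using tendsto_real_sqrt[OF LIMSEQ_Suc[OF lim_const_over_n[of K]]] by simp
    have "\<exists>c. c \<in> carrier M \<and> y k \<ominus> x0 = sq c" for k using op_leD[OF y(2)] by blast
    then obtain c where c: "\<And>k. c k \<in> carrier M" "\<And>k. y k \<ominus> x0 = sq (c k)" by metis
    have "\<exists>c. c \<in> carrier M \<and> s \<ominus> y k = sq c" for k using op_leD[OF ub[OF y(1)]] by blast
    then obtain e where e: "\<And>k. e k \<in> carrier M" "\<And>k. s \<ominus> y k = sq (e k)" by metis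
    \<comment> \<open>Monotone completeness is applied to the positive elements
      \<open>y k \<ominus> x0\<close>, all below \<open>s \<ominus> x0\<close>. They form a Cauchy
      sequence because \<open>y k\<close> and \<open>y l\<close> are both close to a common upper
      bound in \<open>D\<close>.\<close>
    have "\<exists>c'\<in>carrier M. (\<lambda>k. norm2 M (sq (c k) \<ominus> sq c')) \<longlonglongrightarrow> 0"
      unfolding sq_def
    proof (rule monotone_complete[OF d(1) c(1) e(1)], fold sq_def)
      fix k
      show "sq (c k) \<oplus> sq (e k) = sq d"
        using minus_split[OF sc yc x0c, of k] c e d by simp
    next
      fix \<epsilon>' :: real assume e': "\<epsilon>' > 0"
      obtain N where N: "\<And>k. k \<ge> N \<Longrightarrow> sqrt (K / real (Suc k)) < \<epsilon>' / 2"
        using order_tendstoD(2)[OF lim0, of "\<epsilon>' / 2"] e' by (auto simp: eventually_sequentially)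
      have "norm2 M (sq (c k) \<ominus> sq (c l)) < \<epsilon>'" if "k \<ge> N" "l \<ge> N" for k l
      proof -
        obtain w where w: "w \<in> D" "op_le M (y k) w" "op_le M (y l) w" using dir[OF y(1) y(1)] by blast
        have "sq (c k) \<ominus> sq (c l) = y k \<ominus> y l"
          unfolding c(2)[symmetric] using yc[of k] yc[of l] x0c by algebra
        also have "norm2 M (y k \<ominus> y l) \<le> norm2 M (w \<ominus> y k) + norm2 M (w \<ominus> y l)"
          using norm2_triangle_minus[of "y k" w "y l"] norm2_minus_commute[of "y k" w] yc Dc[OF w(1)] by simp
        also have "\<dots> < \<epsilon>'"
          using est3'[OF w(1,2)] est3'[OF w(1,3)] N[OF that(1)] N[OF that(2)] by linarith
        finally show ?thesis .
      qed
      then show "\<exists>N. \<forall>k\<ge>N. \<forall>l\<ge>N. norm2 M (sq (c k) \<ominus> sq (c l)) < \<epsilon>'" by blast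
    qed
    then obtain c' where c': "c' \<in> carrier M" "(\<lambda>k. norm2 M (sq (c k) \<ominus> sq c')) \<longlonglongrightarrow> 0" by blast
    define z where "z = x0 \<oplus> sq c'"
    have zc: "z \<in> carrier M" using x0c c' by (simp add: z_def)
    have zsa: "z \<in> self_adjoints M"
      using zc x0 Dsa c' by (auto simp: self_adjoints_def z_def sadd sq_def smult sclosed sstar)
    have yz: "norm2 M (y k \<ominus> z) = norm2 M (sq (c k) \<ominus> sq c')" for k
    proof -
      have "a \<ominus> (b \<oplus> g) = (a \<ominus> b) \<ominus> g" if "a \<in> carrier M" "b \<in> carrier M" "g \<in> carrier M" for a b g
        using that by algebra
      from this[OF yc x0c sq_closed[OF c'(1)], of k]
      have "y k \<ominus> z = sq (c k) \<ominus> sq c'" by (simp add: z_def c(2))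
      then show ?thesis by simp
    qed
    have limyz: "(\<lambda>k. norm2 M (y k \<ominus> z)) \<longlonglongrightarrow> 0" using c'(2) by (simp add: yz)
    \<comment> \<open>\<open>z\<close> has to bound the whole net and not only the sequence
      \<open>y\<close>. Choose \<open>w k\<close> in \<open>D\<close> above \<open>x\<close> and
      \<open>y k\<close>; it is close to \<open>y k\<close>, hence tends to \<open>z\<close>. A
      second use of monotone completeness shows that the limit \<open>z \<ominus> x\<close> of the
      positive elements \<open>w k \<ominus> x\<close> is positive.\<close>
    have "op_le M x z" if x: "x \<in> D" for x
    proof -
      have xc: "x \<in> carrier M" using x Dc by blast
      have "\<exists>w. w \<in> D \<and> op_le M x w \<and> op_le M (y k) w" for k using dir[OF x y(1)] by blast
      then obtain w where w: "\<And>k. w k \<in> D" "\<And>k. op_le M x (w k)" "\<And>k. op_le M (y k) (w k)" by metis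
      have wc: "w k \<in> carrier M" for k using w Dc by blast
      have "norm2 M (w k \<ominus> z) \<le> sqrt (K / real (Suc k)) + norm2 M (y k \<ominus> z)" for k
        by (rule order_trans[OF norm2_triangle_minus[OF wc yc zc] add_right_mono[OF est3'[OF w(1) w(3)]]])
      note wz = this
      have limwz: "(\<lambda>k. norm2 M (w k \<ominus> z)) \<longlonglongrightarrow> 0"
      proof (rule tendsto_sandwich[OF always_eventually always_eventually tendsto_const])
        show "\<forall>k. 0 \<le> norm2 M (w k \<ominus> z)" using norm2_nonneg wc zc by blast
        show "\<forall>k. norm2 M (w k \<ominus> z) \<le> sqrt (K / real (Suc k)) + norm2 M (y k \<ominus> z)" using wz by blast
        show "(\<lambda>k. sqrt (K / real (Suc k)) + norm2 M (y k \<ominus> z)) \<longlonglongrightarrow> 0"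
          using tendsto_add[OF lim0 limyz] by simp
      qed
      have "\<exists>a. a \<in> carrier M \<and> w k \<ominus> x = sq a" for k using op_leD[OF w(2)] by blast
      then obtain a where a: "\<And>k. a k \<in> carrier M" "\<And>k. w k \<ominus> x = sq (a k)" by metis
      have "\<exists>a. a \<in> carrier M \<and> s \<ominus> w k = sq a" for k using op_leD[OF ub[OF w(1)]] by blast
      then obtain b where b: "\<And>k. b k \<in> carrier M" "\<And>k. s \<ominus> w k = sq (b k)" by metis
      obtain d' where d': "d' \<in> carrier M" "s \<ominus> x = sq d'" using op_leD[OF ub[OF x]] by blast
      have "\<exists>a'\<in>carrier M. (\<lambda>k. norm2 M (sq (a k) \<ominus> sq a')) \<longlonglongrightarrow> 0"
        unfolding sq_def
      proof (rule monotone_complete[OF d'(1) a(1) b(1)], fold sq_def)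
        fix k
        show "sq (a k) \<oplus> sq (b k) = sq d'"
          using minus_split[OF sc wc xc, of k] a b d' by simp
      next
        fix \<epsilon>' :: real assume e': "\<epsilon>' > 0"
        obtain N where N: "\<And>k. k \<ge> N \<Longrightarrow> norm2 M (w k \<ominus> z) < \<epsilon>' / 2"
          using order_tendstoD(2)[OF limwz, of "\<epsilon>' / 2"] e' by (auto simp: eventually_sequentially)
        have "norm2 M (sq (a k) \<ominus> sq (a l)) < \<epsilon>'" if "k \<ge> N" "l \<ge> N" for k l
        proof -
          have "sq (a k) \<ominus> sq (a l) = w k \<ominus> w l"
            unfolding a(2)[symmetric] using wc[of k] wc[of l] xc by algebra
          also have "norm2 M (w k \<ominus> w l) \<le> norm2 M (w k \<ominus> z) + norm2 M (w l \<ominus> z)"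
            using norm2_triangle_minus[OF wc zc wc, of k l] norm2_minus_commute[of "w l" z] wc zc by simp
          also have "\<dots> < \<epsilon>'" using N[OF that(1)] N[OF that(2)] by linarith
          finally show ?thesis .
        qed
        then show "\<exists>N. \<forall>k\<ge>N. \<forall>l\<ge>N. norm2 M (sq (a k) \<ominus> sq (a l)) < \<epsilon>'" by blast
      qed
      then obtain a' where a': "a' \<in> carrier M" "(\<lambda>k. norm2 M (sq (a k) \<ominus> sq a')) \<longlonglongrightarrow> 0" by blast
      have "norm2 M ((z \<ominus> x) \<ominus> sq a') \<le> norm2 M (w k \<ominus> z) + norm2 M (sq (a k) \<ominus> sq a')" for k
      proof -
        have "(z \<ominus> x) \<ominus> sq (a k) = z \<ominus> w k"
          unfolding a(2)[symmetric] using wc xc zc by algebra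
        then show ?thesis
          using norm2_triangle_minus[of "z \<ominus> x" "sq (a k)" "sq a'"] norm2_minus_commute[OF zc wc] zc xc a a' by simp
      qed
      then have "norm2 M ((z \<ominus> x) \<ominus> sq a') \<le> 0"
        using tendsto_add[OF limwz a'(2)] by (intro LIMSEQ_le_const[where X = "\<lambda>k. norm2 M (w k \<ominus> z) + norm2 M (sq (a k) \<ominus> sq a')"]) auto
      then have "(z \<ominus> x) \<ominus> sq a' = \<zero>"
        using norm2_faithful[of "(z \<ominus> x) \<ominus> sq a'"] norm2_nonneg[of "(z \<ominus> x) \<ominus> sq a'"] zc xc a' by auto
      then have "z \<ominus> x = sq a'" using zc xc a' by simp
      then show ?thesis using a' by (auto simp: op_le_def sq_def)
    qed
    then have "op_le M s z" by (rule least[OF zsa])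
    then have "Re (tr M s) \<le> Re (tr M z)" using op_le_tr sc zc by blast
    also have "Re (tr M z) \<le> t"
    proof (rule LIMSEQ_le_const)
      show "(\<lambda>k. t + norm2 M (y k \<ominus> z)) \<longlonglongrightarrow> t" using tendsto_add[OF tendsto_const limyz] by simp
      have "Re (tr M z) \<le> t + norm2 M (y k \<ominus> z)" for k
      proof -
        have "Re (tr M z) - Re (tr M (y k)) \<le> cmod (tr M (y k \<ominus> z))"
          using abs_Re_le_cmod[of "tr M (y k \<ominus> z)"] tminus[OF yc zc, of k] by simp
        then show ?thesis using tr_norm2[of "y k \<ominus> z"] yc zc le_t[OF y(1), of k] by simp
      qed
      then show "\<exists>N. \<forall>k\<ge>N. Re (tr M z) \<le> t + norm2 M (y k \<ominus> z)" by blast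
    qed
    finally have st: "Re (tr M s) \<le> t" .
    \<comment> \<open>With this tolerance for the trace, \<open>est2\<close> gives a 2-norm distance
      of at most \<epsilon> / (2 C'). Writing \<open>K + 1\<close> keeps the denominator
      positive.\<close>
    define \<delta> where "\<delta> = (\<epsilon> / (2 * C'))\<^sup>2 / (K + 1)"
    have \<delta>: "\<delta> > 0" using eps C' K by (simp add: \<delta>_def)
    obtain u where u: "u \<in> D" "t - \<delta> < Re (tr M u)" using near_t[OF \<delta>] by blast
    obtain w where w: "w \<in> D" "op_le M x0 w" "op_le M u w" using dir[OF x0 u(1)] by blast
    show ?thesis
    proof (intro bexI[of _ w] ballI impI w(1))
      fix v assume v: "v \<in> D" "op_le M w v"
      have "Re (tr M s) - Re (tr M v) \<le> \<delta>"
        using op_le_tr[OF Dc[OF u(1)] Dc[OF w(1)] w(3)] op_le_tr[OF Dc[OF w(1)] Dc[OF v(1)] v(2)] u(2) st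
        by linarith
      then have "(norm2 M (s \<ominus> v))\<^sup>2 \<le> K * \<delta>"
        by (rule order_trans[OF est2[OF v(1) w(1,2) v(2)] mult_left_mono[OF _ K]])
      also have "\<dots> \<le> (K + 1) * \<delta>" using \<delta> by simp
      also have "\<dots> = (\<epsilon> / (2 * C'))\<^sup>2" using K by (simp add: \<delta>_def)
      finally have "norm2 M (s \<ominus> v) \<le> \<epsilon> / (2 * C')"
        by (rule power2_le_imp_le) (use eps C' in simp)
      then have "C' * norm2 M (s \<ominus> v) \<le> C' * (\<epsilon> / (2 * C'))"
        by (rule mult_left_mono) (use C' in simp)
      also have "C' * (\<epsilon> / (2 * C')) = \<epsilon> / 2" using C' by simp
      finally have half: "C' * norm2 M (s \<ominus> v) \<le> \<epsilon> / 2" .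
      have sv: "s \<ominus> v \<in> carrier M" using sc Dc[OF v(1)] by simp
      have "cmod (\<phi> v - \<phi> s) = cmod (\<phi> (s \<ominus> v))"
        unfolding phi_minus[OF sc Dc[OF v(1)]] by (rule norm_minus_commute)
      also have "\<dots> \<le> C' * norm2 M (s \<ominus> v)" by (rule bd'[OF sv])
      finally have le: "cmod (\<phi> v - \<phi> s) \<le> C' * norm2 M (s \<ominus> v)" .
      have "\<epsilon> / 2 < \<epsilon>" using eps by simp
      then show "cmod (\<phi> v - \<phi> s) < \<epsilon>"
        by (rule le_less_trans[OF order_trans[OF le half]])
    qed
  qed
  show ?thesis unfolding normal_functional_def
    by (intro conjI lin bdc allI impI net)
qed

end

declare mult_carrier_mat [simp del] mult_mat_vec_carrier [simp del] assoc_mult_mat [simp del]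
  assoc_mult_mat_vec [simp del] mat_adjoint_carrier [simp del]

lemma sq_adjoint_carrier [simp]:
  fixes A :: "complex mat"
  shows "A \<in> carrier_mat n n \<Longrightarrow> mat_adjoint A \<in> carrier_mat n n"
  by (rule mat_adjoint_carrier)

section \<open>Matrix algebras as tracial W*-algebras\<close>

text \<open>Bolzano-Weierstrass, one entry after the other. This is the compactness behind monotone
  completeness of the matrix algebras.\<close>

lemma entrywise_convergent_subsequence:
  fixes C :: "nat \<Rightarrow> complex mat"
  assumes "finite S" "\<And>p k. p \<in> S \<Longrightarrow> cmod (C k $$ p) \<le> B"
  shows "\<exists>r L. strict_mono r \<and> (\<forall>p\<in>S. (\<lambda>k. C (r k) $$ p) \<longlonglongrightarrow> L p)"
  using assms
proof (induction S rule: finite_induct)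
  case empty
  show ?case by (rule exI[of _ "\<lambda>k. k"]) (simp add: strict_mono_def)
next
  case (insert q S)
  then obtain r L where r: "strict_mono r" and L: "\<forall>p\<in>S. (\<lambda>k. C (r k) $$ p) \<longlonglongrightarrow> L p" by fastforce
  have "bounded (range (\<lambda>k. C (r k) $$ q))"
    by (rule boundedI[where B = B]) (use insert.prems[of q] in blast)
  then obtain l r' where r': "strict_mono r'" and l: "((\<lambda>k. C (r k) $$ q) \<circ> r') \<longlonglongrightarrow> l"
    using bounded_imp_convergent_subsequence by blast
  have "(\<lambda>k. C ((r \<circ> r') k) $$ p) \<longlonglongrightarrow> (L(q := l)) p" if "p \<in> insert q S" for p
  proof (cases "p = q")
    case True
    then show ?thesis using l by (simp add: o_def)
  next
    case False
    then have "(\<lambda>k. C (r k) $$ p) \<longlonglongrightarrow> L p" using that L by blast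
    from LIMSEQ_subseq_LIMSEQ[OF this r'] show ?thesis using False by (simp add: o_def)
  qed
  then show ?case using strict_mono_o[OF r r'] by blast
qed

lemma frob_tendsto_0:
  fixes C :: "nat \<Rightarrow> complex mat"
  assumes "\<And>k. C k \<in> carrier_mat n n" "L \<in> carrier_mat n n"
    and "\<And>i j. i < n \<Longrightarrow> j < n \<Longrightarrow> (\<lambda>k. C k $$ (i, j)) \<longlonglongrightarrow> L $$ (i, j)"
  shows "(\<lambda>k. frob n (C k - L)) \<longlonglongrightarrow> 0"
proof -
  have "(\<lambda>k. sqrt (\<Sum>i<n. \<Sum>j<n. (cmod (C k $$ (i, j) - L $$ (i, j)))\<^sup>2)) \<longlonglongrightarrow> sqrt (\<Sum>i<n. \<Sum>j<n. (cmod (L $$ (i, j) - L $$ (i, j)))\<^sup>2)"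
    by (intro tendsto_intros assms(3)) auto
  moreover have "frob n (C k - L) = sqrt (\<Sum>i<n. \<Sum>j<n. (cmod (C k $$ (i, j) - L $$ (i, j)))\<^sup>2)" for k
  proof -
    have "(\<Sum>i<n. \<Sum>j<n. (cmod (C k $$ (i, j) - L $$ (i, j)))\<^sup>2) = (frob n (C k - L))\<^sup>2"
      unfolding frob_square using assms(1)[of k] assms(2) by (intro sum.cong refl) auto
    then show ?thesis by simp
  qed
  ultimately show ?thesis by simp
qed

lemma frob_eq_mn2: "n > 0 \<Longrightarrow> frob n A = sqrt n * mn2 n A"
  by (simp add: mn2_def)

text \<open>Laws and types are only defined through algebras on the types \<open>universe\<close>, so the matrix algebras
  have to be transported there along an injection.\<close>

definition copy_alg :: "nat \<Rightarrow> (complex mat \<Rightarrow> 'u) \<Rightarrow> 'u star_alg" where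
  "copy_alg n g = (let h = inv_into (carrier_mat n n) g in \<lparr>
     carrier = g ` carrier_mat n n,
     monoid.mult = (\<lambda>x y. g (h x * h y)),
     one = g (1\<^sub>m n),
     zero = g (0\<^sub>m n n),
     add = (\<lambda>x y. g (h x + h y)),
     scal = (\<lambda>c x. g (c \<cdot>\<^sub>m h x)),
     star = (\<lambda>x. g (mat_adjoint (h x))),
     cnorm = (\<lambda>x. mat_op_norm n (h x)),
     tr = (\<lambda>x. mtr n (h x))\<rparr>)"

locale mat_copy =
  fixes n :: nat and g :: "complex mat \<Rightarrow> 'u"
  assumes inj: "inj_on g (carrier_mat n n)" and n_pos: "n > 0"
begin

abbreviation M :: "'u star_alg" where "M \<equiv> copy_alg n g"
abbreviation h :: "'u \<Rightarrow> complex mat" where "h \<equiv> inv_into (carrier_mat n n) g"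

lemma hg [simp]: "A \<in> carrier_mat n n \<Longrightarrow> h (g A) = A"
  by (rule inv_into_f_f[OF inj])

lemma carrier_M: "carrier M = g ` carrier_mat n n"
  by (simp add: copy_alg_def Let_def)

lemma gc [simp]: "A \<in> carrier_mat n n \<Longrightarrow> g A \<in> carrier M"
  by (simp add: carrier_M)

lemma carrierE: "x \<in> carrier M \<Longrightarrow> (\<And>A. A \<in> carrier_mat n n \<Longrightarrow> x = g A \<Longrightarrow> P) \<Longrightarrow> P"
  by (auto simp: carrier_M)

lemma carrier_h:
  assumes "x \<in> carrier M"
  shows "h x \<in> carrier_mat n n" "x = g (h x)"
  using assms by (auto elim!: carrierE)

lemma g_eq: "A \<in> carrier_mat n n \<Longrightarrow> B \<in> carrier_mat n n \<Longrightarrow> g A = g B \<longleftrightarrow> A = B"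
  by (metis hg)

lemma ops [simp]:
  "A \<in> carrier_mat n n \<Longrightarrow> B \<in> carrier_mat n n \<Longrightarrow> g A \<otimes>\<^bsub>M\<^esub> g B = g (A * B)"
  "A \<in> carrier_mat n n \<Longrightarrow> B \<in> carrier_mat n n \<Longrightarrow> g A \<oplus>\<^bsub>M\<^esub> g B = g (A + B)"
  "\<one>\<^bsub>M\<^esub> = g (1\<^sub>m n)" "\<zero>\<^bsub>M\<^esub> = g (0\<^sub>m n n)"
  "A \<in> carrier_mat n n \<Longrightarrow> scal M c (g A) = g (c \<cdot>\<^sub>m A)"
  "A \<in> carrier_mat n n \<Longrightarrow> star M (g A) = g (mat_adjoint A)"
  "A \<in> carrier_mat n n \<Longrightarrow> cnorm M (g A) = mat_op_norm n A"
  "A \<in> carrier_mat n n \<Longrightarrow> tr M (g A) = mtr n A"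
  by (simp_all add: copy_alg_def Let_def)

lemma ring_M: "ring M"
proof (intro ringI abelian_groupI monoidI)
  fix x assume "x \<in> carrier M"
  then obtain A where A: "A \<in> carrier_mat n n" "x = g A" by (rule carrierE)
  show "\<exists>y\<in>carrier M. y \<oplus>\<^bsub>M\<^esub> x = \<zero>\<^bsub>M\<^esub>"
    by (rule bexI[of _ "g (- A)"]) (use A in auto)
  show "\<one>\<^bsub>M\<^esub> \<otimes>\<^bsub>M\<^esub> x = x" "x \<otimes>\<^bsub>M\<^esub> \<one>\<^bsub>M\<^esub> = x" "\<zero>\<^bsub>M\<^esub> \<oplus>\<^bsub>M\<^esub> x = x"
    using A by auto
  fix y assume "y \<in> carrier M"
  then obtain B where B: "B \<in> carrier_mat n n" "y = g B" by (rule carrierE)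
  show "x \<oplus>\<^bsub>M\<^esub> y \<in> carrier M" "x \<otimes>\<^bsub>M\<^esub> y \<in> carrier M" "x \<oplus>\<^bsub>M\<^esub> y = y \<oplus>\<^bsub>M\<^esub> x"
    using A B comm_add_mat[of A n n B] by auto
  fix z assume "z \<in> carrier M"
  then obtain C where C: "C \<in> carrier_mat n n" "z = g C" by (rule carrierE)
  show "x \<oplus>\<^bsub>M\<^esub> y \<oplus>\<^bsub>M\<^esub> z = x \<oplus>\<^bsub>M\<^esub> (y \<oplus>\<^bsub>M\<^esub> z)" "x \<otimes>\<^bsub>M\<^esub> y \<otimes>\<^bsub>M\<^esub> z = x \<otimes>\<^bsub>M\<^esub> (y \<otimes>\<^bsub>M\<^esub> z)"
    "(x \<oplus>\<^bsub>M\<^esub> y) \<otimes>\<^bsub>M\<^esub> z = x \<otimes>\<^bsub>M\<^esub> z \<oplus>\<^bsub>M\<^esub> y \<otimes>\<^bsub>M\<^esub> z" "z \<otimes>\<^bsub>M\<^esub> (x \<oplus>\<^bsub>M\<^esub> y) = z \<otimes>\<^bsub>M\<^esub> x \<oplus>\<^bsub>M\<^esub> z \<otimes>\<^bsub>M\<^esub> y"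
    using A B C add_mult_distrib_mat[of A n n B C] mult_add_distrib_mat[of C n n A n B] by (auto simp: sq_assoc[where n=n])
qed auto

lemma minus_M [simp]:
  assumes "A \<in> carrier_mat n n" "B \<in> carrier_mat n n"
  shows "g A \<ominus>\<^bsub>M\<^esub> g B = g (A - B)"
proof -
  interpret ring M by (rule ring_M)
  have "\<ominus>\<^bsub>M\<^esub> g B = g (- B)"
    by (rule minus_equality) (use assms in auto)
  then show ?thesis using assms by (simp add: a_minus_def add_uminus_minus_mat)
qed

lemma norm2_M [simp]: "A \<in> carrier_mat n n \<Longrightarrow> norm2 M (g A) = mn2 n A"
  by (simp add: norm2_def mtr_adjoint_self flip: of_real_power)

lemma cstar_M: "cstar_algebra M"
proof (intro cstar_algebra.intro ring_M cstar_algebra_axioms.intro)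
  fix s :: "nat \<Rightarrow> 'u"
  assume s: "\<And>n. s n \<in> carrier M" and cau: "\<forall>e>0. \<exists>n0. \<forall>m\<ge>n0. \<forall>n\<ge>n0. cnorm M (s m \<ominus>\<^bsub>M\<^esub> s n) < e"
  \<comment> \<open>The operator norm dominates entries and is dominated by the Hilbert-Schmidt
    norm, so a Cauchy sequence converges entrywise and therefore in norm.\<close>
  define C where "C k = h (s k)" for k
  have C: "C k \<in> carrier_mat n n" "s k = g (C k)" for k
    using carrier_h[OF s] by (simp_all add: C_def)
  have "\<exists>l. (\<lambda>k. C k $$ p) \<longlonglongrightarrow> l" if p: "fst p < n" "snd p < n" for p
  proof -
    have "Cauchy (\<lambda>k. C k $$ p)"
    proof (rule metric_CauchyI)
      fix e :: real assume "e > 0"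
      then obtain n0 where n0: "\<And>k l. k \<ge> n0 \<Longrightarrow> l \<ge> n0 \<Longrightarrow> cnorm M (s k \<ominus>\<^bsub>M\<^esub> s l) < e" using cau by blast
      have "dist (C k $$ p) (C l $$ p) < e" if "k \<ge> n0" "l \<ge> n0" for k l
        using n0[OF that] entry_le_mat_op_norm[of "C k - C l" n "fst p" "snd p"] C[of k] C[of l] p
        by (cases p) (simp add: dist_norm)
      then show "\<exists>M. \<forall>m\<ge>M. \<forall>n\<ge>M. dist (C m $$ p) (C n $$ p) < e" by blast
    qed
    then show ?thesis using Cauchy_convergent convergent_def by blast
  qed
  then obtain L where L: "\<And>p. fst p < n \<Longrightarrow> snd p < n \<Longrightarrow> (\<lambda>k. C k $$ p) \<longlonglongrightarrow> L p" by metis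
  define X where "X = mat n n L"
  have X: "X \<in> carrier_mat n n" by (simp add: X_def)
  have "(\<lambda>k. frob n (C k - X)) \<longlonglongrightarrow> 0"
    by (rule frob_tendsto_0[OF C(1) X]) (use L in \<open>auto simp: X_def\<close>)
  then have "(\<lambda>k. mat_op_norm n (C k - X)) \<longlonglongrightarrow> 0"
    by (rule tendsto_sandwich[OF always_eventually always_eventually tendsto_const, rotated 2])
      (use C X in \<open>auto intro: mat_op_norm_le_frob\<close>)
  then show "\<exists>x\<in>carrier M. (\<lambda>k. cnorm M (s k \<ominus>\<^bsub>M\<^esub> x)) \<longlonglongrightarrow> 0"
    by (intro bexI[of _ "g X"]) (use C X in auto)
next
  fix x c d assume "x \<in> carrier M"
  then obtain A where A: "A \<in> carrier_mat n n" "x = g A" by (rule carrierE)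
  show "scal M c x \<in> carrier M" "star M x \<in> carrier M" "star M (star M x) = x" "scal M 1 x = x" "0 \<le> cnorm M x"
    "star M (scal M c x) = scal M (cnj c) (star M x)" "(cnorm M x = 0) = (x = \<zero>\<^bsub>M\<^esub>)"
    using A by (auto simp: mat_op_norm_eq_0 g_eq)
  show "scal M (c + d) x = scal M c x \<oplus>\<^bsub>M\<^esub> scal M d x" "scal M c (scal M d x) = scal M (c * d) x"
    using A by (auto simp: g_eq algebra_simps intro!: eq_matI)
  show "cnorm M (scal M c x) = cmod c * cnorm M x" "cnorm M (star M x \<otimes>\<^bsub>M\<^esub> x) = (cnorm M x)\<^sup>2"
    using A by (auto simp: mat_op_norm_smult mat_op_norm_cstar)
  fix y assume "y \<in> carrier M"
  then obtain B where B: "B \<in> carrier_mat n n" "y = g B" by (rule carrierE)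
  show "scal M c (x \<oplus>\<^bsub>M\<^esub> y) = scal M c x \<oplus>\<^bsub>M\<^esub> scal M c y"
    using A B by (auto simp: add_smult_distrib_left_mat[where nr=n and nc=n])
  show "scal M c x \<otimes>\<^bsub>M\<^esub> y = scal M c (x \<otimes>\<^bsub>M\<^esub> y)" "x \<otimes>\<^bsub>M\<^esub> scal M c y = scal M c (x \<otimes>\<^bsub>M\<^esub> y)"
    using A B by (auto simp: mult_smult_assoc_mat[where nr=n and n=n and nc=n] mult_smult_distrib[where nr=n and n=n and nc=n])
  show "star M (x \<oplus>\<^bsub>M\<^esub> y) = star M x \<oplus>\<^bsub>M\<^esub> star M y" "star M (x \<otimes>\<^bsub>M\<^esub> y) = star M y \<otimes>\<^bsub>M\<^esub> star M x"
    using A B by (auto simp: mat_adjoint_add[where n=n and m=n] mat_adjoint_mult[where n=n and m=n and k=n])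
  show "cnorm M (x \<oplus>\<^bsub>M\<^esub> y) \<le> cnorm M x + cnorm M y" "cnorm M (x \<otimes>\<^bsub>M\<^esub> y) \<le> cnorm M x * cnorm M y"
    using A B by (auto simp: mat_op_norm_triangle mat_op_norm_mult)
qed

lemma pretracial_M: "pretracial M"
proof (intro pretracial.intro ring_M pretracial_axioms.intro)
  fix x assume "x \<in> carrier M"
  then obtain A where A: "A \<in> carrier_mat n n" "x = g A" by (rule carrierE)
  show "star M x \<in> carrier M" "star M (star M x) = x" using A by auto
  show "0 \<le> Re (tr M (star M x \<otimes>\<^bsub>M\<^esub> x))" using A by (simp add: mtr_adjoint_self del: of_real_power)
  show "norm2 M x = 0 \<Longrightarrow> x = \<zero>\<^bsub>M\<^esub>" using A by (simp add: mn2_eq_0)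
  show "norm2 M x \<le> cnorm M x" using A by (simp add: mn2_le_op_norm)
  show "cmod (tr M x) \<le> norm2 M x" using A by (simp add: mtr_le_mn2)
  fix y assume "y \<in> carrier M"
  then obtain B where B: "B \<in> carrier_mat n n" "y = g B" by (rule carrierE)
  show "star M (x \<oplus>\<^bsub>M\<^esub> y) = star M x \<oplus>\<^bsub>M\<^esub> star M y" "star M (x \<otimes>\<^bsub>M\<^esub> y) = star M y \<otimes>\<^bsub>M\<^esub> star M x"
    using A B by (auto simp: mat_adjoint_add[where n=n and m=n] mat_adjoint_mult[where n=n and m=n and k=n])
  show "tr M (x \<oplus>\<^bsub>M\<^esub> y) = tr M x + tr M y" using A B by (simp add: mtr_add)
  show "tr M (x \<otimes>\<^bsub>M\<^esub> y) = tr M (y \<otimes>\<^bsub>M\<^esub> x)" using A B by (simp add: mtr_comm)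
  show "norm2 M (x \<oplus>\<^bsub>M\<^esub> y) \<le> norm2 M x + norm2 M y" using A B by (simp add: mn2_triangle)
  show "norm2 M (x \<otimes>\<^bsub>M\<^esub> y) \<le> cnorm M x * norm2 M y" using A B by (simp add: mn2_mult_le)
next
  fix d and c e :: "nat \<Rightarrow> 'u"
  assume d: "d \<in> carrier M" and c: "\<And>k. c k \<in> carrier M" and e: "\<And>k. e k \<in> carrier M"
    and eq: "\<And>k. star M (c k) \<otimes>\<^bsub>M\<^esub> c k \<oplus>\<^bsub>M\<^esub> star M (e k) \<otimes>\<^bsub>M\<^esub> e k = star M d \<otimes>\<^bsub>M\<^esub> d"
    and cau: "\<And>\<epsilon>. \<epsilon> > 0 \<Longrightarrow> \<exists>N. \<forall>k\<ge>N. \<forall>l\<ge>N.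
      norm2 M (star M (c k) \<otimes>\<^bsub>M\<^esub> c k \<ominus>\<^bsub>M\<^esub> star M (c l) \<otimes>\<^bsub>M\<^esub> c l) < \<epsilon>"
  obtain D where D: "D \<in> carrier_mat n n" "d = g D" using carrier_h[OF d] by blast
  define C where "C k = h (c k)" for k
  have C: "C k \<in> carrier_mat n n" "c k = g (C k)" for k
    using carrier_h[OF c] by (simp_all add: C_def)
  define E where "E k = h (e k)" for k
  have E: "E k \<in> carrier_mat n n" "e k = g (E k)" for k
    using carrier_h[OF e] by (simp_all add: E_def)
  have eq': "mat_adjoint (C k) * C k + mat_adjoint (E k) * E k = mat_adjoint D * D" for k
    using eq[of k] C[of k] E[of k] D by (simp add: g_eq)
  \<comment> \<open>The trace of \<open>eq'\<close> reads |C k|^2 + |E k|^2 = |D|^2 in 2-norms,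
    which bounds the \<open>C k\<close> uniformly and makes compactness applicable.\<close>
  have mnC: "mn2 n (C k) \<le> mn2 n D" for k
  proof -
    have "mtr n (mat_adjoint (C k) * C k) + mtr n (mat_adjoint (E k) * E k) = mtr n (mat_adjoint D * D)"
      using eq'[of k] C[of k] E[of k] mtr_add[of "mat_adjoint (C k) * C k" n "mat_adjoint (E k) * E k"] by simp
    then have "complex_of_real ((mn2 n (C k))\<^sup>2 + (mn2 n (E k))\<^sup>2) = complex_of_real ((mn2 n D)\<^sup>2)"
      using C[of k] E[of k] D by (simp add: mtr_adjoint_self del: of_real_power)
    then have "(mn2 n (C k))\<^sup>2 + (mn2 n (E k))\<^sup>2 = (mn2 n D)\<^sup>2" by (simp only: of_real_eq_iff)
    then have "(mn2 n (C k))\<^sup>2 \<le> (mn2 n D)\<^sup>2" using zero_le_power2[of "mn2 n (E k)"] by linarith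
    then show ?thesis by (rule power2_le_imp_le) simp
  qed
  have bd: "cmod (C k $$ p) \<le> sqrt n * mn2 n D" if p: "p \<in> {..<n} \<times> {..<n}" for p k
  proof -
    have "cmod (C k $$ p) \<le> frob n (C k)"
      unfolding frob_def using p by (intro member_le_L2_set) auto
    also have "\<dots> \<le> sqrt n * mn2 n D"
      unfolding frob_eq_mn2[OF n_pos] using mnC by (intro mult_left_mono) auto
    finally show ?thesis .
  qed
  obtain r L where r: "strict_mono r" and L: "\<forall>p\<in>{..<n} \<times> {..<n}. (\<lambda>k. C (r k) $$ p) \<longlonglongrightarrow> L p"
    using entrywise_convergent_subsequence[of "{..<n} \<times> {..<n}" C "sqrt n * mn2 n D"] bd by blast
  define X where "X = mat n n L"
  have X: "X \<in> carrier_mat n n" by (simp add: X_def)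
  have Xij: "(\<lambda>k. C (r k) $$ (i, j)) \<longlonglongrightarrow> X $$ (i, j)" if "i < n" "j < n" for i j
    using L that by (simp add: X_def)
  have sqe: "(mat_adjoint Y * Y) $$ (i, j) = (\<Sum>l<n. cnj (Y $$ (l, i)) * Y $$ (l, j))"
    if "Y \<in> carrier_mat n n" "i < n" "j < n" for Y i j
  proof -
    have "(mat_adjoint Y * Y) $$ (i, j) = (\<Sum>l<n. mat_adjoint Y $$ (i, l) * Y $$ (l, j))"
      by (rule mat_mult_index[where n=n and k=n]) (use that in auto)
    also have "\<dots> = (\<Sum>l<n. cnj (Y $$ (l, i)) * Y $$ (l, j))"
      by (rule sum.cong) (use that in auto)
    finally show ?thesis .
  qed
  have "(\<lambda>k. frob n (mat_adjoint (C (r k)) * C (r k) - mat_adjoint X * X)) \<longlonglongrightarrow> 0"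
  proof (rule frob_tendsto_0)
    fix i j assume ij: "i < n" "j < n"
    show "(\<lambda>k. (mat_adjoint (C (r k)) * C (r k)) $$ (i, j)) \<longlonglongrightarrow> (mat_adjoint X * X) $$ (i, j)"
      unfolding sqe[OF X ij] sqe[OF C(1) ij]
      by (intro tendsto_sum tendsto_mult tendsto_cnj Xij) (use ij in auto)
  qed (use C X in auto)
  then have "(\<lambda>k. frob n (mat_adjoint (C (r k)) * C (r k) - mat_adjoint X * X) / sqrt n) \<longlonglongrightarrow> 0 / sqrt n"
    by (rule tendsto_divide[OF _ tendsto_const]) (use n_pos in simp)
  then have lim: "(\<lambda>k. mn2 n (mat_adjoint (C (r k)) * C (r k) - mat_adjoint X * X)) \<longlonglongrightarrow> 0"
    by (simp add: mn2_def)
  define S where "S k = mat_adjoint (C k) * C k" for k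
  have S: "S k \<in> carrier_mat n n" for k using C by (simp add: S_def)
  define Z where "Z = mat_adjoint X * X"
  have Z: "Z \<in> carrier_mat n n" using X by (simp add: Z_def)
  \<comment> \<open>So far convergence is known along the subsequence \<open>r\<close>; the Cauchy
    hypothesis extends it to the whole sequence.\<close>
  have "(\<lambda>k. mn2 n (S k - Z)) \<longlonglongrightarrow> 0"
  proof (rule metric_LIMSEQ_I)
    fix \<epsilon> :: real assume eps: "\<epsilon> > 0"
    obtain N where N0: "\<forall>k\<ge>N. \<forall>l\<ge>N.
      norm2 M (star M (c k) \<otimes>\<^bsub>M\<^esub> c k \<ominus>\<^bsub>M\<^esub> star M (c l) \<otimes>\<^bsub>M\<^esub> c l) < \<epsilon> / 2" using cau[of "\<epsilon> / 2"] eps by auto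
    have N: "mn2 n (S k - S l) < \<epsilon> / 2" if "k \<ge> N" "l \<ge> N" for k l
      using N0[rule_format, OF that] C(1) by (simp add: S_def C(2))
    have "\<forall>\<^sub>F l in sequentially. mn2 n (S (r l) - Z) < \<epsilon> / 2"
      unfolding S_def Z_def by (rule order_tendstoD(2)[OF lim]) (use eps in simp)
    then have "\<exists>l0. \<forall>l\<ge>l0. mn2 n (S (r l) - Z) < \<epsilon> / 2"
      unfolding eventually_sequentially .
    then obtain l0 where l0: "\<forall>l\<ge>l0. mn2 n (S (r l) - Z) < \<epsilon> / 2" ..
    define l where "l = max l0 N"
    have l1: "l0 \<le> l" unfolding l_def by (rule max.cobounded1)
    have l2: "N \<le> r l" by (rule order_trans[OF _ seq_suble[OF r]]) (simp add: l_def)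
    have "dist (mn2 n (S k - Z)) 0 < \<epsilon>" if "k \<ge> N" for k
    proof -
      have "mn2 n (S k - Z) \<le> mn2 n (S k - S (r l)) + mn2 n (S (r l) - Z)"
        by (rule mn2_triangle_minus[OF S S Z])
      also have "\<dots> < \<epsilon> / 2 + \<epsilon> / 2"
        by (rule add_strict_mono[OF N[OF that l2] l0[rule_format, OF l1]])
      finally show ?thesis by (simp add: dist_real_def)
    qed
    then show "\<exists>no. \<forall>k\<ge>no. dist (mn2 n (S k - Z)) 0 < \<epsilon>" by blast
  qed
  then show "\<exists>c'\<in>carrier M. (\<lambda>k. norm2 M (star M (c k) \<otimes>\<^bsub>M\<^esub> c k \<ominus>\<^bsub>M\<^esub> star M c' \<otimes>\<^bsub>M\<^esub> c')) \<longlonglongrightarrow> 0"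
    by (intro bexI[of _ "g X"]) (use C X in \<open>auto simp: S_def Z_def\<close>)
qed

end

section \<open>Duals of matrix algebras\<close>

lemma (in cstar_algebra) dual_norm_bdd:
  assumes "\<phi> \<in> dual M"
  shows "bdd_above {cmod (\<phi> x) | x. x \<in> carrier M \<and> cnorm M x \<le> 1}"
proof -
  obtain C where C: "\<And>x. x \<in> carrier M \<Longrightarrow> cmod (\<phi> x) \<le> C * cnorm M x" using assms by (auto simp: dual_def)
  have "cmod (\<phi> x) \<le> \<bar>C\<bar>" if "x \<in> carrier M" "cnorm M x \<le> 1" for x
  proof -
    have "C * cnorm M x \<le> \<bar>C\<bar> * 1"
      using cnorm_nonneg[OF that(1)] that(2) by (intro mult_mono) auto
    then show ?thesis using C[OF that(1)] by simp
  qed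
  then show ?thesis by (intro bdd_aboveI[where M = "\<bar>C\<bar>"]) blast
qed

lemma (in cstar_algebra) dual_bound:
  assumes \<phi>: "\<phi> \<in> dual M" and x: "x \<in> carrier M"
  shows "cmod (\<phi> x) \<le> dual_norm M \<phi> * cnorm M x"
proof (cases "x = \<zero>")
  case True
  obtain C where C: "\<And>x. x \<in> carrier M \<Longrightarrow> cmod (\<phi> x) \<le> C * cnorm M x" using \<phi> by (auto simp: dual_def)
  have "cnorm M x = 0" using cnorm_eq_0[OF x] True by simp
  then show ?thesis using C[OF x] by simp
next
  case False
  define c where "c = cnorm M x"
  have c: "c > 0" using False cnorm_eq_0[OF x] cnorm_nonneg[OF x] by (simp add: c_def)
  define y where "y = scal M (complex_of_real (1 / c)) x"
  have y: "y \<in> carrier M" "cnorm M y \<le> 1"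
    using c x by (auto simp: y_def scal_closed cnorm_scal norm_divide c_def)
  have "cmod (\<phi> y) \<le> dual_norm M \<phi>"
    unfolding dual_norm_def by (rule cSup_upper[OF _ dual_norm_bdd[OF \<phi>]]) (use y in blast)
  moreover have "\<phi> y = complex_of_real (1 / c) * \<phi> x"
    using \<phi> x unfolding dual_def linear_functional_def y_def by blast
  ultimately show ?thesis using c by (simp add: norm_mult norm_divide c_def field_simps)
qed

context mat_copy
begin

definition unit_mat :: "nat \<times> nat \<Rightarrow> complex mat" where
  "unit_mat p = mat n n (\<lambda>q. if q = p then 1 else 0)"

lemma unit_mat_carrier [simp]: "unit_mat p \<in> carrier_mat n n"
  by (simp add: unit_mat_def)

lemma linear_functional_g:
  assumes "linear_functional M \<phi>"
  shows "A \<in> carrier_mat n n \<Longrightarrow> B \<in> carrier_mat n n \<Longrightarrow> \<phi> (g (A + B)) = \<phi> (g A) + \<phi> (g B)"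
    and "A \<in> carrier_mat n n \<Longrightarrow> \<phi> (g (c \<cdot>\<^sub>m A)) = c * \<phi> (g A)"
proof -
  assume A: "A \<in> carrier_mat n n"
  have "\<phi> (scal M c (g A)) = c * \<phi> (g A)"
    using assms gc[OF A] unfolding linear_functional_def by blast
  then show "\<phi> (g (c \<cdot>\<^sub>m A)) = c * \<phi> (g A)" using A by simp
  assume B: "B \<in> carrier_mat n n"
  have "\<phi> (g A \<oplus>\<^bsub>M\<^esub> g B) = \<phi> (g A) + \<phi> (g B)"
    using assms gc[OF A] gc[OF B] unfolding linear_functional_def by blast
  then show "\<phi> (g (A + B)) = \<phi> (g A) + \<phi> (g B)" using A B by simp
qed

lemma functional_expansion:
  assumes lin: "linear_functional M \<phi>" and A: "A \<in> carrier_mat n n"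
  shows "\<phi> (g A) = (\<Sum>p\<in>{..<n}\<times>{..<n}. A $$ p * \<phi> (g (unit_mat p)))"
proof -
  have gen: "\<phi> (g (mat n n (\<lambda>q. if q \<in> S then A $$ q else 0))) = (\<Sum>p\<in>S. A $$ p * \<phi> (g (unit_mat p)))"
    if "finite S" for S
    using that
  proof (induction S rule: finite_induct)
    case empty
    have "mat n n (\<lambda>q. if q \<in> {} then A $$ q else 0) = 0 \<cdot>\<^sub>m 1\<^sub>m n" by (intro eq_matI) auto
    then show ?case using linear_functional_g(2)[OF lin, of "1\<^sub>m n" 0] by simp
  next
    case (insert p S)
    have "mat n n (\<lambda>q. if q \<in> insert p S then A $$ q else 0)
        = A $$ p \<cdot>\<^sub>m unit_mat p + mat n n (\<lambda>q. if q \<in> S then A $$ q else 0)"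
      using insert.hyps by (intro eq_matI) (auto simp: unit_mat_def)
    then show ?case
      using insert by (simp add: linear_functional_g[OF lin])
  qed
  have "A = mat n n (\<lambda>q. if q \<in> {..<n}\<times>{..<n} then A $$ q else 0)"
    using A by (intro eq_matI) auto
  then show ?thesis using gen[of "{..<n}\<times>{..<n}"] by simp
qed

lemma dualI:
  assumes "linear_functional M \<phi>" "\<phi> \<in> extensional (carrier M)"
    and "\<And>A. A \<in> carrier_mat n n \<Longrightarrow> cmod (\<phi> (g A)) \<le> C * mat_op_norm n A"
  shows "\<phi> \<in> dual M"
proof -
  have "cmod (\<phi> x) \<le> C * cnorm M x" if "x \<in> carrier M" for x
    using carrier_h[OF that] assms(3)[of "h x"] ops(7)[of "h x" ] by metis
  then show ?thesis using assms by (auto simp: dual_def)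
qed

lemma linear_functional_restrict:
  assumes "\<And>A B. A \<in> carrier_mat n n \<Longrightarrow> B \<in> carrier_mat n n \<Longrightarrow> F (A + B) = F A + F B"
    and "\<And>c A. A \<in> carrier_mat n n \<Longrightarrow> F (c \<cdot>\<^sub>m A) = c * F A"
  shows "linear_functional M (\<lambda>x\<in>carrier M. F (h x))"
  unfolding linear_functional_def
proof (intro conjI ballI allI)
  fix x c assume "x \<in> carrier M"
  then obtain A where A: "A \<in> carrier_mat n n" "x = g A" by (rule carrierE)
  show "(\<lambda>x\<in>carrier M. F (h x)) (scal M c x) = c * (\<lambda>x\<in>carrier M. F (h x)) x"
    using A assms by simp
  fix y assume "y \<in> carrier M"
  then obtain B where B: "B \<in> carrier_mat n n" "y = g B" by (rule carrierE)
  show "(\<lambda>x\<in>carrier M. F (h x)) (x \<oplus>\<^bsub>M\<^esub> y) = (\<lambda>x\<in>carrier M. F (h x)) x + (\<lambda>x\<in>carrier M. F (h x)) y"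
    using A B assms by simp
qed

definition entry :: "nat \<times> nat \<Rightarrow> 'u \<Rightarrow> complex" where
  "entry p = (\<lambda>x\<in>carrier M. h x $$ p)"

lemma entry_dual: "p \<in> {..<n}\<times>{..<n} \<Longrightarrow> entry p \<in> dual M"
  unfolding entry_def
  by (rule dualI[where C = 1], rule linear_functional_restrict)
     (auto intro: entry_le_mat_op_norm)

lemma dual_add:
  assumes "\<phi> \<in> dual M" "\<psi> \<in> dual M"
  shows "(\<lambda>x\<in>carrier M. \<phi> x + \<psi> x) \<in> dual M"
proof -
  interpret C: cstar_algebra M by (rule cstar_M)
  obtain C1 where C1: "\<And>x. x \<in> carrier M \<Longrightarrow> cmod (\<phi> x) \<le> C1 * cnorm M x" using assms(1) by (auto simp: dual_def)
  obtain C2 where C2: "\<And>x. x \<in> carrier M \<Longrightarrow> cmod (\<psi> x) \<le> C2 * cnorm M x" using assms(2) by (auto simp: dual_def)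
  have "cmod (\<phi> x + \<psi> x) \<le> (C1 + C2) * cnorm M x" if "x \<in> carrier M" for x
    using norm_triangle_ineq[of "\<phi> x" "\<psi> x"] C1[OF that] C2[OF that] by (simp add: distrib_right)
  moreover have "linear_functional M (\<lambda>x\<in>carrier M. \<phi> x + \<psi> x)"
    using assms by (auto simp: dual_def linear_functional_def C.scal_closed distrib_left)
  ultimately show ?thesis by (auto simp: dual_def)
qed

lemma dual_scal:
  assumes "\<phi> \<in> dual M"
  shows "(\<lambda>x\<in>carrier M. c * \<phi> x) \<in> dual M"
proof -
  interpret C: cstar_algebra M by (rule cstar_M)
  obtain C1 where C1: "\<And>x. x \<in> carrier M \<Longrightarrow> cmod (\<phi> x) \<le> C1 * cnorm M x" using assms(1) by (auto simp: dual_def)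
  have "cmod (c * \<phi> x) \<le> (cmod c * C1) * cnorm M x" if "x \<in> carrier M" for x
    using mult_left_mono[OF C1[OF that], of "cmod c"] by (simp add: norm_mult mult.assoc)
  moreover have "linear_functional M (\<lambda>x\<in>carrier M. c * \<phi> x)"
    using assms by (auto simp: dual_def linear_functional_def C.scal_closed distrib_left)
  ultimately show ?thesis by (auto simp: dual_def)
qed

lemma dual_zero: "(\<lambda>x\<in>carrier M. 0) \<in> dual M"
proof -
  interpret C: cstar_algebra M by (rule cstar_M)
  show ?thesis by (auto simp: dual_def linear_functional_def C.scal_closed intro: exI[of _ 0])
qed

text \<open>The entry functionals span the dual by \<open>functional_expansion\<close>, so
  \<open>f\<close> is determined by its values on them, and these values are the entries of the
  representing matrix.\<close>

lemma bidual_evaluation: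
  assumes add: "\<forall>\<phi>\<in>dual M. \<forall>\<psi>\<in>dual M. f (\<lambda>x\<in>carrier M. \<phi> x + \<psi> x) = f \<phi> + f \<psi>"
    and scal: "\<forall>\<phi>\<in>dual M. \<forall>c. f (\<lambda>x\<in>carrier M. c * \<phi> x) = c * f \<phi>"
  shows "\<exists>x\<in>carrier M. \<forall>\<phi>\<in>dual M. f \<phi> = \<phi> x"
proof -
  define X where "X = mat n n (\<lambda>p. f (entry p))"
  have X: "X \<in> carrier_mat n n" by (simp add: X_def)
  have f0: "f (\<lambda>x\<in>carrier M. 0) = 0"
    using bspec[OF scal dual_zero, rule_format, of 0] by (simp cong: restrict_cong)
  have comb: "(\<lambda>x\<in>carrier M. \<Sum>p\<in>S. a p * entry p x) \<in> dual M \<and>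
      f (\<lambda>x\<in>carrier M. \<Sum>p\<in>S. a p * entry p x) = (\<Sum>p\<in>S. a p * f (entry p))"
    if "finite S" "S \<subseteq> {..<n}\<times>{..<n}" for S a
    using that
  proof (induction S rule: finite_induct)
    case empty
    then show ?case using f0 dual_zero unfolding sum.empty by blast
  next
    case (insert p S)
    define \<psi> where "\<psi> = (\<lambda>x\<in>carrier M. \<Sum>p\<in>S. a p * entry p x)"
    have \<psi>: "\<psi> \<in> dual M" "f \<psi> = (\<Sum>p\<in>S. a p * f (entry p))" 
      unfolding \<psi>_def using insert.IH insert.prems by blast+
    define \<chi> where "\<chi> = (\<lambda>x\<in>carrier M. a p * entry p x)"
    have e: "entry p \<in> dual M" using insert by (intro entry_dual) auto
    have \<chi>: "\<chi> \<in> dual M" "f \<chi> = a p * f (entry p)"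
      unfolding \<chi>_def using dual_scal[OF e] scal e by blast+
    have eq: "(\<lambda>x\<in>carrier M. \<Sum>p\<in>insert p S. a p * entry p x) = (\<lambda>x\<in>carrier M. \<chi> x + \<psi> x)"
      using insert.hyps by (auto simp: \<chi>_def \<psi>_def intro!: restrict_ext)
    have "f (\<lambda>x\<in>carrier M. \<chi> x + \<psi> x) = f \<chi> + f \<psi>" using add \<chi>(1) \<psi>(1) by blast
    moreover have "(\<Sum>p\<in>insert p S. a p * f (entry p)) = f \<chi> + f \<psi>"
      unfolding \<chi>(2) \<psi>(2) by (rule sum.insert[OF insert.hyps])
    ultimately show ?case
      unfolding eq using dual_add[OF \<chi>(1) \<psi>(1)] by metis
  qed
  have "f \<phi> = \<phi> (g X)" if \<phi>: "\<phi> \<in> dual M" for \<phi>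
  proof -
    have lin: "linear_functional M \<phi>" and ext: "\<phi> \<in> extensional (carrier M)" using \<phi> by (auto simp: dual_def)
    have exp: "\<phi> = (\<lambda>x\<in>carrier M. \<Sum>p\<in>{..<n}\<times>{..<n}. \<phi> (g (unit_mat p)) * entry p x)"
    proof (rule extensionalityI[OF ext])
      fix x assume x: "x \<in> carrier M"
      show "\<phi> x = (\<lambda>x\<in>carrier M. \<Sum>p\<in>{..<n}\<times>{..<n}. \<phi> (g (unit_mat p)) * entry p x) x"
        using functional_expansion[OF lin carrier_h(1)[OF x]] carrier_h(2)[OF x] x
        by (simp add: entry_def mult.commute)
    qed simp
    have "f \<phi> = (\<Sum>p\<in>{..<n}\<times>{..<n}. \<phi> (g (unit_mat p)) * f (entry p))"
      using comb[of "{..<n}\<times>{..<n}" "\<lambda>p. \<phi> (g (unit_mat p))"] exp by simp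
    also have "\<dots> = (\<Sum>p\<in>{..<n}\<times>{..<n}. X $$ p * \<phi> (g (unit_mat p)))"
      by (intro sum.cong refl) (auto simp: X_def)
    also have "\<dots> = \<phi> (g X)" by (rule functional_expansion[OF lin X, symmetric])
    finally show ?thesis .
  qed
  then show ?thesis using X by (intro bexI[of _ "g X"]) auto
qed

text \<open>The norming functionals can be written down: for |v| \<le> 1 and \<open>w\<close> the
  normalized vector A v, the functional x \<mapsto> <x v, w> has norm at most 1 and takes the value
  |A v| at A.\<close>

lemma cnorm_eq_Sup_dual:
  assumes x: "x \<in> carrier M"
  shows "cnorm M x = Sup {cmod (\<phi> x) | \<phi>. \<phi> \<in> dual M \<and> dual_norm M \<phi> \<le> 1}" (is "_ = Sup ?S")
proof (rule antisym)
  interpret C: cstar_algebra M by (rule cstar_M)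
  obtain A where A: "A \<in> carrier_mat n n" "x = g A" using carrier_h[OF x] by blast
  have le: "cmod (\<phi> x) \<le> cnorm M x" if "\<phi> \<in> dual M" "dual_norm M \<phi> \<le> 1" for \<phi>
    using C.dual_bound[OF that(1) x] mult_right_mono[OF that(2) C.cnorm_nonneg[OF x]] by simp
  have zero_norm: "dual_norm M (\<lambda>x\<in>carrier M. 0) \<le> 1"
    unfolding dual_norm_def
  proof (rule cSup_least)
    have "cmod ((\<lambda>x\<in>carrier M. 0) \<zero>\<^bsub>M\<^esub>) \<in> {cmod ((\<lambda>x\<in>carrier M. 0) x) |x. x \<in> carrier M \<and> cnorm M x \<le> 1}"
      using C.cnorm_eq_0[of "\<zero>\<^bsub>M\<^esub>"] by (intro CollectI exI[of _ "\<zero>\<^bsub>M\<^esub>"]) simp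
    then show "{cmod ((\<lambda>x\<in>carrier M. 0) x) |x. x \<in> carrier M \<and> cnorm M x \<le> 1} \<noteq> {}" by blast
  qed auto
  show "Sup ?S \<le> cnorm M x"
  proof (rule cSup_least)
    show "?S \<noteq> {}" using dual_zero zero_norm by blast
  qed (use le in blast)
  have bdd: "bdd_above ?S" by (rule bdd_aboveI[where M = "cnorm M x"]) (use le in blast)
  have "mat_op_norm n A \<le> Sup ?S"
  proof (rule mat_op_norm_le)
    fix v :: "complex vec" assume v: "v \<in> carrier_vec n" "vec_norm2 v \<le> 1"
    define c where "c = vec_norm2 (A *\<^sub>v v)"
    \<comment> \<open>For \<open>c = 0\<close> this is the zero vector, as \<open>1 / 0 = 0\<close>;
      the value \<open>c\<close> computed at the end is then still correct.\<close>
    define w where "w = complex_of_real (1 / c) \<cdot>\<^sub>v (A *\<^sub>v v)"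
    have w: "w \<in> carrier_vec n" using A v by (simp add: w_def)
    have w1: "vec_norm2 w \<le> 1" by (simp add: w_def vec_norm2_smult c_def norm_divide)
    define \<phi> where "\<phi> = (\<lambda>x\<in>carrier M. (h x *\<^sub>v v) \<bullet>c w)"
    have bnd: "cmod (\<phi> (g B)) \<le> 1 * mat_op_norm n B" if B: "B \<in> carrier_mat n n" for B
    proof -
      have "cmod (\<phi> (g B)) \<le> vec_norm2 (B *\<^sub>v v) * vec_norm2 w"
        using B v w by (simp add: \<phi>_def vec_norm2_Cauchy_Schwarz[where n=n])
      also have "\<dots> \<le> (mat_op_norm n B * 1) * 1"
        using mat_op_norm_bound[OF B v(1)] v(2) w1 B
        by (intro mult_mono order_trans[OF mat_op_norm_bound[OF B v(1)] mult_left_mono]) auto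
      finally show ?thesis by simp
    qed
    have lin: "linear_functional M \<phi>"
      unfolding \<phi>_def
    proof (rule linear_functional_restrict)
      fix B D :: "complex mat" and k :: complex assume B: "B \<in> carrier_mat n n"
      have "(k \<cdot>\<^sub>m B) *\<^sub>v v = k \<cdot>\<^sub>v (B *\<^sub>v v)" using B v by (intro eq_vecI) auto
      then show "((k \<cdot>\<^sub>m B) *\<^sub>v v) \<bullet>c w = k * ((B *\<^sub>v v) \<bullet>c w)"
        using B v w by (simp add: smult_scalar_prod_distrib[where n=n])
      assume D: "D \<in> carrier_mat n n"
      show "((B + D) *\<^sub>v v) \<bullet>c w = ((B *\<^sub>v v) \<bullet>c w) + ((D *\<^sub>v v) \<bullet>c w)"
        using B D v w by (simp add: add_mult_distrib_mat_vec[where nr=n and nc=n] add_scalar_prod_distrib[where n=n])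
    qed
    have \<phi>: "\<phi> \<in> dual M" by (rule dualI[OF lin _ bnd]) (unfold \<phi>_def, rule restrict_extensional)
    have "dual_norm M \<phi> \<le> 1"
      unfolding dual_norm_def
    proof (rule cSup_least)
      have "cmod (\<phi> \<zero>\<^bsub>M\<^esub>) \<in> {cmod (\<phi> x) |x. x \<in> carrier M \<and> cnorm M x \<le> 1}"
        using C.cnorm_eq_0[of "\<zero>\<^bsub>M\<^esub>"] by (intro CollectI exI[of _ "\<zero>\<^bsub>M\<^esub>"]) simp
      then show "{cmod (\<phi> x) |x. x \<in> carrier M \<and> cnorm M x \<le> 1} \<noteq> {}" by blast
    next
      fix r assume "r \<in> {cmod (\<phi> x) |x. x \<in> carrier M \<and> cnorm M x \<le> 1}"
      then obtain y where y: "r = cmod (\<phi> y)" "y \<in> carrier M" "cnorm M y \<le> 1" by blast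
      obtain B where B: "B \<in> carrier_mat n n" "y = g B" using carrier_h[OF y(2)] by blast
      show "r \<le> 1" using bnd[OF B(1)] y B by simp
    qed
    then have mem: "cmod (\<phi> x) \<le> Sup ?S" using \<phi> by (intro cSup_upper[OF _ bdd]) blast
    have "\<phi> x = complex_of_real (1 / c) * complex_of_real (c\<^sup>2)"
    proof -
      have "\<phi> x = (A *\<^sub>v v) \<bullet>c w" using A x by (simp add: \<phi>_def)
      also have "conjugate w = complex_of_real (1 / c) \<cdot>\<^sub>v conjugate (A *\<^sub>v v)"
        by (simp add: w_def conjugate_smult_vec)
      also have "(A *\<^sub>v v) \<bullet> \<dots> = complex_of_real (1 / c) * ((A *\<^sub>v v) \<bullet>c (A *\<^sub>v v))"
        using A v by (simp add: scalar_prod_smult_distrib[where n=n])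
      finally show ?thesis using vec_norm2_square[of "A *\<^sub>v v" n] A v by (simp add: c_def)
    qed
    also have "\<dots> = complex_of_real c" by (simp add: power2_eq_square)
    finally have "cmod (\<phi> x) = c" by (simp add: c_def)
    then show "vec_norm2 (A *\<^sub>v v) \<le> Sup ?S" using mem by (simp add: c_def)
  qed
  then show "cnorm M x \<le> Sup ?S" using A by simp
qed

text \<open>A finite-dimensional space is reflexive, so its whole dual serves as a predual.\<close>

lemma predual_M: "predual M (dual M)"
  unfolding predual_def
proof (intro conjI ballI allI impI)
  fix f :: "('u \<Rightarrow> complex) \<Rightarrow> complex"
  assume "(\<forall>\<phi>\<in>dual M. \<forall>\<psi>\<in>dual M. f (\<lambda>x\<in>carrier M. \<phi> x + \<psi> x) = f \<phi> + f \<psi>) \<and>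
        (\<forall>\<phi>\<in>dual M. \<forall>c. f (\<lambda>x\<in>carrier M. c * \<phi> x) = c * f \<phi>) \<and>
        (\<exists>C. \<forall>\<phi>\<in>dual M. cmod (f \<phi>) \<le> C * dual_norm M \<phi>)"
  then show "\<exists>x\<in>carrier M. \<forall>\<phi>\<in>dual M. f \<phi> = \<phi> x" by (intro bidual_evaluation) blast+
qed (use dual_zero dual_add dual_scal cnorm_eq_Sup_dual in auto)

lemma tracial_wstar_M: "tracial_wstar_algebra M"
proof -
  interpret P: pretracial M by (rule pretracial_M)
  have "linear_functional M (tr M)"
    unfolding linear_functional_def
  proof (intro conjI ballI allI)
    fix x c assume "x \<in> carrier M"
    then obtain A where A: "A \<in> carrier_mat n n" "x = g A" by (rule carrierE)
    show "tr M (scal M c x) = c * tr M x" using A by (simp add: mtr_smult)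
  qed (rule P.tadd)
  then have "normal_functional M (tr M)"
    by (rule P.normal_of_norm2_bounded[where C = 1]) (simp add: P.tr_norm2)
  moreover have "Im (tr M (star M x \<otimes>\<^bsub>M\<^esub> x)) = 0 \<and> 0 \<le> Re (tr M (star M x \<otimes>\<^bsub>M\<^esub> x))"
    and "tr M (star M x \<otimes>\<^bsub>M\<^esub> x) = 0 \<longrightarrow> x = \<zero>\<^bsub>M\<^esub>" if "x \<in> carrier M" for x
  proof -
    obtain A where A: "A \<in> carrier_mat n n" "x = g A" using carrier_h[OF \<open>x \<in> carrier M\<close>] by blast
    show "Im (tr M (star M x \<otimes>\<^bsub>M\<^esub> x)) = 0 \<and> 0 \<le> Re (tr M (star M x \<otimes>\<^bsub>M\<^esub> x))"
      "tr M (star M x \<otimes>\<^bsub>M\<^esub> x) = 0 \<longrightarrow> x = \<zero>\<^bsub>M\<^esub>"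
      using A by (simp_all add: mtr_adjoint_self mn2_eq_0 del: of_real_power)
  qed
  moreover have "tr M \<one>\<^bsub>M\<^esub> = 1" using n_pos by (simp add: mtr_one)
  ultimately show ?thesis
    unfolding tracial_wstar_algebra_def wstar_algebra_def faithful_normal_tracial_state_def
    using cstar_M predual_M P.tcomm by blast
qed

end

section \<open>Words and polynomials in matrices\<close>

lemma sq_one_mult [simp]:
  fixes A :: "complex mat"
  shows "A \<in> carrier_mat n n \<Longrightarrow> 1\<^sub>m n * A = A" "A \<in> carrier_mat n n \<Longrightarrow> A * 1\<^sub>m n = A"
    "A \<in> carrier_mat n n \<Longrightarrow> 0\<^sub>m n n * A = 0\<^sub>m n n" "A \<in> carrier_mat n n \<Longrightarrow> A * 0\<^sub>m n n = 0\<^sub>m n n"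
  by (simp_all add: left_mult_one_mat right_mult_one_mat left_mult_zero_mat right_mult_zero_mat)

lemma smult_smult_mat: "a \<cdot>\<^sub>m (b \<cdot>\<^sub>m A) = (a * b) \<cdot>\<^sub>m (A :: complex mat)"
  by (intro eq_matI) auto

lemma smult_mult_smult:
  fixes A B :: "complex mat"
  shows "A \<in> carrier_mat n n \<Longrightarrow> B \<in> carrier_mat n n \<Longrightarrow> (a \<cdot>\<^sub>m A) * (b \<cdot>\<^sub>m B) = (a * b) \<cdot>\<^sub>m (A * B)"
  by (simp add: mult_smult_assoc_mat[where nr=n and n=n and nc=n] mult_smult_distrib[where nr=n and n=n and nc=n] smult_smult_mat mult.commute)

lemma eval_word_Nil [simp]: "eval_word M X [] = \<one>\<^bsub>M\<^esub>"
  by (simp add: eval_word_def)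

lemma eval_word_Cons [simp]:
  "eval_word M X (ib # w) = (if snd ib then star M (X (fst ib)) else X (fst ib)) \<otimes>\<^bsub>M\<^esub> eval_word M X w"
  by (simp add: eval_word_def case_prod_beta)

abbreviation letters :: "('i \<times> bool) list \<Rightarrow> 'i set" where
  "letters w \<equiv> fst ` set w"

lemma eval_word_cong: "(\<And>i. i \<in> letters w \<Longrightarrow> X i = Y i) \<Longrightarrow> eval_word M X w = eval_word M Y w"
  by (induction w) auto

lemma eval_word_relabel: "eval_word M (\<lambda>i. X (f i)) w = eval_word M X (map (\<lambda>ib. (f (fst ib), snd ib)) w)"
  by (induction w) auto

abbreviation mword :: "nat \<Rightarrow> ('i \<Rightarrow> complex mat) \<Rightarrow> ('i \<times> bool) list \<Rightarrow> complex mat" where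
  "mword n \<equiv> eval_word (mat_alg n)"

lemma mword_carrier [simp]: "(\<And>i. i \<in> letters w \<Longrightarrow> X i \<in> carrier_mat n n) \<Longrightarrow> mword n X w \<in> carrier_mat n n"
  by (induction w) auto

lemma mword_append:
  assumes "\<And>i. X i \<in> carrier_mat n n"
  shows "mword n X (w @ v) = mword n X w * mword n X v"
  using assms by (induction w) (auto simp: sq_assoc[where n=n])

definition rev_adj :: "('i \<times> bool) list \<Rightarrow> ('i \<times> bool) list" where
  "rev_adj w = rev (map (\<lambda>ib. (fst ib, \<not> snd ib)) w)"

lemma letters_rev_adj [simp]: "letters (rev_adj w) = letters w"
  by (auto simp: rev_adj_def image_image)

lemma mword_adjoint:
  assumes "\<And>i. X i \<in> carrier_mat n n"
  shows "mat_adjoint (mword n X w) = mword n X (rev_adj w)"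
proof (induction w)
  case (Cons ib w)
  have "mat_adjoint (mword n X (ib # w)) = mat_adjoint (mword n X w) * mat_adjoint (if snd ib then mat_adjoint (X (fst ib)) else X (fst ib))"
    using assms by (simp add: mat_adjoint_mult[where n=n and m=n and k=n])
  also have "\<dots> = mword n X (rev_adj w @ [(fst ib, \<not> snd ib)])"
    using Cons assms by (auto simp: mword_append)
  also have "rev_adj w @ [(fst ib, \<not> snd ib)] = rev_adj (ib # w)" by (simp add: rev_adj_def)
  finally show ?case .
qed (simp add: rev_adj_def)

definition wcoef :: "('i \<Rightarrow> real) \<Rightarrow> ('i \<times> bool) list \<Rightarrow> real" where
  "wcoef c w = prod_list (map (\<lambda>ib. c (fst ib)) w)"

lemma wcoef_simps [simp]: "wcoef c [] = 1" "wcoef c (ib # w) = c (fst ib) * wcoef c w"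
  by (simp_all add: wcoef_def)

text \<open>Tuples with arbitrary radii are written as rescaled tuples of contractions. Formulas and
  polynomials are evaluated in this form, so that the codes below only concern contractions.\<close>

abbreviation scaled :: "('i \<Rightarrow> real) \<Rightarrow> ('i \<Rightarrow> complex mat) \<Rightarrow> 'i \<Rightarrow> complex mat" where
  "scaled c X \<equiv> (\<lambda>i. complex_of_real (c i) \<cdot>\<^sub>m X i)"

lemma mword_scaled:
  assumes "\<And>i. X i \<in> carrier_mat n n"
  shows "mword n (scaled c X) w = complex_of_real (wcoef c w) \<cdot>\<^sub>m mword n X w"
proof (induction w)
  case Nil
  show ?case by (auto intro!: eq_matI)
next
  case (Cons ib w)
  show ?case using assms Cons.IH by (auto simp: smult_mult_smult[where n=n])
qed

lemma mword_norm:
  assumes "\<And>i. i \<in> letters w \<Longrightarrow> X i \<in> carrier_mat n n" "\<And>i. i \<in> letters w \<Longrightarrow> mat_op_norm n (X i) \<le> c i"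
  shows "mat_op_norm n (mword n X w) \<le> wcoef c w"
  using assms
proof (induction w)
  case Nil
  then show ?case using mat_op_norm_one by simp
next
  case (Cons ib w)
  let ?Y = "if snd ib then mat_adjoint (X (fst ib)) else X (fst ib)"
  have Y: "?Y \<in> carrier_mat n n" "mat_op_norm n ?Y \<le> c (fst ib)"
    using Cons.prems by (auto simp: mat_op_norm_adjoint)
  have W: "mword n X w \<in> carrier_mat n n" using Cons.prems by simp
  have "mat_op_norm n (?Y * mword n X w) \<le> mat_op_norm n ?Y * mat_op_norm n (mword n X w)"
    by (rule mat_op_norm_mult[OF Y(1) W])
  also have "\<dots> \<le> c (fst ib) * wcoef c w"
  proof (rule mult_mono)
    show "mat_op_norm n (mword n X w) \<le> wcoef c w" by (rule Cons.IH) (use Cons.prems in auto)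
    show "0 \<le> c (fst ib)" using mat_op_norm_nonneg[OF Y(1)] Y(2) by linarith
    show "0 \<le> mat_op_norm n (mword n X w)" using W by simp
  qed (rule Y(2))
  finally show ?case by (simp only: eval_word_Cons wcoef_simps mat_alg_simps)
qed

lemma mword_conj:
  assumes "V \<in> unitaries n" "\<And>i. i \<in> letters w \<Longrightarrow> X i \<in> carrier_mat n n"
  shows "mword n (\<lambda>i. conj_by V (X i)) w = conj_by V (mword n X w)"
  using assms(2) by (induction w) (use assms(1) in \<open>auto simp: conj_by_mult[where n=n] conj_by_adjoint[where n=n]\<close>)

text \<open>Lists of coefficients and words, in which a word may be repeated. Sums and products then
  need no collecting of terms, and evaluation is a recursion that suits the estimates;
  \<open>ex_lpoly\<close> connects them with \<open>nc_poly\<close>.\<close>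

type_synonym 'i lpoly = "(complex \<times> ('i \<times> bool) list) list"

fun leval :: "nat \<Rightarrow> ('i \<Rightarrow> complex mat) \<Rightarrow> 'i lpoly \<Rightarrow> complex mat" where
  "leval n X [] = 0\<^sub>m n n"
| "leval n X (cw # l) = fst cw \<cdot>\<^sub>m mword n X (snd cw) + leval n X l"

definition lletters :: "'i lpoly \<Rightarrow> 'i set" where
  "lletters l = (\<Union>cw\<in>set l. letters (snd cw))"

lemma lletters_simps [simp]:
  "lletters [] = {}" "lletters (cw # l) = letters (snd cw) \<union> lletters l" "lletters (l @ l') = lletters l \<union> lletters l'"
  by (auto simp: lletters_def)

lemma finite_lletters: "finite (lletters l)"
  by (simp add: lletters_def)

lemma leval_carrier [simp]: "(\<And>i. i \<in> lletters l \<Longrightarrow> X i \<in> carrier_mat n n) \<Longrightarrow> leval n X l \<in> carrier_mat n n"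
  by (induction l) auto

lemma leval_append:
  assumes "\<And>i. X i \<in> carrier_mat n n"
  shows "leval n X (l @ l') = leval n X l + leval n X l'"
  using assms by (induction l) (simp_all add: assoc_add_mat[where nr=n and nc=n])

definition lscal :: "complex \<Rightarrow> 'i lpoly \<Rightarrow> 'i lpoly" where
  "lscal c l = map (\<lambda>dw. (c * fst dw, snd dw)) l"

lemma lletters_lscal [simp]: "lletters (lscal c l) = lletters l"
  by (simp add: lletters_def lscal_def)

lemma leval_lscal:
  assumes "\<And>i. X i \<in> carrier_mat n n"
  shows "leval n X (lscal c l) = c \<cdot>\<^sub>m leval n X l"
  using assms by (induction l)
   (auto simp: lscal_def add_smult_distrib_left_mat[where nr=n and nc=n] smult_smult_mat)

definition ladj :: "'i lpoly \<Rightarrow> 'i lpoly" where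
  "ladj l = map (\<lambda>cw. (cnj (fst cw), rev_adj (snd cw))) l"

lemma lletters_ladj [simp]: "lletters (ladj l) = lletters l"
  by (auto simp: lletters_def ladj_def)

lemma leval_ladj:
  assumes "\<And>i. X i \<in> carrier_mat n n"
  shows "leval n X (ladj l) = mat_adjoint (leval n X l)"
  using assms by (induction l) (simp_all add: ladj_def mat_adjoint_add[where n=n and m=n] mword_adjoint)

fun lmul :: "'i lpoly \<Rightarrow> 'i lpoly \<Rightarrow> 'i lpoly" where
  "lmul [] l' = []"
| "lmul (cw # l) l' = map (\<lambda>dv. (fst cw * fst dv, snd cw @ snd dv)) l' @ lmul l l'"

lemma leval_map_mult:
  assumes "\<And>i. X i \<in> carrier_mat n n"
  shows "leval n X (map (\<lambda>dv. (c * fst dv, w @ snd dv)) l) = (c \<cdot>\<^sub>m mword n X w) * leval n X l"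
proof (induction l)
  case Nil
  show ?case using assms by simp
next
  case (Cons dv l)
  have "(c \<cdot>\<^sub>m mword n X w) * (fst dv \<cdot>\<^sub>m mword n X (snd dv)) = (c * fst dv) \<cdot>\<^sub>m mword n X (w @ snd dv)"
    using assms by (simp add: mword_append smult_mult_smult[where n=n])
  then show ?case using Cons assms by (simp add: mult_add_distrib_mat[where nr=n and n=n and nc=n])
qed

lemma leval_lmul:
  assumes "\<And>i. X i \<in> carrier_mat n n"
  shows "leval n X (lmul l l') = leval n X l * leval n X l'"
proof (induction l)
  case Nil
  show ?case using assms by simp
next
  case (Cons cw l)
  then show ?case using assms
    by (simp add: leval_append leval_map_mult add_mult_distrib_mat[where nr=n and n=n and nc=n])
qed

lemma lletters_lmul: "lletters (lmul l l') \<subseteq> lletters l \<union> lletters l'"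
  by (induction l) (auto simp: lletters_def)

lemma mtr_leval:
  assumes "\<And>i. i \<in> lletters l \<Longrightarrow> X i \<in> carrier_mat n n"
  shows "mtr n (leval n X l) = (\<Sum>cw\<leftarrow>l. fst cw * mtr n (mword n X (snd cw)))"
  using assms by (induction l) (simp_all add: mtr_add mtr_smult)

lemma leval_conj:
  assumes "V \<in> unitaries n" "\<And>i. i \<in> lletters l \<Longrightarrow> X i \<in> carrier_mat n n"
  shows "leval n (\<lambda>i. conj_by V (X i)) l = conj_by V (leval n X l)"
  using assms(2) by (induction l) (use assms(1) in \<open>auto simp: mword_conj conj_by_add[where n=n] conj_by_smult[where n=n]\<close>)

text \<open>Stated from the few algebraic facts that the induction uses, because it is applied to
  the matrix algebras, to their copies and to the ultraproduct.\<close>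

lemma tr_eval_poly:
  fixes M :: "'a star_alg"
  assumes ab: "abelian_group M"
    and add: "\<And>x y. x \<in> carrier M \<Longrightarrow> y \<in> carrier M \<Longrightarrow> tr M (x \<oplus>\<^bsub>M\<^esub> y) = tr M x + tr M y"
    and scal: "\<And>c x. x \<in> carrier M \<Longrightarrow> tr M (scal M c x) = c * tr M x"
    and scal_closed: "\<And>c x. x \<in> carrier M \<Longrightarrow> scal M c x \<in> carrier M"
    and words: "\<And>w. w \<in> Poly_Mapping.keys p \<Longrightarrow> eval_word M X w \<in> carrier M"
  shows "tr M (eval_poly M X p) = (\<Sum>w\<in>Poly_Mapping.keys p. Poly_Mapping.lookup p w * tr M (eval_word M X w))"
proof -
  interpret abelian_group M by (rule ab)
  have z: "tr M \<zero>\<^bsub>M\<^esub> = 0" using add[of "\<zero>\<^bsub>M\<^esub>" "\<zero>\<^bsub>M\<^esub>"] by simp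
  have "tr M (\<Oplus>\<^bsub>M\<^esub>w\<in>S. scal M (Poly_Mapping.lookup p w) (eval_word M X w))
      = (\<Sum>w\<in>S. Poly_Mapping.lookup p w * tr M (eval_word M X w))"
    if "finite S" "S \<subseteq> Poly_Mapping.keys p" for S
    using that
  proof (induction S rule: finite_induct)
    case empty
    show ?case by (simp add: z)
  next
    case (insert w S)
    have c: "(\<lambda>w. scal M (Poly_Mapping.lookup p w) (eval_word M X w)) \<in> S \<rightarrow> carrier M"
      using insert.prems words scal_closed by auto
    have d: "scal M (Poly_Mapping.lookup p w) (eval_word M X w) \<in> carrier M" "eval_word M X w \<in> carrier M"
      using insert.prems words scal_closed by auto
    have "tr M (\<Oplus>\<^bsub>M\<^esub>w\<in>insert w S. scal M (Poly_Mapping.lookup p w) (eval_word M X w))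
      = tr M (scal M (Poly_Mapping.lookup p w) (eval_word M X w)) + tr M (\<Oplus>\<^bsub>M\<^esub>w\<in>S. scal M (Poly_Mapping.lookup p w) (eval_word M X w))"
      using finsum_insert[OF insert.hyps c d(1)] add[OF d(1) finsum_closed[OF c]] by simp
    then show ?case using insert scal[OF d(2)] by simp
  qed
  then show ?thesis by (simp add: eval_poly_def)
qed

lemma tr_eval_poly_mat:
  assumes "\<And>w i. w \<in> Poly_Mapping.keys p \<Longrightarrow> i \<in> letters w \<Longrightarrow> X i \<in> carrier_mat n n"
  shows "tr (mat_alg n) (eval_poly (mat_alg n) X p) = (\<Sum>w\<in>Poly_Mapping.keys p. Poly_Mapping.lookup p w * mtr n (mword n X w))"
proof -
  interpret ring "mat_alg n" by (rule ring_mat_alg)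
  have "tr (mat_alg n) (eval_poly (mat_alg n) X p) = (\<Sum>w\<in>Poly_Mapping.keys p. Poly_Mapping.lookup p w * tr (mat_alg n) (mword n X w))"
    by (rule tr_eval_poly) (use assms in \<open>auto simp: mtr_add mtr_smult intro!: abelian_group_axioms mword_carrier\<close>)
  then show ?thesis by simp
qed

lemma op_ball_mat_alg: "A \<in> op_ball (mat_alg n) r \<longleftrightarrow> A \<in> carrier_mat n n \<and> mat_op_norm n A \<le> r"
  by (simp add: op_ball_def)

context mat_copy
begin

lemma eval_word_copy: "(\<And>i. i \<in> letters w \<Longrightarrow> X i \<in> carrier_mat n n) \<Longrightarrow>
    eval_word M (\<lambda>i. g (X i)) w = g (mword n X w)"
  by (induction w) auto

lemma tr_eval_poly_copy:
  assumes "\<And>w i. w \<in> Poly_Mapping.keys p \<Longrightarrow> i \<in> letters w \<Longrightarrow> X i \<in> carrier_mat n n"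
  shows "tr M (eval_poly M (\<lambda>i. g (X i)) p) = tr (mat_alg n) (eval_poly (mat_alg n) X p)"
proof -
  interpret C: cstar_algebra M by (rule cstar_M)
  interpret P: pretracial M by (rule pretracial_M)
  have ew: "eval_word M (\<lambda>i. g (X i)) w = g (mword n X w)" "mword n X w \<in> carrier_mat n n"
    if "w \<in> Poly_Mapping.keys p" for w
    using assms[OF that] by (auto intro: eval_word_copy)
  have "tr M (eval_poly M (\<lambda>i. g (X i)) p) = (\<Sum>w\<in>Poly_Mapping.keys p. Poly_Mapping.lookup p w * tr M (eval_word M (\<lambda>i. g (X i)) w))"
  proof (rule tr_eval_poly)
    fix c x assume "x \<in> carrier M"
    then obtain A where "A \<in> carrier_mat n n" "x = g A" by (rule carrierE)
    then show "tr M (scal M c x) = c * tr M x" by (simp add: mtr_smult)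
  next
    fix w assume "w \<in> Poly_Mapping.keys p"
    then show "eval_word M (\<lambda>i. g (X i)) w \<in> carrier M" using ew by simp
  qed (rule C.abelian_group_axioms P.tadd C.scal_closed; assumption)+
  also have "\<dots> = (\<Sum>w\<in>Poly_Mapping.keys p. Poly_Mapping.lookup p w * mtr n (mword n X w))"
    using ew by (intro sum.cong refl) simp
  also have "\<dots> = tr (mat_alg n) (eval_poly (mat_alg n) X p)" by (rule tr_eval_poly_mat[OF assms, symmetric])
  finally show ?thesis .
qed

lemma op_ball_copy: "op_ball M r = g ` op_ball (mat_alg n) r"
  by (auto simp: op_ball_def carrier_M)

lemma interp_copy:
  assumes "\<And>j. X j \<in> carrier_mat n n"
  shows "interp M \<phi> (\<lambda>j. g (X j)) = interp (mat_alg n) \<phi> X"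
  using assms
proof (induction \<phi> arbitrary: X)
  case (Connective f \<phi>s)
  have "map (\<lambda>\<phi>. interp M \<phi> (\<lambda>j. g (X j))) \<phi>s = map (\<lambda>\<phi>. interp (mat_alg n) \<phi> X) \<phi>s"
    using Connective by (intro map_cong) auto
  then show ?case by (simp only: interp.simps)
next
  case (Inf_ball j r \<phi>)
  have "interp M \<phi> ((\<lambda>j. g (X j))(j := g a)) = interp (mat_alg n) \<phi> (X(j := a))" if "a \<in> op_ball (mat_alg n) r" for a
  proof -
    have "(\<lambda>j. g (X j))(j := g a) = (\<lambda>i. g ((X(j := a)) i))" by auto
    moreover have "(X(j := a)) i \<in> carrier_mat n n" for i using Inf_ball.prems that by (simp add: op_ball_mat_alg)
    ultimately show ?thesis using Inf_ball.IH[of "X(j := a)"] by (simp only:)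
  qed
  then show ?case by (simp add: op_ball_copy image_image cong: image_cong)
next
  case (Sup_ball j r \<phi>)
  have "interp M \<phi> ((\<lambda>j. g (X j))(j := g a)) = interp (mat_alg n) \<phi> (X(j := a))" if "a \<in> op_ball (mat_alg n) r" for a
  proof -
    have "(\<lambda>j. g (X j))(j := g a) = (\<lambda>i. g ((X(j := a)) i))" by auto
    moreover have "(X(j := a)) i \<in> carrier_mat n n" for i using Sup_ball.prems that by (simp add: op_ball_mat_alg)
    ultimately show ?thesis using Sup_ball.IH[of "X(j := a)"] by (simp only:)
  qed
  then show ?case by (simp add: op_ball_copy image_image cong: image_cong)
qed (auto simp only: interp.simps intro!: arg_cong[of _ _ Re] arg_cong[of _ _ Im] tr_eval_poly_copy)

end

text \<open>The entries in row-major order, each stored as a constant polynomial. Its purpose is to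
  be injective on square matrices of size \<open>n\<close>.\<close>

definition to_universe :: "nat \<Rightarrow> complex mat \<Rightarrow> 'i universe" where
  "to_universe n A k = Poly_Mapping.single [] (A $$ (k div n, k mod n))"

lemma mat_copy_universe: "n > 0 \<Longrightarrow> mat_copy n (to_universe n :: complex mat \<Rightarrow> 'i universe)"
proof
  assume n: "n > 0"
  show "inj_on (to_universe n :: complex mat \<Rightarrow> 'i universe) (carrier_mat n n)"
  proof (rule inj_onI, rule eq_matI)
    fix A B :: "complex mat" and i j
    assume A: "A \<in> carrier_mat n n" and B: "B \<in> carrier_mat n n" and eq: "(to_universe n A :: 'i universe) = to_universe n B"
      and "i < dim_row B" "j < dim_col B"
    then have ij: "i < n" "j < n" by auto
    have "Poly_Mapping.lookup ((to_universe n A :: 'i universe) (i * n + j)) [] = Poly_Mapping.lookup ((to_universe n B :: 'i universe) (i * n + j)) []"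
      using eq by simp
    then show "A $$ (i, j) = B $$ (i, j)"
      using ij by (simp add: to_universe_def)
  qed auto
qed

text \<open>Neighborhoods of a law consist of laws realized over \<open>universe\<close>, so the
  laws of microstates must be realized there too. The copy of the matrix algebra along
  \<open>to_universe\<close> provides this.\<close>

lemma law_mat_in_laws:
  assumes n: "n > 0" and X: "\<And>i. i \<in> I \<Longrightarrow> X i \<in> op_ball (mat_alg n) (r i)"
  shows "law I (mat_alg n) X \<in> laws I r"
proof -
  interpret mat_copy n "to_universe n :: complex mat \<Rightarrow> 'a universe" by (rule mat_copy_universe[OF n])
  have "law I (mat_alg n) X = law I M (\<lambda>i. to_universe n (X i))"
    unfolding law_def
  proof (rule restrict_ext)
    fix p :: "'a nc_poly" assume "p \<in> nc_polys I"
    then have "X i \<in> carrier_mat n n" if "w \<in> Poly_Mapping.keys p" "i \<in> letters w" for w i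
      using X that unfolding nc_polys_def op_ball_mat_alg by blast
    then show "tr (mat_alg n) (eval_poly (mat_alg n) X p) = tr M (eval_poly M (\<lambda>i. to_universe n (X i)) p)"
      by (rule tr_eval_poly_copy[symmetric])
  qed
  moreover have "\<forall>i\<in>I. to_universe n (X i) \<in> op_ball M (r i)" using X by (simp add: op_ball_copy)
  ultimately show ?thesis unfolding laws_def using tracial_wstar_M by blast
qed

lemma tp_mat_in_types_bounded:
  assumes n: "n > 0" and X: "\<And>j. X j \<in> op_ball (mat_alg n) (r j)"
  shows "tp (mat_alg n) X \<in> types_bounded r"
proof -
  interpret mat_copy n "to_universe n :: complex mat \<Rightarrow> nat universe" by (rule mat_copy_universe[OF n])
  have "X j \<in> carrier_mat n n" for j using X[of j] by (simp add: op_ball_mat_alg)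
  then have "tp (mat_alg n) X = tp M (\<lambda>j. to_universe n (X j))"
    unfolding tp_def by (simp add: interp_copy)
  moreover have "\<forall>j. to_universe n (X j) \<in> op_ball M (r j)" using X by (simp add: op_ball_copy)
  ultimately show ?thesis unfolding types_bounded_def using tracial_wstar_M by blast
qed

section \<open>Counting sign matrices modulo unitary conjugation\<close>

text \<open>The full two-sided series has sum 3; the tail \<open>2 / 2 ^ L\<close> is kept so that
  the induction closes.\<close>

lemma sum_half_abs_le: "(\<Sum>j\<in>{-int L..int L}. (1/2::real) ^ nat \<bar>j\<bar>) \<le> 3 - 2 / 2 ^ L"
proof (induction L)
  case (Suc L)
  have eq: "{-int (Suc L)..int (Suc L)} = insert (- int (Suc L)) (insert (int (Suc L)) {-int L..int L})" by auto
  have "(\<Sum>j\<in>{-int (Suc L)..int (Suc L)}. (1/2::real) ^ nat \<bar>j\<bar>)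
      = (1/2) ^ Suc L + ((1/2) ^ Suc L + (\<Sum>j\<in>{-int L..int L}. (1/2::real) ^ nat \<bar>j\<bar>))"
    unfolding eq by (subst sum.insert, simp, force)+ (simp add: nat_add_distrib)
  also have "\<dots> \<le> 3 - 2 / 2 ^ Suc L" using Suc by (simp add: power_divide)
  finally show ?case .
qed simp

definition lattice_pts :: "'d set \<Rightarrow> nat \<Rightarrow> ('d \<Rightarrow> int) set" where
  "lattice_pts D L = {k \<in> (\<Pi>\<^sub>E i\<in>D. UNIV). (\<Sum>i\<in>D. nat \<bar>k i\<bar>) \<le> L}"

lemma lattice_pts_subset:
  assumes "finite D"
  shows "lattice_pts D L \<subseteq> (\<Pi>\<^sub>E i\<in>D. {-int L..int L})"
proof
  fix k assume k: "k \<in> lattice_pts D L"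
  have "k i \<in> {-int L..int L}" if "i \<in> D" for i
  proof -
    have "nat \<bar>k i\<bar> \<le> (\<Sum>i\<in>D. nat \<bar>k i\<bar>)" using member_le_sum[OF that, of "\<lambda>i. nat \<bar>k i\<bar>"] assms by simp
    then show ?thesis using k by (auto simp: lattice_pts_def)
  qed
  then show "k \<in> (\<Pi>\<^sub>E i\<in>D. {-int L..int L})" using k by (auto simp: lattice_pts_def PiE_def)
qed

lemma finite_lattice_pts: "finite D \<Longrightarrow> finite (lattice_pts D L)"
  by (rule finite_subset[OF lattice_pts_subset]) (simp_all add: finite_PiE)

text \<open>Give a point \<open>k\<close> the weight 2^(L - |k|_1), which is at least 1 on the
  l1-ball. Summed over a full cube the weights factor over the coordinates, and each factor is at
  most 3.\<close>

lemma card_lattice_pts: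
  assumes D: "finite D"
  shows "real (card (lattice_pts D L)) \<le> 2 ^ L * 3 ^ card D"
proof -
  define B where "B = (\<Pi>\<^sub>E i\<in>D. {-int L..int L})"
  have B: "finite B" using D by (simp add: B_def finite_PiE)
  have "real (card (lattice_pts D L)) = (\<Sum>k\<in>lattice_pts D L. 1)" by simp
  also have "\<dots> \<le> (\<Sum>k\<in>lattice_pts D L. 2 ^ L * (\<Prod>i\<in>D. (1/2::real) ^ nat \<bar>k i\<bar>))"
  proof (rule sum_mono)
    fix k assume "k \<in> lattice_pts D L"
    then have le: "(\<Sum>i\<in>D. nat \<bar>k i\<bar>) \<le> L" by (simp add: lattice_pts_def)
    have "(\<Prod>i\<in>D. (1/2::real) ^ nat \<bar>k i\<bar>) = (1/2) ^ (\<Sum>i\<in>D. nat \<bar>k i\<bar>)" by (simp add: power_sum)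
    also have "\<dots> \<ge> (1/2) ^ L" by (rule power_decreasing[OF le]) simp_all
    finally have "(2::real) ^ L * (1/2) ^ L \<le> 2 ^ L * (\<Prod>i\<in>D. (1/2::real) ^ nat \<bar>k i\<bar>)" by (intro mult_left_mono) auto
    then show "1 \<le> 2 ^ L * (\<Prod>i\<in>D. (1/2::real) ^ nat \<bar>k i\<bar>)" by (simp flip: power_mult_distrib)
  qed
  also have "\<dots> \<le> (\<Sum>k\<in>B. 2 ^ L * (\<Prod>i\<in>D. (1/2::real) ^ nat \<bar>k i\<bar>))"
    using lattice_pts_subset[OF D, of L] B by (intro sum_mono2) (auto simp: B_def prod_nonneg)
  also have "\<dots> = 2 ^ L * (\<Prod>i\<in>D. \<Sum>j\<in>{-int L..int L}. (1/2::real) ^ nat \<bar>j\<bar>)"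
    unfolding sum_distrib_left[symmetric] B_def by (subst prod_sum_PiE[OF D]) auto
  also have "\<dots> \<le> 2 ^ L * (\<Prod>i\<in>D. 3)"
  proof (intro mult_left_mono prod_mono conjI)
    have "(0::real) \<le> 2 / 2 ^ L" by simp
    then show "(\<Sum>j\<in>{-int L..int L}. (1/2::real) ^ nat \<bar>j\<bar>) \<le> 3" using sum_half_abs_le[of L] by linarith
  qed (auto intro: sum_nonneg)
  finally show ?thesis by simp
qed

section \<open>Exponential moments and Hamming balls\<close>

lemma two_pow_fact_le: "2 ^ n * fact n \<le> (fact (2 * n) :: real)"
proof (induction n)
  case (Suc n)
  have "2 ^ Suc n * fact (Suc n) = (2 * real (Suc n)) * (2 ^ n * fact n)" by (simp add: algebra_simps)
  also have "\<dots> \<le> (2 * real (Suc n)) * fact (2 * n)" using Suc by (intro mult_left_mono) auto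
  also have "\<dots> \<le> (2 * real (Suc n)) * (real (Suc (2 * n)) * fact (2 * n))"
    by (intro mult_left_mono) (auto simp: mult_le_cancel_right1)
  also have "\<dots> = fact (2 * Suc n)" by (simp add: algebra_simps)
  finally show ?case .
qed simp

text \<open>Comparison of the two power series term by term, with (2n)! \<ge> 2^n n!. This is the
  sub-Gaussian bound for a random sign.\<close>

lemma cosh_le_exp_square: "cosh x \<le> exp (x\<^sup>2 / 2)" for x :: real
proof (rule sums_le)
  have "(\<lambda>n. if even (2 * n) then x ^ (2 * n) /\<^sub>R fact (2 * n) else 0) sums cosh x"
  proof (subst sums_mono_reindex[of "\<lambda>n. 2 * n" "\<lambda>n. if even n then x ^ n /\<^sub>R fact n else 0"])
    show "strict_mono (\<lambda>n::nat. 2 * n)" by (simp add: strict_mono_def)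
    show "(if even n then x ^ n /\<^sub>R fact n else 0) = 0" if "n \<notin> range (\<lambda>n::nat. 2 * n)" for n
      using that by (auto elim!: evenE)
    show "(\<lambda>n. if even n then x ^ n /\<^sub>R fact n else 0) sums cosh x" by (rule cosh_converges)
  qed
  then show "(\<lambda>n. x ^ (2 * n) / fact (2 * n)) sums cosh x" by (simp add: divide_inverse mult.commute)
  show "(\<lambda>n. (x\<^sup>2 / 2) ^ n /\<^sub>R fact n) sums exp (x\<^sup>2 / 2)" by (rule exp_converges)
  fix n
  have "x ^ (2 * n) / fact (2 * n) \<le> x ^ (2 * n) / (2 ^ n * fact n)"
    by (rule divide_left_mono[OF two_pow_fact_le]) (auto simp: power_mult)
  also have "\<dots> = (x\<^sup>2 / 2) ^ n /\<^sub>R fact n" 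
    unfolding power_mult power_divide real_scaleR_def by (simp only: divide_inverse inverse_mult_distrib mult_ac)
  finally show "x ^ (2 * n) / fact (2 * n) \<le> (x\<^sup>2 / 2) ^ n /\<^sub>R fact n" .
qed

abbreviation sgn_of :: "'p set \<Rightarrow> 'p \<Rightarrow> real" where
  "sgn_of S p \<equiv> (if p \<in> S then 1 else -1)"

text \<open>A subset of \<open>P\<close> is a choice of signs. Expanding the product over
  \<open>P\<close> of exp (u p) + exp (- u p) gives the sum over all choices, and each factor is
  twice a hyperbolic cosine.\<close>

lemma exp_sum_signs:
  fixes u :: "'p \<Rightarrow> real"
  assumes P: "finite P"
  shows "(\<Sum>S\<in>Pow P. exp (\<Sum>p\<in>P. sgn_of S p * u p)) \<le> 2 ^ card P * exp ((\<Sum>p\<in>P. (u p)\<^sup>2) / 2)"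
proof -
  have "(\<Sum>S\<in>Pow P. exp (\<Sum>p\<in>P. sgn_of S p * u p)) = (\<Sum>S\<in>Pow P. (\<Prod>p\<in>S. exp (u p)) * (\<Prod>p\<in>P - S. exp (- u p)))"
  proof (rule sum.cong[OF refl])
    fix S assume S: "S \<in> Pow P"
    then have fin: "finite S" "finite (P - S)" using P finite_subset by auto
    have "(\<Sum>p\<in>P. sgn_of S p * u p) = (\<Sum>p\<in>P - S. sgn_of S p * u p) + (\<Sum>p\<in>S. sgn_of S p * u p)"
      using S P by (intro sum.subset_diff) auto
    also have "\<dots> = (\<Sum>p\<in>P - S. - u p) + (\<Sum>p\<in>S. u p)"
      by (intro arg_cong2[of _ _ _ _ "(+)"] sum.cong) auto
    finally show "exp (\<Sum>p\<in>P. sgn_of S p * u p) = (\<Prod>p\<in>S. exp (u p)) * (\<Prod>p\<in>P - S. exp (- u p))"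
      using fin by (simp add: exp_add exp_sum mult.commute)
  qed
  also have "\<dots> = (\<Prod>p\<in>P. exp (u p) + exp (- u p))" by (rule prod_add[OF P, symmetric])
  also have "\<dots> \<le> (\<Prod>p\<in>P. 2 * exp ((u p)\<^sup>2 / 2))"
    using cosh_le_exp_square by (intro prod_mono) (auto simp: cosh_def field_simps intro: add_nonneg_nonneg)
  also have "\<dots> = 2 ^ card P * exp ((\<Sum>p\<in>P. (u p)\<^sup>2) / 2)"
    using P by (simp add: prod.distrib exp_sum sum_divide_distrib)
  finally show ?thesis .
qed

text \<open>Markov's inequality for the exponential moment. The parameter in the exponent is fixed
  to 1; the caller rescales \<open>u\<close> instead.\<close>

lemma card_large_signs:
  fixes u :: "'p \<Rightarrow> real"
  assumes P: "finite P"
  shows "real (card {S \<in> Pow P. t < (\<Sum>p\<in>P. sgn_of S p * u p)}) \<le> 2 ^ card P * exp ((\<Sum>p\<in>P. (u p)\<^sup>2) / 2 - t)"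
proof -
  let ?B = "{S \<in> Pow P. t < (\<Sum>p\<in>P. sgn_of S p * u p)}"
  have "real (card ?B) * exp t = (\<Sum>S\<in>?B. exp t)" by simp
  also have "\<dots> \<le> (\<Sum>S\<in>?B. exp (\<Sum>p\<in>P. sgn_of S p * u p))" by (intro sum_mono) auto
  also have "\<dots> \<le> (\<Sum>S\<in>Pow P. exp (\<Sum>p\<in>P. sgn_of S p * u p))"
    using P by (intro sum_mono2) auto
  also have "\<dots> \<le> 2 ^ card P * exp ((\<Sum>p\<in>P. (u p)\<^sup>2) / 2)" by (rule exp_sum_signs[OF P])
  finally have "real (card ?B) \<le> 2 ^ card P * exp ((\<Sum>p\<in>P. (u p)\<^sup>2) / 2) / exp t"
    by (subst pos_le_divide_eq) simp_all
  then show ?thesis by (simp add: exp_diff)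
qed

text \<open>With N = card P, the weight 9^(N/10) (1/9)^distance is at least 1 on the ball, and over
  all subsets it sums to 9^(N/10) (1 + 1/9)^N. The base 1/9 is the optimal one for radius
  N/10.\<close>

lemma card_hamming_ball:
  assumes P: "finite P" and S0: "S0 \<subseteq> P"
  shows "real (card {S \<in> Pow P. 10 * card (sym_diff S S0) \<le> card P}) \<le> sqrt 2 ^ card P"
proof -
  define N where "N = card P"
  let ?B = "{S \<in> Pow P. 10 * card (sym_diff S S0) \<le> card P}"
  define q :: real where "q = 9 powr (1/10)"
  have q0: "q > 0" by (simp add: q_def)
  have q10: "q ^ 10 = 9" by (simp add: q_def powr_powr flip: powr_realpow)
  \<comment> \<open>A rational upper bound for the tenth root of 9, small enough that its product
    with 10/9 stays below \<surd>2.\<close>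
  have "(9::real) \<le> (127/100) ^ 10" by (simp add: power_divide)
  then have "q ^ 10 \<le> (127/100) ^ 10" using q10 by simp
  then have q: "q \<le> 127/100" by (rule power_le_imp_le_base[of _ 9, simplified]) simp
  have s2: "(127/100) * (10/9) \<le> sqrt 2" by (rule real_le_rsqrt) (simp add: power2_eq_square)
  have "real (card ?B) = (\<Sum>S\<in>?B. 1)" by simp
  also have "\<dots> \<le> (\<Sum>S\<in>?B. q ^ N * (1/9) ^ card (sym_diff S S0))"
  proof (rule sum_mono)
    fix S assume "S \<in> ?B"
    then have le: "10 * card (sym_diff S S0) \<le> N" by (simp add: N_def)
    have "1 \<le> q" unfolding q_def by (rule ge_one_powr_ge_zero) simp_all
    then have "q ^ (10 * card (sym_diff S S0)) \<le> q ^ N" using le by (intro power_increasing) auto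
    then have "9 ^ card (sym_diff S S0) \<le> q ^ N" by (simp add: power_mult q10)
    then show "1 \<le> q ^ N * (1/9) ^ card (sym_diff S S0)" by (simp add: power_divide)
  qed
  also have "\<dots> \<le> (\<Sum>S\<in>Pow P. q ^ N * (1/9) ^ card (sym_diff S S0))"
    using P q0 by (intro sum_mono2) auto
  also have "\<dots> = q ^ N * (\<Sum>S\<in>Pow P. (1/9) ^ card (sym_diff S S0))" by (simp add: sum_distrib_left)
  also have "(\<Sum>S\<in>Pow P. (1/9::real) ^ card (sym_diff S S0))
      = (\<Sum>S\<in>Pow P. (\<Prod>p\<in>S. if p \<in> S0 then 1 else 1/9) * (\<Prod>p\<in>P - S. if p \<in> S0 then 1/9 else 1))"
  proof (rule sum.cong[OF refl])
    fix S assume S: "S \<in> Pow P"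
    then have fin: "finite S" "finite S0" using P S0 finite_subset by auto
    have "(\<Prod>p\<in>S. if p \<in> S0 then 1 else 1/9::real) = (1/9) ^ card (S - S0)"
      using fin(1) by (subst prod.If_cases) (auto simp: Diff_eq)
    moreover have "(\<Prod>p\<in>P - S. if p \<in> S0 then 1/9 else 1::real) = (1/9) ^ card (S0 - S)"
    proof -
      have "(P - S) \<inter> {p. p \<in> S0} = S0 - S" using S0 by auto
      then show ?thesis using P by (subst prod.If_cases) auto
    qed
    moreover have "card (sym_diff S S0) = card (S - S0) + card (S0 - S)"
      using fin by (intro card_Un_disjoint) auto
    ultimately show "(1/9::real) ^ card (sym_diff S S0)
      = (\<Prod>p\<in>S. if p \<in> S0 then 1 else 1/9) * (\<Prod>p\<in>P - S. if p \<in> S0 then 1/9 else 1)"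
      by (simp add: power_add)
  qed
  also have "\<dots> = (\<Prod>p\<in>P. (if p \<in> S0 then 1 else 1/9) + (if p \<in> S0 then 1/9 else 1))"
    by (rule prod_add[OF P, symmetric])
  also have "\<dots> = (\<Prod>p\<in>P. 10/9)" by (intro prod.cong) auto
  also have "q ^ N * \<dots> = (q * (10/9)) ^ N" by (simp add: N_def flip: power_mult_distrib)
  also have "\<dots> \<le> sqrt 2 ^ N"
    using q q0 s2 by (intro power_mono) auto
  finally show ?thesis by (simp add: N_def)
qed

section \<open>Operator norms of sign matrices\<close>

definition bil :: "nat \<Rightarrow> (nat \<times> nat) set \<Rightarrow> (nat \<Rightarrow> real) \<Rightarrow> (nat \<Rightarrow> real) \<Rightarrow> real" where
  "bil n S x w = (\<Sum>p\<in>{..<n}\<times>{..<n}. sgn_of S p * (x (fst p) * w (snd p)))"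

abbreviation nr :: "nat \<Rightarrow> (nat \<Rightarrow> real) \<Rightarrow> real" where "nr n x \<equiv> L2_set x {..<n}"

lemma bil_add: "bil n S (\<lambda>i. x i + y i) w = bil n S x w + bil n S y w"
  "bil n S x (\<lambda>i. v i + w i) = bil n S x v + bil n S x w"
  by (simp_all add: bil_def algebra_simps sum.distrib)

lemma bil_scale: "bil n S (\<lambda>i. a * x i) w = a * bil n S x w" "bil n S x (\<lambda>i. a * w i) = a * bil n S x w"
  by (simp_all add: bil_def sum_distrib_left mult_ac)

lemma sum_abs_le_nr: "(\<Sum>i<n. \<bar>x i\<bar>) \<le> sqrt n * nr n x"
  using L2_set_mult_ineq[of "\<lambda>_. 1" x "{..<n}"] by (simp add: L2_set_constant)

lemma bil_bounded: "\<bar>bil n S x w\<bar> \<le> real n * (nr n x * nr n w)"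
proof -
  have "\<bar>bil n S x w\<bar> \<le> (\<Sum>p\<in>{..<n}\<times>{..<n}. \<bar>sgn_of S p * (x (fst p) * w (snd p))\<bar>)"
    unfolding bil_def by (rule sum_abs)
  also have "\<dots> = (\<Sum>i<n. \<bar>x i\<bar>) * (\<Sum>j<n. \<bar>w j\<bar>)"
    unfolding sum_product sum.cartesian_product by (intro sum.cong refl) (auto simp: abs_mult)
  also have "\<dots> \<le> (sqrt n * nr n x) * (sqrt n * nr n w)"
    by (intro mult_mono sum_abs_le_nr sum_nonneg mult_nonneg_nonneg) auto
  also have "\<dots> = (sqrt n * sqrt n) * (nr n x * nr n w)" by (simp only: mult_ac)
  finally show ?thesis by simp
qed

text \<open>Integer numerators of points with denominator 4 \<surd>n that approximate the unit ball.
  The l1 bound is used for counting them, while the l2 bound says that the points have norm at most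
  5/4 and enters the exponential moment.\<close>

definition net :: "nat \<Rightarrow> (nat \<Rightarrow> int) set" where
  "net n = {k \<in> lattice_pts {..<n} (5 * n). (\<Sum>i<n. (k i)\<^sup>2) \<le> 25 * int n}"

text \<open>A set of index pairs encodes a sign matrix. The bound on the net forces its operator norm to be
  at most \<open>50 \<surd>n\<close>, and at least half of all sign matrices satisfy it.\<close>

definition bounded_signs :: "nat \<Rightarrow> (nat \<times> nat) set set" where
  "bounded_signs n = {S \<in> Pow ({..<n}\<times>{..<n}). \<forall>k\<in>net n. \<forall>l\<in>net n.
     bil n S (\<lambda>i. of_int (k i)) (\<lambda>i. of_int (l i)) \<le> 320 * real n * sqrt n}"

lemma finite_bounded_signs: "finite (bounded_signs n)"
  unfolding bounded_signs_def by (rule finite_subset[of _ "Pow ({..<n}\<times>{..<n})"]) auto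

lemma card_net: "real (card (net n)) \<le> 128 ^ n" "finite (net n)"
proof -
  have fin: "finite (lattice_pts {..<n} (5 * n))" by (simp add: finite_lattice_pts)
  have sub: "net n \<subseteq> lattice_pts {..<n} (5 * n)" by (auto simp: net_def)
  show "finite (net n)" by (rule finite_subset[OF sub fin])
  have "real (card (net n)) \<le> 2 ^ (5 * n) * 3 ^ n"
    using card_lattice_pts[of "{..<n}" "5 * n"] card_mono[OF fin sub] by simp
  also have "\<dots> = 96 ^ n" by (simp add: power_mult flip: power_mult_distrib)
  also have "\<dots> \<le> 128 ^ n" by (rule power_mono) simp_all
  finally show "real (card (net n)) \<le> 128 ^ n" .
qed

text \<open>Union bound over pairs of net points. A fixed pair violates its bound for a proportion
  of at most exp (-35 n) \<le> 2^(-35 n) of all sign matrices, and there are at most 128^(2n) =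
  2^(14n) pairs. What remains is 2^(-21n) \<le> 1/2.\<close>

lemma card_bounded_signs:
  assumes n: "n > 0"
  shows "2 ^ (n * n) / 2 \<le> real (card (bounded_signs n))"
proof -
  define P where "P = {..<n}\<times>{..<n}"
  have P: "finite P" "card P = n * n" by (simp_all add: P_def)
  define bad where "bad k l = {S \<in> Pow P. 320 * real n * sqrt n < bil n S (\<lambda>i. of_int (k i)) (\<lambda>i. of_int (l i))}"
    for k l :: "nat \<Rightarrow> int"
  have cb: "real (card (bad k l)) \<le> 2 ^ (n * n) * exp (- (35 * real n))" if k: "k \<in> net n" and l: "l \<in> net n" for k l
  proof -
    \<comment> \<open>Scaled so that the threshold 320 n \<surd>n becomes 40 n while the squares of
      \<open>u\<close> sum to at most (625/64) n. The exponent is therefore at most 5 n - 40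
      n.\<close>
    define u where "u p = (1 / (8 * sqrt n)) * (real_of_int (k (fst p)) * real_of_int (l (snd p)))" for p
    have sub: "bad k l \<subseteq> {S \<in> Pow P. 40 * real n < (\<Sum>p\<in>P. sgn_of S p * u p)}"
    proof (rule subsetI)
      fix S assume S: "S \<in> bad k l"
      have "(\<Sum>p\<in>P. sgn_of S p * u p) = (1 / (8 * sqrt n)) * bil n S (\<lambda>i. of_int (k i)) (\<lambda>i. of_int (l i))"
        unfolding u_def bil_def P_def sum_distrib_left by (intro sum.cong refl) (simp only: mult_ac)
      moreover have "(1 / (8 * sqrt n)) * (320 * real n * sqrt n) < (1 / (8 * sqrt n)) * bil n S (\<lambda>i. of_int (k i)) (\<lambda>i. of_int (l i))"
        using S n by (intro mult_strict_left_mono) (auto simp: bad_def)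
      moreover have "(1 / (8 * sqrt n)) * (320 * real n * sqrt n) = 40 * real n" using n by simp
      ultimately show "S \<in> {S \<in> Pow P. 40 * real n < (\<Sum>p\<in>P. sgn_of S p * u p)}" using S by (simp add: bad_def)
    qed
    have "(\<Sum>p\<in>P. (u p)\<^sup>2) = (1 / (8 * sqrt n))\<^sup>2 * (\<Sum>p\<in>P. (real_of_int (k (fst p)))\<^sup>2 * (real_of_int (l (snd p)))\<^sup>2)"
      by (simp add: u_def power_mult_distrib sum_distrib_left power_divide)
    also have "(\<Sum>p\<in>P. (real_of_int (k (fst p)))\<^sup>2 * (real_of_int (l (snd p)))\<^sup>2)
        = real_of_int (\<Sum>i<n. (k i)\<^sup>2) * real_of_int (\<Sum>j<n. (l j)\<^sup>2)"
      unfolding P_def by (simp add: sum_product sum.cartesian_product case_prod_beta)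
    also have "\<dots> \<le> (25 * real n) * (25 * real n)"
    proof (intro mult_mono)
      have "(\<Sum>i<n. (k i)\<^sup>2) \<le> 25 * int n" "(\<Sum>i<n. (l i)\<^sup>2) \<le> 25 * int n" using k l by (simp_all add: net_def)
      then show "real_of_int (\<Sum>i<n. (k i)\<^sup>2) \<le> 25 * real n" "real_of_int (\<Sum>i<n. (l i)\<^sup>2) \<le> 25 * real n"
        by linarith+
    qed (auto intro: sum_nonneg)
    finally have "(\<Sum>p\<in>P. (u p)\<^sup>2) \<le> (1 / (8 * sqrt n))\<^sup>2 * ((25 * real n) * (25 * real n))"
      by (simp add: mult_left_mono)
    also have "\<dots> = (625/64) * real n" using n by (simp add: power_divide power_mult_distrib)
    finally have u2: "(\<Sum>p\<in>P. (u p)\<^sup>2) / 2 - 40 * real n \<le> - (35 * real n)" by simp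
    have "real (card (bad k l)) \<le> real (card {S \<in> Pow P. 40 * real n < (\<Sum>p\<in>P. sgn_of S p * u p)})"
      using card_mono[OF _ sub] P by simp
    also have "\<dots> \<le> 2 ^ card P * exp ((\<Sum>p\<in>P. (u p)\<^sup>2) / 2 - 40 * real n)"
      by (rule card_large_signs[OF P(1)])
    also have "\<dots> \<le> 2 ^ (n * n) * exp (- (35 * real n))"
      unfolding P(2) using u2 by (intro mult_left_mono) auto
    finally show ?thesis .
  qed
  define Bad where "Bad = (\<Union>kl\<in>net n \<times> net n. bad (fst kl) (snd kl))"
  have finbad: "finite (bad k l)" for k l using P by (simp add: bad_def)
  have "real (card Bad) \<le> real (\<Sum>kl\<in>net n \<times> net n. card (bad (fst kl) (snd kl)))"
    unfolding Bad_def by (intro of_nat_mono card_UN_le) (simp add: card_net)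
  also have "\<dots> = (\<Sum>kl\<in>net n \<times> net n. real (card (bad (fst kl) (snd kl))))" by simp
  also have "\<dots> \<le> (\<Sum>kl\<in>net n \<times> net n. 2 ^ (n * n) * exp (- (35 * real n)))"
    by (intro sum_mono cb) auto
  also have "\<dots> = (real (card (net n)) * real (card (net n))) * (2 ^ (n * n) * exp (- (35 * real n)))"
    by (simp add: card_cartesian_product)
  also have "\<dots> \<le> (128 ^ n * 128 ^ n) * (2 ^ (n * n) * exp (- (35 * real n)))"
    by (intro mult_right_mono mult_mono card_net) auto
  also have "\<dots> \<le> (128 ^ n * 128 ^ n) * (2 ^ (n * n) * (1 / 2 ^ (35 * n)))"
  proof (intro mult_left_mono)
    have "(2::real) ^ (35 * n) \<le> exp 1 ^ (35 * n)"
      using exp_ge_add_one_self[of 1] by (intro power_mono) auto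
    also have "\<dots> = exp (35 * real n)" by (simp flip: exp_of_nat_mult)
    finally show "exp (- (35 * real n)) \<le> 1 / 2 ^ (35 * n)"
      by (simp add: exp_minus field_simps)
  qed auto
  also have "\<dots> = 2 ^ (n * n) * (1 / 2 ^ (21 * n))"
  proof -
    have "(128::real) ^ n = 2 ^ (7 * n)" by (simp add: power_mult)
    moreover have "(2::real) ^ (35 * n) = 2 ^ (7 * n) * 2 ^ (7 * n) * 2 ^ (21 * n)" by (simp flip: power_add)
    ultimately show ?thesis by simp
  qed
  also have "\<dots> \<le> 2 ^ (n * n) * (1 / 2 ^ 1)"
    using n by (intro mult_left_mono divide_left_mono power_increasing) auto
  finally have bad: "real (card Bad) \<le> 2 ^ (n * n) / 2" by simp
  have "bounded_signs n = Pow P - Bad"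
    by (auto simp: bounded_signs_def Bad_def bad_def P_def not_less) (meson linorder_not_less)+
  moreover have "Bad \<subseteq> Pow P" by (auto simp: Bad_def bad_def)
  moreover have "finite Bad" using P by (auto simp: Bad_def finbad card_net)
  ultimately have "card (bounded_signs n) = card (Pow P) - card Bad" "card Bad \<le> card (Pow P)"
    using P by (simp_all add: card_Diff_subset card_mono)
  then have "real (card (bounded_signs n)) = 2 ^ (n * n) - real (card Bad)"
    using P by (simp add: card_Pow of_nat_diff)
  then show ?thesis using bad by simp
qed

lemma net_approx:
  assumes n: "n > 0" and x: "nr n x \<le> 1"
  shows "\<exists>k\<in>net n. nr n (\<lambda>i. x i - of_int (k i) / (4 * sqrt n)) \<le> 1/4 \<and> nr n (\<lambda>i. of_int (k i) / (4 * sqrt n)) \<le> 5/4"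
proof -
  define c where "c = 4 * sqrt n"
  have c: "c > 0" "c\<^sup>2 = 16 * real n" using n by (simp_all add: c_def power_mult_distrib)
  define k where "k = (\<lambda>i\<in>{..<n}. \<lfloor>c * x i\<rfloor>)"
  have ki: "of_int (k i) \<le> c * x i" "c * x i < of_int (k i) + 1" if "i < n" for i
    using that by (simp_all add: k_def)
  have e: "\<bar>x i - of_int (k i) / c\<bar> \<le> 1 / c" if "i < n" for i
  proof -
    have "x i - of_int (k i) / c = (c * x i - of_int (k i)) / c" using c by (simp add: field_simps)
    moreover have "\<bar>c * x i - of_int (k i)\<bar> \<le> 1" using ki[OF that] by linarith
    ultimately show ?thesis using c by (simp add: divide_right_mono)
  qed
  have "nr n (\<lambda>i. x i - of_int (k i) / c) = nr n (\<lambda>i. \<bar>x i - of_int (k i) / c\<bar>)" by (simp add: L2_set_def)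
  also have "\<dots> \<le> nr n (\<lambda>_. 1 / c)" using e by (intro L2_set_mono) auto
  also have "\<dots> = 1/4" using c n by (simp add: L2_set_constant c_def)
  finally have 1: "nr n (\<lambda>i. x i - of_int (k i) / c) \<le> 1/4" .
  have "nr n (\<lambda>i. of_int (k i) / c) = nr n (\<lambda>i. x i + - (x i - of_int (k i) / c))" by simp
  also have "\<dots> \<le> nr n x + nr n (\<lambda>i. - (x i - of_int (k i) / c))" by (rule L2_set_triangle_ineq)
  also have "nr n (\<lambda>i. - (x i - of_int (k i) / c)) = nr n (\<lambda>i. x i - of_int (k i) / c)" by (simp add: L2_set_def power2_commute)
  finally have 2: "nr n (\<lambda>i. of_int (k i) / c) \<le> 5/4" using 1 x by simp
  have "(\<Sum>i<n. (real_of_int (k i))\<^sup>2) = c\<^sup>2 * (nr n (\<lambda>i. of_int (k i) / c))\<^sup>2"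
    using c by (simp add: L2_set_def sum_nonneg power_divide sum_distrib_left)
  also have "\<dots> \<le> c\<^sup>2 * (5/4)\<^sup>2" by (intro mult_left_mono power_mono 2) auto
  also have "\<dots> = 25 * real n" unfolding c(2) by (simp add: power2_eq_square)
  finally have "real_of_int (\<Sum>i<n. (k i)\<^sup>2) \<le> real_of_int (25 * int n)" by simp
  then have sq: "(\<Sum>i<n. (k i)\<^sup>2) \<le> 25 * int n" by (simp only: of_int_le_iff)
  have "real (\<Sum>i<n. nat \<bar>k i\<bar>) = (\<Sum>i<n. \<bar>real_of_int (k i)\<bar>)" by simp
  also have "\<dots> \<le> (\<Sum>i<n. c * \<bar>x i\<bar> + 1)"
  proof (rule sum_mono)
    fix i assume "i \<in> {..<n}"
    then have "i < n" by simp
    have "\<bar>c * x i\<bar> = c * \<bar>x i\<bar>" using c by (simp add: abs_mult)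
    then show "\<bar>real_of_int (k i)\<bar> \<le> c * \<bar>x i\<bar> + 1" using ki[OF \<open>i < n\<close>] by linarith
  qed
  also have "\<dots> = c * (\<Sum>i<n. \<bar>x i\<bar>) + real n" by (simp add: sum.distrib sum_distrib_left)
  also have "\<dots> \<le> c * (sqrt n * 1) + real n"
    using c x by (intro add_right_mono mult_left_mono order_trans[OF sum_abs_le_nr]) auto
  also have "\<dots> = real (5 * n)" by (simp add: c_def)
  finally have "(\<Sum>i<n. nat \<bar>k i\<bar>) \<le> 5 * n" by (simp only: of_nat_le_iff)
  then have "k \<in> net n" using sq by (simp add: net_def lattice_pts_def k_def)
  then show ?thesis using 1 2 unfolding c_def by blast
qed

text \<open>The usual net argument. The crude bound by n makes the supremum T over unit vectors
  finite. Splitting x = y + e and w = z + f with y, z from the net gives T \<le> 20 \<surd>n + (5/16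
  + 1/4) T, where 20 is 320 divided by the 16 from the two denominators; hence T \<le> (320/7)
  \<surd>n < 50 \<surd>n.\<close>

lemma bounded_signs_bil:
  assumes n: "n > 0" and S: "S \<in> bounded_signs n"
  shows "bil n S x w \<le> 50 * sqrt n * (nr n x * nr n w)"
proof -
  define A where "A = {bil n S x w | x w. nr n x \<le> 1 \<and> nr n w \<le> 1}"
  define T where "T = Sup A"
  have bd: "bdd_above A"
  proof (rule bdd_aboveI[where M = "real n"])
    fix r assume "r \<in> A"
    then obtain x w where xw: "r = bil n S x w" "nr n x \<le> 1" "nr n w \<le> 1" by (auto simp: A_def)
    have "nr n x * nr n w \<le> 1 * 1" using xw by (intro mult_mono) auto
    then have "real n * (nr n x * nr n w) \<le> real n * 1" by (intro mult_left_mono) auto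
    then show "r \<le> real n" using bil_bounded[of n S x w] xw by simp
  qed
  have zero: "bil n S (\<lambda>_. 0) (\<lambda>_. 0) = 0" "nr n (\<lambda>_. 0) = 0" by (simp_all add: bil_def L2_set_def)
  have T0: "0 \<le> T"
    unfolding T_def using zero by (intro cSup_upper[OF _ bd]) (force simp: A_def)
  have hom: "bil n S x w \<le> T * (nr n x * nr n w)" for x w
  proof (cases "nr n x = 0 \<or> nr n w = 0")
    case True
    then have "bil n S x w \<le> 0" using bil_bounded[of n S x w] by auto
    then show ?thesis using T0 True by auto
  next
    case False
    then have pos: "nr n x > 0" "nr n w > 0" using L2_set_nonneg by (simp_all add: less_le)
    define x' where "x' i = (1 / nr n x) * x i" for i
    define w' where "w' i = (1 / nr n w) * w i" for i
    have "nr n x' = 1 / nr n x * nr n x" "nr n w' = 1 / nr n w * nr n w"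
      unfolding x'_def w'_def by (subst L2_set_right_distrib; simp)+
    then have "nr n x' \<le> 1" "nr n w' \<le> 1" using pos by auto
    then have "bil n S x' w' \<le> T" unfolding T_def by (intro cSup_upper[OF _ bd]) (auto simp: A_def)
    moreover have "bil n S x' w' = 1 / nr n x * (1 / nr n w * bil n S x w)"
      unfolding x'_def w'_def by (simp only: bil_scale)
    ultimately show ?thesis using pos by (simp add: field_simps)
  qed
  have "Sup A \<le> 20 * sqrt n + 9/16 * T"
  proof (rule cSup_least)
    have "bil n S (\<lambda>_. 0) (\<lambda>_. 0) \<in> A"
      unfolding A_def using zero by (intro CollectI exI[of _ "\<lambda>_. 0"]) simp
    then show "A \<noteq> {}" by blast
    fix r assume "r \<in> A"
    then obtain x w where xw: "r = bil n S x w" "nr n x \<le> 1" "nr n w \<le> 1" by (auto simp: A_def)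
    obtain k where k: "k \<in> net n" "nr n (\<lambda>i. x i - of_int (k i) / (4 * sqrt n)) \<le> 1/4"
      "nr n (\<lambda>i. of_int (k i) / (4 * sqrt n)) \<le> 5/4" using net_approx[OF n xw(2)] by blast
    obtain l where l: "l \<in> net n" "nr n (\<lambda>i. w i - of_int (l i) / (4 * sqrt n)) \<le> 1/4"
      "nr n (\<lambda>i. of_int (l i) / (4 * sqrt n)) \<le> 5/4" using net_approx[OF n xw(3)] by blast
    define y where "y i = of_int (k i) / (4 * sqrt n)" for i
    define z where "z i = of_int (l i) / (4 * sqrt n)" for i
    define e where "e i = x i - y i" for i
    define f where "f i = w i - z i" for i
    have x: "x = (\<lambda>i. y i + e i)" and w: "w = (\<lambda>i. z i + f i)" by (simp_all add: e_def f_def)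
    have "bil n S x w = bil n S y w + bil n S e w" by (subst x) (rule bil_add)
    also have "bil n S y w = bil n S y z + bil n S y f" by (subst w) (rule bil_add)
    finally have "bil n S x w = bil n S y z + bil n S y f + bil n S e w" .
    moreover have "bil n S y z \<le> 20 * sqrt n"
    proof -
      have "bil n S y z = bil n S (\<lambda>i. (1 / (4 * sqrt n)) * of_int (k i)) (\<lambda>i. (1 / (4 * sqrt n)) * of_int (l i))"
        by (simp add: y_def[abs_def] z_def[abs_def])
      also have "\<dots> = 1 / (4 * sqrt n) * (1 / (4 * sqrt n) * bil n S (\<lambda>i. of_int (k i)) (\<lambda>i. of_int (l i)))"
        by (simp only: bil_scale)
      also have "\<dots> \<le> 1 / (4 * sqrt n) * (1 / (4 * sqrt n) * (320 * real n * sqrt n))"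
        using S k(1) l(1) by (intro mult_left_mono) (auto simp: bounded_signs_def)
      also have "\<dots> = 20 * sqrt n" using n by (simp add: field_simps)
      finally show ?thesis .
    qed
    moreover have "bil n S y f \<le> T * (5/4 * (1/4))"
      using k(3) l(2) T0 unfolding y_def[symmetric] z_def[symmetric] f_def[symmetric]
      by (intro order_trans[OF hom] mult_left_mono mult_mono) auto
    moreover have "bil n S e w \<le> T * (1/4 * 1)"
      using k(2) xw(3) T0 unfolding y_def[symmetric] e_def[symmetric]
      by (intro order_trans[OF hom] mult_left_mono mult_mono) auto
    ultimately show "r \<le> 20 * sqrt n + 9/16 * T" using xw(1) by linarith
  qed
  then have "T \<le> 50 * sqrt n" unfolding T_def[symmetric] using real_sqrt_ge_zero[of "real n"] by linarith
  then have "T * (nr n x * nr n w) \<le> 50 * sqrt n * (nr n x * nr n w)"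
    by (intro mult_right_mono) auto
  then show ?thesis using hom[of x w] by linarith
qed

definition sign_mat :: "nat \<Rightarrow> (nat \<times> nat) set \<Rightarrow> complex mat" where
  "sign_mat n S = mat n n (\<lambda>p. complex_of_real (sgn_of S p / (50 * sqrt n)))"

lemma sign_mat_carrier [simp]: "sign_mat n S \<in> carrier_mat n n"
  by (simp add: sign_mat_def)

text \<open>Pair the image with itself: its squared norm is the bilinear form at the image and
  \<open>p\<close>, and one factor cancels.\<close>

lemma nr_sign_image:
  assumes n: "n > 0" and S: "S \<in> bounded_signs n"
  shows "nr n (\<lambda>i. \<Sum>j<n. sgn_of S (i, j) * p j) \<le> 50 * sqrt n * nr n p"
proof (cases "nr n (\<lambda>i. \<Sum>j<n. sgn_of S (i, j) * p j) = 0")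
  case False
  define a where "a i = (\<Sum>j<n. sgn_of S (i, j) * p j)" for i
  have pos: "nr n a > 0" using False L2_set_nonneg[of a "{..<n}"] by (simp add: a_def[abs_def] less_le)
  have "nr n a * nr n a = (\<Sum>i<n. a i * a i)" by (simp add: L2_set_def sum_nonneg power2_eq_square)
  also have "\<dots> = (\<Sum>i<n. \<Sum>j<n. sgn_of S (i, j) * (a i * p j))"
    by (subst (2) a_def) (simp only: sum_distrib_left mult_ac)
  also have "\<dots> = bil n S a p"
    by (simp add: bil_def sum.cartesian_product case_prod_beta)
  also have "\<dots> \<le> 50 * sqrt n * (nr n a * nr n p)" by (rule bounded_signs_bil[OF n S])
  finally have "nr n a * nr n a \<le> nr n a * (50 * sqrt n * nr n p)" by (simp only: mult_ac)
  then show ?thesis using pos by (simp add: a_def[abs_def])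
qed simp

lemma sum_real_scaled:
  "(\<Sum>j<n. complex_of_real (s j / c) * z j) = Complex ((\<Sum>j<n. s j * Re (z j)) / c) ((\<Sum>j<n. s j * Im (z j)) / c)"
  by (simp add: complex_eq_iff sum_divide_distrib)

text \<open>The matrix is real, so it acts separately on the real and the imaginary part of a
  vector, and the real estimate applies to each.\<close>

lemma sign_mat_norm:
  assumes n: "n > 0" and S: "S \<in> bounded_signs n"
  shows "mat_op_norm n (sign_mat n S) \<le> 1"
proof (rule mat_op_norm_le')
  fix v :: "complex vec" assume v: "v \<in> carrier_vec n"
  define c where "c = 50 * sqrt n"
  have c: "c > 0" using n by (simp add: c_def)
  define a where "a i = (\<Sum>j<n. sgn_of S (i, j) * Re (v $ j))" for i
  define b where "b i = (\<Sum>j<n. sgn_of S (i, j) * Im (v $ j))" for i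
  have ent: "(sign_mat n S *\<^sub>v v) $ i = Complex (a i / c) (b i / c)" if i: "i < n" for i
  proof -
    have "(sign_mat n S *\<^sub>v v) $ i = (\<Sum>j<n. sign_mat n S $$ (i, j) * v $ j)"
      by (rule mult_mat_vec_index[OF sign_mat_carrier v i])
    also have "\<dots> = (\<Sum>j<n. complex_of_real (sgn_of S (i, j) / c) * v $ j)"
      using i by (intro sum.cong refl) (simp add: sign_mat_def c_def)
    finally have e: "(sign_mat n S *\<^sub>v v) $ i = (\<Sum>j<n. complex_of_real (sgn_of S (i, j) / c) * v $ j)" .
    show ?thesis unfolding e a_def b_def by (rule sum_real_scaled)
  qed
  have vn: "(vec_norm2 v)\<^sup>2 = (nr n (\<lambda>j. Re (v $ j)))\<^sup>2 + (nr n (\<lambda>j. Im (v $ j)))\<^sup>2"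
    using v by (simp add: vec_norm2_L2 L2_set_def sum_nonneg cmod_power2 sum.distrib)
  have "(vec_norm2 (sign_mat n S *\<^sub>v v))\<^sup>2 = (\<Sum>i<n. (cmod ((sign_mat n S *\<^sub>v v) $ i))\<^sup>2)"
    using sign_mat_carrier[of n S] by (simp add: vec_norm2_L2 L2_set_def sum_nonneg sign_mat_def)
  also have "\<dots> = (\<Sum>i<n. (a i / c)\<^sup>2 + (b i / c)\<^sup>2)"
    using ent by (intro sum.cong refl) (simp add: cmod_power2)
  also have "\<dots> = ((nr n a)\<^sup>2 + (nr n b)\<^sup>2) / c\<^sup>2"
    by (simp add: L2_set_def sum_nonneg power_divide sum.distrib sum_divide_distrib add_divide_distrib)
  also have "\<dots> \<le> ((c * nr n (\<lambda>j. Re (v $ j)))\<^sup>2 + (c * nr n (\<lambda>j. Im (v $ j)))\<^sup>2) / c\<^sup>2"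
    using nr_sign_image[OF n S, of "\<lambda>j. Re (v $ j)"] nr_sign_image[OF n S, of "\<lambda>j. Im (v $ j)"]
    unfolding a_def[abs_def, symmetric] b_def[abs_def, symmetric] c_def[symmetric]
    by (intro divide_right_mono add_mono power_mono) auto
  also have "\<dots> = (vec_norm2 v)\<^sup>2"
    using c by (simp add: vn power_mult_distrib add_divide_distrib)
  finally show "vec_norm2 (sign_mat n S *\<^sub>v v) \<le> 1 * vec_norm2 v"
    using power2_le_imp_le[OF _ vec_norm2_nonneg] by simp
qed simp

text \<open>Each differing sign contributes (2 / (50 \<surd>n))^2 = 1 / (625 n) to the squared
  Hilbert-Schmidt distance, and normalizing divides by n once more.\<close>

lemma sign_mat_dist:
  assumes n: "n > 0" and S: "S \<subseteq> {..<n}\<times>{..<n}" "S' \<subseteq> {..<n}\<times>{..<n}"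
  shows "real (card (sym_diff S S')) = 625 * (real n * real n) * (mn2 n (sign_mat n S - sign_mat n S'))\<^sup>2"
proof -
  define P where "P = {..<n}\<times>{..<n}"
  have P: "finite P" by (simp add: P_def)
  have "(frob n (sign_mat n S - sign_mat n S'))\<^sup>2 = (\<Sum>p\<in>P. (cmod ((sign_mat n S - sign_mat n S') $$ p))\<^sup>2)"
    by (simp add: frob_def L2_set_def sum_nonneg P_def)
  also have "\<dots> = (\<Sum>p\<in>P. if p \<in> sym_diff S S' then 1 / (625 * real n) else 0)"
  proof (rule sum.cong[OF refl])
    fix p assume p: "p \<in> P"
    then have pn: "fst p < n" "snd p < n" by (auto simp: P_def)
    have "(sign_mat n S - sign_mat n S') $$ p = complex_of_real ((sgn_of S p - sgn_of S' p) / (50 * sqrt n))"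
      using pn by (cases p) (simp add: sign_mat_def diff_divide_distrib)
    then have "cmod ((sign_mat n S - sign_mat n S') $$ p) = \<bar>(sgn_of S p - sgn_of S' p) / (50 * sqrt n)\<bar>"
      by (simp only: norm_of_real)
    then have "(cmod ((sign_mat n S - sign_mat n S') $$ p))\<^sup>2 = (sgn_of S p - sgn_of S' p)\<^sup>2 / (2500 * real n)"
      by (simp add: power_divide power_mult_distrib)
    also have "\<dots> = (if p \<in> sym_diff S S' then 1 / (625 * real n) else 0)" by auto
    finally show "(cmod ((sign_mat n S - sign_mat n S') $$ p))\<^sup>2 = (if p \<in> sym_diff S S' then 1 / (625 * real n) else 0)" .
  qed
  also have "\<dots> = (\<Sum>p\<in>sym_diff S S'. 1 / (625 * real n))"
  proof -
    have "P \<inter> sym_diff S S' = sym_diff S S'" using S by (auto simp: P_def)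
    then show ?thesis using sum.inter_restrict[OF P, of "\<lambda>_. 1 / (625 * real n)" "sym_diff S S'"] by (simp only:)
  qed
  finally have "(frob n (sign_mat n S - sign_mat n S'))\<^sup>2 = real (card (sym_diff S S')) / (625 * real n)" by simp
  then show ?thesis using n by (simp add: mn2_def power_divide)
qed

text \<open>Rounds the entries of a unitary to a grid of width \<open>1 / (600 \<surd>n)\<close>; the \<open>\<ell>\<^sup>1\<close> bound on the
  rounded unitaries leaves only \<open>2\<^bsup>O(n\<^sup>2)\<^esup>\<close> cells.\<close>

definition cell :: "nat \<Rightarrow> complex mat \<Rightarrow> (nat \<times> nat) \<times> bool \<Rightarrow> int" where
  "cell n V = (\<lambda>d\<in>({..<n}\<times>{..<n})\<times>UNIV.
     \<lfloor>600 * sqrt n * (if snd d then Re (V $$ fst d) else Im (V $$ fst d))\<rfloor>)"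

definition cells :: "nat \<Rightarrow> ((nat \<times> nat) \<times> bool \<Rightarrow> int) set" where
  "cells n = lattice_pts (({..<n}\<times>{..<n})\<times>UNIV) (1202 * (n * n))"

lemma finite_cells: "finite (cells n)"
  unfolding cells_def by (rule finite_lattice_pts) simp

text \<open>The exponent 1206 consists of 1202 from the l1 radius and of 4 from the 2 n^2
  coordinates, each counted with a factor 3 \<le> 4.\<close>

lemma card_cells: "real (card (cells n)) \<le> 2 ^ (1206 * (n * n))"
proof -
  have "real (card (cells n)) \<le> 2 ^ (1202 * (n * n)) * 3 ^ (2 * (n * n))"
    using card_lattice_pts[of "({..<n}\<times>{..<n})\<times>(UNIV::bool set)" "1202 * (n * n)"]
    by (simp add: cells_def card_cartesian_product mult.commute)
  also have "\<dots> \<le> 2 ^ (1202 * (n * n)) * 4 ^ (2 * (n * n))" by (intro mult_left_mono power_mono) auto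
  also have "(4::real) ^ (2 * (n * n)) = 2 ^ (4 * (n * n))" by (simp add: power_mult)
  also have "(2::real) ^ (1202 * (n * n)) * 2 ^ (4 * (n * n)) = 2 ^ (1206 * (n * n))" by (simp flip: power_add)
  finally show ?thesis .
qed

text \<open>A unitary has Hilbert-Schmidt norm at most \<surd>n, so by Cauchy-Schwarz the absolute
  values of its entries sum to at most n \<surd>n. Scaling by 600 \<surd>n and counting real and
  imaginary parts gives 1200 n^2; rounding adds at most 1 for each of the 2 n^2 coordinates.\<close>

lemma cell_in_cells:
  assumes n: "n > 0" and V: "V \<in> unitaries n"
  shows "cell n V \<in> cells n"
proof -
  have Vc: "V \<in> carrier_mat n n" using V by (rule unitaries_carrier)
  define c where "c = 600 * sqrt n"
  have c: "c > 0" using n by (simp add: c_def)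
  define D where "D = ({..<n}\<times>{..<n})\<times>(UNIV::bool set)"
  have "mn2 n V \<le> 1" using mn2_le_op_norm[OF Vc] unitaries_norm[OF V] by linarith
  then have fr: "frob n V \<le> sqrt n" using n by (simp add: mn2_def)
  have sumV: "(\<Sum>p\<in>{..<n}\<times>{..<n}. cmod (V $$ p)) \<le> real n * sqrt n"
  proof -
    have "(\<Sum>p\<in>{..<n}\<times>{..<n}. cmod (V $$ p)) \<le> L2_set (\<lambda>_. 1) ({..<n}\<times>{..<n}) * frob n V"
      using L2_set_mult_ineq[of "\<lambda>_. 1" "\<lambda>p. cmod (V $$ p)" "{..<n}\<times>{..<n}"] by (simp add: frob_def)
    also have "L2_set (\<lambda>_. 1) ({..<n}\<times>{..<n}) = real n" by (simp add: L2_set_constant)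
    finally show ?thesis using fr mult_left_mono[of "frob n V" "sqrt n" "real n"] by simp
  qed
  have fl: "real (nat \<bar>\<lfloor>c * y\<rfloor>\<bar>) \<le> c * a + 1" if "\<bar>y\<bar> \<le> a" for y a
  proof -
    have "\<bar>c * y\<bar> \<le> c * a" using c that by (simp add: abs_mult)
    then have "\<bar>real_of_int \<lfloor>c * y\<rfloor>\<bar> \<le> c * a + 1" by linarith
    then show ?thesis by simp
  qed
  have "real (\<Sum>d\<in>D. nat \<bar>cell n V d\<bar>) = (\<Sum>d\<in>D. real (nat \<bar>cell n V d\<bar>))" by simp
  also have "\<dots> \<le> (\<Sum>d\<in>D. c * cmod (V $$ fst d) + 1)"
  proof (rule sum_mono)
    fix d assume d: "d \<in> D"
    have "\<bar>if snd d then Re (V $$ fst d) else Im (V $$ fst d)\<bar> \<le> cmod (V $$ fst d)"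
      by (simp add: abs_Re_le_cmod abs_Im_le_cmod)
    from fl[OF this] show "real (nat \<bar>cell n V d\<bar>) \<le> c * cmod (V $$ fst d) + 1"
      using d by (simp add: cell_def D_def c_def)
  qed
  also have "\<dots> = (\<Sum>p\<in>{..<n}\<times>{..<n}. \<Sum>b\<in>(UNIV::bool set). c * cmod (V $$ p) + 1)"
    unfolding D_def by (subst sum.cartesian_product) (simp add: case_prod_beta)
  also have "\<dots> = 2 * (c * (\<Sum>p\<in>{..<n}\<times>{..<n}. cmod (V $$ p)) + real (n * n))"
    by (simp add: sum.distrib sum_distrib_left UNIV_bool)
  also have "\<dots> \<le> 2 * (c * (real n * sqrt n) + real (n * n))"
    using c sumV by (intro mult_left_mono add_right_mono) auto
  also have "c * (real n * sqrt n) = 600 * (real n * (sqrt n * sqrt n))" by (simp add: c_def)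
  also have "2 * (\<dots> + real (n * n)) = real (1202 * (n * n))" by simp
  finally have "(\<Sum>d\<in>D. nat \<bar>cell n V d\<bar>) \<le> 1202 * (n * n)" by (simp only: of_nat_le_iff)
  then show ?thesis by (simp add: cells_def lattice_pts_def D_def cell_def)
qed

text \<open>Each entry differs by at most \<surd>2 / (600 \<surd>n), so the squared 2-norm distance
  is at most 1/180000, less than 1/400^2.\<close>

lemma cell_dist:
  assumes n: "n > 0" and V: "V \<in> carrier_mat n n" and W: "W \<in> carrier_mat n n" and eq: "cell n V = cell n W"
  shows "mn2 n (V - W) \<le> 1/400"
proof -
  define c where "c = 600 * sqrt n"
  have c: "c > 0" "c\<^sup>2 = 360000 * real n" using n by (simp_all add: c_def power_mult_distrib)
  have near: "\<bar>x - y\<bar> \<le> 1 / c" if "\<lfloor>c * x\<rfloor> = \<lfloor>c * y\<rfloor>" for x y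
  proof -
    have "\<bar>c * x - c * y\<bar> \<le> 1" using that by linarith
    then have "c * \<bar>x - y\<bar> \<le> 1" using c by (simp add: abs_mult flip: right_diff_distrib)
    then show ?thesis using c by (simp add: field_simps)
  qed
  have sq: "(cmod ((V - W) $$ (i, j)))\<^sup>2 \<le> 2 / c\<^sup>2" if ij: "i < n" "j < n" for i j
  proof -
    have "\<lfloor>c * Re (V $$ (i, j))\<rfloor> = \<lfloor>c * Re (W $$ (i, j))\<rfloor>"
      using fun_cong[OF eq, of "((i, j), True)"] ij by (simp add: cell_def c_def)
    then have re: "\<bar>Re (V $$ (i, j)) - Re (W $$ (i, j))\<bar> \<le> 1 / c" by (rule near)
    have "\<lfloor>c * Im (V $$ (i, j))\<rfloor> = \<lfloor>c * Im (W $$ (i, j))\<rfloor>"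
      using fun_cong[OF eq, of "((i, j), False)"] ij by (simp add: cell_def c_def)
    then have im: "\<bar>Im (V $$ (i, j)) - Im (W $$ (i, j))\<bar> \<le> 1 / c" by (rule near)
    have s: "a\<^sup>2 \<le> 1 / c\<^sup>2" if "\<bar>a\<bar> \<le> 1 / c" for a
      using power_mono[OF that, of 2] by (simp add: power_divide)
    have "(cmod ((V - W) $$ (i, j)))\<^sup>2 = (Re (V $$ (i, j)) - Re (W $$ (i, j)))\<^sup>2 + (Im (V $$ (i, j)) - Im (W $$ (i, j)))\<^sup>2"
      using V W ij by (simp add: cmod_power2)
    also have "\<dots> \<le> 1 / c\<^sup>2 + 1 / c\<^sup>2" by (intro add_mono s re im)
    finally show ?thesis by simp
  qed
  have "(frob n (V - W))\<^sup>2 \<le> (\<Sum>i<n. \<Sum>j<n. 2 / c\<^sup>2)"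
    unfolding frob_square by (intro sum_mono sq) auto
  also have "\<dots> = real n * (1 / 180000)" using n by (simp add: c)
  also have "\<dots> \<le> real n * (1/400)\<^sup>2" by (intro mult_left_mono) (simp_all add: power2_eq_square)
  finally have "(frob n (V - W))\<^sup>2 \<le> real n * (1/400)\<^sup>2" .
  then have "(mn2 n (V - W))\<^sup>2 \<le> (1/400)\<^sup>2"
    using n by (simp add: mn2_def power_divide field_simps)
  then show ?thesis by (rule power2_le_imp_le) simp
qed

lemma conj_by_dist:
  assumes V: "V \<in> unitaries n" and W: "W \<in> unitaries n" and A: "A \<in> carrier_mat n n" "mat_op_norm n A \<le> 1"
  shows "mn2 n (conj_by V A - conj_by W A) \<le> 2 * mn2 n (V - W)"
proof -
  have Vc: "V \<in> carrier_mat n n" and Wc: "W \<in> carrier_mat n n" using V W by (auto simp: unitaries_carrier)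
  have nV: "mat_op_norm n V \<le> 1" and nW: "mat_op_norm n W \<le> 1" using V W by (auto simp: unitaries_norm)
  have e1: "conj_by V A - W * A * mat_adjoint V = (V - W) * (A * mat_adjoint V)"
    using Vc Wc A by (simp add: conj_by_def sq_assoc[where n=n] minus_mult_distrib_mat[where nr=n and n=n and nc=n])
  have e2: "W * A * mat_adjoint V - conj_by W A = (W * A) * mat_adjoint (V - W)"
    using Vc Wc A by (simp add: conj_by_def mult_minus_distrib_mat[where nr=n and n=n and nc=n] mat_adjoint_minus[where n=n and m=n])
  have p1: "mat_op_norm n (A * mat_adjoint V) \<le> 1"
    using mat_op_norm_mult[of A n "mat_adjoint V"] mult_mono[OF A(2) nV] A Vc by (simp add: mat_op_norm_adjoint)
  have p2: "mat_op_norm n (W * A) \<le> 1"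
    using mat_op_norm_mult[of W n A] mult_mono[OF nW A(2)] A Wc by simp
  have "mn2 n (conj_by V A - conj_by W A) \<le> mn2 n (conj_by V A - W * A * mat_adjoint V) + mn2 n (W * A * mat_adjoint V - conj_by W A)"
    by (rule mn2_triangle_minus) (use V W Vc Wc A in simp_all)
  also have "mn2 n (conj_by V A - W * A * mat_adjoint V) \<le> mn2 n (V - W)"
    unfolding e1 using mn2_mult_le'[of "V - W" n "A * mat_adjoint V"] p1 Vc Wc A
      mult_left_mono[OF p1, of "mn2 n (V - W)"] by simp
  also have "mn2 n (W * A * mat_adjoint V - conj_by W A) \<le> mn2 n (V - W)"
    unfolding e2 using mn2_mult_le[of "W * A" n "mat_adjoint (V - W)"] p2 Vc Wc A
      mult_right_mono[OF p2, of "mn2 n (V - W)"] mn2_adjoint[of "V - W" n] by simp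
  finally show ?thesis by simp
qed

section \<open>Tuples of sign matrices near one unitary orbit\<close>

definition packed :: "nat \<Rightarrow> nat \<Rightarrow> (nat \<Rightarrow> (nat \<times> nat) set) set" where
  "packed n m = (\<Pi>\<^sub>E i\<in>{..<m}. bounded_signs n)"

lemma finite_packed: "finite (packed n m)"
  unfolding packed_def by (intro finite_PiE finite_bounded_signs) auto

lemma card_packed: "n > 0 \<Longrightarrow> (2 ^ (n * n) / 2) ^ m \<le> real (card (packed n m))"
  using power_mono[OF card_bounded_signs, of n m] by (simp add: packed_def card_PiE)

text \<open>Sort the tuples by the cell of a unitary that brings \<open>S0\<close> near them.
  Unitaries of one cell almost agree, so all tuples sorted into one cell lie in a product of Hamming
  balls centered at any one of these tuples.\<close>

lemma card_near_orbit:
  assumes n: "n > 0" and S0: "S0 \<in> packed n m"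
  shows "real (card {S \<in> packed n m. \<exists>V\<in>unitaries n. \<forall>i<m. mn2 n (sign_mat n (S i) - conj_by V (sign_mat n (S0 i))) < 1/400})
    \<le> 2 ^ (1206 * (n * n)) * (sqrt 2 ^ (n * n)) ^ m"
proof -
  define Fib where "Fib \<kappa> = {S \<in> packed n m. \<exists>V\<in>unitaries n. cell n V = \<kappa> \<and>
      (\<forall>i<m. mn2 n (sign_mat n (S i) - conj_by V (sign_mat n (S0 i))) < 1/400)}" for \<kappa>
  have fin: "finite (Fib \<kappa>)" for \<kappa> using finite_packed[of n m] by (simp add: Fib_def)
  have S0i: "S0 i \<in> bounded_signs n" if "i < m" for i using S0 that by (auto simp: packed_def)
  have fib: "real (card (Fib \<kappa>)) \<le> (sqrt 2 ^ (n * n)) ^ m" for \<kappa>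
  proof (cases "Fib \<kappa> = {}")
    case False
    then obtain S1 W where S1: "S1 \<in> packed n m" and W: "W \<in> unitaries n" "cell n W = \<kappa>"
      "\<And>i. i < m \<Longrightarrow> mn2 n (sign_mat n (S1 i) - conj_by W (sign_mat n (S0 i))) < 1/400" by (auto simp: Fib_def)
    define H where "H i = {S \<in> Pow ({..<n}\<times>{..<n}). 10 * card (sym_diff S (S1 i)) \<le> card ({..<n}\<times>{..<n})}" for i
    have S1i: "S1 i \<subseteq> {..<n}\<times>{..<n}" if "i < m" for i using S1 that by (auto simp: packed_def bounded_signs_def)
    have "Fib \<kappa> \<subseteq> (\<Pi>\<^sub>E i\<in>{..<m}. H i)"
    proof
      fix S assume "S \<in> Fib \<kappa>"
      then obtain V where S: "S \<in> packed n m" and V: "V \<in> unitaries n" "cell n V = \<kappa>"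
        "\<And>i. i < m \<Longrightarrow> mn2 n (sign_mat n (S i) - conj_by V (sign_mat n (S0 i))) < 1/400" by (auto simp: Fib_def)
      have "S i \<in> H i" if i: "i < m" for i
      proof -
        have Si: "S i \<subseteq> {..<n}\<times>{..<n}" using S i by (auto simp: packed_def bounded_signs_def)
        let ?A = "sign_mat n (S0 i)"
        have "mn2 n (sign_mat n (S i) - sign_mat n (S1 i)) \<le> mn2 n (sign_mat n (S i) - conj_by V ?A) + mn2 n (conj_by V ?A - sign_mat n (S1 i))"
          by (rule mn2_triangle_minus) (use V(1) in simp_all)
        also have "mn2 n (conj_by V ?A - sign_mat n (S1 i)) \<le> mn2 n (conj_by V ?A - conj_by W ?A) + mn2 n (conj_by W ?A - sign_mat n (S1 i))"
          by (rule mn2_triangle_minus) (use V(1) W(1) in simp_all)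
        also have "mn2 n (conj_by W ?A - sign_mat n (S1 i)) = mn2 n (sign_mat n (S1 i) - conj_by W ?A)"
          by (rule mn2_minus_commute) (use W(1) in simp_all)
        also have "mn2 n (conj_by V ?A - conj_by W ?A) \<le> 2 * mn2 n (V - W)"
          by (rule conj_by_dist[OF V(1) W(1) sign_mat_carrier sign_mat_norm[OF n S0i[OF i]]])
        also have "mn2 n (V - W) \<le> 1/400"
          by (rule cell_dist[OF n unitaries_carrier[OF V(1)] unitaries_carrier[OF W(1)]]) (simp add: V W)
        \<comment> \<open>1/400 comes from each of the two tuples and 2/400 from the change of
          unitary. By \<open>sign_mat_dist\<close> at most 625 n^2 / 10000 = n^2 / 16 signs differ,
          which is within the radius n^2 / 10 of \<open>card_hamming_ball\<close>.\<close>
        finally have "mn2 n (sign_mat n (S i) - sign_mat n (S1 i)) \<le> 1/100" using V(3)[OF i] W(3)[OF i] by simp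
        then have "(mn2 n (sign_mat n (S i) - sign_mat n (S1 i)))\<^sup>2 \<le> (1/100)\<^sup>2" by (intro power_mono) auto
        then have "625 * (real n * real n) * (mn2 n (sign_mat n (S i) - sign_mat n (S1 i)))\<^sup>2 \<le> 625 * (real n * real n) * (1/100)\<^sup>2"
          by (intro mult_left_mono) auto
        also have "\<dots> \<le> real (n * n) / 10" by (simp add: power2_eq_square)
        finally have "real (card (sym_diff (S i) (S1 i))) \<le> real (n * n) / 10"
          unfolding sign_mat_dist[OF n Si S1i[OF i]] .
        then have "10 * card (sym_diff (S i) (S1 i)) \<le> n * n" by linarith
        then show ?thesis using Si by (simp add: H_def)
      qed
      then show "S \<in> (\<Pi>\<^sub>E i\<in>{..<m}. H i)" using S by (auto simp: packed_def PiE_def)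
    qed
    moreover have "finite (\<Pi>\<^sub>E i\<in>{..<m}. H i)" by (intro finite_PiE) (auto simp: H_def)
    ultimately have "real (card (Fib \<kappa>)) \<le> real (card (\<Pi>\<^sub>E i\<in>{..<m}. H i))" by (intro of_nat_mono card_mono)
    also have "\<dots> = (\<Prod>i<m. real (card (H i)))" by (simp add: card_PiE)
    also have "\<dots> \<le> (\<Prod>i<m. sqrt 2 ^ (n * n))"
    proof (intro prod_mono conjI)
      fix i assume "i \<in> {..<m}"
      then show "real (card (H i)) \<le> sqrt 2 ^ (n * n)"
        using card_hamming_ball[of "{..<n}\<times>{..<n}" "S1 i"] S1i[of i] by (simp add: H_def)
    qed simp
    finally show ?thesis by simp
  qed simp
  have "{S \<in> packed n m. \<exists>V\<in>unitaries n. \<forall>i<m. mn2 n (sign_mat n (S i) - conj_by V (sign_mat n (S0 i))) < 1/400} \<subseteq> (\<Union>\<kappa>\<in>cells n. Fib \<kappa>)"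
    using cell_in_cells[OF n] by (auto simp: Fib_def)
  then have "card {S \<in> packed n m. \<exists>V\<in>unitaries n. \<forall>i<m. mn2 n (sign_mat n (S i) - conj_by V (sign_mat n (S0 i))) < 1/400}
      \<le> card (\<Union>\<kappa>\<in>cells n. Fib \<kappa>)" by (rule card_mono[rotated]) (simp add: finite_cells fin)
  also have "\<dots> \<le> (\<Sum>\<kappa>\<in>cells n. card (Fib \<kappa>))" by (rule card_UN_le[OF finite_cells])
  finally have "real (card {S \<in> packed n m. \<exists>V\<in>unitaries n. \<forall>i<m. mn2 n (sign_mat n (S i) - conj_by V (sign_mat n (S0 i))) < 1/400})
      \<le> real (\<Sum>\<kappa>\<in>cells n. card (Fib \<kappa>))" by (rule of_nat_mono)
  also have "\<dots> \<le> (\<Sum>\<kappa>\<in>cells n. (sqrt 2 ^ (n * n)) ^ m)" unfolding of_nat_sum by (intro sum_mono fib)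
  also have "\<dots> = real (card (cells n)) * (sqrt 2 ^ (n * n)) ^ m" by simp
  also have "\<dots> \<le> 2 ^ (1206 * (n * n)) * (sqrt 2 ^ (n * n)) ^ m" by (intro mult_right_mono card_cells) auto
  finally show ?thesis .
qed

section \<open>Approximate types of matrix tuples\<close>

definition coord_box :: "nat \<Rightarrow> real \<Rightarrow> (nat \<Rightarrow> real) set" where
  "coord_box l B = {x. (\<forall>i<l. \<bar>x i\<bar> \<le> B) \<and> (\<forall>i\<ge>l. x i = 0)}"

lemma compact_box: "compact (coord_box l B)"
proof -
  have eq: "coord_box l B = (\<Pi>\<^sub>E i\<in>UNIV. if i < l then {-B..B} else {0})"
  proof (rule Set.set_eqI)
    fix x :: "nat \<Rightarrow> real"
    have "x i \<in> (if i < l then {-B..B} else {0}) \<longleftrightarrow> (i < l \<longrightarrow> \<bar>x i\<bar> \<le> B) \<and> (l \<le> i \<longrightarrow> x i = 0)" for i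
      by (cases "i < l") (simp_all add: abs_le_iff minus_le_iff conj_commute)
    then show "x \<in> coord_box l B \<longleftrightarrow> x \<in> (\<Pi>\<^sub>E i\<in>UNIV. if i < l then {-B..B} else {0})"
      unfolding coord_box_def PiE_iff by (simp only: mem_Collect_eq extensional_UNIV UNIV_I) blast
  qed
  have "compactin (product_topology (\<lambda>i. euclideanreal) UNIV) (\<Pi>\<^sub>E i\<in>UNIV. if i < l then {-B..B} else {0})"
    unfolding compactin_PiE by (intro disjI2 ballI) (simp add: compactin_euclidean_iff)
  then show ?thesis unfolding eq euclidean_product_topology compactin_euclidean_iff .
qed

lemma continuous_on_box:
  assumes "continuous_map (Euclidean_space l) euclideanreal f"
  shows "continuous_on (coord_box l B) f"
proof -
  have "continuous_map (top_of_set {x. \<forall>i\<ge>l. x i = 0}) euclideanreal f"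
    using assms by (simp add: Euclidean_space_def euclidean_product_topology)
  then have "continuous_on {x. \<forall>i\<ge>l. x i = 0} f" by (simp add: continuous_map_iff_continuous2)
  then show ?thesis by (rule continuous_on_subset) (auto simp: coord_box_def)
qed

text \<open>The metric on sequences is a series with weights 2^(-n) of total mass 2. Uniform
  continuity on a box refers to this metric, whereas formulas provide closeness in each
  coordinate.\<close>

lemma dist_fun_le:
  fixes x y :: "nat \<Rightarrow> real"
  assumes "\<And>i. \<bar>x i - y i\<bar> \<le> d"
  shows "dist x y \<le> 2 * d"
proof -
  have s: "summable (\<lambda>n. (1/2)^n * min (dist (x (from_nat n)) (y (from_nat n))) (1::real))"
    by (rule summable_comparison_test'[of "\<lambda>n. (1/2)^n"]) (auto simp: summable_geometric_iff)
  have g: "summable (\<lambda>n. (1/2::real)^n * d)" by (intro summable_mult2) (simp add: summable_geometric_iff)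
  have "dist x y \<le> suminf (\<lambda>n. (1/2)^n * d)"
    unfolding dist_fun_def
  proof (rule suminf_le[OF _ s g])
    fix n
    have "min (dist (x (from_nat n)) (y (from_nat n))) 1 \<le> d"
      using assms[of "from_nat n"] by (simp add: dist_real_def min.coboundedI1)
    then show "(1/2)^n * min (dist (x (from_nat n)) (y (from_nat n))) 1 \<le> (1/2)^n * d" by (intro mult_left_mono) auto
  qed
  also have "\<dots> = suminf (\<lambda>n. (1/2)^n) * d" by (rule suminf_mult2[symmetric]) (simp add: summable_geometric_iff)
  also have "suminf (\<lambda>n. (1/2::real)^n) = 2" by (simp add: suminf_geometric)
  finally show ?thesis .
qed

lemma connective_bounded:
  assumes "continuous_map (Euclidean_space l) euclideanreal f"
  shows "\<exists>C. \<forall>x\<in>coord_box l B. \<bar>f x\<bar> \<le> C"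
proof -
  have "bounded (f ` coord_box l B)"
    by (rule compact_imp_bounded[OF compact_continuous_image[OF continuous_on_box[OF assms] compact_box]])
  then show ?thesis by (auto simp: bounded_iff)
qed

lemma connective_uniform:
  assumes f: "continuous_map (Euclidean_space l) euclideanreal f" and e: "e > 0"
  shows "\<exists>d>0. \<forall>x\<in>coord_box l B. \<forall>y\<in>coord_box l B. (\<forall>i<l. \<bar>x i - y i\<bar> \<le> d) \<longrightarrow> \<bar>f x - f y\<bar> \<le> e"
proof -
  have "uniformly_continuous_on (coord_box l B) f"
    by (rule compact_uniformly_continuous[OF continuous_on_box[OF f] compact_box])
  then obtain d where d: "d > 0" "\<And>x y. x \<in> coord_box l B \<Longrightarrow> y \<in> coord_box l B \<Longrightarrow> dist y x < d \<Longrightarrow> dist (f y) (f x) < e"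
    using e unfolding uniformly_continuous_on_def by metis
  have "\<bar>f x - f y\<bar> \<le> e" if x: "x \<in> coord_box l B" and y: "y \<in> coord_box l B" and n: "\<forall>i<l. \<bar>x i - y i\<bar> \<le> d / 4" for x y
  proof -
    have "\<bar>x i - y i\<bar> \<le> d / 4" for i
      using n x y d(1) by (cases "i < l") (auto simp: coord_box_def)
    then have "dist x y \<le> 2 * (d / 4)" by (rule dist_fun_le)
    then show ?thesis using d(2)[OF y x] d(1) by (simp add: dist_real_def)
  qed
  then show ?thesis using d(1) by (intro exI[of _ "d / 4"]) auto
qed

lemma abs_INF_le:
  fixes F :: "'a \<Rightarrow> real"
  assumes "A \<noteq> {}" "\<And>a. a \<in> A \<Longrightarrow> \<bar>F a\<bar> \<le> B"
  shows "\<bar>INF a\<in>A. F a\<bar> \<le> B" "\<bar>SUP a\<in>A. F a\<bar> \<le> B"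
proof -
  have le: "F a \<le> B" "- B \<le> F a" if "a \<in> A" for a using assms(2)[OF that] by (auto simp: abs_le_iff)
  obtain a where a: "a \<in> A" using assms(1) by blast
  have bd: "bdd_below (F ` A)" "bdd_above (F ` A)"
    using le by (auto intro!: bdd_belowI[where m = "- B"] bdd_aboveI[where M = B])
  have "(INF a\<in>A. F a) \<le> B" using cINF_lower[OF bd(1) a] le[OF a] by linarith
  moreover have "- B \<le> (INF a\<in>A. F a)" using assms(1) le by (intro cINF_greatest) auto
  ultimately show "\<bar>INF a\<in>A. F a\<bar> \<le> B" by simp
  have "- B \<le> (SUP a\<in>A. F a)" using cSUP_upper[OF a bd(2)] le[OF a] by linarith
  moreover have "(SUP a\<in>A. F a) \<le> B" using assms(1) le by (intro cSUP_least) auto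
  ultimately show "\<bar>SUP a\<in>A. F a\<bar> \<le> B" by simp
qed

lemma INF_le_INF_plus:
  fixes F :: "'a \<Rightarrow> real"
  assumes "A \<noteq> {}" "bdd_below (G ` A')" "\<And>a. a \<in> A \<Longrightarrow> \<exists>b\<in>A'. G b \<le> F a + e"
  shows "(INF b\<in>A'. G b) \<le> (INF a\<in>A. F a) + e"
proof -
  have "(INF b\<in>A'. G b) - e \<le> (INF a\<in>A. F a)"
  proof (rule cINF_greatest[OF assms(1)])
    fix a assume "a \<in> A"
    then obtain b where "b \<in> A'" "G b \<le> F a + e" using assms(3) by blast
    then show "(INF b\<in>A'. G b) - e \<le> F a" using cINF_lower[OF assms(2), of b] by linarith
  qed
  then show ?thesis by simp
qed

lemma SUP_le_SUP_plus:
  fixes F :: "'a \<Rightarrow> real"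
  assumes "A \<noteq> {}" "bdd_above (G ` A')" "\<And>a. a \<in> A \<Longrightarrow> \<exists>b\<in>A'. F a \<le> G b + e"
  shows "(SUP a\<in>A. F a) \<le> (SUP b\<in>A'. G b) + e"
proof (rule cSUP_least[OF assms(1)])
  fix a assume "a \<in> A"
  then obtain b where "b \<in> A'" "F a \<le> G b + e" using assms(3) by blast
  then show "F a \<le> (SUP b\<in>A'. G b) + e" using cSUP_upper[OF _ assms(2), of b] by linarith
qed

section \<open>Formulas on tuples of contractions\<close>

definition unit_tuples :: "nat \<Rightarrow> (nat \<Rightarrow> complex mat) set" where
  "unit_tuples n = {X. \<forall>j. X j \<in> op_ball (mat_alg n) 1}"

lemma unit_tuplesD: "X \<in> unit_tuples n \<Longrightarrow> X j \<in> carrier_mat n n" "X \<in> unit_tuples n \<Longrightarrow> mat_op_norm n (X j) \<le> 1"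
  by (auto simp: unit_tuples_def op_ball_mat_alg)

lemma unit_tuples_upd: "X \<in> unit_tuples n \<Longrightarrow> a \<in> op_ball (mat_alg n) 1 \<Longrightarrow> X(j := a) \<in> unit_tuples n"
  by (simp add: unit_tuples_def)

lemma zero_op_ball: "0 \<le> r \<Longrightarrow> 0\<^sub>m n n \<in> op_ball (mat_alg n) r"
  by (simp add: op_ball_mat_alg)

lemma op_ball_ne: "0 \<le> r \<Longrightarrow> op_ball (mat_alg n) r \<noteq> {}"
  using zero_op_ball by blast

lemma op_ball_scaled:
  assumes "r > 0"
  shows "op_ball (mat_alg n) r = (\<lambda>a. complex_of_real r \<cdot>\<^sub>m a) ` op_ball (mat_alg n) 1"
proof (rule Set.set_eqI, rule iffI)
  fix a assume "a \<in> op_ball (mat_alg n) r"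
  then have a: "a \<in> carrier_mat n n" "mat_op_norm n a \<le> r" by (auto simp: op_ball_mat_alg)
  have "a = complex_of_real r \<cdot>\<^sub>m (complex_of_real (1 / r) \<cdot>\<^sub>m a)"
    using assms a by (intro eq_matI) auto
  moreover have "complex_of_real (1 / r) \<cdot>\<^sub>m a \<in> op_ball (mat_alg n) 1"
    using assms a by (simp add: op_ball_mat_alg mat_op_norm_smult norm_divide)
  ultimately show "a \<in> (\<lambda>a. complex_of_real r \<cdot>\<^sub>m a) ` op_ball (mat_alg n) 1" by blast
next
  fix a assume "a \<in> (\<lambda>a. complex_of_real r \<cdot>\<^sub>m a) ` op_ball (mat_alg n) 1"
  then show "a \<in> op_ball (mat_alg n) r"
    using assms by (auto simp: op_ball_mat_alg mat_op_norm_smult mult_left_le)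
qed

lemma scaled_upd: "(scaled c X)(j := complex_of_real r \<cdot>\<^sub>m a) = scaled (c(j := r)) (X(j := a))"
  by auto

lemma interp_Inf_scaled:
  assumes "r > 0"
  shows "interp (mat_alg n) (Inf_ball j r \<phi>) (scaled c X)
    = (INF a\<in>op_ball (mat_alg n) 1. interp (mat_alg n) \<phi> (scaled (c(j := r)) (X(j := a))))"
    "interp (mat_alg n) (Sup_ball j r \<phi>) (scaled c X)
    = (SUP a\<in>op_ball (mat_alg n) 1. interp (mat_alg n) \<phi> (scaled (c(j := r)) (X(j := a))))"
  unfolding interp.simps op_ball_scaled[OF assms] image_image scaled_upd by simp_all

lemma mtr_mword_le: "X \<in> unit_tuples n \<Longrightarrow> cmod (mtr n (mword n X w)) \<le> 1"
proof -
  assume X: "X \<in> unit_tuples n"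
  have c: "mword n X w \<in> carrier_mat n n" using unit_tuplesD(1)[OF X] by simp
  have "mat_op_norm n (mword n X w) \<le> wcoef (\<lambda>_. 1) w"
    by (rule mword_norm) (use unit_tuplesD[OF X] in auto)
  also have "wcoef (\<lambda>_. 1) w = 1" by (induction w) auto
  finally show ?thesis using mtr_le_mn2[OF c] mn2_le_op_norm[OF c] by linarith
qed

lemma tr_poly_scaled:
  assumes X: "X \<in> unit_tuples n"
  shows "tr (mat_alg n) (eval_poly (mat_alg n) (scaled c X) p)
    = (\<Sum>w\<in>Poly_Mapping.keys p. Poly_Mapping.lookup p w * (complex_of_real (wcoef c w) * mtr n (mword n X w)))"
proof -
  have Xc: "X i \<in> carrier_mat n n" for i using unit_tuplesD[OF X] by blast
  have "mtr n (mword n (scaled c X) w) = complex_of_real (wcoef c w) * mtr n (mword n X w)" for w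
    unfolding mword_scaled[OF Xc] by (rule mtr_smult) (simp add: Xc)
  then show ?thesis by (subst tr_eval_poly_mat) (use Xc in auto)
qed

text \<open>The bound must be uniform in \<open>n\<close>: it puts the arguments of a connective
  into one compact box and gives quantifiers bounded ranges. The scales \<open>c\<close> vary in the
  induction, since a quantifier over a ball of radius \<open>r\<close> replaces \<open>c j\<close>
  by \<open>r\<close>.\<close>

lemma interp_bounded:
  "well_formed \<phi> \<Longrightarrow> \<exists>B. \<forall>n. \<forall>X\<in>unit_tuples n. \<bar>interp (mat_alg n) \<phi> (scaled c X)\<bar> \<le> B"
proof (induction \<phi> arbitrary: c)
  case (Re_tr p)
  have "\<bar>interp (mat_alg n) (Re_tr p) (scaled c X)\<bar> \<le> (\<Sum>w\<in>Poly_Mapping.keys p. cmod (Poly_Mapping.lookup p w) * \<bar>wcoef c w\<bar>)"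
    if X: "X \<in> unit_tuples n" for n X
  proof -
    have "\<bar>interp (mat_alg n) (Re_tr p) (scaled c X)\<bar> \<le> cmod (tr (mat_alg n) (eval_poly (mat_alg n) (scaled c X) p))"
      unfolding interp.simps by (rule abs_Re_le_cmod)
    also have "\<dots> \<le> (\<Sum>w\<in>Poly_Mapping.keys p. cmod (Poly_Mapping.lookup p w) * \<bar>wcoef c w\<bar>)"
      unfolding tr_poly_scaled[OF X]
      by (intro sum_norm_le) (auto simp: norm_mult intro!: mult_left_mono mult_left_le mtr_mword_le[OF X])
    finally show ?thesis .
  qed
  then show ?case by blast
next
  case (Im_tr p)
  have "\<bar>interp (mat_alg n) (Im_tr p) (scaled c X)\<bar> \<le> (\<Sum>w\<in>Poly_Mapping.keys p. cmod (Poly_Mapping.lookup p w) * \<bar>wcoef c w\<bar>)"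
    if X: "X \<in> unit_tuples n" for n X
  proof -
    have "\<bar>interp (mat_alg n) (Im_tr p) (scaled c X)\<bar> \<le> cmod (tr (mat_alg n) (eval_poly (mat_alg n) (scaled c X) p))"
      unfolding interp.simps by (rule abs_Im_le_cmod)
    also have "\<dots> \<le> (\<Sum>w\<in>Poly_Mapping.keys p. cmod (Poly_Mapping.lookup p w) * \<bar>wcoef c w\<bar>)"
      unfolding tr_poly_scaled[OF X]
      by (intro sum_norm_le) (auto simp: norm_mult intro!: mult_left_mono mult_left_le mtr_mword_le[OF X])
    finally show ?thesis .
  qed
  then show ?case by blast
next
  case (Connective f \<phi>s)
  have "\<exists>B. \<forall>n. \<forall>X\<in>unit_tuples n. \<bar>interp (mat_alg n) \<phi> (scaled c X)\<bar> \<le> B" if "\<phi> \<in> set \<phi>s" for \<phi>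
    using Connective that by auto
  then obtain Bf where Bf: "\<And>\<phi> n X. \<phi> \<in> set \<phi>s \<Longrightarrow> X \<in> unit_tuples n \<Longrightarrow> \<bar>interp (mat_alg n) \<phi> (scaled c X)\<bar> \<le> Bf \<phi>" by metis
  define B where "B = Max (insert 0 (Bf ` set \<phi>s))"
  have B: "\<bar>interp (mat_alg n) \<phi> (scaled c X)\<bar> \<le> B" if "\<phi> \<in> set \<phi>s" "X \<in> unit_tuples n" for \<phi> n X
    using Bf[OF that] that(1) unfolding B_def by (intro order_trans[OF Bf[OF that]] Max_ge) auto
  obtain C where C: "\<And>x. x \<in> coord_box (length \<phi>s) B \<Longrightarrow> \<bar>f x\<bar> \<le> C"
    using connective_bounded[of "length \<phi>s" f B] Connective.prems by auto
  have "\<bar>interp (mat_alg n) (Connective f \<phi>s) (scaled c X)\<bar> \<le> C" if "X \<in> unit_tuples n" for n X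
    unfolding interp.simps by (rule C) (use B[OF _ that] in \<open>auto simp: coord_box_def\<close>)
  then show ?case by blast
next
  case (Inf_ball j r \<phi>)
  then have r: "r > 0" by simp
  obtain B where B: "\<And>n X. X \<in> unit_tuples n \<Longrightarrow> \<bar>interp (mat_alg n) \<phi> (scaled (c(j := r)) X)\<bar> \<le> B"
    using Inf_ball.IH[of "c(j := r)"] Inf_ball.prems by auto
  have "\<bar>interp (mat_alg n) (Inf_ball j r \<phi>) (scaled c X)\<bar> \<le> B" if "X \<in> unit_tuples n" for n X
    unfolding interp_Inf_scaled[OF r]
    by (rule abs_INF_le[OF op_ball_ne B[OF unit_tuples_upd[OF that]]]) simp_all
  then show ?case by blast
next
  case (Sup_ball j r \<phi>)
  then have r: "r > 0" by simp
  obtain B where B: "\<And>n X. X \<in> unit_tuples n \<Longrightarrow> \<bar>interp (mat_alg n) \<phi> (scaled (c(j := r)) X)\<bar> \<le> B"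
    using Sup_ball.IH[of "c(j := r)"] Sup_ball.prems by auto
  have "\<bar>interp (mat_alg n) (Sup_ball j r \<phi>) (scaled c X)\<bar> \<le> B" if "X \<in> unit_tuples n" for n X
    unfolding interp_Inf_scaled[OF r]
    by (rule abs_INF_le[OF op_ball_ne B[OF unit_tuples_upd[OF that]]]) simp_all
  then show ?case by blast
qed

section \<open>Codes of approximate types\<close>

definition words :: "nat \<Rightarrow> (nat \<times> bool) list set" where
  "words N = {w. set w \<subseteq> {..<N} \<times> UNIV \<and> length w \<le> N}"

lemma finite_words: "finite (words N)"
  unfolding words_def by (rule finite_lists_length_le) simp

lemma words_mono: "N' \<le> N \<Longrightarrow> words N' \<subseteq> words N"
  unfolding words_def by fastforce

lemma ex_words: "\<exists>N. w \<in> words N"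
proof -
  define N where "N = Suc (Max (insert 0 (letters w))) + length w"
  have "i < N" if "i \<in> letters w" for i
  proof -
    have "i \<le> Max (insert 0 (letters w))" using that by (intro Max_ge) auto
    then show ?thesis by (simp add: N_def)
  qed
  then have "w \<in> words N" by (force simp: words_def N_def)
  then show ?thesis ..
qed

text \<open>\<open>cl k N n X\<close> is a code for the approximate type of \<open>X\<close> of quantifier depth \<open>k\<close>: it records the
  moments of length at most \<open>N\<close> up to rounding, and the set of codes of depth \<open>k - 1\<close> reached by
  changing one of the first \<open>N\<close> entries. The number of possible codes does not depend on \<open>n\<close>.\<close>

definition leaf :: "nat \<Rightarrow> nat \<Rightarrow> (nat \<Rightarrow> complex mat) \<Rightarrow> ((nat \<times> bool) list \<times> nat \<times> int \<times> int) set" where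
  "leaf N n X = (\<lambda>(w, M). (w, M, \<lfloor>real M * Re (mtr n (mword n X w))\<rfloor>, \<lfloor>real M * Im (mtr n (mword n X w))\<rfloor>)) ` (words N \<times> {..N})"

primrec cl :: "nat \<Rightarrow> nat \<Rightarrow> nat \<Rightarrow> (nat \<Rightarrow> complex mat) \<Rightarrow> nat" where
  "cl 0 N n X = set_encode (to_nat ` leaf N n X)"
| "cl (Suc k) N n X = prod_encode (cl k N n X,
     set_encode ((\<lambda>(j, a). prod_encode (j, cl k N n (X(j := a)))) ` ({..<N} \<times> op_ball (mat_alg n) 1)))"

lemma set_encode_mono: "finite B \<Longrightarrow> A \<subseteq> B \<Longrightarrow> set_encode A \<le> set_encode B"
  unfolding set_encode_def by (rule sum_mono2) auto

lemma floor_mult_bound: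
  assumes "\<bar>x\<bar> \<le> 1" "M \<le> N"
  shows "\<lfloor>real M * x\<rfloor> \<in> {-int N..int N}"
proof -
  have "\<bar>real M * x\<bar> \<le> real N * 1" unfolding abs_mult using assms by (intro mult_mono) auto
  then have "- real N \<le> real M * x" "real M * x \<le> real N" by (auto simp: abs_le_iff)
  then show ?thesis by (simp add: le_floor_iff floor_le_iff)
qed

lemma leaf_subset:
  assumes "X \<in> unit_tuples n"
  shows "leaf N n X \<subseteq> words N \<times> {..N} \<times> {-int N..int N} \<times> {-int N..int N}"
proof
  fix y assume "y \<in> leaf N n X"
  then obtain w M where y: "w \<in> words N" "M \<le> N"
    "y = (w, M, \<lfloor>real M * Re (mtr n (mword n X w))\<rfloor>, \<lfloor>real M * Im (mtr n (mword n X w))\<rfloor>)"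
    by (auto simp: leaf_def)
  have "\<bar>Re (mtr n (mword n X w))\<bar> \<le> 1" "\<bar>Im (mtr n (mword n X w))\<bar> \<le> 1"
    using mtr_mword_le[OF assms, of w] abs_Re_le_cmod[of "mtr n (mword n X w)"] abs_Im_le_cmod[of "mtr n (mword n X w)"]
    by linarith+
  from floor_mult_bound[OF this(1) y(2)] floor_mult_bound[OF this(2) y(2)]
  show "y \<in> words N \<times> {..N} \<times> {-int N..int N} \<times> {-int N..int N}" using y by blast
qed

text \<open>A code of depth k + 1 is a pair of a bounded number and the encoding of a subset of a
  finite set, where both the bound and the finite set come from depth k and are the same for all
  \<open>n\<close>.\<close>

lemma cl_bound: "\<exists>B. \<forall>n. \<forall>X\<in>unit_tuples n. cl k N n X < B"
proof (induction k)
  case 0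
  define F where "F = to_nat ` (words N \<times> {..N} \<times> {-int N..int N} \<times> {-int N..int N})"
  have "finite F" by (simp add: F_def finite_words)
  have "cl 0 N n X < Suc (set_encode F)" if "X \<in> unit_tuples n" for n X
    unfolding cl.simps less_Suc_eq_le
    by (rule set_encode_mono[OF \<open>finite F\<close>]) (use leaf_subset[OF that] in \<open>unfold F_def, blast\<close>)
  then show ?case by blast
next
  case (Suc k)
  then obtain B where B: "\<And>n X. X \<in> unit_tuples n \<Longrightarrow> cl k N n X < B" by blast
  define F where "F = prod_encode ` ({..<N} \<times> {..<B})"
  have "finite F" by (simp add: F_def)
  define G where "G = prod_encode ` ({..<B} \<times> {..set_encode F})"
  have G: "finite G" by (simp add: G_def)
  have "cl (Suc k) N n X < Suc (Max G)" if X: "X \<in> unit_tuples n" for n X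
  proof -
    let ?S = "(\<lambda>(j, a). prod_encode (j, cl k N n (X(j := a)))) ` ({..<N} \<times> op_ball (mat_alg n) 1)"
    have "set_encode ?S \<le> set_encode F"
    proof (rule set_encode_mono[OF \<open>finite F\<close>], rule subsetI)
      fix y assume "y \<in> ?S"
      then obtain j a where "j < N" "a \<in> op_ball (mat_alg n) 1" "y = prod_encode (j, cl k N n (X(j := a)))" by auto
      then show "y \<in> F" using B[OF unit_tuples_upd[OF X]] by (simp add: F_def)
    qed
    then have "cl (Suc k) N n X \<in> G" using B[OF X] by (simp add: G_def)
    then show ?thesis using Max_ge[OF G] by (simp add: less_Suc_eq_le)
  qed
  then show ?case by blast
qed

text \<open>The ball is infinite, but by \<open>cl_bound\<close> only finitely many codes occur.
  Finiteness matters because \<open>set_encode\<close> is injective on finite sets only.\<close>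

lemma finite_cl_image:
  assumes X: "X \<in> unit_tuples n"
  shows "finite ((\<lambda>(j, a). prod_encode (j, cl k N n (X(j := a)))) ` ({..<N} \<times> op_ball (mat_alg n) 1))"
proof -
  obtain B where B: "\<And>n X. X \<in> unit_tuples n \<Longrightarrow> cl k N n X < B" using cl_bound by blast
  have "(\<lambda>(j, a). prod_encode (j, cl k N n (X(j := a)))) ` ({..<N} \<times> op_ball (mat_alg n) 1) \<subseteq> prod_encode ` ({..<N} \<times> {..<B})"
    using B[OF unit_tuples_upd[OF X]] by auto
  then show ?thesis by (rule finite_subset) simp
qed

text \<open>One round of the Ehrenfeucht-Fraisse game: a change of \<open>X\<close> at a recorded
  position is answered by a change of \<open>Y\<close> with the same code one level down.\<close>

lemma cl_Suc_eqD:
  assumes X: "X \<in> unit_tuples n" and Y: "Y \<in> unit_tuples n" and eq: "cl (Suc k) N n X = cl (Suc k) N n Y"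
    and j: "j < N" and a: "a \<in> op_ball (mat_alg n) 1"
  shows "\<exists>b\<in>op_ball (mat_alg n) 1. cl k N n (X(j := a)) = cl k N n (Y(j := b))"
proof -
  let ?F = "\<lambda>X. (\<lambda>(j, a). prod_encode (j, cl k N n (X(j := a)))) ` ({..<N} \<times> op_ball (mat_alg n) 1)"
  have "?F X = ?F Y"
    using eq set_encode_eq[OF finite_cl_image[OF X, of k N] finite_cl_image[OF Y, of k N]] by simp
  moreover have "prod_encode (j, cl k N n (X(j := a))) \<in> ?F X" using j a by force
  ultimately have "prod_encode (j, cl k N n (X(j := a))) \<in> ?F Y" by simp
  then obtain j' b where b: "b \<in> op_ball (mat_alg n) 1"
    and "prod_encode (j, cl k N n (X(j := a))) = prod_encode (j', cl k N n (Y(j' := b)))" by auto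
  then have "cl k N n (X(j := a)) = cl k N n (Y(j' := b))" "j = j'"
    unfolding prod_encode_eq prod.inject by blast+
  then show ?thesis using b by blast
qed

lemma cl_Suc_eqI:
  assumes X: "X \<in> unit_tuples n" and Y: "Y \<in> unit_tuples n" and "cl k N n X = cl k N n Y"
    and "\<And>j a. j < N \<Longrightarrow> a \<in> op_ball (mat_alg n) 1 \<Longrightarrow> \<exists>b\<in>op_ball (mat_alg n) 1. cl k N n (X(j := a)) = cl k N n (Y(j := b))"
    and "\<And>j b. j < N \<Longrightarrow> b \<in> op_ball (mat_alg n) 1 \<Longrightarrow> \<exists>a\<in>op_ball (mat_alg n) 1. cl k N n (Y(j := b)) = cl k N n (X(j := a))"
  shows "cl (Suc k) N n X = cl (Suc k) N n Y"
proof -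
  let ?F = "\<lambda>X. (\<lambda>(j, a). prod_encode (j, cl k N n (X(j := a)))) ` ({..<N} \<times> op_ball (mat_alg n) 1)"
  have sub: "?F X \<subseteq> ?F Y"
    if h: "\<And>j a. j < N \<Longrightarrow> a \<in> op_ball (mat_alg n) 1 \<Longrightarrow> \<exists>b\<in>op_ball (mat_alg n) 1. cl k N n (X(j := a)) = cl k N n (Y(j := b))" for X Y
  proof
    fix y assume "y \<in> ?F X"
    then obtain j a where "j < N" "a \<in> op_ball (mat_alg n) 1" and y: "y = prod_encode (j, cl k N n (X(j := a)))" by auto
    then obtain b where "b \<in> op_ball (mat_alg n) 1" "cl k N n (X(j := a)) = cl k N n (Y(j := b))" using h by blast
    then show "y \<in> ?F Y" using y \<open>j < N\<close> by force
  qed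
  have "?F X = ?F Y" using sub[of X Y] sub[of Y X] assms by blast
  then show ?thesis using assms(3) by (simp only: cl.simps)
qed

text \<open>This is the reason why \<open>leaf\<close> records the floors of M t for all M \<le> N:
  the floor of N t alone need not determine the floor of N' t.\<close>

lemma leaf_mono:
  assumes "leaf N n X = leaf N n Y" "N' \<le> N"
  shows "leaf N' n X = leaf N' n Y"
proof -
  have r: "leaf N' n X = {y \<in> leaf N n X. fst y \<in> words N' \<and> fst (snd y) \<le> N'}" for X
    using words_mono[OF assms(2)] assms(2) by (force simp: leaf_def)
  show ?thesis unfolding r assms(1) ..
qed

lemma leaf_eq_iff:
  assumes X: "X \<in> unit_tuples n" and Y: "Y \<in> unit_tuples n"
  shows "cl 0 N n X = cl 0 N n Y \<longleftrightarrow> leaf N n X = leaf N n Y"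
proof -
  have fin: "finite (leaf N n X)" if "X \<in> unit_tuples n" for X
    by (rule finite_subset[OF leaf_subset[OF that]]) (simp add: finite_words)
  have "cl 0 N n X = cl 0 N n Y \<longleftrightarrow> to_nat ` leaf N n X = to_nat ` leaf N n Y"
    unfolding cl.simps by (rule set_encode_eq) (simp_all add: fin X Y)
  also have "\<dots> \<longleftrightarrow> leaf N n X = leaf N n Y" by (rule inj_image_eq_iff[OF inj_to_nat])
  finally show ?thesis .
qed

text \<open>Back and forth: each change at a position below \<open>N'\<close> is answered at
  precision \<open>N\<close>, the answer is compared at precision \<open>N'\<close> by the induction
  hypothesis, and \<open>cl_Suc_eqI\<close> reassembles the equality of codes.\<close>

lemma cl_mono:
  assumes "X \<in> unit_tuples n" "Y \<in> unit_tuples n" "cl k N n X = cl k N n Y" "N' \<le> N"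
  shows "cl k N' n X = cl k N' n Y"
  using assms
proof (induction k arbitrary: X Y)
  case 0
  then show ?case using leaf_mono unfolding leaf_eq_iff[OF 0(1,2)] by blast
next
  case (Suc k)
  have *: "\<exists>b\<in>op_ball (mat_alg n) 1. cl k N' n (X(j := a)) = cl k N' n (Y(j := b))"
    if X: "X \<in> unit_tuples n" and Y: "Y \<in> unit_tuples n" and eq: "cl (Suc k) N n X = cl (Suc k) N n Y" and j: "j < N'" and a: "a \<in> op_ball (mat_alg n) 1" for X Y j a
  proof -
    have "j < N" using j Suc.prems(4) by simp
    then obtain b where b: "b \<in> op_ball (mat_alg n) 1" "cl k N n (X(j := a)) = cl k N n (Y(j := b))"
      using cl_Suc_eqD[OF X Y eq _ a] by blast
    then show ?thesis using Suc.IH[OF unit_tuples_upd[OF X a] unit_tuples_upd[OF Y b(1)] b(2) Suc.prems(4)] by blast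
  qed
  show ?case
    by (rule cl_Suc_eqI[OF Suc.prems(1,2) Suc.IH[OF Suc.prems(1,2) _ Suc.prems(4)]])
      (use Suc.prems(3) in simp, use *[OF Suc.prems(1,2,3)] *[OF Suc.prems(2,1) Suc.prems(3)[symmetric]] in blast)+
qed

text \<open>A code of depth k + 1 contains the code of depth k of the same tuple as its first
  component; it is stored there for this purpose.\<close>

lemma cl_antimono_depth: "cl k N n X = cl k N n Y \<Longrightarrow> k' \<le> k \<Longrightarrow> cl k' N n X = cl k' N n Y"
  by (induction k) (auto simp: le_Suc_eq)

section \<open>Tuples with equal codes satisfy nearly the same formulas\<close>

definition sim :: "nat \<Rightarrow> nat \<Rightarrow> nat \<Rightarrow> (nat \<Rightarrow> complex mat) \<Rightarrow> (nat \<Rightarrow> complex mat) \<Rightarrow> bool" where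
  "sim k N n X Y \<longleftrightarrow> X \<in> unit_tuples n \<and> Y \<in> unit_tuples n \<and> cl k N n X = cl k N n Y"

lemma sim_mono: "sim k N n X Y \<Longrightarrow> k' \<le> k \<Longrightarrow> N' \<le> N \<Longrightarrow> sim k' N' n X Y"
  unfolding sim_def using cl_mono cl_antimono_depth by blast

lemma sim_sym: "sim k N n X Y \<Longrightarrow> sim k N n Y X"
  by (auto simp: sim_def)

lemma sim_extend:
  assumes "sim (Suc k) N n X Y" "j < N" "a \<in> op_ball (mat_alg n) 1"
  shows "\<exists>b\<in>op_ball (mat_alg n) 1. sim k N n (X(j := a)) (Y(j := b))"
  using cl_Suc_eqD[of X n Y k N j a] assms unit_tuples_upd unfolding sim_def by blast

lemma mtr_mword_near:
  assumes sim: "sim 0 N n X Y" and w: "w \<in> words N" and N: "N > 0"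
  shows "cmod (mtr n (mword n X w) - mtr n (mword n Y w)) \<le> 2 / real N"
proof -
  have l: "leaf N n X = leaf N n Y" using sim leaf_eq_iff[of X n Y N] by (auto simp: sim_def)
  have "(w, N, \<lfloor>real N * Re (mtr n (mword n X w))\<rfloor>, \<lfloor>real N * Im (mtr n (mword n X w))\<rfloor>) \<in> leaf N n X"
    using w by (force simp: leaf_def)
  then have "(w, N, \<lfloor>real N * Re (mtr n (mword n X w))\<rfloor>, \<lfloor>real N * Im (mtr n (mword n X w))\<rfloor>) \<in> leaf N n Y"
    unfolding l .
  then have f: "\<lfloor>real N * Re (mtr n (mword n X w))\<rfloor> = \<lfloor>real N * Re (mtr n (mword n Y w))\<rfloor>"
    "\<lfloor>real N * Im (mtr n (mword n X w))\<rfloor> = \<lfloor>real N * Im (mtr n (mword n Y w))\<rfloor>"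
    by (auto simp: leaf_def)
  have near: "\<bar>x - y\<bar> \<le> 1 / real N" if "\<lfloor>real N * x\<rfloor> = \<lfloor>real N * y\<rfloor>" for x y
  proof -
    have "\<bar>real N * x - real N * y\<bar> \<le> 1" using that by linarith
    then have "real N * \<bar>x - y\<bar> \<le> 1" by (simp add: abs_mult flip: right_diff_distrib)
    then show ?thesis using N by (simp add: field_simps)
  qed
  show ?thesis
    using near[OF f(1)] near[OF f(2)] cmod_le[of "mtr n (mword n X w) - mtr n (mword n Y w)"] by simp
qed

lemma ex_words_finite:
  assumes "finite W"
  shows "\<exists>N. W \<subseteq> words N"
  using assms
proof (induction W rule: finite_induct)
  case (insert w W)
  obtain N1 N2 where "w \<in> words N1" "W \<subseteq> words N2" using insert ex_words by blast
  then have "insert w W \<subseteq> words (max N1 N2)"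
    using words_mono[of N1 "max N1 N2"] words_mono[of N2 "max N1 N2"] by auto
  then show ?case by blast
qed simp

lemma sum_words_near:
  fixes W :: "(nat \<times> bool) list set" and a :: "(nat \<times> bool) list \<Rightarrow> complex"
  assumes W: "finite W" and d: "d > 0"
  shows "\<exists>N. \<forall>n X Y. sim 0 N n X Y \<longrightarrow>
    cmod ((\<Sum>w\<in>W. a w * mtr n (mword n X w)) - (\<Sum>w\<in>W. a w * mtr n (mword n Y w))) \<le> d"
proof -
  obtain N1 where N1: "W \<subseteq> words N1" using ex_words_finite[OF W] by blast
  define A where "A = (\<Sum>w\<in>W. cmod (a w))"
  have A: "0 \<le> A" by (simp add: A_def sum_nonneg)
  obtain N2 where N2: "2 * A / d < real N2" using reals_Archimedean2 by blast
  define N where "N = Suc (max N1 N2)"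
  have N: "N > 0" "N1 \<le> N" "2 * A / d < real N" using N2 by (auto simp: N_def)
  have "cmod ((\<Sum>w\<in>W. a w * mtr n (mword n X w)) - (\<Sum>w\<in>W. a w * mtr n (mword n Y w))) \<le> d"
    if s: "sim 0 N n X Y" for n X Y
  proof -
    have "cmod ((\<Sum>w\<in>W. a w * mtr n (mword n X w)) - (\<Sum>w\<in>W. a w * mtr n (mword n Y w)))
      = cmod (\<Sum>w\<in>W. a w * (mtr n (mword n X w) - mtr n (mword n Y w)))"
      by (simp add: right_diff_distrib sum_subtractf)
    also have "\<dots> \<le> (\<Sum>w\<in>W. cmod (a w) * (2 / real N))"
    proof (rule sum_norm_le)
      fix w assume "w \<in> W"
      then have "w \<in> words N" using N1 words_mono[OF N(2)] by blast
      from mtr_mword_near[OF s this N(1)]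
      show "cmod (a w * (mtr n (mword n X w) - mtr n (mword n Y w))) \<le> cmod (a w) * (2 / real N)"
        unfolding norm_mult by (rule mult_left_mono) simp
    qed
    also have "\<dots> = A * (2 / real N)" by (simp only: A_def sum_distrib_right)
    also have "\<dots> \<le> d"
    proof -
      have "2 * A < d * real N" using N(3) d by (simp add: divide_less_eq mult.commute)
      then show ?thesis using N(1) by (simp add: divide_le_eq mult.commute)
    qed
    finally show ?thesis .
  qed
  then show ?thesis by blast
qed

lemma less_max_Suc: "j < max N (Suc j)"
  by simp

lemma list_bound_uniform:
  fixes P :: "'f \<Rightarrow> nat \<Rightarrow> nat \<Rightarrow> bool"
  assumes "\<And>x. x \<in> set xs \<Longrightarrow> \<exists>k N. P x k N"
    and "\<And>x k N k' N'. P x k N \<Longrightarrow> k \<le> k' \<Longrightarrow> N \<le> N' \<Longrightarrow> P x k' N'"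
  shows "\<exists>k N. \<forall>x\<in>set xs. P x k N"
  using assms(1)
proof (induction xs)
  case (Cons x xs)
  then obtain k N k' N' where "P x k N" "\<forall>x\<in>set xs. P x k' N'" by (meson list.set_intros)
  then have "\<forall>y\<in>set (x # xs). P y (max k k') (max N N')"
    using assms(2)[of _ _ _ "max k k'" "max N N'"] by auto
  then show ?case by blast
qed simp

text \<open>Each quantifier costs one level of depth: an entry tried for one tuple is answered for
  the other by \<open>sim_extend\<close>. The precision is raised to \<open>Suc j\<close> so that
  the changed position \<open>j\<close> is among the recorded ones. Depth and precision are the same
  for all \<open>n\<close>.\<close>

lemma interp_near:
  "well_formed \<phi> \<Longrightarrow> d > 0 \<Longrightarrow> \<exists>k N. \<forall>n X Y. sim k N n X Y \<longrightarrow>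
    \<bar>interp (mat_alg n) \<phi> (scaled c X) - interp (mat_alg n) \<phi> (scaled c Y)\<bar> \<le> d"
proof (induction \<phi> arbitrary: c d)
  case (Re_tr p)
  obtain N where N: "\<And>n X Y. sim 0 N n X Y \<Longrightarrow>
      cmod ((\<Sum>w\<in>Poly_Mapping.keys p. (Poly_Mapping.lookup p w * complex_of_real (wcoef c w)) * mtr n (mword n X w))
        - (\<Sum>w\<in>Poly_Mapping.keys p. (Poly_Mapping.lookup p w * complex_of_real (wcoef c w)) * mtr n (mword n Y w))) \<le> d"
    using sum_words_near[OF finite_keys Re_tr(2), of "\<lambda>w. Poly_Mapping.lookup p w * complex_of_real (wcoef c w)"] by blast
  have "\<bar>interp (mat_alg n) (Re_tr p) (scaled c X) - interp (mat_alg n) (Re_tr p) (scaled c Y)\<bar> \<le> d" if s: "sim 0 N n X Y" for n X Y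
  proof -
    have X: "X \<in> unit_tuples n" and Y: "Y \<in> unit_tuples n" using s by (auto simp: sim_def)
    show ?thesis
      unfolding interp.simps minus_complex.sel[symmetric]
      by (rule order_trans[OF abs_Re_le_cmod]) (use N[OF s] in \<open>simp only: tr_poly_scaled[OF X] tr_poly_scaled[OF Y] mult.assoc\<close>)
  qed
  then show ?case by blast
next
  case (Im_tr p)
  obtain N where N: "\<And>n X Y. sim 0 N n X Y \<Longrightarrow>
      cmod ((\<Sum>w\<in>Poly_Mapping.keys p. (Poly_Mapping.lookup p w * complex_of_real (wcoef c w)) * mtr n (mword n X w))
        - (\<Sum>w\<in>Poly_Mapping.keys p. (Poly_Mapping.lookup p w * complex_of_real (wcoef c w)) * mtr n (mword n Y w))) \<le> d"
    using sum_words_near[OF finite_keys Im_tr(2), of "\<lambda>w. Poly_Mapping.lookup p w * complex_of_real (wcoef c w)"] by blast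
  have "\<bar>interp (mat_alg n) (Im_tr p) (scaled c X) - interp (mat_alg n) (Im_tr p) (scaled c Y)\<bar> \<le> d" if s: "sim 0 N n X Y" for n X Y
  proof -
    have X: "X \<in> unit_tuples n" and Y: "Y \<in> unit_tuples n" using s by (auto simp: sim_def)
    show ?thesis
      unfolding interp.simps minus_complex.sel[symmetric]
      by (rule order_trans[OF abs_Im_le_cmod]) (use N[OF s] in \<open>simp only: tr_poly_scaled[OF X] tr_poly_scaled[OF Y] mult.assoc\<close>)
  qed
  then show ?case by blast
next
  case (Connective f \<phi>s)
  have f: "continuous_map (Euclidean_space (length \<phi>s)) euclideanreal f" and wf: "\<And>\<phi>. \<phi> \<in> set \<phi>s \<Longrightarrow> well_formed \<phi>"
    using Connective.prems by auto
  have "\<exists>B. \<forall>n. \<forall>X\<in>unit_tuples n. \<bar>interp (mat_alg n) \<phi> (scaled c X)\<bar> \<le> B" if "\<phi> \<in> set \<phi>s" for \<phi>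
    by (rule interp_bounded[OF wf[OF that]])
  then obtain Bf where Bf: "\<And>\<phi> n X. \<phi> \<in> set \<phi>s \<Longrightarrow> X \<in> unit_tuples n \<Longrightarrow> \<bar>interp (mat_alg n) \<phi> (scaled c X)\<bar> \<le> Bf \<phi>" by metis
  define B where "B = Max (insert 0 (Bf ` set \<phi>s))"
  have B: "\<bar>interp (mat_alg n) \<phi> (scaled c X)\<bar> \<le> B" if "\<phi> \<in> set \<phi>s" "X \<in> unit_tuples n" for \<phi> n X
    unfolding B_def by (rule order_trans[OF Bf[OF that] Max_ge]) (use that(1) in auto)
  define v where "v n X = (\<lambda>i. if i < length \<phi>s then map (\<lambda>\<phi>. interp (mat_alg n) \<phi> (scaled c X)) \<phi>s ! i else 0)" for n X
  have vb: "v n X \<in> coord_box (length \<phi>s) B" if "X \<in> unit_tuples n" for n X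
    using B[OF _ that] by (simp add: v_def coord_box_def)
  obtain e where e: "e > 0" "\<And>x y. x \<in> coord_box (length \<phi>s) B \<Longrightarrow> y \<in> coord_box (length \<phi>s) B \<Longrightarrow>
      (\<forall>i<length \<phi>s. \<bar>x i - y i\<bar> \<le> e) \<Longrightarrow> \<bar>f x - f y\<bar> \<le> d"
    using connective_uniform[OF f Connective.prems(2), of B] by blast
  define P where "P \<phi> k N \<longleftrightarrow> (\<forall>n X Y. sim k N n X Y \<longrightarrow>
    \<bar>interp (mat_alg n) \<phi> (scaled c X) - interp (mat_alg n) \<phi> (scaled c Y)\<bar> \<le> e)" for \<phi> k N
  have "\<exists>k N. \<forall>\<phi>\<in>set \<phi>s. P \<phi> k N"
  proof (rule list_bound_uniform)
    show "\<exists>k N. P \<phi> k N" if "\<phi> \<in> set \<phi>s" for \<phi>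
      unfolding P_def by (rule Connective.IH[OF that wf[OF that] e(1)])
    show "P \<phi> k' N'" if "P \<phi> k N" "k \<le> k'" "N \<le> N'" for \<phi> k N k' N'
      using that sim_mono unfolding P_def by blast
  qed
  then obtain k N where kN: "\<And>\<phi> n X Y. \<phi> \<in> set \<phi>s \<Longrightarrow> sim k N n X Y \<Longrightarrow>
    \<bar>interp (mat_alg n) \<phi> (scaled c X) - interp (mat_alg n) \<phi> (scaled c Y)\<bar> \<le> e" unfolding P_def by blast
  have "\<bar>interp (mat_alg n) (Connective f \<phi>s) (scaled c X) - interp (mat_alg n) (Connective f \<phi>s) (scaled c Y)\<bar> \<le> d"
    if s: "sim k N n X Y" for n X Y
  proof -
    have X: "X \<in> unit_tuples n" and Y: "Y \<in> unit_tuples n" using s by (auto simp: sim_def)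
    have "\<forall>i<length \<phi>s. \<bar>v n X i - v n Y i\<bar> \<le> e" using kN[OF _ s] by (simp add: v_def)
    from e(2)[OF vb[OF X] vb[OF Y] this] show ?thesis by (simp only: interp.simps v_def)
  qed
  then show ?case by blast
next
  case (Inf_ball j r \<phi>)
  then have r: "r > 0" and wf: "well_formed \<phi>" by auto
  let ?c = "c(j := r)"
  obtain k N where kN: "\<And>n X Y. sim k N n X Y \<Longrightarrow>
      \<bar>interp (mat_alg n) \<phi> (scaled ?c X) - interp (mat_alg n) \<phi> (scaled ?c Y)\<bar> \<le> d"
    using Inf_ball.IH[OF wf Inf_ball.prems(2), of ?c] by blast
  obtain B where B: "\<And>n X. X \<in> unit_tuples n \<Longrightarrow> \<bar>interp (mat_alg n) \<phi> (scaled ?c X)\<bar> \<le> B"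
    using interp_bounded[OF wf, of ?c] by blast
  have half: "interp (mat_alg n) (Inf_ball j r \<phi>) (scaled c Y) \<le> interp (mat_alg n) (Inf_ball j r \<phi>) (scaled c X) + d"
    if s: "sim (Suc k) (max N (Suc j)) n X Y" for n X Y
    unfolding interp_Inf_scaled[OF r]
  proof (rule INF_le_INF_plus[OF op_ball_ne])
    have Y: "Y \<in> unit_tuples n" using s by (auto simp: sim_def)
    show "bdd_below ((\<lambda>a. interp (mat_alg n) \<phi> (scaled ?c (Y(j := a)))) ` op_ball (mat_alg n) 1)"
      by (rule bdd_belowI[where m = "- B"]) (use B[OF unit_tuples_upd[OF Y]] in \<open>auto simp: abs_le_iff minus_le_iff simp del: fun_upd_apply\<close>)
    fix a assume a: "a \<in> op_ball (mat_alg n) 1"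
    obtain b where b: "b \<in> op_ball (mat_alg n) 1" "sim k (max N (Suc j)) n (X(j := a)) (Y(j := b))"
      using sim_extend[OF s less_max_Suc a] by blast
    have "sim k N n (X(j := a)) (Y(j := b))" by (rule sim_mono[OF b(2)]) auto
    from kN[OF this] have "interp (mat_alg n) \<phi> (scaled ?c (Y(j := b))) \<le> interp (mat_alg n) \<phi> (scaled ?c (X(j := a))) + d"
      by linarith
    then show "\<exists>b\<in>op_ball (mat_alg n) 1. interp (mat_alg n) \<phi> (scaled ?c (Y(j := b))) \<le> interp (mat_alg n) \<phi> (scaled ?c (X(j := a))) + d"
      using b(1) by blast
  qed simp
  have "\<bar>interp (mat_alg n) (Inf_ball j r \<phi>) (scaled c X) - interp (mat_alg n) (Inf_ball j r \<phi>) (scaled c Y)\<bar> \<le> d"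
    if s: "sim (Suc k) (max N (Suc j)) n X Y" for n X Y
    using half[OF s] half[OF sim_sym[OF s]] by (simp only: abs_le_iff) linarith
  then show ?case by blast
next
  case (Sup_ball j r \<phi>)
  then have r: "r > 0" and wf: "well_formed \<phi>" by auto
  let ?c = "c(j := r)"
  obtain k N where kN: "\<And>n X Y. sim k N n X Y \<Longrightarrow>
      \<bar>interp (mat_alg n) \<phi> (scaled ?c X) - interp (mat_alg n) \<phi> (scaled ?c Y)\<bar> \<le> d"
    using Sup_ball.IH[OF wf Sup_ball.prems(2), of ?c] by blast
  obtain B where B: "\<And>n X. X \<in> unit_tuples n \<Longrightarrow> \<bar>interp (mat_alg n) \<phi> (scaled ?c X)\<bar> \<le> B"
    using interp_bounded[OF wf, of ?c] by blast
  have half: "interp (mat_alg n) (Sup_ball j r \<phi>) (scaled c X) \<le> interp (mat_alg n) (Sup_ball j r \<phi>) (scaled c Y) + d"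
    if s: "sim (Suc k) (max N (Suc j)) n X Y" for n X Y
    unfolding interp_Inf_scaled[OF r]
  proof (rule SUP_le_SUP_plus[OF op_ball_ne])
    have Y: "Y \<in> unit_tuples n" using s by (auto simp: sim_def)
    show "bdd_above ((\<lambda>a. interp (mat_alg n) \<phi> (scaled ?c (Y(j := a)))) ` op_ball (mat_alg n) 1)"
      by (rule bdd_aboveI[where M = "B"]) (use B[OF unit_tuples_upd[OF Y]] in \<open>auto simp: abs_le_iff simp del: fun_upd_apply\<close>)
    fix a assume a: "a \<in> op_ball (mat_alg n) 1"
    obtain b where b: "b \<in> op_ball (mat_alg n) 1" "sim k (max N (Suc j)) n (X(j := a)) (Y(j := b))"
      using sim_extend[OF s less_max_Suc a] by blast
    have "sim k N n (X(j := a)) (Y(j := b))" by (rule sim_mono[OF b(2)]) auto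
    from kN[OF this] have "interp (mat_alg n) \<phi> (scaled ?c (X(j := a))) \<le> interp (mat_alg n) \<phi> (scaled ?c (Y(j := b))) + d"
      by linarith
    then show "\<exists>b\<in>op_ball (mat_alg n) 1. interp (mat_alg n) \<phi> (scaled ?c (X(j := a))) \<le> interp (mat_alg n) \<phi> (scaled ?c (Y(j := b))) + d"
      using b(1) by blast
  qed simp
  have "\<bar>interp (mat_alg n) (Sup_ball j r \<phi>) (scaled c X) - interp (mat_alg n) (Sup_ball j r \<phi>) (scaled c Y)\<bar> \<le> d"
    if s: "sim (Suc k) (max N (Suc j)) n X Y" for n X Y
    using half[OF s] half[OF sim_sym[OF s]] by (simp only: abs_le_iff) linarith
  then show ?case by blast
qed

section \<open>Limits along ultrafilters\<close>

locale ultra =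
  fixes U :: "nat filter"
  assumes free: "free_ultrafilter U"
begin

lemma U_ne: "U \<noteq> bot" using free by (simp add: free_ultrafilter_def)

lemma ultraD: "eventually P U \<or> eventually (\<lambda>n. \<not> P n) U" using free by (simp add: free_ultrafilter_def)

lemma U_ge: "eventually (\<lambda>n. k \<le> n) U"
proof (induction k)
  case (Suc k)
  have "eventually (\<lambda>n. n \<noteq> k) U" using free by (simp add: free_ultrafilter_def)
  with Suc show ?case by eventually_elim auto
qed simp

lemma U_sequentially: "U \<le> sequentially"
proof (rule filter_leI)
  fix P assume "eventually P sequentially"
  then obtain k where k: "\<And>n. n \<ge> k \<Longrightarrow> P n" by (auto simp: eventually_sequentially)
  show "eventually P U" using U_ge[of k] by (rule eventually_mono) (rule k)
qed

lemma limI: "(f \<longlongrightarrow> l) sequentially \<Longrightarrow> (f \<longlongrightarrow> l) U"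
  by (rule tendsto_mono[OF U_sequentially])

text \<open>Compactness yields a cluster point. An open set around it must lie in the image
  ultrafilter, since otherwise its complement would, which excludes a cluster point inside.\<close>

lemma compact_lim:
  fixes f :: "nat \<Rightarrow> 'b :: topological_space"
  assumes "compact K" "\<And>n. f n \<in> K"
  shows "\<exists>l\<in>K. (f \<longlongrightarrow> l) U"
proof -
  have "filtermap f U \<noteq> bot" using U_ne by (simp add: filtermap_bot_iff)
  moreover have "eventually (\<lambda>x. x \<in> K) (filtermap f U)" using assms(2) by (simp add: eventually_filtermap)
  ultimately obtain l where l: "l \<in> K" "inf (nhds l) (filtermap f U) \<noteq> bot"
    using assms(1) unfolding compact_filter by blast
  have "(f \<longlongrightarrow> l) U"
  proof (rule topological_tendstoI)
    fix S assume S: "open S" "l \<in> S"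
    show "eventually (\<lambda>n. f n \<in> S) U"
    proof (rule ccontr)
      assume "\<not> eventually (\<lambda>n. f n \<in> S) U"
      then have "eventually (\<lambda>x. x \<notin> S) (filtermap f U)" using ultraD by (auto simp: eventually_filtermap)
      moreover have "eventually (\<lambda>x. x \<in> S) (nhds l)" using S eventually_nhds by blast
      ultimately have "eventually (\<lambda>x. False) (inf (nhds l) (filtermap f U))"
        unfolding eventually_inf by blast
      then show False using l(2) by (simp add: trivial_limit_def)
    qed
  qed
  then show ?thesis using l(1) by blast
qed

lemma bounded_lim:
  fixes f :: "nat \<Rightarrow> 'b :: euclidean_space"
  assumes "\<And>n. norm (f n) \<le> C"
  shows "\<exists>l. (f \<longlongrightarrow> l) U"
  using compact_lim[of "cball 0 C" f] assms by auto

lemma Lim_eq: "(f \<longlongrightarrow> (l :: 'b :: t2_space)) U \<Longrightarrow> Lim U f = l"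
  by (rule tendsto_Lim[OF U_ne])

lemma lim_unique: "(f \<longlongrightarrow> (l :: 'b :: t2_space)) U \<Longrightarrow> (f \<longlongrightarrow> l') U \<Longrightarrow> l = l'"
  by (rule tendsto_unique[OF U_ne])

lemma lim_le: "(f \<longlongrightarrow> (a::real)) U \<Longrightarrow> (g \<longlongrightarrow> b) U \<Longrightarrow> (\<And>n. f n \<le> g n) \<Longrightarrow> a \<le> b"
  by (rule tendsto_le[OF U_ne, of g b f a]) simp_all

lemma lim_less_eventually: "(f \<longlongrightarrow> (a::real)) U \<Longrightarrow> a < b \<Longrightarrow> eventually (\<lambda>n. f n < b) U"
  by (rule order_tendstoD(2))

text \<open>The form in which countable saturation is used. Take for \<open>\<kappa> n\<close> the
  largest i \<le> n such that \<open>P 0\<close>, ..., \<open>P i\<close> all hold at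
  \<open>n\<close>; the cap i \<le> n guarantees that a largest one exists.\<close>

lemma diagonal:
  assumes "\<And>i::nat. eventually (P i) U"
  shows "\<exists>\<kappa>. (\<forall>i. eventually (\<lambda>n. i \<le> \<kappa> n) U) \<and> eventually (\<lambda>n. P (\<kappa> n) n) U"
proof -
  define Q where "Q n i \<longleftrightarrow> i \<le> n \<and> (\<forall>j\<le>i. P j n)" for n i
  define \<kappa> where "\<kappa> n = (GREATEST i. Q n i)" for n
  have allP: "eventually (\<lambda>n. \<forall>j\<le>i. P j n) U" for i
  proof (induction i)
    case (Suc i)
    then show ?case using assms[of "Suc i"] by eventually_elim (auto simp: le_Suc_eq)
  qed (use assms[of 0] in simp)
  have g: "Q n (\<kappa> n)" "i \<le> \<kappa> n" if "Q n i" for n i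
  proof -
    have b: "\<forall>y. Q n y \<longrightarrow> y \<le> n" by (simp add: Q_def)
    show "Q n (\<kappa> n)" unfolding \<kappa>_def using GreatestI_nat[of "Q n", OF that] b by blast
    show "i \<le> \<kappa> n" unfolding \<kappa>_def using Greatest_le_nat[of "Q n", OF that] b by blast
  qed
  have "eventually (\<lambda>n. i \<le> \<kappa> n) U" for i
    using U_ge[of i] allP[of i] by eventually_elim (rule g(2), simp add: Q_def)
  moreover have "eventually (\<lambda>n. P (\<kappa> n) n) U"
    using allP[of 0]
  proof eventually_elim
    case (elim n)
    then have "Q n 0" by (simp add: Q_def)
    from g(1)[OF this] show ?case by (simp add: Q_def)
  qed
  ultimately show ?thesis by blast
qed

end

text \<open>\<open>C (1 + C\<^sup>* C + E\<^sup>* E)\<^sup>-\<^sup>1\<close> is a contraction; multiplying it by \<open>1 + D\<^sup>* D\<close> gives back almost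
  \<open>C\<close> when \<open>C\<^sup>* C + E\<^sup>* E\<close> is close to \<open>D\<^sup>* D\<close>. This truncation replaces functional calculus.\<close>

lemma resolvent:
  fixes C E :: "complex mat"
  assumes C: "C \<in> carrier_mat n n" and E: "E \<in> carrier_mat n n"
  shows "\<exists>G\<in>carrier_mat n n. G * (1\<^sub>m n + (mat_adjoint C * C + mat_adjoint E * E)) = 1\<^sub>m n \<and> mat_op_norm n (C * G) \<le> 1"
proof -
  define A where "A = 1\<^sub>m n + (mat_adjoint C * C + mat_adjoint E * E)"
  have A: "A \<in> carrier_mat n n" using C E by (simp add: A_def)
  \<comment> \<open>The quadratic form of 1 + C* C + E* E. Its positivity makes the matrix
    injective, hence invertible, and it also provides the norm estimate for
    \<open>C * G\<close>.\<close>
  have form: "(vec_norm2 w)\<^sup>2 + (vec_norm2 (C *\<^sub>v w))\<^sup>2 + (vec_norm2 (E *\<^sub>v w))\<^sup>2 = Re (w \<bullet>c (A *\<^sub>v w))"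
    if w: "w \<in> carrier_vec n" for w
  proof -
    have sq: "w \<bullet>c ((mat_adjoint F * F) *\<^sub>v w) = complex_of_real ((vec_norm2 (F *\<^sub>v w))\<^sup>2)" if F: "F \<in> carrier_mat n n" for F
    proof -
      have Fw: "F *\<^sub>v w \<in> carrier_vec n" using F w by simp
      have "(mat_adjoint F * F) *\<^sub>v w = mat_adjoint F *\<^sub>v (F *\<^sub>v w)"
        using F w by (intro assoc_mult_mat_vec[where n\<^sub>1=n]) simp_all
      then show ?thesis using cscalar_prod_adjoint[OF F w Fw] vec_norm2_square[OF Fw] by simp
    qed
    have "A *\<^sub>v w = w + ((mat_adjoint C * C) *\<^sub>v w + (mat_adjoint E * E) *\<^sub>v w)"
      unfolding A_def using C E w by (simp add: add_mult_distrib_mat_vec[where nr=n and nc=n])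
    then have "w \<bullet>c (A *\<^sub>v w) = w \<bullet>c w + (w \<bullet>c ((mat_adjoint C * C) *\<^sub>v w) + w \<bullet>c ((mat_adjoint E * E) *\<^sub>v w))"
      using C E w by (simp add: conjugate_add_vec[where n=n] scalar_prod_add_distrib[where n=n])
    then show ?thesis unfolding sq[OF C] sq[OF E] vec_norm2_square[OF w] by simp
  qed
  have inj: "v = 0\<^sub>v n" if v: "v \<in> carrier_vec n" and z: "A *\<^sub>v v = 0\<^sub>v n" for v
  proof -
    have "Re (v \<bullet>c (A *\<^sub>v v)) = 0" unfolding z using v by simp
    then have "(vec_norm2 v)\<^sup>2 \<le> 0"
      using form[OF v] zero_le_power2[of "vec_norm2 (C *\<^sub>v v)"] zero_le_power2[of "vec_norm2 (E *\<^sub>v v)"] by linarith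
    then have "vec_norm2 v = 0" by simp
    then show ?thesis using vec_norm2_eq_0[OF v] by blast
  qed
  then have "det A \<noteq> 0" using det_0_iff_vec_prod_zero_field[OF A] by blast
  then have "A \<in> Units (ring_mat TYPE(complex) n ())" by (rule det_non_zero_imp_unit[OF A])
  then obtain G where G: "G \<in> carrier_mat n n" "G * A = 1\<^sub>m n" "A * G = 1\<^sub>m n"
    by (auto simp: Units_def ring_mat_simps)
  have "mat_op_norm n (C * G) \<le> 1"
  proof (rule mat_op_norm_le')
    fix u :: "complex vec" assume u: "u \<in> carrier_vec n"
    define w where "w = G *\<^sub>v u"
    have w: "w \<in> carrier_vec n" using G u by (simp add: w_def)
    have "A *\<^sub>v w = (A * G) *\<^sub>v u" unfolding w_def using A G u by (intro assoc_mult_mat_vec[symmetric]) simp_all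
    then have Aw: "A *\<^sub>v w = u" using G u by simp
    have "Re (w \<bullet>c u) \<le> vec_norm2 w * vec_norm2 u"
      using vec_norm2_Cauchy_Schwarz[OF w u] complex_Re_le_cmod[of "w \<bullet>c u"] by linarith
    \<comment> \<open>From \<open>A w = u\<close>, the form and Cauchy-Schwarz. Dropping the second
      square gives |w| \<le> |u|, and inserting this gives |C w| \<le> |u|.\<close>
    then have le: "(vec_norm2 w)\<^sup>2 + (vec_norm2 (C *\<^sub>v w))\<^sup>2 \<le> vec_norm2 w * vec_norm2 u"
      using form[OF w] zero_le_power2[of "vec_norm2 (E *\<^sub>v w)"] unfolding Aw by linarith
    have "vec_norm2 w \<le> vec_norm2 u"
    proof (cases "vec_norm2 w = 0")
      case False
      then have pos: "vec_norm2 w > 0" using vec_norm2_nonneg[of w] by (simp add: less_le)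
      have "vec_norm2 w * vec_norm2 w \<le> vec_norm2 w * vec_norm2 u"
        using le zero_le_power2[of "vec_norm2 (C *\<^sub>v w)"] unfolding power2_eq_square by linarith
      then show ?thesis using pos by simp
    qed simp
    then have "vec_norm2 w * vec_norm2 u \<le> (vec_norm2 u)\<^sup>2" by (simp add: power2_eq_square mult_right_mono)
    then have "(vec_norm2 (C *\<^sub>v w))\<^sup>2 \<le> (vec_norm2 u)\<^sup>2" using le zero_le_power2[of "vec_norm2 w"] by linarith
    then have "vec_norm2 (C *\<^sub>v w) \<le> vec_norm2 u" by (rule power2_le_imp_le) simp
    moreover have "(C * G) *\<^sub>v u = C *\<^sub>v w" unfolding w_def using C G u by (intro assoc_mult_mat_vec) simp_all
    ultimately show "vec_norm2 ((C * G) *\<^sub>v u) \<le> 1 * vec_norm2 u" by simp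
  qed simp
  then show ?thesis using G by (auto simp: A_def)
qed

text \<open>With H = C* C + E* E, S = D* D and G = (1 + H)^(-1), put C' = C G (1 + S). Then C' - C =
  C G (S - H), where C G is a contraction. The norm bound depends on \<open>D\<close> alone, however
  large \<open>C\<close> is.\<close>

lemma bounded_modification:
  fixes C E D :: "complex mat"
  assumes C: "C \<in> carrier_mat n n" and E: "E \<in> carrier_mat n n" and D: "D \<in> carrier_mat n n"
  shows "\<exists>C'\<in>carrier_mat n n. mat_op_norm n C' \<le> 1 + (mat_op_norm n D)\<^sup>2 \<and>
    mn2 n (C' - C) \<le> mn2 n (mat_adjoint C * C + mat_adjoint E * E - mat_adjoint D * D)"
proof -
  define H where "H = mat_adjoint C * C + mat_adjoint E * E"
  define S where "S = mat_adjoint D * D"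
  have H: "H \<in> carrier_mat n n" and S: "S \<in> carrier_mat n n" using C E D by (simp_all add: H_def S_def)
  obtain G where G: "G \<in> carrier_mat n n" "G * (1\<^sub>m n + H) = 1\<^sub>m n" "mat_op_norm n (C * G) \<le> 1"
    using resolvent[OF C E] unfolding H_def by blast
  define C' where "C' = C * G * (1\<^sub>m n + S)"
  have C': "C' \<in> carrier_mat n n" using C G S by (simp add: C'_def)
  have "mat_op_norm n (1\<^sub>m n + S) \<le> 1 + (mat_op_norm n D)\<^sup>2"
    using mat_op_norm_triangle[of "1\<^sub>m n" n S] mat_op_norm_one[of n] mat_op_norm_cstar[OF D] S by (simp add: S_def)
  then have "mat_op_norm n (C * G) * mat_op_norm n (1\<^sub>m n + S) \<le> 1 * (1 + (mat_op_norm n D)\<^sup>2)"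
    using G C S by (intro mult_mono) auto
  then have norm: "mat_op_norm n C' \<le> 1 + (mat_op_norm n D)\<^sup>2"
    using mat_op_norm_mult[of "C * G" n "1\<^sub>m n + S"] C G S by (simp add: C'_def)
  have "C * G * (1\<^sub>m n + H) = C" using C G H by (simp add: sq_assoc[where n=n])
  then have "C' - C = C * G * (1\<^sub>m n + S) - C * G * (1\<^sub>m n + H)" by (simp add: C'_def)
  also have "\<dots> = C * G * ((1\<^sub>m n + S) - (1\<^sub>m n + H))"
    using C G S H by (intro mult_minus_distrib_mat[where nr=n and n=n and nc=n, symmetric]) simp_all
  also have "(1\<^sub>m n + S) - (1\<^sub>m n + H) = S - H" using S H by (intro eq_matI) auto
  finally have eq: "C' - C = C * G * (S - H)" .
  have "mn2 n (C' - C) \<le> mat_op_norm n (C * G) * mn2 n (S - H)"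
    unfolding eq using C G S H by (intro mn2_mult_le) simp_all
  also have "\<dots> \<le> 1 * mn2 n (S - H)" using G by (intro mult_right_mono) auto
  also have "\<dots> = mn2 n (H - S)" using mn2_minus_commute[OF S H] by simp
  finally show ?thesis using C' norm unfolding H_def S_def by blast
qed

section \<open>The matrix ultraproduct\<close>

context ultra
begin

abbreviation Q where "Q \<equiv> matrix_ultraproduct U"
abbreviation cls where "cls \<equiv> ultra_class U mat_alg"
abbreviation bs :: "(nat \<Rightarrow> complex mat) set" where "bs \<equiv> bounded_seqs mat_alg"

definition null :: "(nat \<Rightarrow> complex mat) \<Rightarrow> bool" where
  "null x \<longleftrightarrow> ((\<lambda>n. mn2 n (x n)) \<longlongrightarrow> 0) U"

lemma bs_iff: "x \<in> bs \<longleftrightarrow> (\<forall>n. x n \<in> carrier_mat n n) \<and> (\<exists>C. \<forall>n. mat_op_norm n (x n) \<le> C)"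
  by (simp add: bounded_seqs_def)

lemma bsI: "(\<And>n. x n \<in> carrier_mat n n) \<Longrightarrow> (\<And>n. mat_op_norm n (x n) \<le> C) \<Longrightarrow> x \<in> bs"
  unfolding bs_iff by blast

lemma bs_carrier [simp]: "x \<in> bs \<Longrightarrow> x n \<in> carrier_mat n n"
  by (simp add: bs_iff)

lemma bs_bound: "x \<in> bs \<Longrightarrow> \<exists>C\<ge>0. \<forall>n. mat_op_norm n (x n) \<le> C"
proof -
  assume x: "x \<in> bs"
  then obtain C where C: "\<And>n. mat_op_norm n (x n) \<le> C" unfolding bs_iff by blast
  have "0 \<le> C" using mat_op_norm_nonneg[OF bs_carrier[OF x, of 0]] C[of 0] by linarith
  then show ?thesis using C by blast
qed

lemma bs_ops [simp]:
  assumes x: "x \<in> bs"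
  shows "y \<in> bs \<Longrightarrow> (\<lambda>n. x n + y n) \<in> bs" "y \<in> bs \<Longrightarrow> (\<lambda>n. x n * y n) \<in> bs"
    "(\<lambda>n. c \<cdot>\<^sub>m x n) \<in> bs" "(\<lambda>n. mat_adjoint (x n)) \<in> bs" "(\<lambda>n. - x n) \<in> bs" "y \<in> bs \<Longrightarrow> (\<lambda>n. x n - y n) \<in> bs"
proof -
  obtain C where C: "C \<ge> 0" "\<And>n. mat_op_norm n (x n) \<le> C" using bs_bound[OF x] by blast
  show scal: "(\<lambda>n. c \<cdot>\<^sub>m x n) \<in> bs" for c
    by (rule bsI[where C = "cmod c * C"]) (use x C in \<open>auto simp: mat_op_norm_smult intro!: mult_left_mono\<close>)
  show "(\<lambda>n. mat_adjoint (x n)) \<in> bs"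
    by (rule bsI[where C = C]) (use x C in \<open>auto simp: mat_op_norm_adjoint\<close>)
  have neg: "- A = (-1) \<cdot>\<^sub>m A" for A :: "complex mat" by (intro eq_matI) auto
  show "(\<lambda>n. - x n) \<in> bs" unfolding neg by (rule scal)
  assume y: "y \<in> bs"
  obtain D where D: "D \<ge> 0" "\<And>n. mat_op_norm n (y n) \<le> D" using bs_bound[OF y] by blast
  show "(\<lambda>n. x n + y n) \<in> bs"
    by (rule bsI[where C = "C + D"]) (use x y C D in \<open>auto intro!: order_trans[OF mat_op_norm_triangle] add_mono\<close>)
  show "(\<lambda>n. x n * y n) \<in> bs"
    by (rule bsI[where C = "C * D"]) (use x y C D in \<open>auto intro!: order_trans[OF mat_op_norm_mult] mult_mono\<close>)
  show "(\<lambda>n. x n - y n) \<in> bs"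
  proof (rule bsI[where C = "C + D"])
    fix n
    have "x n - y n = x n + (-1) \<cdot>\<^sub>m y n" using bs_carrier[OF x] bs_carrier[OF y] by (intro eq_matI) auto
    then show "mat_op_norm n (x n - y n) \<le> C + D"
      using mat_op_norm_triangle[of "x n" n "(-1) \<cdot>\<^sub>m y n"] mat_op_norm_smult[of "y n" n "-1"] C(2)[of n] D(2)[of n] x y by simp
  qed (use x y in simp)
qed

lemma bs_const [simp]: "(\<lambda>n. 1\<^sub>m n) \<in> bs" "(\<lambda>n. 0\<^sub>m n n) \<in> bs"
  by (rule bsI[where C = 1], simp_all add: mat_op_norm_one)+

lemma cls_def: "x \<in> bs \<Longrightarrow> cls x = {y \<in> bs. null (\<lambda>n. x n - y n)}"
proof -
  assume x: "x \<in> bs"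
  have "norm2 (mat_alg n) (x n \<ominus>\<^bsub>mat_alg n\<^esub> y n) = mn2 n (x n - y n)" if "y \<in> bs" for y n
    using x that by simp
  then show ?thesis unfolding ultra_class_def null_def by auto
qed

lemma null_refl: "x \<in> bs \<Longrightarrow> null (\<lambda>n. x n - x n)"
proof -
  assume x: "x \<in> bs"
  have "x n - x n = 0\<^sub>m n n" for n using bs_carrier[OF x, of n] by (intro eq_matI) auto
  then show ?thesis by (simp add: null_def)
qed

lemma null_sym: "x \<in> bs \<Longrightarrow> y \<in> bs \<Longrightarrow> null (\<lambda>n. x n - y n) \<Longrightarrow> null (\<lambda>n. y n - x n)"
  unfolding null_def by (subst mn2_minus_commute) auto

lemma null_bound2:
  assumes "null x" "null y" "\<And>n. mn2 n (z n) \<le> K * mn2 n (x n) + L * mn2 n (y n)"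
  shows "null z"
  unfolding null_def
proof (rule tendsto_sandwich[OF always_eventually always_eventually tendsto_const])
  show "\<forall>n. 0 \<le> mn2 n (z n)" "\<forall>n. mn2 n (z n) \<le> K * mn2 n (x n) + L * mn2 n (y n)" using assms by auto
  show "((\<lambda>n. K * mn2 n (x n) + L * mn2 n (y n)) \<longlongrightarrow> 0) U"
    using tendsto_add[OF tendsto_mult_left tendsto_mult_left, of "\<lambda>n. mn2 n (x n)" 0 U "\<lambda>n. mn2 n (y n)" 0 K L] assms(1,2)
    by (simp add: null_def)
qed

lemma null_bound1: "null x \<Longrightarrow> (\<And>n. mn2 n (z n) \<le> K * mn2 n (x n)) \<Longrightarrow> null z"
  using null_bound2[of x x z K 0] by simp

lemma null_trans:
  assumes "x \<in> bs" "y \<in> bs" "z \<in> bs" "null (\<lambda>n. x n - y n)" "null (\<lambda>n. y n - z n)"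
  shows "null (\<lambda>n. x n - z n)"
  by (rule null_bound2[OF assms(4,5), of _ 1 1])
    (use mn2_triangle_minus[OF bs_carrier[OF assms(1)] bs_carrier[OF assms(2)] bs_carrier[OF assms(3)]] in simp)

lemma cls_eq_iff:
  assumes x: "x \<in> bs" and y: "y \<in> bs"
  shows "cls x = cls y \<longleftrightarrow> null (\<lambda>n. x n - y n)"
proof
  assume "cls x = cls y"
  moreover have "y \<in> cls y" using y null_refl by (simp add: cls_def)
  ultimately have "y \<in> cls x" by simp
  then show "null (\<lambda>n. x n - y n)" unfolding cls_def[OF x] by simp
next
  assume n: "null (\<lambda>n. x n - y n)"
  show "cls x = cls y"
    unfolding cls_def[OF x] cls_def[OF y]
    using null_trans[OF x y _ n] null_trans[OF y x _ null_sym[OF x y n]] by blast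
qed

lemma mem_cls: "x \<in> bs \<Longrightarrow> y \<in> cls x \<Longrightarrow> y \<in> bs \<and> cls y = cls x"
  using cls_eq_iff[of x y] by (auto simp: cls_def)

lemma self_mem_cls: "x \<in> bs \<Longrightarrow> x \<in> cls x"
  using null_refl by (simp add: cls_def)

lemma rep:
  assumes "x \<in> bs"
  shows "representative (cls x) \<in> bs" "null (\<lambda>n. x n - representative (cls x) n)"
proof -
  have "representative (cls x) \<in> cls x"
    unfolding representative_def by (rule someI[of "\<lambda>y. y \<in> cls x"]) (rule self_mem_cls[OF assms])
  then show "representative (cls x) \<in> bs" "null (\<lambda>n. x n - representative (cls x) n)"
    using assms by (simp_all add: cls_def)
qed

lemma carrier_Q: "carrier Q = cls ` bs"
  by (simp add: tracial_ultraproduct_def)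

lemma cls_carrier [simp]: "x \<in> bs \<Longrightarrow> cls x \<in> carrier Q"
  by (simp add: carrier_Q)

lemma carrierQ_E: "a \<in> carrier Q \<Longrightarrow> (\<And>x. x \<in> bs \<Longrightarrow> a = cls x \<Longrightarrow> P) \<Longrightarrow> P"
  by (auto simp: carrier_Q)

lemma cls_eqI: "x \<in> bs \<Longrightarrow> y \<in> bs \<Longrightarrow> null (\<lambda>n. x n - y n) \<Longrightarrow> cls x = cls y"
  using cls_eq_iff by blast

lemma null_minus_add:
  assumes b: "x \<in> bs" "y \<in> bs" "x' \<in> bs" "y' \<in> bs" and n: "null (\<lambda>n. x n - x' n)" "null (\<lambda>n. y n - y' n)"
  shows "null (\<lambda>n. (x n + y n) - (x' n + y' n))"
proof (rule null_bound2[OF n, of _ 1 1])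
  fix k
  have "(x k + y k) - (x' k + y' k) = (x k - x' k) + (y k - y' k)"
    using b[THEN bs_carrier, of k] by (intro eq_matI) auto
  then show "mn2 k ((x k + y k) - (x' k + y' k)) \<le> 1 * mn2 k (x k - x' k) + 1 * mn2 k (y k - y' k)"
    using mn2_triangle[of "x k - x' k" k "y k - y' k"] b[THEN bs_carrier, of k] by simp
qed

lemma null_minus_mult:
  assumes b: "x \<in> bs" "y \<in> bs" "x' \<in> bs" "y' \<in> bs" and n: "null (\<lambda>n. x n - x' n)" "null (\<lambda>n. y n - y' n)"
  shows "null (\<lambda>n. (x n * y n) - (x' n * y' n))"
proof -
  obtain K where K: "K \<ge> 0" "\<And>n. mat_op_norm n (y n) \<le> K" using bs_bound[OF b(2)] by blast
  obtain L where L: "L \<ge> 0" "\<And>n. mat_op_norm n (x' n) \<le> L" using bs_bound[OF b(3)] by blast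
  show ?thesis
  proof (rule null_bound2[OF n, of _ K L])
    fix k
    note c = b[THEN bs_carrier, of k]
    have "(x k * y k) - (x' k * y' k) = (x k * y k - x' k * y k) + (x' k * y k - x' k * y' k)"
      using c by (intro eq_matI) auto
    also have "x k * y k - x' k * y k = (x k - x' k) * y k"
      by (rule minus_mult_distrib_mat[symmetric]) (use c in auto)
    also have "x' k * y k - x' k * y' k = x' k * (y k - y' k)"
      by (rule mult_minus_distrib_mat[symmetric]) (use c in auto)
    finally have "mn2 k ((x k * y k) - (x' k * y' k)) \<le> mn2 k ((x k - x' k) * y k) + mn2 k (x' k * (y k - y' k))"
      using mn2_triangle[of "(x k - x' k) * y k" k "x' k * (y k - y' k)"] c by simp
    also have "mn2 k ((x k - x' k) * y k) \<le> mn2 k (x k - x' k) * mat_op_norm k (y k)"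
      by (rule mn2_mult_le') (use c in auto)
    also have "\<dots> \<le> mn2 k (x k - x' k) * K" using K by (intro mult_left_mono) auto
    also have "mn2 k (x' k * (y k - y' k)) \<le> mat_op_norm k (x' k) * mn2 k (y k - y' k)"
      by (rule mn2_mult_le) (use c in auto)
    also have "\<dots> \<le> L * mn2 k (y k - y' k)" using L by (intro mult_right_mono) auto
    finally show "mn2 k ((x k * y k) - (x' k * y' k)) \<le> K * mn2 k (x k - x' k) + L * mn2 k (y k - y' k)"
      by (simp add: mult.commute)
  qed
qed

text \<open>The operations are defined through one chosen representative of each class; 2-norm
  estimates show that every bounded representative gives the same result.\<close>

lemma Q_ops [simp]:
  "x \<in> bs \<Longrightarrow> y \<in> bs \<Longrightarrow> cls x \<oplus>\<^bsub>Q\<^esub> cls y = cls (\<lambda>n. x n + y n)"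
  "x \<in> bs \<Longrightarrow> y \<in> bs \<Longrightarrow> cls x \<otimes>\<^bsub>Q\<^esub> cls y = cls (\<lambda>n. x n * y n)"
  "\<one>\<^bsub>Q\<^esub> = cls (\<lambda>n. 1\<^sub>m n)" "\<zero>\<^bsub>Q\<^esub> = cls (\<lambda>n. 0\<^sub>m n n)"
  "x \<in> bs \<Longrightarrow> scal Q c (cls x) = cls (\<lambda>n. c \<cdot>\<^sub>m x n)"
  "x \<in> bs \<Longrightarrow> star Q (cls x) = cls (\<lambda>n. mat_adjoint (x n))"
proof -
  assume x: "x \<in> bs"
  note rx = rep[OF x]
  note sx = null_sym[OF x rx]
  show "star Q (cls x) = cls (\<lambda>n. mat_adjoint (x n))"
  proof -
    have "null (\<lambda>n. mat_adjoint (representative (cls x) n) - mat_adjoint (x n))"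
    proof (rule null_bound1[OF sx, of _ 1])
      fix k
      have c: "x k \<in> carrier_mat k k" "representative (cls x) k \<in> carrier_mat k k" using x rx by auto
      then show "mn2 k (mat_adjoint (representative (cls x) k) - mat_adjoint (x k)) \<le> 1 * mn2 k (representative (cls x) k - x k)"
        using mn2_adjoint[of "representative (cls x) k - x k" k] by (simp add: mat_adjoint_minus[where n=k and m=k])
    qed
    then have "cls (\<lambda>n. mat_adjoint (representative (cls x) n)) = cls (\<lambda>n. mat_adjoint (x n))"
      using x rx by (intro cls_eqI) auto
    then show ?thesis by (simp add: tracial_ultraproduct_def)
  qed
  show "scal Q c (cls x) = cls (\<lambda>n. c \<cdot>\<^sub>m x n)"
  proof -
    have "null (\<lambda>n. c \<cdot>\<^sub>m representative (cls x) n - c \<cdot>\<^sub>m x n)"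
    proof (rule null_bound1[OF sx, of _ "cmod c"])
      fix k
      have c: "x k \<in> carrier_mat k k" "representative (cls x) k \<in> carrier_mat k k" using x rx by auto
      then have "c \<cdot>\<^sub>m representative (cls x) k - c \<cdot>\<^sub>m x k = c \<cdot>\<^sub>m (representative (cls x) k - x k)"
        by (intro eq_matI) (auto simp: right_diff_distrib)
      then show "mn2 k (c \<cdot>\<^sub>m representative (cls x) k - c \<cdot>\<^sub>m x k) \<le> cmod c * mn2 k (representative (cls x) k - x k)"
        using mn2_smult[of "representative (cls x) k - x k" k c] c by simp
    qed
    then have "cls (\<lambda>n. c \<cdot>\<^sub>m representative (cls x) n) = cls (\<lambda>n. c \<cdot>\<^sub>m x n)"
      using x rx by (intro cls_eqI) auto
    then show ?thesis by (simp add: tracial_ultraproduct_def)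
  qed
  assume y: "y \<in> bs"
  note ry = rep[OF y]
  note sy = null_sym[OF y ry]
  have "cls (\<lambda>n. representative (cls x) n + representative (cls y) n) = cls (\<lambda>n. x n + y n)"
    using x y rx ry null_minus_add[OF rx(1) ry(1) x y sx sy] by (intro cls_eqI) auto
  then show "cls x \<oplus>\<^bsub>Q\<^esub> cls y = cls (\<lambda>n. x n + y n)" by (simp add: tracial_ultraproduct_def)
  have "cls (\<lambda>n. representative (cls x) n * representative (cls y) n) = cls (\<lambda>n. x n * y n)"
    using x y rx ry null_minus_mult[OF rx(1) ry(1) x y sx sy] by (intro cls_eqI) auto
  then show "cls x \<otimes>\<^bsub>Q\<^esub> cls y = cls (\<lambda>n. x n * y n)" by (simp add: tracial_ultraproduct_def)
qed (simp_all add: tracial_ultraproduct_def)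

lemma ring_Q: "ring Q"
proof (intro ringI abelian_groupI monoidI)
  fix a assume "a \<in> carrier Q"
  then obtain x where x: "x \<in> bs" "a = cls x" by (rule carrierQ_E)
  note cx = bs_carrier[OF x(1)]
  show "\<exists>b\<in>carrier Q. b \<oplus>\<^bsub>Q\<^esub> a = \<zero>\<^bsub>Q\<^esub>"
    by (rule bexI[of _ "cls (\<lambda>n. - x n)"]) (use x in \<open>simp_all add: uminus_l_inv_mat[OF cx]\<close>)
  show "\<one>\<^bsub>Q\<^esub> \<otimes>\<^bsub>Q\<^esub> a = a" "a \<otimes>\<^bsub>Q\<^esub> \<one>\<^bsub>Q\<^esub> = a" "\<zero>\<^bsub>Q\<^esub> \<oplus>\<^bsub>Q\<^esub> a = a"
    using x by (simp_all add: sq_one_mult[OF cx] left_add_zero_mat[OF cx])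
  fix b assume "b \<in> carrier Q"
  then obtain y where y: "y \<in> bs" "b = cls y" by (rule carrierQ_E)
  note cy = bs_carrier[OF y(1)]
  show "a \<oplus>\<^bsub>Q\<^esub> b \<in> carrier Q" "a \<otimes>\<^bsub>Q\<^esub> b \<in> carrier Q" using x y by simp_all
  show "a \<oplus>\<^bsub>Q\<^esub> b = b \<oplus>\<^bsub>Q\<^esub> a" using x y by (simp add: comm_add_mat[OF cx cy])
  fix c assume "c \<in> carrier Q"
  then obtain z where z: "z \<in> bs" "c = cls z" by (rule carrierQ_E)
  note cz = bs_carrier[OF z(1)]
  show "a \<oplus>\<^bsub>Q\<^esub> b \<oplus>\<^bsub>Q\<^esub> c = a \<oplus>\<^bsub>Q\<^esub> (b \<oplus>\<^bsub>Q\<^esub> c)" using x y z by (simp add: assoc_add_mat[OF cx cy cz])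
  show "a \<otimes>\<^bsub>Q\<^esub> b \<otimes>\<^bsub>Q\<^esub> c = a \<otimes>\<^bsub>Q\<^esub> (b \<otimes>\<^bsub>Q\<^esub> c)" using x y z by (simp add: sq_assoc[OF cx cy cz])
  show "(a \<oplus>\<^bsub>Q\<^esub> b) \<otimes>\<^bsub>Q\<^esub> c = a \<otimes>\<^bsub>Q\<^esub> c \<oplus>\<^bsub>Q\<^esub> b \<otimes>\<^bsub>Q\<^esub> c"
    using x y z by (simp add: add_mult_distrib_mat[OF cx cy cz])
  show "c \<otimes>\<^bsub>Q\<^esub> (a \<oplus>\<^bsub>Q\<^esub> b) = c \<otimes>\<^bsub>Q\<^esub> a \<oplus>\<^bsub>Q\<^esub> c \<otimes>\<^bsub>Q\<^esub> b"
    using x y z by (simp add: mult_add_distrib_mat[OF cz cx cy])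
qed simp_all

lemma Q_minus [simp]:
  assumes x: "x \<in> bs" and y: "y \<in> bs"
  shows "cls x \<ominus>\<^bsub>Q\<^esub> cls y = cls (\<lambda>n. x n - y n)"
proof -
  interpret ring Q by (rule ring_Q)
  have "\<ominus>\<^bsub>Q\<^esub> cls y = cls (\<lambda>n. - y n)"
    by (rule minus_equality) (use y in \<open>simp_all add: uminus_l_inv_mat[OF bs_carrier[OF y]]\<close>)
  moreover have "x n + - y n = x n - y n" for n by (rule add_uminus_minus_mat[OF bs_carrier[OF x] bs_carrier[OF y]])
  ultimately show ?thesis using x y by (simp add: a_minus_def)
qed

section \<open>Trace, 2-norm and quotient norm as limits\<close>

lemma tr_Q:
  assumes x: "x \<in> bs"
  shows "((\<lambda>n. mtr n (x n)) \<longlongrightarrow> tr Q (cls x)) U"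
proof -
  obtain C where C: "\<And>n. mat_op_norm n (x n) \<le> C" using bs_bound[OF x] by blast
  have "cmod (mtr n (x n)) \<le> C" for n
    using mtr_le_mn2[OF bs_carrier[OF x, of n]] mn2_le_op_norm[OF bs_carrier[OF x, of n]] C[of n] by linarith
  then obtain l where l: "((\<lambda>n. mtr n (x n)) \<longlongrightarrow> l) U"
    using bounded_lim[of "\<lambda>n. mtr n (x n)"] by blast
  note rx = rep[OF x]
  have "((\<lambda>n. mtr n (x n) - mtr n (representative (cls x) n)) \<longlongrightarrow> 0) U"
  proof (rule tendsto_0_le[where K = 1])
    show "((\<lambda>n. mn2 n (x n - representative (cls x) n)) \<longlongrightarrow> 0) U" using rx(2) by (simp add: null_def)
    show "eventually (\<lambda>n. cmod (mtr n (x n) - mtr n (representative (cls x) n)) \<le> norm (mn2 n (x n - representative (cls x) n)) * 1) U"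
    proof (rule always_eventually, rule allI)
      fix n
      have c: "x n \<in> carrier_mat n n" "representative (cls x) n \<in> carrier_mat n n" using x rx by auto
      show "cmod (mtr n (x n) - mtr n (representative (cls x) n)) \<le> norm (mn2 n (x n - representative (cls x) n)) * 1"
        using mtr_le_mn2[of "x n - representative (cls x) n" n] c by (simp add: mtr_minus)
    qed
  qed
  from tendsto_diff[OF l this] have "((\<lambda>n. mtr n (representative (cls x) n)) \<longlongrightarrow> l) U" by simp
  from Lim_eq[OF this] have "tr Q (cls x) = l" by (simp add: tracial_ultraproduct_def)
  then show ?thesis using l by simp
qed

lemma norm2_Q:
  assumes x: "x \<in> bs"
  shows "((\<lambda>n. mn2 n (x n)) \<longlongrightarrow> norm2 Q (cls x)) U"
proof -
  have "((\<lambda>n. mtr n (mat_adjoint (x n) * x n)) \<longlongrightarrow> tr Q (star Q (cls x) \<otimes>\<^bsub>Q\<^esub> cls x)) U"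
    using tr_Q[of "\<lambda>n. mat_adjoint (x n) * x n"] x by simp
  then have "((\<lambda>n. sqrt (Re (mtr n (mat_adjoint (x n) * x n)))) \<longlongrightarrow> norm2 Q (cls x)) U"
    unfolding norm2_def by (intro tendsto_real_sqrt tendsto_Re)
  moreover have "sqrt (Re (mtr n (mat_adjoint (x n) * x n))) = mn2 n (x n)" for n
    using bs_carrier[OF x, of n] by (simp add: mtr_adjoint_self flip: of_real_power)
  ultimately show ?thesis by simp
qed

lemma norm2_Q_0: "x \<in> bs \<Longrightarrow> norm2 Q (cls x) = 0 \<longleftrightarrow> null x"
  using norm2_Q[of x] lim_unique unfolding null_def by metis

lemma cnorm_Q: "cnorm Q A = (INF x\<in>A. SUP n. mat_op_norm n (x n))"
  by (simp add: tracial_ultraproduct_def)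

lemma sup_norm:
  assumes "x \<in> bs"
  shows "mat_op_norm n (x n) \<le> (SUP n. mat_op_norm n (x n))" "0 \<le> (SUP n. mat_op_norm n (x n))"
proof -
  obtain C where C: "\<And>n. mat_op_norm n (x n) \<le> C" using bs_bound[OF assms] by blast
  have b: "bdd_above (range (\<lambda>n. mat_op_norm n (x n)))" by (rule bdd_aboveI[where M = C]) (use C in auto)
  show le: "mat_op_norm n (x n) \<le> (SUP n. mat_op_norm n (x n))" for n by (rule cSUP_upper[OF _ b]) simp
  show "0 \<le> (SUP n. mat_op_norm n (x n))" using le[of 0] mat_op_norm_nonneg[OF bs_carrier[OF assms, of 0]] by linarith
qed

lemma cnorm_Q_le:
  assumes x: "x \<in> bs" and r: "\<And>n. mat_op_norm n (x n) \<le> r"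
  shows "cnorm Q (cls x) \<le> r"
proof -
  have "bdd_below ((\<lambda>x. SUP n. mat_op_norm n (x n)) ` cls x)"
    by (rule bdd_belowI[where m = 0]) (use sup_norm(2) mem_cls[OF x] in auto)
  then have "cnorm Q (cls x) \<le> (SUP n. mat_op_norm n (x n))"
    unfolding cnorm_Q by (rule cINF_lower[OF _ self_mem_cls[OF x]])
  also have "\<dots> \<le> r" by (rule cSUP_least) (use r in auto)
  finally show ?thesis .
qed

lemma cnorm_Q_rep:
  assumes x: "x \<in> bs" and e: "e > 0"
  shows "\<exists>y\<in>bs. cls y = cls x \<and> (\<forall>n. mat_op_norm n (y n) \<le> cnorm Q (cls x) + e)"
proof -
  have "bdd_below ((\<lambda>x. SUP n. mat_op_norm n (x n)) ` cls x)"
    by (rule bdd_belowI[where m = 0]) (use sup_norm(2) mem_cls[OF x] in auto)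
  moreover have "cls x \<noteq> {}" using self_mem_cls[OF x] by blast
  ultimately obtain y where y: "y \<in> cls x" "(SUP n. mat_op_norm n (y n)) < cnorm Q (cls x) + e"
    using cINF_less_iff[of "cls x" "\<lambda>x. SUP n. mat_op_norm n (x n)" "cnorm Q (cls x) + e"] e by (auto simp: cnorm_Q)
  have yb: "y \<in> bs" "cls y = cls x" using mem_cls[OF x y(1)] by auto
  have "mat_op_norm n (y n) \<le> cnorm Q (cls x) + e" for n using sup_norm(1)[OF yb(1), of n] y(2) by linarith
  then show ?thesis using yb by blast
qed

lemma cnorm_Q_nonneg: "x \<in> bs \<Longrightarrow> 0 \<le> cnorm Q (cls x)"
  unfolding cnorm_Q by (rule cINF_greatest) (use self_mem_cls mem_cls sup_norm(2) in blast)+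

text \<open>The quotient norm is an infimum, which directly gives only representatives bounded by r
  + 1/(k + 1). A diagonal sequence of these, shrunk slightly, obeys the exact bound. Los's theorem
  needs it exactly, because quantifiers range over the same radius in every factor.\<close>

lemma op_ball_rep:
  assumes a: "a \<in> op_ball Q r" and r: "r > 0"
  shows "\<exists>x\<in>bs. a = cls x \<and> (\<forall>n. mat_op_norm n (x n) \<le> r)"
proof -
  have "a \<in> carrier Q" and ar: "cnorm Q a \<le> r" using a by (auto simp: op_ball_def)
  then obtain x where x: "x \<in> bs" "a = cls x" using carrierQ_E by blast
  have "\<exists>y\<in>bs. cls y = cls x \<and> (\<forall>n. mat_op_norm n (y n) \<le> r + 1 / real (Suc k))" for k
  proof -
    obtain y where y: "y \<in> bs" "cls y = cls x" "\<forall>n. mat_op_norm n (y n) \<le> cnorm Q (cls x) + 1 / real (Suc k)"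
      using cnorm_Q_rep[OF x(1), of "1 / real (Suc k)"] by auto
    have "mat_op_norm n (y n) \<le> r + 1 / real (Suc k)" for n
      by (rule order_trans[OF y(3)[rule_format] add_right_mono]) (use ar x(2) in simp)
    then show ?thesis using y by blast
  qed
  then obtain y where y: "\<And>k. y k \<in> bs" "\<And>k. cls (y k) = cls x" "\<And>k n. mat_op_norm n (y k n) \<le> r + 1 / real (Suc k)"
    by metis
  have "eventually (\<lambda>n. mn2 n (y k n - x n) < 1 / real (Suc k)) U" for k
  proof -
    have "null (\<lambda>n. y k n - x n)" using y(2)[of k] cls_eq_iff[OF y(1) x(1)] by blast
    then show ?thesis unfolding null_def by (rule order_tendstoD(2)) simp
  qed
  then obtain \<kappa> where \<kappa>: "\<And>i. eventually (\<lambda>n. i \<le> \<kappa> n) U"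
    and k2: "eventually (\<lambda>n. mn2 n (y (\<kappa> n) n - x n) < 1 / real (Suc (\<kappa> n))) U"
    using diagonal[of "\<lambda>k n. mn2 n (y k n - x n) < 1 / real (Suc k)"] by blast
  \<comment> \<open>The factor that shrinks the bound r + 1/(\<kappa> n + 1) to r. The resulting
    change has 2-norm at most (1 - s n) (r + 1/(\<kappa> n + 1)) = 1/(\<kappa> n + 1), hence tends
    to 0 along the ultrafilter.\<close>
  define s where "s n = r / (r + 1 / real (Suc (\<kappa> n)))" for n
  have s: "0 \<le> s n" "s n \<le> 1" "s n * (r + 1 / real (Suc (\<kappa> n))) = r" for n
  proof -
    have p: "0 < 1 / real (Suc (\<kappa> n))" by simp
    then have q: "0 < r + 1 / real (Suc (\<kappa> n))" using r by linarith
    show "0 \<le> s n" unfolding s_def using r q by (intro divide_nonneg_nonneg) linarith+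
    show "s n \<le> 1" unfolding s_def divide_le_eq_1_pos[OF q] using p by linarith
    have "r + 1 / real (Suc (\<kappa> n)) \<noteq> 0" by (rule less_imp_neq[OF q, THEN not_sym])
    from nonzero_eq_divide_eq[OF this, THEN iffD1, OF refl]
    show "s n * (r + 1 / real (Suc (\<kappa> n))) = r" unfolding s_def .
  qed
  define z where "z n = complex_of_real (s n) \<cdot>\<^sub>m y (\<kappa> n) n" for n
  have zc: "z n \<in> carrier_mat n n" for n by (simp add: z_def y(1))
  have zr: "mat_op_norm n (z n) \<le> r" for n
  proof -
    have "mat_op_norm n (z n) = s n * mat_op_norm n (y (\<kappa> n) n)"
      using s(1) by (simp add: z_def mat_op_norm_smult y(1))
    also have "\<dots> \<le> s n * (r + 1 / real (Suc (\<kappa> n)))" by (intro mult_left_mono y(3) s(1))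
    finally show ?thesis by (simp only: s(3))
  qed
  have zb: "z \<in> bs" by (rule bsI[OF zc zr])
  have small: "((\<lambda>n. 1 / real (Suc (\<kappa> n))) \<longlongrightarrow> 0) U"
  proof (rule tendstoI)
    fix e :: real assume "e > 0"
    then obtain i where i: "1 / real (Suc i) < e" using nat_approx_posE by blast
    have "dist (1 / real (Suc (\<kappa> n))) 0 < e" if "i \<le> \<kappa> n" for n
    proof -
      have "1 / real (Suc (\<kappa> n)) \<le> 1 / real (Suc i)" using that by (intro divide_left_mono) auto
      then show ?thesis using i by simp
    qed
    then show "eventually (\<lambda>n. dist (1 / real (Suc (\<kappa> n))) 0 < e) U" using \<kappa>[of i] by (rule eventually_mono[rotated])
  qed
  have est: "eventually (\<lambda>n. mn2 n (z n - x n) \<le> 2 * (1 / real (Suc (\<kappa> n)))) U"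
    using k2
  proof eventually_elim
    case (elim n)
    have "z n - y (\<kappa> n) n = complex_of_real (s n - 1) \<cdot>\<^sub>m y (\<kappa> n) n"
      using bs_carrier[OF y(1), of "\<kappa> n" n] by (intro eq_matI) (auto simp: z_def left_diff_distrib)
    then have "mn2 n (z n - y (\<kappa> n) n) = (1 - s n) * mn2 n (y (\<kappa> n) n)"
      using s(2)[of n] by (simp add: mn2_smult y(1) norm_of_real[of "s n - 1"] del: of_real_diff)
    also have "\<dots> \<le> (1 - s n) * (r + 1 / real (Suc (\<kappa> n)))"
      using s(2)[of n] mn2_le_op_norm[OF bs_carrier[OF y(1)], of n "\<kappa> n"] y(3)[of n "\<kappa> n"] by (intro mult_left_mono) auto
    also have "\<dots> = 1 / real (Suc (\<kappa> n))" using s(3)[of n] by (simp add: left_diff_distrib)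
    finally show ?case
      using mn2_triangle_minus[OF zc bs_carrier[OF y(1)] bs_carrier[OF x(1)], of n "\<kappa> n"] elim by linarith
  qed
  have "null (\<lambda>n. z n - x n)"
    unfolding null_def
  proof (rule tendsto_sandwich[OF always_eventually est tendsto_const])
    show "((\<lambda>n. 2 * (1 / real (Suc (\<kappa> n)))) \<longlongrightarrow> 0) U" using tendsto_mult_left[OF small, of 2] by simp
  qed simp
  then have "cls z = cls x" by (rule cls_eqI[OF zb x(1)])
  then show ?thesis using zb zr x(2) by blast
qed

end

lemma interp_bounded_ball:
  assumes "well_formed \<phi>" "\<And>j. c j > 0"
  shows "\<exists>B. \<forall>n Y. (\<forall>j. Y j \<in> op_ball (mat_alg n) (c j)) \<longrightarrow> \<bar>interp (mat_alg n) \<phi> Y\<bar> \<le> B"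
proof -
  obtain B where B: "\<And>n X. X \<in> unit_tuples n \<Longrightarrow> \<bar>interp (mat_alg n) \<phi> (scaled c X)\<bar> \<le> B"
    using interp_bounded[OF assms(1), of c] by blast
  have "\<bar>interp (mat_alg n) \<phi> Y\<bar> \<le> B" if Y: "\<forall>j. Y j \<in> op_ball (mat_alg n) (c j)" for n Y
  proof -
    have "\<exists>x. x \<in> op_ball (mat_alg n) 1 \<and> Y j = complex_of_real (c j) \<cdot>\<^sub>m x" for j
      using Y op_ball_scaled[OF assms(2), of n j] by blast
    then obtain X where X: "\<And>j. X j \<in> op_ball (mat_alg n) 1" "\<And>j. Y j = complex_of_real (c j) \<cdot>\<^sub>m X j" by metis
    have "Y = scaled c X" using X(2) by blast
    moreover have "X \<in> unit_tuples n" using X(1) by (simp add: unit_tuples_def)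
    ultimately show ?thesis using B by simp
  qed
  then show ?thesis by blast
qed

context ultra
begin

lemma tr_Q_ops:
  assumes x: "x \<in> bs" and y: "y \<in> bs"
  shows "tr Q (cls (\<lambda>n. x n + y n)) = tr Q (cls x) + tr Q (cls y)"
    "tr Q (cls (\<lambda>n. x n * y n)) = tr Q (cls (\<lambda>n. y n * x n))"
    "tr Q (cls (\<lambda>n. c \<cdot>\<^sub>m x n)) = c * tr Q (cls x)"
proof -
  note cx = bs_carrier[OF x] and cy = bs_carrier[OF y]
  have "((\<lambda>n. mtr n (x n + y n)) \<longlongrightarrow> tr Q (cls x) + tr Q (cls y)) U"
    unfolding mtr_add[OF cx cy] by (intro tendsto_add tr_Q x y)
  then show "tr Q (cls (\<lambda>n. x n + y n)) = tr Q (cls x) + tr Q (cls y)"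
    using lim_unique[OF tr_Q[of "\<lambda>n. x n + y n"]] x y by simp
  have "((\<lambda>n. mtr n (x n * y n)) \<longlongrightarrow> tr Q (cls (\<lambda>n. y n * x n))) U"
    unfolding mtr_comm[OF cx cy] by (intro tr_Q) (use x y in simp)
  then show "tr Q (cls (\<lambda>n. x n * y n)) = tr Q (cls (\<lambda>n. y n * x n))"
    using lim_unique[OF tr_Q[of "\<lambda>n. x n * y n"]] x y by simp
  have "((\<lambda>n. mtr n (c \<cdot>\<^sub>m x n)) \<longlongrightarrow> c * tr Q (cls x)) U"
    unfolding mtr_smult[OF cx] by (intro tendsto_mult tendsto_const tr_Q x)
  then show "tr Q (cls (\<lambda>n. c \<cdot>\<^sub>m x n)) = c * tr Q (cls x)"
    using lim_unique[OF tr_Q[of "\<lambda>n. c \<cdot>\<^sub>m x n"]] x by simp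
qed

text \<open>Representatives may exceed the quotient norm by \<open>e\<close>; the estimates are
  proved with this error, and then \<open>e\<close> tends to 0.\<close>

lemma norm2_Q_le_cnorm:
  assumes x: "x \<in> bs" and y: "y \<in> bs"
  shows "norm2 Q (cls (\<lambda>n. x n * y n)) \<le> cnorm Q (cls x) * norm2 Q (cls y)"
    "norm2 Q (cls x) \<le> cnorm Q (cls x)"
proof -
  have est: "norm2 Q (cls (\<lambda>n. x n * y n)) \<le> (cnorm Q (cls x) + e) * norm2 Q (cls y)" if e: "e > 0" for e
  proof -
    obtain x' where x': "x' \<in> bs" "cls x' = cls x" "\<And>n. mat_op_norm n (x' n) \<le> cnorm Q (cls x) + e"
      using cnorm_Q_rep[OF x e] by blast
    have "cls (\<lambda>n. x n * y n) = cls x' \<otimes>\<^bsub>Q\<^esub> cls y" unfolding x'(2) using x y by simp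
    also have "\<dots> = cls (\<lambda>n. x' n * y n)" by (rule Q_ops(2)[OF x'(1) y])
    finally have eq: "cls (\<lambda>n. x n * y n) = cls (\<lambda>n. x' n * y n)" .
    show ?thesis
      unfolding eq
    proof (rule lim_le[OF norm2_Q tendsto_mult[OF tendsto_const norm2_Q[OF y]]])
      fix n
      have "mn2 n (x' n * y n) \<le> mat_op_norm n (x' n) * mn2 n (y n)"
        by (rule mn2_mult_le[OF bs_carrier[OF x'(1)] bs_carrier[OF y]])
      also have "\<dots> \<le> (cnorm Q (cls x) + e) * mn2 n (y n)" by (intro mult_right_mono x'(3)) simp
      finally show "mn2 n (x' n * y n) \<le> (cnorm Q (cls x) + e) * mn2 n (y n)" .
    qed (use x' y in simp)
  qed
  show "norm2 Q (cls (\<lambda>n. x n * y n)) \<le> cnorm Q (cls x) * norm2 Q (cls y)"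
  proof (rule tendsto_lowerbound[of "\<lambda>e. (cnorm Q (cls x) + e) * norm2 Q (cls y)" _ "at_right 0"])
    show "((\<lambda>e. (cnorm Q (cls x) + e) * norm2 Q (cls y)) \<longlongrightarrow> cnorm Q (cls x) * norm2 Q (cls y)) (at_right 0)"
      by (rule tendsto_eq_intros refl | simp)+
    show "eventually (\<lambda>e. norm2 Q (cls (\<lambda>n. x n * y n)) \<le> (cnorm Q (cls x) + e) * norm2 Q (cls y)) (at_right 0)"
      using eventually_at_right_less[of "0::real"] by (rule eventually_mono) (rule est)
  qed simp
  show "norm2 Q (cls x) \<le> cnorm Q (cls x)"
  proof (rule field_le_epsilon)
    fix e :: real assume "e > 0"
    then obtain x' where x': "x' \<in> bs" "cls x' = cls x" "\<And>n. mat_op_norm n (x' n) \<le> cnorm Q (cls x) + e"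
      using cnorm_Q_rep[OF x] by blast
    show "norm2 Q (cls x) \<le> cnorm Q (cls x) + e"
    proof (subst x'(2)[symmetric], rule lim_le[OF norm2_Q[OF x'(1)] tendsto_const])
      show "mn2 n (x' n) \<le> cnorm Q (cls x) + e" for n
        using mn2_le_op_norm[OF bs_carrier[OF x'(1)], of n] x'(3)[of n] by linarith
    qed
  qed
qed

text \<open>Apart from monotone completeness, everything passes to the limit from matrices. For
  monotone completeness the representatives of all \<open>c k\<close> must share one norm bound, so
  that a diagonal sequence through them is bounded and defines an element again.\<close>

lemma pretracial_Q: "pretracial Q"
proof (intro pretracial.intro ring_Q pretracial_axioms.intro)
  fix a assume "a \<in> carrier Q"
  then obtain x where x: "x \<in> bs" "a = cls x" by (rule carrierQ_E)
  note cx = bs_carrier[OF x(1)]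
  show "star Q a \<in> carrier Q" "star Q (star Q a) = a" using x by simp_all
  have tn: "tr Q (star Q a \<otimes>\<^bsub>Q\<^esub> a) = complex_of_real ((norm2 Q a)\<^sup>2)"
  proof -
    have "((\<lambda>n. mtr n (mat_adjoint (x n) * x n)) \<longlongrightarrow> tr Q (star Q a \<otimes>\<^bsub>Q\<^esub> a)) U"
      using tr_Q[of "\<lambda>n. mat_adjoint (x n) * x n"] x by simp
    moreover have "((\<lambda>n. mtr n (mat_adjoint (x n) * x n)) \<longlongrightarrow> complex_of_real ((norm2 Q a)\<^sup>2)) U"
      unfolding mtr_adjoint_self[OF cx] x(2) by (intro tendsto_of_real tendsto_power norm2_Q x(1))
    ultimately show ?thesis by (rule lim_unique)
  qed
  show "0 \<le> Re (tr Q (star Q a \<otimes>\<^bsub>Q\<^esub> a))" unfolding tn by simp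
  show "norm2 Q a = 0 \<Longrightarrow> a = \<zero>\<^bsub>Q\<^esub>"
  proof -
    assume "norm2 Q a = 0"
    then have n: "null x" using norm2_Q_0[OF x(1)] x(2) by simp
    have "x n - 0\<^sub>m n n = x n" for n using cx[of n] by (intro eq_matI) auto
    then have "cls x = cls (\<lambda>n. 0\<^sub>m n n)" using n x by (intro cls_eqI) simp_all
    then show "a = \<zero>\<^bsub>Q\<^esub>" using x by simp
  qed
  show "norm2 Q a \<le> cnorm Q a" using norm2_Q_le_cnorm(2)[OF x(1) x(1)] x(2) by simp
  show "cmod (tr Q a) \<le> norm2 Q a"
    unfolding x(2) by (rule lim_le[OF tendsto_norm[OF tr_Q[OF x(1)]] norm2_Q[OF x(1)]]) (rule mtr_le_mn2[OF cx])
  fix b assume "b \<in> carrier Q"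
  then obtain y where y: "y \<in> bs" "b = cls y" by (rule carrierQ_E)
  note cy = bs_carrier[OF y(1)]
  show "star Q (a \<oplus>\<^bsub>Q\<^esub> b) = star Q a \<oplus>\<^bsub>Q\<^esub> star Q b" using x y by (simp add: mat_adjoint_add[OF cx cy])
  show "star Q (a \<otimes>\<^bsub>Q\<^esub> b) = star Q b \<otimes>\<^bsub>Q\<^esub> star Q a" using x y by (simp add: mat_adjoint_mult[OF cx cy])
  show "tr Q (a \<oplus>\<^bsub>Q\<^esub> b) = tr Q a + tr Q b" using x y by (simp add: tr_Q_ops(1))
  show "tr Q (a \<otimes>\<^bsub>Q\<^esub> b) = tr Q (b \<otimes>\<^bsub>Q\<^esub> a)" using x y tr_Q_ops(2)[OF x(1) y(1)] by simp
  show "norm2 Q (a \<oplus>\<^bsub>Q\<^esub> b) \<le> norm2 Q a + norm2 Q b"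
  proof -
    have "norm2 Q (cls (\<lambda>n. x n + y n)) \<le> norm2 Q (cls x) + norm2 Q (cls y)"
      by (rule lim_le[OF norm2_Q tendsto_add[OF norm2_Q[OF x(1)] norm2_Q[OF y(1)]]]) (use x y mn2_triangle[OF cx cy] in simp_all)
    then show ?thesis using x y by simp
  qed
  show "norm2 Q (a \<otimes>\<^bsub>Q\<^esub> b) \<le> cnorm Q a * norm2 Q b" using norm2_Q_le_cnorm(1)[OF x(1) y(1)] x y by simp
next
  fix d and c e :: "nat \<Rightarrow> (nat \<Rightarrow> complex mat) set"
  assume d: "d \<in> carrier Q" and c: "\<And>k. c k \<in> carrier Q" and e: "\<And>k. e k \<in> carrier Q"
    and eq: "\<And>k. star Q (c k) \<otimes>\<^bsub>Q\<^esub> c k \<oplus>\<^bsub>Q\<^esub> star Q (e k) \<otimes>\<^bsub>Q\<^esub> e k = star Q d \<otimes>\<^bsub>Q\<^esub> d"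
    and cau: "\<And>\<epsilon>. \<epsilon> > 0 \<Longrightarrow> \<exists>N. \<forall>k\<ge>N. \<forall>l\<ge>N.
      norm2 Q (star Q (c k) \<otimes>\<^bsub>Q\<^esub> c k \<ominus>\<^bsub>Q\<^esub> star Q (c l) \<otimes>\<^bsub>Q\<^esub> c l) < \<epsilon>"
  obtain D where D: "D \<in> bs" "d = cls D" using d carrier_Q by blast
  obtain R where R: "R \<ge> 0" "\<And>n. mat_op_norm n (D n) \<le> R" using bs_bound[OF D(1)] by blast
  \<comment> \<open>The common bound comes from \<open>bounded_modification\<close>: the equation
    with \<open>d\<close> holds up to a null sequence, so the truncated matrices represent the same
    class.\<close>
  have "\<exists>C. C \<in> bs \<and> c k = cls C \<and> (\<forall>n. mat_op_norm n (C n) \<le> 1 + R\<^sup>2)" for k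
  proof -
    obtain C where C: "C \<in> bs" "c k = cls C" using c[of k] carrier_Q by blast
    obtain E where E: "E \<in> bs" "e k = cls E" using e[of k] carrier_Q by blast
    have "cls (\<lambda>n. mat_adjoint (C n) * C n + mat_adjoint (E n) * E n) = cls (\<lambda>n. mat_adjoint (D n) * D n)"
      using eq[of k] C E D by simp
    then have nl: "null (\<lambda>n. mat_adjoint (C n) * C n + mat_adjoint (E n) * E n - mat_adjoint (D n) * D n)"
      using C E D by (subst (asm) cls_eq_iff) simp_all
    have "\<exists>C'. C' \<in> carrier_mat n n \<and> mat_op_norm n C' \<le> 1 + (mat_op_norm n (D n))\<^sup>2 \<and>
      mn2 n (C' - C n) \<le> mn2 n (mat_adjoint (C n) * C n + mat_adjoint (E n) * E n - mat_adjoint (D n) * D n)" for n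
      using bounded_modification[OF bs_carrier[OF C(1)] bs_carrier[OF E(1)] bs_carrier[OF D(1)], of n] by blast
    then obtain C' where C': "\<And>n. C' n \<in> carrier_mat n n" "\<And>n. mat_op_norm n (C' n) \<le> 1 + (mat_op_norm n (D n))\<^sup>2"
      "\<And>n. mn2 n (C' n - C n) \<le> mn2 n (mat_adjoint (C n) * C n + mat_adjoint (E n) * E n - mat_adjoint (D n) * D n)"
      by metis
    have b: "mat_op_norm n (C' n) \<le> 1 + R\<^sup>2" for n
    proof -
      have "(mat_op_norm n (D n))\<^sup>2 \<le> R\<^sup>2" by (rule power_mono[OF R(2)]) (simp add: D(1))
      then show ?thesis using C'(2)[of n] by linarith
    qed
    have C'b: "C' \<in> bs" by (rule bsI[OF C'(1) b])
    have "null (\<lambda>n. C' n - C n)" by (rule null_bound1[OF nl, of _ 1]) (use C'(3) in simp)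
    then have "cls C' = cls C" by (rule cls_eqI[OF C'b C(1)])
    then show ?thesis using C'b b C(2) by (intro exI[of _ C']) simp
  qed
  then obtain C where C: "\<And>k. C k \<in> bs" "\<And>k. c k = cls (C k)" "\<And>k n. mat_op_norm n (C k n) \<le> 1 + R\<^sup>2" by metis
  define S where "S k n = mat_adjoint (C k n) * C k n" for k n
  have Sb: "S k \<in> bs" for k unfolding S_def[abs_def] using C(1) by simp
  have sqc: "star Q (c k) \<otimes>\<^bsub>Q\<^esub> c k = cls (S k)" for k using C(1) by (simp add: C(2) S_def[abs_def])
  have "\<exists>N. \<forall>k\<ge>N. \<forall>l\<ge>N. norm2 Q (cls (\<lambda>n. S k n - S l n)) < 1 / real (Suc i)" for i
    using cau[of "1 / real (Suc i)"] Sb by (simp add: sqc)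
  then obtain f where f: "\<And>i k l. k \<ge> f i \<Longrightarrow> l \<ge> f i \<Longrightarrow> norm2 Q (cls (\<lambda>n. S k n - S l n)) < 1 / real (Suc i)" by metis
  \<comment> \<open>A monotone majorant of the Cauchy moduli: for j \<le> i both \<open>h i\<close>
    and \<open>h j\<close> are at least \<open>f j\<close>, so \<open>S (h i)\<close> and
    \<open>S (h j)\<close> are closer than 1/(j + 1).\<close>
  define h where "h i = (\<Sum>j\<le>i. f j)" for i
  have h: "f j \<le> h i" if "j \<le> i" for i j
    unfolding h_def using that by (intro member_le_sum) auto
  have "eventually (\<lambda>n. \<forall>j\<le>i. mn2 n (S (h i) n - S (h j) n) < 1 / real (Suc j)) U" for i
  proof -
    have "eventually (\<lambda>n. mn2 n (S (h i) n - S (h j) n) < 1 / real (Suc j)) U" if "j \<le> i" for j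
      by (rule lim_less_eventually[OF norm2_Q f]) (use Sb h[OF that] h[OF order_refl, of j] in simp_all)
    then have "eventually (\<lambda>n. \<forall>j\<in>{..i}. mn2 n (S (h i) n - S (h j) n) < 1 / real (Suc j)) U"
      by (intro eventually_ball_finite) auto
    then show ?thesis by (rule eventually_mono) simp
  qed
  then obtain \<kappa> where \<kappa>: "\<And>i. eventually (\<lambda>n. i \<le> \<kappa> n) U"
    and \<kappa>2: "eventually (\<lambda>n. \<forall>j\<le>\<kappa> n. mn2 n (S (h (\<kappa> n)) n - S (h j) n) < 1 / real (Suc j)) U"
    using diagonal[of "\<lambda>i n. \<forall>j\<le>i. mn2 n (S (h i) n - S (h j) n) < 1 / real (Suc j)"] by blast
  \<comment> \<open>At size \<open>n\<close> use the approximation with index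
    \<open>h (\<kappa> n)\<close>. For each fixed j the index \<kappa> n eventually exceeds j, which
    makes X* X close to \<open>S (h j)\<close>.\<close>
  define X where "X n = C (h (\<kappa> n)) n" for n
  have Xb: "X \<in> bs" by (rule bsI[where C = "1 + R\<^sup>2"]) (simp_all add: X_def C)
  have SX: "S (h (\<kappa> n)) n = mat_adjoint (X n) * X n" for n by (simp add: S_def X_def)
  have Yb: "(\<lambda>n. mat_adjoint (X n) * X n) \<in> bs" using Xb by simp
  have near: "norm2 Q (cls (\<lambda>n. mat_adjoint (X n) * X n - S (h j) n)) \<le> 1 / real (Suc j)" for j
  proof (rule tendsto_upperbound[OF norm2_Q _ U_ne])
    show "eventually (\<lambda>n. mn2 n (mat_adjoint (X n) * X n - S (h j) n) \<le> 1 / real (Suc j)) U"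
      using \<kappa>[of j] \<kappa>2 by eventually_elim (auto simp: SX[symmetric] intro: less_imp_le)
  qed (use Yb Sb in simp)
  have "(\<lambda>k. norm2 Q (cls (\<lambda>n. S k n - mat_adjoint (X n) * X n))) \<longlonglongrightarrow> 0"
  proof (rule metric_LIMSEQ_I)
    fix \<epsilon> :: real assume "\<epsilon> > 0"
    then obtain i where i: "1 / real (Suc i) < \<epsilon> / 2" using nat_approx_posE[of "\<epsilon> / 2"] by auto
    have "dist (norm2 Q (cls (\<lambda>n. S k n - mat_adjoint (X n) * X n))) 0 < \<epsilon>" if k: "k \<ge> f i" for k
    proof -
      have "norm2 Q (cls (\<lambda>n. S k n - mat_adjoint (X n) * X n))
        \<le> norm2 Q (cls (\<lambda>n. S k n - S (h i) n)) + norm2 Q (cls (\<lambda>n. mat_adjoint (X n) * X n - S (h i) n))"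
      proof (rule lim_le[OF norm2_Q tendsto_add[OF norm2_Q norm2_Q]])
        fix n
        show "mn2 n (S k n - mat_adjoint (X n) * X n) \<le> mn2 n (S k n - S (h i) n) + mn2 n (mat_adjoint (X n) * X n - S (h i) n)"
          using mn2_triangle_minus[OF bs_carrier[OF Sb] bs_carrier[OF Sb] bs_carrier[OF Yb], of n k "h i"]
            mn2_minus_commute[OF bs_carrier[OF Sb] bs_carrier[OF Yb], of n "h i"] by simp
      qed (use Sb Yb in simp_all)
      also have "\<dots> < 1 / real (Suc i) + 1 / real (Suc i)"
        by (rule add_less_le_mono[OF f[OF k h[OF order_refl]] near])
      finally have "norm2 Q (cls (\<lambda>n. S k n - mat_adjoint (X n) * X n)) < \<epsilon>" using i by linarith
      moreover have "0 \<le> norm2 Q (cls (\<lambda>n. S k n - mat_adjoint (X n) * X n))"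
        by (rule lim_le[OF tendsto_const norm2_Q]) (use Sb Yb in simp_all)
      ultimately show ?thesis by simp
    qed
    then show "\<exists>no. \<forall>k\<ge>no. dist (norm2 Q (cls (\<lambda>n. S k n - mat_adjoint (X n) * X n))) 0 < \<epsilon>" by blast
  qed
  moreover have "star Q (cls X) \<otimes>\<^bsub>Q\<^esub> cls X = cls (\<lambda>n. mat_adjoint (X n) * X n)" using Xb by simp
  ultimately show "\<exists>c'\<in>carrier Q. (\<lambda>k. norm2 Q (star Q (c k) \<otimes>\<^bsub>Q\<^esub> c k \<ominus>\<^bsub>Q\<^esub> star Q c' \<otimes>\<^bsub>Q\<^esub> c')) \<longlonglongrightarrow> 0"
    using Xb Sb Yb by (intro bexI[of _ "cls X"]) (simp_all add: sqc)
qed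

lemma eval_word_Q:
  assumes "\<And>i. Z i \<in> bs"
  shows "(\<lambda>n. mword n (\<lambda>i. Z i n) w) \<in> bs \<and> eval_word Q (\<lambda>i. cls (Z i)) w = cls (\<lambda>n. mword n (\<lambda>i. Z i n) w)"
proof (induction w)
  case (Cons ib w)
  show ?case using Cons assms by (cases "snd ib") simp_all
qed simp

lemma tr_eval_poly_Q:
  assumes Z: "\<And>i. Z i \<in> bs"
  shows "((\<lambda>n. tr (mat_alg n) (eval_poly (mat_alg n) (\<lambda>i. Z i n) p)) \<longlongrightarrow> tr Q (eval_poly Q (\<lambda>i. cls (Z i)) p)) U"
proof -
  interpret P: pretracial Q by (rule pretracial_Q)
  have "tr Q (eval_poly Q (\<lambda>i. cls (Z i)) p) = (\<Sum>w\<in>Poly_Mapping.keys p. Poly_Mapping.lookup p w * tr Q (eval_word Q (\<lambda>i. cls (Z i)) w))"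
  proof (rule tr_eval_poly)
    fix c a assume "a \<in> carrier Q"
    then obtain x where "x \<in> bs" "a = cls x" by (rule carrierQ_E)
    then show "tr Q (scal Q c a) = c * tr Q a" "scal Q c a \<in> carrier Q" by (simp_all add: tr_Q_ops(3))
  next
    fix w
    show "eval_word Q (\<lambda>i. cls (Z i)) w \<in> carrier Q"
      using eval_word_Q[where Z = Z and w = w, OF Z] cls_carrier by presburger
  qed (rule P.abelian_group_axioms, rule P.tadd)
  moreover have "tr (mat_alg n) (eval_poly (mat_alg n) (\<lambda>i. Z i n) p) = (\<Sum>w\<in>Poly_Mapping.keys p. Poly_Mapping.lookup p w * mtr n (mword n (\<lambda>i. Z i n) w))" for n
    by (rule tr_eval_poly_mat) (simp add: Z)
  moreover have "((\<lambda>n. mtr n (mword n (\<lambda>i. Z i n) w)) \<longlongrightarrow> tr Q (eval_word Q (\<lambda>i. cls (Z i)) w)) U" for w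
    using eval_word_Q[where Z = Z and w = w, OF Z] tr_Q by simp
  ultimately show ?thesis by (simp only:) (intro tendsto_sum tendsto_mult tendsto_const)
qed


section \<open>Los's theorem\<close>

text \<open>For the upper bound, \<open>rep\<close> turns a nearly optimal element of
  \<open>K\<close> into a sequence of competitors. For the lower bound, nearly optimal points of the
  sets \<open>A n\<close> form a sequence, and \<open>seq\<close> identifies the limit of their
  values as a value of \<open>G\<close>.\<close>

lemma tendsto_INF:
  fixes F :: "nat \<Rightarrow> 'b \<Rightarrow> real" and G :: "'c \<Rightarrow> real"
  assumes ne: "\<And>n. A n \<noteq> {}" "K \<noteq> {}"
    and bd: "\<And>n a. a \<in> A n \<Longrightarrow> \<bar>F n a\<bar> \<le> B"
    and seq: "\<And>x. (\<And>n. x n \<in> A n) \<Longrightarrow> \<exists>k\<in>K. ((\<lambda>n. F n (x n)) \<longlongrightarrow> G k) U"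
    and rep: "\<And>k. k \<in> K \<Longrightarrow> \<exists>x. (\<forall>n. x n \<in> A n) \<and> ((\<lambda>n. F n (x n)) \<longlongrightarrow> G k) U"
  shows "((\<lambda>n. INF a\<in>A n. F n a) \<longlongrightarrow> (INF k\<in>K. G k)) U"
proof (rule tendstoI)
  fix e :: real assume e: "e > 0"
  have lb: "bdd_below (F n ` A n)" for n
    by (rule bdd_belowI[where m = "- B"]) (use bd in \<open>force simp: abs_le_iff\<close>)
  have GB: "- B \<le> G k" if k: "k \<in> K" for k
  proof -
    obtain x where x: "\<forall>n. x n \<in> A n" "((\<lambda>n. F n (x n)) \<longlongrightarrow> G k) U" using rep[OF k] by blast
    have "- B \<le> F n (x n)" for n using bd[OF x(1)[rule_format], of n] by linarith
    then show ?thesis by (rule lim_le[OF tendsto_const x(2)])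
  qed
  have lbG: "bdd_below (G ` K)" by (rule bdd_belowI[where m = "- B"]) (use GB in auto)
  let ?L = "INF k\<in>K. G k"
  obtain k where k: "k \<in> K" "G k < ?L + e"
    using cINF_less_iff[OF ne(2) lbG, of "?L + e"] e by auto
  obtain x where x: "\<forall>n. x n \<in> A n" "((\<lambda>n. F n (x n)) \<longlongrightarrow> G k) U" using rep[OF k(1)] by blast
  have up: "eventually (\<lambda>n. F n (x n) < ?L + e) U" by (rule order_tendstoD(2)[OF x(2) k(2)])
  have "\<exists>a\<in>A n. F n a < (INF a\<in>A n. F n a) + e / 2" for n
    using cINF_less_iff[OF ne(1)[of n] lb, of "(INF a\<in>A n. F n a) + e / 2"] e by auto
  then obtain y where y: "\<And>n. y n \<in> A n" "\<And>n. F n (y n) < (INF a\<in>A n. F n a) + e / 2" by metis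
  obtain k' where k': "k' \<in> K" "((\<lambda>n. F n (y n)) \<longlongrightarrow> G k') U" using seq[OF y(1)] by blast
  have "?L \<le> G k'" by (rule cINF_lower[OF lbG k'(1)])
  then have "?L - e / 2 < G k'" using e by linarith
  then have lo: "eventually (\<lambda>n. ?L - e / 2 < F n (y n)) U" by (rule order_tendstoD(1)[OF k'(2)])
  show "eventually (\<lambda>n. dist (INF a\<in>A n. F n a) ?L < e) U"
    using up lo
  proof eventually_elim
    case (elim n)
    have "(INF a\<in>A n. F n a) \<le> F n (x n)" by (rule cINF_lower[OF lb]) (use x in blast)
    then show ?case using elim y(2)[of n] by (simp add: dist_real_def abs_less_iff)
  qed
qed

lemma SUP_uminus: "(SUP a\<in>A. F a) = - (INF a\<in>A. - F a)" for F :: "'a \<Rightarrow> real"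
  by (simp add: Inf_real_def image_image)

lemma fun_upd_slice: "(\<lambda>i. (Z(j := x)) i n) = (\<lambda>i. Z i n)(j := x n)"
  by auto

lemma cls_upd: "(\<lambda>i. cls ((Z(j := x)) i)) = (\<lambda>i. cls (Z i))(j := cls x)"
  by (rule ext) simp

lemma bs_op_ball: "x \<in> bs \<Longrightarrow> \<exists>c>0. \<forall>n. x n \<in> op_ball (mat_alg n) c"
proof -
  assume x: "x \<in> bs"
  then obtain C where C: "C \<ge> 0" "\<forall>n. mat_op_norm n (x n) \<le> C" using bs_bound by blast
  have "x n \<in> op_ball (mat_alg n) (C + 1)" for n
    unfolding op_ball_mat_alg using bs_carrier[OF x, of n] C(2)[rule_format, of n] by simp
  then show ?thesis using C(1) by (intro exI[of _ "C + 1"]) simp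
qed

text \<open>Connectives pass to the limit by uniform continuity on a box that contains all values.
  For quantifiers, a sequence in the balls of the factors defines an element of the ball of the
  ultraproduct, and \<open>op_ball_rep\<close> is the converse; suprema are reduced to infima by
  negation.\<close>

lemma interp_Q:
  "well_formed \<phi> \<Longrightarrow> (\<And>j. Z j \<in> bs) \<Longrightarrow>
    ((\<lambda>n. interp (mat_alg n) \<phi> (\<lambda>j. Z j n)) \<longlongrightarrow> interp Q \<phi> (\<lambda>j. cls (Z j))) U"
proof (induction \<phi> arbitrary: Z)
  case (Re_tr p)
  show ?case unfolding interp.simps by (intro tendsto_Re tr_eval_poly_Q Re_tr)
next
  case (Im_tr p)
  show ?case unfolding interp.simps by (intro tendsto_Im tr_eval_poly_Q Im_tr)
next
  case (Connective f \<phi>s)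
  have f: "continuous_map (Euclidean_space (length \<phi>s)) euclideanreal f" and wf: "\<And>\<phi>. \<phi> \<in> set \<phi>s \<Longrightarrow> well_formed \<phi>"
    using Connective.prems by auto
  have "\<exists>c. c > 0 \<and> (\<forall>n. Z j n \<in> op_ball (mat_alg n) c)" for j
    by (rule bs_op_ball[OF Connective.prems(2)])
  then obtain c where c: "\<And>j. c j > 0" "\<And>j n. Z j n \<in> op_ball (mat_alg n) (c j)" by metis
  have "\<exists>B. \<forall>n. \<bar>interp (mat_alg n) \<phi> (\<lambda>j. Z j n)\<bar> \<le> B" if in_set: "\<phi> \<in> set \<phi>s" for \<phi>
  proof -
    obtain B where "\<forall>n Y. (\<forall>j. Y j \<in> op_ball (mat_alg n) (c j)) \<longrightarrow> \<bar>interp (mat_alg n) \<phi> Y\<bar> \<le> B"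
      using interp_bounded_ball[where c = c, OF wf[OF in_set] c(1)] by blast
    then have "\<forall>n. \<bar>interp (mat_alg n) \<phi> (\<lambda>j. Z j n)\<bar> \<le> B" using c(2) by simp
    then show ?thesis by blast
  qed
  then obtain Bf where Bf: "\<And>\<phi> n. \<phi> \<in> set \<phi>s \<Longrightarrow> \<bar>interp (mat_alg n) \<phi> (\<lambda>j. Z j n)\<bar> \<le> Bf \<phi>" by metis
  define B where "B = Max (insert 0 (Bf ` set \<phi>s))"
  have B: "\<bar>interp (mat_alg n) \<phi> (\<lambda>j. Z j n)\<bar> \<le> B" if "\<phi> \<in> set \<phi>s" for \<phi> n
    unfolding B_def by (rule order_trans[OF Bf[OF that] Max_ge]) (use that in auto)
  have lim: "((\<lambda>n. interp (mat_alg n) \<phi> (\<lambda>j. Z j n)) \<longlongrightarrow> interp Q \<phi> (\<lambda>j. cls (Z j))) U" if "\<phi> \<in> set \<phi>s" for \<phi>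
    by (rule Connective.IH[OF that wf[OF that] Connective.prems(2)])
  have BQ: "\<bar>interp Q \<phi> (\<lambda>j. cls (Z j))\<bar> \<le> B" if "\<phi> \<in> set \<phi>s" for \<phi>
    by (rule lim_le[OF tendsto_rabs[OF lim[OF that]] tendsto_const B[OF that]])
  define v where "v n = (\<lambda>i. if i < length \<phi>s then map (\<lambda>\<phi>. interp (mat_alg n) \<phi> (\<lambda>j. Z j n)) \<phi>s ! i else 0)" for n
  define w where "w = (\<lambda>i. if i < length \<phi>s then map (\<lambda>\<phi>. interp Q \<phi> (\<lambda>j. cls (Z j))) \<phi>s ! i else 0)"
  have vb: "v n \<in> coord_box (length \<phi>s) B" for n using B by (simp add: v_def coord_box_def)
  have wb: "w \<in> coord_box (length \<phi>s) B" using BQ by (simp add: w_def coord_box_def)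
  have "((\<lambda>n. f (v n)) \<longlongrightarrow> f w) U"
  proof (rule tendstoI)
    fix e :: real assume e: "e > 0"
    obtain d where d: "d > 0" "\<And>x y. x \<in> coord_box (length \<phi>s) B \<Longrightarrow> y \<in> coord_box (length \<phi>s) B \<Longrightarrow>
        (\<forall>i<length \<phi>s. \<bar>x i - y i\<bar> \<le> d) \<Longrightarrow> \<bar>f x - f y\<bar> \<le> e / 2"
      using connective_uniform[OF f, of "e / 2" B] e by (metis half_gt_zero)
    have "eventually (\<lambda>n. \<bar>v n i - w i\<bar> \<le> d) U" if "i < length \<phi>s" for i
    proof -
      have "((\<lambda>n. v n i) \<longlongrightarrow> w i) U" using lim[of "\<phi>s ! i"] that by (simp add: v_def w_def)
      from tendstoD[OF this d(1)] show ?thesis by (rule eventually_mono) (simp add: dist_real_def)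
    qed
    then have "eventually (\<lambda>n. \<forall>i\<in>{..<length \<phi>s}. \<bar>v n i - w i\<bar> \<le> d) U"
      by (intro eventually_ball_finite) auto
    then show "eventually (\<lambda>n. dist (f (v n)) (f w) < e) U"
    proof (rule eventually_mono)
      fix n assume "\<forall>i\<in>{..<length \<phi>s}. \<bar>v n i - w i\<bar> \<le> d"
      then have "\<bar>f (v n) - f w\<bar> \<le> e / 2" by (intro d(2)[OF vb wb]) simp
      then show "dist (f (v n)) (f w) < e" using e by (simp add: dist_real_def)
    qed
  qed
  then show ?case by (simp only: interp.simps v_def w_def)
next
  case (Inf_ball j r \<phi>)
  then have r: "r > 0" and wf: "well_formed \<phi>" by auto
  have "\<exists>c. c > 0 \<and> (\<forall>n. Z j n \<in> op_ball (mat_alg n) c)" for j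
    by (rule bs_op_ball[OF Inf_ball.prems(2)])
  then obtain c where c: "\<And>j. c j > 0" "\<And>j n. Z j n \<in> op_ball (mat_alg n) (c j)" by metis
  obtain B where B: "\<And>n Y. (\<forall>i. Y i \<in> op_ball (mat_alg n) ((c(j := r)) i)) \<Longrightarrow> \<bar>interp (mat_alg n) \<phi> Y\<bar> \<le> B"
  proof -
    have "(c(j := r)) i > 0" for i using c(1) r by simp
    from interp_bounded_ball[OF wf, of "c(j := r)", OF this] show ?thesis using that by blast
  qed
  have IH: "((\<lambda>n. interp (mat_alg n) \<phi> ((\<lambda>i. Z i n)(j := x n))) \<longlongrightarrow> interp Q \<phi> ((\<lambda>i. cls (Z i))(j := cls x))) U"
    if "x \<in> bs" for x
    using Inf_ball.IH[OF wf, of "Z(j := x)"] that Inf_ball.prems(2) unfolding fun_upd_slice cls_upd by simp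
  show ?case
    unfolding interp.simps
  proof (rule tendsto_INF[where B = B])
    show "op_ball (mat_alg n) r \<noteq> {}" for n using r by (simp add: op_ball_ne)
    have "cls (\<lambda>n. 0\<^sub>m n n) \<in> op_ball Q r"
      using cnorm_Q_le[OF bs_const(2), of r] r by (simp add: op_ball_def)
    then show "op_ball Q r \<noteq> {}" by blast
    show "\<bar>interp (mat_alg n) \<phi> ((\<lambda>i. Z i n)(j := a))\<bar> \<le> B" if "a \<in> op_ball (mat_alg n) r" for n a
      by (rule B) (use c(2) that in simp)
  next
    fix x assume x: "\<And>n. x n \<in> op_ball (mat_alg n) r"
    have xb: "x \<in> bs" by (rule bsI[where C = r]) (use x in \<open>simp_all add: op_ball_mat_alg\<close>)
    have "cls x \<in> op_ball Q r" using cnorm_Q_le[OF xb, of r] x xb by (simp add: op_ball_def op_ball_mat_alg)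
    then show "\<exists>k\<in>op_ball Q r. ((\<lambda>n. interp (mat_alg n) \<phi> ((\<lambda>i. Z i n)(j := x n))) \<longlongrightarrow> interp Q \<phi> ((\<lambda>i. cls (Z i))(j := k))) U"
      using IH[OF xb] by blast
  next
    fix k assume "k \<in> op_ball Q r"
    then obtain x where x: "x \<in> bs" "k = cls x" "\<forall>n. mat_op_norm n (x n) \<le> r" using op_ball_rep[OF _ r] by blast
    then have "\<forall>n. x n \<in> op_ball (mat_alg n) r" by (simp add: op_ball_mat_alg)
    then show "\<exists>x. (\<forall>n. x n \<in> op_ball (mat_alg n) r) \<and>
      ((\<lambda>n. interp (mat_alg n) \<phi> ((\<lambda>i. Z i n)(j := x n))) \<longlongrightarrow> interp Q \<phi> ((\<lambda>i. cls (Z i))(j := k))) U"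
      using IH[OF x(1)] unfolding x(2) by blast
  qed
next
  case (Sup_ball j r \<phi>)
  then have r: "r > 0" and wf: "well_formed \<phi>" by auto
  have "\<exists>c. c > 0 \<and> (\<forall>n. Z j n \<in> op_ball (mat_alg n) c)" for j
    by (rule bs_op_ball[OF Sup_ball.prems(2)])
  then obtain c where c: "\<And>j. c j > 0" "\<And>j n. Z j n \<in> op_ball (mat_alg n) (c j)" by metis
  obtain B where B: "\<And>n Y. (\<forall>i. Y i \<in> op_ball (mat_alg n) ((c(j := r)) i)) \<Longrightarrow> \<bar>interp (mat_alg n) \<phi> Y\<bar> \<le> B"
  proof -
    have "(c(j := r)) i > 0" for i using c(1) r by simp
    from interp_bounded_ball[OF wf, of "c(j := r)", OF this] show ?thesis using that by blast
  qed
  have IH: "((\<lambda>n. - interp (mat_alg n) \<phi> ((\<lambda>i. Z i n)(j := x n))) \<longlongrightarrow> - interp Q \<phi> ((\<lambda>i. cls (Z i))(j := cls x))) U"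
    if "x \<in> bs" for x
    by (rule tendsto_minus)
      (use Sup_ball.IH[OF wf, of "Z(j := x)"] that Sup_ball.prems(2) in \<open>unfold fun_upd_slice cls_upd, simp\<close>)
  have "((\<lambda>n. INF a\<in>op_ball (mat_alg n) r. - interp (mat_alg n) \<phi> ((\<lambda>i. Z i n)(j := a)))
     \<longlongrightarrow> (INF a\<in>op_ball Q r. - interp Q \<phi> ((\<lambda>i. cls (Z i))(j := a)))) U"
  proof (rule tendsto_INF[where B = B])
    show "op_ball (mat_alg n) r \<noteq> {}" for n using r by (simp add: op_ball_ne)
    have "cls (\<lambda>n. 0\<^sub>m n n) \<in> op_ball Q r"
      using cnorm_Q_le[OF bs_const(2), of r] r by (simp add: op_ball_def)
    then show "op_ball Q r \<noteq> {}" by blast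
    show "\<bar>- interp (mat_alg n) \<phi> ((\<lambda>i. Z i n)(j := a))\<bar> \<le> B" if "a \<in> op_ball (mat_alg n) r" for n a
      unfolding abs_minus_cancel by (rule B) (use c(2) that in simp)
  next
    fix x assume x: "\<And>n. x n \<in> op_ball (mat_alg n) r"
    have xb: "x \<in> bs" by (rule bsI[where C = r]) (use x in \<open>simp_all add: op_ball_mat_alg\<close>)
    have "cls x \<in> op_ball Q r" using cnorm_Q_le[OF xb, of r] x xb by (simp add: op_ball_def op_ball_mat_alg)
    then show "\<exists>k\<in>op_ball Q r. ((\<lambda>n. - interp (mat_alg n) \<phi> ((\<lambda>i. Z i n)(j := x n))) \<longlongrightarrow> - interp Q \<phi> ((\<lambda>i. cls (Z i))(j := k))) U"
      using IH[OF xb] by blast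
  next
    fix k assume "k \<in> op_ball Q r"
    then obtain x where x: "x \<in> bs" "k = cls x" "\<forall>n. mat_op_norm n (x n) \<le> r" using op_ball_rep[OF _ r] by blast
    then have "\<forall>n. x n \<in> op_ball (mat_alg n) r" by (simp add: op_ball_mat_alg)
    then show "\<exists>x. (\<forall>n. x n \<in> op_ball (mat_alg n) r) \<and>
      ((\<lambda>n. - interp (mat_alg n) \<phi> ((\<lambda>i. Z i n)(j := x n))) \<longlongrightarrow> - interp Q \<phi> ((\<lambda>i. cls (Z i))(j := k))) U"
      using IH[OF x(1)] unfolding x(2) by blast
  qed
  from tendsto_minus[OF this] show ?case unfolding interp.simps SUP_uminus .
qed

end

section \<open>Generating sets of the ultraproduct\<close>

lemma cmod_diff_square:
  "(cmod (a - c * b))\<^sup>2 = (cmod a)\<^sup>2 - 2 * Re (c * (cnj a * b)) + (cmod c)\<^sup>2 * (cmod b)\<^sup>2"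
  unfolding cmod_power2 by (simp add: power2_eq_square algebra_simps)

lemma one_smult_mat: "(1::complex) \<cdot>\<^sub>m A = A"
  by (intro eq_matI) auto

lemma mn2_diff_square:
  assumes A: "A \<in> carrier_mat n n" and B: "B \<in> carrier_mat n n"
  shows "(mn2 n (A - c \<cdot>\<^sub>m B))\<^sup>2 = (mn2 n A)\<^sup>2 - 2 * Re (c * mtr n (mat_adjoint A * B)) + (cmod c)\<^sup>2 * (mn2 n B)\<^sup>2"
proof -
  have "(frob n (A - c \<cdot>\<^sub>m B))\<^sup>2 = (\<Sum>i<n. \<Sum>j<n. (cmod (A $$ (i, j) - c * B $$ (i, j)))\<^sup>2)"
    unfolding frob_square using A B by (intro sum.cong refl) auto
  also have "\<dots> = (frob n A)\<^sup>2 - 2 * Re (c * (\<Sum>i<n. \<Sum>j<n. cnj (A $$ (i, j)) * B $$ (i, j))) + (cmod c)\<^sup>2 * (frob n B)\<^sup>2"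
    unfolding cmod_diff_square frob_square
    by (simp add: sum.distrib sum_subtractf sum_distrib_left Re_sum)
  finally show ?thesis
    unfolding mn2_def mtr_adjoint_mult[OF A B]
    by (simp add: power_divide diff_divide_distrib add_divide_distrib Re_divide_of_nat)
qed

text \<open>Choose s = 1 / (V + 1), for which the quadratic term is at most s T. With T = |<g, v>|^2
  and V = |v|^2 this says that a near-minimizer of the distance to a subspace leaves a difference
  almost orthogonal to it.\<close>

lemma small_of_minimal:
  fixes T V \<eta> \<delta> \<beta> :: real
  assumes T: "0 \<le> T" and V: "0 \<le> V" and \<beta>: "\<beta> \<le> \<delta> + \<eta>"
    and min: "\<And>s. \<delta> \<le> \<beta> - 2 * s * T + s\<^sup>2 * T * V"
  shows "T \<le> \<eta> * (V + 1)"
proof -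
  define s where "s = 1 / (V + 1)"
  have s: "s > 0" "s * V \<le> 1" "s * (V + 1) = 1" using V by (simp_all add: s_def)
  have "s\<^sup>2 * T * V = (s * T) * (s * V)" by (simp add: power2_eq_square)
  also have "\<dots> \<le> (s * T) * 1" using s T by (intro mult_left_mono) simp_all
  finally have "s * T \<le> \<eta>" using min[of s] \<beta> by simp
  then have "s * T * (V + 1) \<le> \<eta> * (V + 1)" using V by (intro mult_right_mono) simp_all
  moreover have "s * T * (V + 1) = T" using s(3) by (simp add: mult.assoc mult.left_commute[of s])
  ultimately show ?thesis by simp
qed

context ultra
begin

section \<open>Separation in the inner product of the trace\<close>

lemma Q_inner:
  assumes a: "a \<in> carrier Q" and b: "b \<in> carrier Q"
  shows "scal Q c a \<in> carrier Q" "star Q a \<in> carrier Q" "tr Q (scal Q c a) = c * tr Q a"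
    "a \<otimes>\<^bsub>Q\<^esub> scal Q c b = scal Q c (a \<otimes>\<^bsub>Q\<^esub> b)"
    "cmod (tr Q (star Q a \<otimes>\<^bsub>Q\<^esub> b)) \<le> norm2 Q a * norm2 Q b"
    "(norm2 Q (a \<ominus>\<^bsub>Q\<^esub> scal Q c b))\<^sup>2 =
      (norm2 Q a)\<^sup>2 - 2 * Re (c * tr Q (star Q a \<otimes>\<^bsub>Q\<^esub> b)) + (cmod c)\<^sup>2 * (norm2 Q b)\<^sup>2"
    "tr Q (star Q a \<otimes>\<^bsub>Q\<^esub> a) = complex_of_real ((norm2 Q a)\<^sup>2)"
    "0 \<le> norm2 Q a"
proof -
  obtain x where x: "x \<in> bs" "a = cls x" using a by (rule carrierQ_E)
  obtain y where y: "y \<in> bs" "b = cls y" using b by (rule carrierQ_E)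
  note cx = bs_carrier[OF x(1)] and cy = bs_carrier[OF y(1)]
  show "scal Q c a \<in> carrier Q" "star Q a \<in> carrier Q" "tr Q (scal Q c a) = c * tr Q a" using x by (simp_all add: tr_Q_ops(3))
  show "a \<otimes>\<^bsub>Q\<^esub> scal Q c b = scal Q c (a \<otimes>\<^bsub>Q\<^esub> b)"
    using x y by (simp add: mult_smult_distrib[OF cx cy])
  have ip: "((\<lambda>n. mtr n (mat_adjoint (x n) * y n)) \<longlongrightarrow> tr Q (star Q a \<otimes>\<^bsub>Q\<^esub> b)) U"
    using tr_Q[of "\<lambda>n. mat_adjoint (x n) * y n"] x y by simp
  show "cmod (tr Q (star Q a \<otimes>\<^bsub>Q\<^esub> b)) \<le> norm2 Q a * norm2 Q b"
    unfolding x(2) y(2)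
    by (rule lim_le[OF tendsto_norm[OF ip[unfolded x(2) y(2)]] tendsto_mult[OF norm2_Q[OF x(1)] norm2_Q[OF y(1)]]])
      (rule mtr_adjoint_mult_le[OF cx cy])
  have 1: "((\<lambda>n. (mn2 n (x n - c \<cdot>\<^sub>m y n))\<^sup>2) \<longlongrightarrow> (norm2 Q (a \<ominus>\<^bsub>Q\<^esub> scal Q c b))\<^sup>2) U"
    using tendsto_power[OF norm2_Q[of "\<lambda>n. x n - c \<cdot>\<^sub>m y n"]] x y by simp
  have 2: "((\<lambda>n. (mn2 n (x n - c \<cdot>\<^sub>m y n))\<^sup>2) \<longlongrightarrow>
      (norm2 Q a)\<^sup>2 - 2 * Re (c * tr Q (star Q a \<otimes>\<^bsub>Q\<^esub> b)) + (cmod c)\<^sup>2 * (norm2 Q b)\<^sup>2) U"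
    unfolding mn2_diff_square[OF cx cy] x(2) y(2)
    by (intro tendsto_intros norm2_Q x(1) y(1) ip[unfolded x(2) y(2)])
  show "(norm2 Q (a \<ominus>\<^bsub>Q\<^esub> scal Q c b))\<^sup>2 =
      (norm2 Q a)\<^sup>2 - 2 * Re (c * tr Q (star Q a \<otimes>\<^bsub>Q\<^esub> b)) + (cmod c)\<^sup>2 * (norm2 Q b)\<^sup>2"
    by (rule lim_unique[OF 1 2])
  have 3: "((\<lambda>n. mtr n (mat_adjoint (x n) * x n)) \<longlongrightarrow> tr Q (star Q a \<otimes>\<^bsub>Q\<^esub> a)) U"
    using tr_Q[of "\<lambda>n. mat_adjoint (x n) * x n"] x by simp
  have 4: "((\<lambda>n. mtr n (mat_adjoint (x n) * x n)) \<longlongrightarrow> complex_of_real ((norm2 Q a)\<^sup>2)) U"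
    unfolding mtr_adjoint_self[OF cx] x(2) by (intro tendsto_of_real tendsto_power norm2_Q x(1))
  show "tr Q (star Q a \<otimes>\<^bsub>Q\<^esub> a) = complex_of_real ((norm2 Q a)\<^sup>2)" by (rule lim_unique[OF 3 4])
  show "0 \<le> norm2 Q a" unfolding x(2) by (rule lim_le[OF tendsto_const norm2_Q[OF x(1)]]) simp
qed

text \<open>In place of an orthogonal projection take near-minimizers \<open>b k\<close> of the
  distance from \<open>a\<close> to \<open>N\<close>. The functionals v \<mapsto> <g k, v> with g k
  = a - b k tend to 0 on \<open>N\<close> by \<open>small_of_minimal\<close>. At \<open>a\<close>
  they do not, since <g k, a> = |g k|^2 + <g k, b k>, where the first term stays at least \<delta>^2
  and the second tends to 0.\<close>

lemma separating_functional:
  assumes N: "N \<subseteq> carrier Q" "N \<noteq> {}"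
    and add: "\<And>a b. a \<in> N \<Longrightarrow> b \<in> N \<Longrightarrow> a \<oplus>\<^bsub>Q\<^esub> b \<in> N" and scal: "\<And>a c. a \<in> N \<Longrightarrow> scal Q c a \<in> N"
    and a: "a \<in> carrier Q" and d: "d > 0" "\<And>b. b \<in> N \<Longrightarrow> d \<le> norm2 Q (a \<ominus>\<^bsub>Q\<^esub> b)"
  shows "\<exists>\<phi>. normal_functional Q \<phi> \<and> \<phi> a \<noteq> 0 \<and> (\<forall>b\<in>N. \<phi> b = 0)"
proof -
  interpret P: pretracial Q by (rule pretracial_Q)
  define \<delta> where "\<delta> = (INF b\<in>N. norm2 Q (a \<ominus>\<^bsub>Q\<^esub> b))"
  have Nc: "b \<in> carrier Q" if "b \<in> N" for b using N that by blast
  have lb: "bdd_below ((\<lambda>b. norm2 Q (a \<ominus>\<^bsub>Q\<^esub> b)) ` N)" by (rule bdd_belowI[where m = d]) (use d(2) in auto)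
  have \<delta>: "d \<le> \<delta>" unfolding \<delta>_def by (rule cINF_greatest[OF N(2)]) (rule d(2))
  have \<delta>_le: "\<delta>\<^sup>2 \<le> (norm2 Q (a \<ominus>\<^bsub>Q\<^esub> b))\<^sup>2" if "b \<in> N" for b
    using cINF_lower[OF lb that] \<delta> d(1) by (intro power_mono) (simp_all add: \<delta>_def)
  have "\<exists>b\<in>N. (norm2 Q (a \<ominus>\<^bsub>Q\<^esub> b))\<^sup>2 < \<delta>\<^sup>2 + 1 / real (Suc k)" for k
  proof -
    have "\<delta> < sqrt (\<delta>\<^sup>2 + 1 / real (Suc k))" by (rule real_less_rsqrt) simp
    then obtain b where b: "b \<in> N" "norm2 Q (a \<ominus>\<^bsub>Q\<^esub> b) < sqrt (\<delta>\<^sup>2 + 1 / real (Suc k))"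
      using cINF_less_iff[OF N(2) lb] unfolding \<delta>_def by blast
    have "(norm2 Q (a \<ominus>\<^bsub>Q\<^esub> b))\<^sup>2 < (sqrt (\<delta>\<^sup>2 + 1 / real (Suc k)))\<^sup>2"
      by (rule power_strict_mono[OF b(2)]) (use Q_inner(8) a Nc[OF b(1)] in simp_all)
    also have "\<dots> = \<delta>\<^sup>2 + 1 / real (Suc k)" by (rule real_sqrt_pow2) simp
    finally show ?thesis using b(1) by blast
  qed
  then obtain b where b: "\<And>k. b k \<in> N" "\<And>k. (norm2 Q (a \<ominus>\<^bsub>Q\<^esub> b k))\<^sup>2 < \<delta>\<^sup>2 + 1 / real (Suc k)" by metis
  have bc: "b k \<in> carrier Q" for k by (rule Nc[OF b(1)])
  define g where "g k = a \<ominus>\<^bsub>Q\<^esub> b k" for k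
  have gc: "g k \<in> carrier Q" for k using a bc by (simp add: g_def)
  define C where "C = sqrt (\<delta>\<^sup>2 + 1)"
  have C: "C \<ge> 0" by (simp add: C_def)
  have gn: "norm2 Q (g k) \<le> C" for k
  proof -
    have "1 / real (Suc k) \<le> 1" by simp
    then have "(norm2 Q (g k))\<^sup>2 \<le> \<delta>\<^sup>2 + 1" using b(2)[of k] unfolding g_def by linarith
    then show ?thesis unfolding C_def by (rule real_le_rsqrt)
  qed
  have small: "(cmod (tr Q (star Q (g k) \<otimes>\<^bsub>Q\<^esub> v)))\<^sup>2 \<le> 1 / real (Suc k) * ((norm2 Q v)\<^sup>2 + 1)" if v: "v \<in> N" for v k
  proof (rule small_of_minimal)
    show "(norm2 Q (g k))\<^sup>2 \<le> \<delta>\<^sup>2 + 1 / real (Suc k)" using b(2)[of k] by (simp add: g_def)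
    fix s :: real
    define t where "t = tr Q (star Q (g k) \<otimes>\<^bsub>Q\<^esub> v)"
    \<comment> \<open>The factor \<open>cnj t\<close> makes the linear term of the expansion real:
      \<open>Re (c * t)\<close> becomes s |t|^2, as in \<open>small_of_minimal\<close>.\<close>
    define c where "c = complex_of_real s * cnj t"
    have "g k \<ominus>\<^bsub>Q\<^esub> scal Q c v = a \<ominus>\<^bsub>Q\<^esub> (b k \<oplus>\<^bsub>Q\<^esub> scal Q c v)"
      using a bc[of k] Nc[OF scal[OF v]] by (simp add: g_def a_minus_def P.minus_add P.a_assoc)
    then have "\<delta>\<^sup>2 \<le> (norm2 Q (g k \<ominus>\<^bsub>Q\<^esub> scal Q c v))\<^sup>2" using \<delta>_le[OF add[OF b(1) scal[OF v]], of k c] by simp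
    also have "\<dots> = (norm2 Q (g k))\<^sup>2 - 2 * Re (c * t) + (cmod c)\<^sup>2 * (norm2 Q v)\<^sup>2"
      using Q_inner(6)[OF gc[of k] Nc[OF v], of c] by (simp add: t_def)
    also have "Re (c * t) = s * (cmod t)\<^sup>2"
      unfolding c_def cmod_power2 by (simp add: power2_eq_square algebra_simps)
    also have "(cmod c)\<^sup>2 = s\<^sup>2 * (cmod t)\<^sup>2" by (simp add: c_def norm_mult power_mult_distrib)
    finally show "\<delta>\<^sup>2 \<le> (norm2 Q (g k))\<^sup>2 - 2 * s * (cmod (tr Q (star Q (g k) \<otimes>\<^bsub>Q\<^esub> v)))\<^sup>2 +
        s\<^sup>2 * (cmod (tr Q (star Q (g k) \<otimes>\<^bsub>Q\<^esub> v)))\<^sup>2 * (norm2 Q v)\<^sup>2"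
      by (simp add: t_def)
  qed simp_all
  \<comment> \<open>The limit is taken of functionals and not of the \<open>g k\<close>, so no
    completion of \<open>Q\<close> enters. The index \<open>k\<close> numbers the near-minimizers;
    the ultrafilter here only selects limits and has no connection with matrix sizes.\<close>
  define \<phi> where "\<phi> v = Lim U (\<lambda>k. tr Q (star Q (g k) \<otimes>\<^bsub>Q\<^esub> v))" for v
  have le: "cmod (tr Q (star Q (g k) \<otimes>\<^bsub>Q\<^esub> v)) \<le> C * norm2 Q v" if v: "v \<in> carrier Q" for k v
    by (rule order_trans[OF Q_inner(5)[OF gc v] mult_right_mono[OF gn Q_inner(8)[OF v v]]])
  have lim: "((\<lambda>k. tr Q (star Q (g k) \<otimes>\<^bsub>Q\<^esub> v)) \<longlongrightarrow> \<phi> v) U" if v: "v \<in> carrier Q" for v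
  proof -
    obtain l where l: "((\<lambda>k. tr Q (star Q (g k) \<otimes>\<^bsub>Q\<^esub> v)) \<longlongrightarrow> l) U"
      using bounded_lim[where f = "\<lambda>k. tr Q (star Q (g k) \<otimes>\<^bsub>Q\<^esub> v)", OF le[OF v]] by blast
    then show ?thesis using Lim_eq[OF l] by (simp add: \<phi>_def)
  qed
  have inv_lim: "((\<lambda>k. 1 / real (Suc k) * K) \<longlongrightarrow> 0) U" for K
    using tendsto_mult_right[OF limI[OF LIMSEQ_inverse_real_of_nat], of K] by (simp add: inverse_eq_divide)
  have zero: "\<phi> v = 0" if v: "v \<in> N" for v
  proof -
    have "((\<lambda>k. (cmod (tr Q (star Q (g k) \<otimes>\<^bsub>Q\<^esub> v)))\<^sup>2) \<longlongrightarrow> (cmod (\<phi> v))\<^sup>2) U"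
      by (intro tendsto_power tendsto_norm lim Nc v)
    from lim_le[OF this inv_lim small[OF v]] have "(cmod (\<phi> v))\<^sup>2 \<le> 0" .
    then show ?thesis by simp
  qed
  have "\<phi> a \<noteq> 0"
  proof
    assume "\<phi> a = 0"
    \<comment> \<open>The estimate \<open>small\<close> contains the norm of \<open>v\<close>, so
      applying it at the varying elements \<open>b k\<close> requires that these stay
      bounded.\<close>
    have bn: "norm2 Q (b k) \<le> norm2 Q a + C" for k
    proof -
      have "b k = a \<oplus>\<^bsub>Q\<^esub> (b k \<ominus>\<^bsub>Q\<^esub> a)" using P.a_lcomm[OF a bc[of k] P.a_inv_closed[OF a]]
          P.r_neg[OF a] P.r_zero[OF bc[of k]] by (simp only: a_minus_def)
      moreover have "norm2 Q (b k \<ominus>\<^bsub>Q\<^esub> a) \<le> C" using gn[of k] P.norm2_minus_commute[OF a bc[of k]] by (simp add: g_def)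
      moreover have "norm2 Q (a \<oplus>\<^bsub>Q\<^esub> (b k \<ominus>\<^bsub>Q\<^esub> a)) \<le> norm2 Q a + norm2 Q (b k \<ominus>\<^bsub>Q\<^esub> a)"
        by (rule P.norm2_triangle[OF a P.minus_closed[OF bc a]])
      ultimately show ?thesis by simp
    qed
    have e: "tr Q (star Q (g k) \<otimes>\<^bsub>Q\<^esub> a) = complex_of_real ((norm2 Q (g k))\<^sup>2) + tr Q (star Q (g k) \<otimes>\<^bsub>Q\<^esub> b k)" for k
    proof -
      have "a = g k \<oplus>\<^bsub>Q\<^esub> b k" using a bc[of k] by (simp add: g_def a_minus_def P.a_assoc P.l_neg)
      then have "star Q (g k) \<otimes>\<^bsub>Q\<^esub> a = star Q (g k) \<otimes>\<^bsub>Q\<^esub> g k \<oplus>\<^bsub>Q\<^esub> star Q (g k) \<otimes>\<^bsub>Q\<^esub> b k"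
        using P.r_distr[OF gc[of k] bc[of k] P.sclosed[OF gc[of k]]] by simp
      then show ?thesis using P.tadd gc[of k] bc[of k] P.sclosed[OF gc[of k]] Q_inner(7)[OF gc[of k] gc[of k]] by simp
    qed
    have low: "\<delta>\<^sup>2 - cmod (tr Q (star Q (g k) \<otimes>\<^bsub>Q\<^esub> b k)) \<le> cmod (tr Q (star Q (g k) \<otimes>\<^bsub>Q\<^esub> a))" for k
    proof -
      have "\<delta>\<^sup>2 \<le> (norm2 Q (g k))\<^sup>2" unfolding g_def by (rule \<delta>_le[OF b(1)])
      moreover have "cmod (complex_of_real ((norm2 Q (g k))\<^sup>2)) \<le> cmod (tr Q (star Q (g k) \<otimes>\<^bsub>Q\<^esub> a)) + cmod (tr Q (star Q (g k) \<otimes>\<^bsub>Q\<^esub> b k))"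
        using norm_triangle_ineq4[of "tr Q (star Q (g k) \<otimes>\<^bsub>Q\<^esub> a)" "tr Q (star Q (g k) \<otimes>\<^bsub>Q\<^esub> b k)"] unfolding e by simp
      moreover have "cmod (complex_of_real ((norm2 Q (g k))\<^sup>2)) = (norm2 Q (g k))\<^sup>2" by (simp only: norm_of_real) simp
      ultimately show ?thesis by linarith
    qed
    have "((\<lambda>k. (cmod (tr Q (star Q (g k) \<otimes>\<^bsub>Q\<^esub> b k)))\<^sup>2) \<longlongrightarrow> 0) U"
    proof (rule tendsto_sandwich[OF always_eventually always_eventually tendsto_const])
      show "((\<lambda>k. 1 / real (Suc k) * ((norm2 Q a + C)\<^sup>2 + 1)) \<longlongrightarrow> 0) U" by (rule inv_lim)
      show "\<forall>k. (cmod (tr Q (star Q (g k) \<otimes>\<^bsub>Q\<^esub> b k)))\<^sup>2 \<le> 1 / real (Suc k) * ((norm2 Q a + C)\<^sup>2 + 1)"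
      proof
        fix k
        have "(norm2 Q (b k))\<^sup>2 \<le> (norm2 Q a + C)\<^sup>2" by (rule power_mono[OF bn Q_inner(8)[OF bc bc]])
        then have "1 / real (Suc k) * ((norm2 Q (b k))\<^sup>2 + 1) \<le> 1 / real (Suc k) * ((norm2 Q a + C)\<^sup>2 + 1)"
          by (intro mult_left_mono) simp_all
        then show "(cmod (tr Q (star Q (g k) \<otimes>\<^bsub>Q\<^esub> b k)))\<^sup>2 \<le> 1 / real (Suc k) * ((norm2 Q a + C)\<^sup>2 + 1)"
          using small[OF b(1), of k k] by linarith
      qed
    qed simp
    from tendsto_real_sqrt[OF this]
    have "((\<lambda>k. cmod (tr Q (star Q (g k) \<otimes>\<^bsub>Q\<^esub> b k))) \<longlongrightarrow> 0) U" by simp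
    from lim_le[OF tendsto_diff[OF tendsto_const this] tendsto_norm[OF lim[OF a]] low]
    have "\<delta>\<^sup>2 \<le> 0" using \<open>\<phi> a = 0\<close> by simp
    then show False using \<delta> d(1) by simp
  qed
  moreover have "normal_functional Q \<phi>"
  proof (rule P.normal_of_norm2_bounded)
    show "cmod (\<phi> v) \<le> C * norm2 Q v" if "v \<in> carrier Q" for v
      by (rule lim_le[OF tendsto_norm[OF lim[OF that]] tendsto_const le[OF that]])
    show "linear_functional Q \<phi>"
      unfolding linear_functional_def
    proof (intro conjI ballI allI)
      fix u v assume u: "u \<in> carrier Q" and v: "v \<in> carrier Q"
      have "tr Q (star Q (g k) \<otimes>\<^bsub>Q\<^esub> (u \<oplus>\<^bsub>Q\<^esub> v)) = tr Q (star Q (g k) \<otimes>\<^bsub>Q\<^esub> u) + tr Q (star Q (g k) \<otimes>\<^bsub>Q\<^esub> v)" for k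
        using P.r_distr[OF u v P.sclosed[OF gc[of k]]] P.tadd P.sclosed[OF gc[of k]] u v by simp
      then show "\<phi> (u \<oplus>\<^bsub>Q\<^esub> v) = \<phi> u + \<phi> v"
        using lim_unique[OF lim[of "u \<oplus>\<^bsub>Q\<^esub> v"]] tendsto_add[OF lim[OF u] lim[OF v]] u v by simp
    next
      fix u c assume u: "u \<in> carrier Q"
      have "tr Q (star Q (g k) \<otimes>\<^bsub>Q\<^esub> scal Q c u) = c * tr Q (star Q (g k) \<otimes>\<^bsub>Q\<^esub> u)" for k
        using Q_inner(4)[OF P.sclosed[OF gc[of k]] u, of c] P.sclosed[OF gc[of k]] u
        by (simp add: Q_inner(3)[where b = "\<zero>\<^bsub>Q\<^esub>"])
      then show "\<phi> (scal Q c u) = c * \<phi> u"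
        using lim_unique[OF lim[of "scal Q c u"]] tendsto_mult_left[OF lim[OF u], of c] Q_inner(1)[OF u u] by simp
    qed
  qed
  ultimately show ?thesis using zero by blast
qed

text \<open>A point outside \<open>N\<close> has positive 2-norm distance from \<open>N\<close>, and
  the functional separating it is normal. The set where that functional does not vanish is an
  ultraweak neighborhood that avoids \<open>N\<close>.\<close>

lemma closedin_ultraweak:
  assumes N: "N \<subseteq> carrier Q" "N \<noteq> {}"
    and add: "\<And>a b. a \<in> N \<Longrightarrow> b \<in> N \<Longrightarrow> a \<oplus>\<^bsub>Q\<^esub> b \<in> N" and scal: "\<And>a c. a \<in> N \<Longrightarrow> scal Q c a \<in> N"
    and closed: "\<And>a. a \<in> carrier Q \<Longrightarrow> \<forall>e>0. \<exists>b\<in>N. norm2 Q (a \<ominus>\<^bsub>Q\<^esub> b) < e \<Longrightarrow> a \<in> N"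
  shows "closedin (ultraweak Q) N"
proof -
  interpret P: pretracial Q by (rule pretracial_Q)
  \<comment> \<open>A generated topology lives on the union of its generating sets; the zero
    functional shows that the whole carrier is one of them.\<close>
  have "normal_functional Q (\<lambda>_. 0)"
    by (rule P.normal_of_norm2_bounded[where C = 0]) (simp_all add: linear_functional_def)
  then have "carrier Q \<in> {{x \<in> carrier Q. \<phi> x \<in> V} | \<phi> V. normal_functional Q \<phi> \<and> open V}"
    by (intro CollectI exI[of _ "\<lambda>_. 0"] exI[of _ UNIV]) simp
  then have top: "topspace (ultraweak Q) = carrier Q"
    unfolding ultraweak_def topology_generated_by_topspace by blast
  show ?thesis
    unfolding closedin_def top
  proof (intro conjI N(1), subst openin_subopen, intro ballI)
    fix a assume a: "a \<in> carrier Q - N"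
    then obtain d where d: "d > 0" "\<not> (\<exists>b\<in>N. norm2 Q (a \<ominus>\<^bsub>Q\<^esub> b) < d)" using closed[of a] by blast
    obtain \<phi> where \<phi>: "normal_functional Q \<phi>" "\<phi> a \<noteq> 0" "\<forall>b\<in>N. \<phi> b = 0"
      using separating_functional[OF N add scal _ d(1), of a] a d(2) by (metis DiffD1 not_le)
    have "openin (ultraweak Q) {x \<in> carrier Q. \<phi> x \<in> - {0}}"
      unfolding ultraweak_def using \<phi>(1) by (intro topology_generated_by_Basis CollectI) blast
    then show "\<exists>T. openin (ultraweak Q) T \<and> a \<in> T \<and> T \<subseteq> carrier Q - N"
      using a \<phi> by (intro exI[of _ "{x \<in> carrier Q. \<phi> x \<in> - {0}}"]) auto
  qed
qed

lemma leval_bs: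
  assumes "\<And>i. X i \<in> bs"
  shows "(\<lambda>n. leval n (\<lambda>i. X i n) l) \<in> bs"
proof (induction l)
  case (Cons cw l)
  have "(\<lambda>n. mword n (\<lambda>i. X i n) (snd cw)) \<in> bs" using eval_word_Q[where Z = X and w = "snd cw", OF assms] by blast
  from bs_ops(1)[OF bs_ops(3)[OF this] Cons] show ?case by simp
qed (simp add: bs_const)

text \<open>The 2-norm limits of polynomials in the generators form a W*-subalgebra: they are closed
  under the operations and, by \<open>closedin_ultraweak\<close>, ultraweakly closed. It contains
  the generators, hence every element.\<close>

lemma generated_approx:
  assumes X: "\<And>i. X i \<in> bs" and gen: "wstar_generated Q ((\<lambda>i. cls (X i)) ` I) = carrier Q"
    and z: "z \<in> bs" and e: "e > 0"
  shows "\<exists>l. lletters l \<subseteq> I \<and> eventually (\<lambda>n. mn2 n (z n - leval n (\<lambda>i. X i n) l) < e) U"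
proof -
  interpret P: pretracial Q by (rule pretracial_Q)
  define L where "L l = cls (\<lambda>n. leval n (\<lambda>i. X i n) l)" for l
  have Lb: "(\<lambda>n. leval n (\<lambda>i. X i n) l) \<in> bs" for l by (rule leval_bs[OF X])
  have Lc: "L l \<in> carrier Q" for l unfolding L_def by (simp add: Lb)
  have Xc: "X i n \<in> carrier_mat n n" for i n using X by simp
  define N where "N = {a \<in> carrier Q. \<forall>e>0. \<exists>l. lletters l \<subseteq> I \<and> norm2 Q (a \<ominus>\<^bsub>Q\<^esub> L l) < e}"
  have ap: "\<exists>l. lletters l \<subseteq> I \<and> norm2 Q (a \<ominus>\<^bsub>Q\<^esub> L l) < e" if "a \<in> N" "e > 0" for a e
    using that unfolding N_def by blast
  have NI: "L l \<in> N" if l: "lletters l \<subseteq> I" for l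
  proof -
    have "norm2 Q (L l \<ominus>\<^bsub>Q\<^esub> L l) = 0"
      unfolding L_def Q_minus[OF Lb Lb] using norm2_Q_0[OF bs_ops(6)[OF Lb Lb]] null_refl[OF Lb] by blast
    then show ?thesis unfolding N_def using l Lc[of l] by fastforce
  qed
  have add: "a \<oplus>\<^bsub>Q\<^esub> b \<in> N" if a: "a \<in> N" and b: "b \<in> N" for a b
    unfolding N_def
  proof (intro CollectI conjI allI impI)
    have c: "a \<in> carrier Q" "b \<in> carrier Q" using a b by (auto simp: N_def)
    then show "a \<oplus>\<^bsub>Q\<^esub> b \<in> carrier Q" by simp
    fix e :: real assume "e > 0"
    then have h: "e / 2 > 0" by simp
    obtain l where l: "lletters l \<subseteq> I" "norm2 Q (a \<ominus>\<^bsub>Q\<^esub> L l) < e / 2" using ap[OF a h] by blast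
    obtain m where m: "lletters m \<subseteq> I" "norm2 Q (b \<ominus>\<^bsub>Q\<^esub> L m) < e / 2" using ap[OF b h] by blast
    have "L (l @ m) = L l \<oplus>\<^bsub>Q\<^esub> L m" unfolding L_def using Lb by (simp add: leval_append[OF Xc])
    then have "(a \<oplus>\<^bsub>Q\<^esub> b) \<ominus>\<^bsub>Q\<^esub> L (l @ m) = (a \<ominus>\<^bsub>Q\<^esub> L l) \<oplus>\<^bsub>Q\<^esub> (b \<ominus>\<^bsub>Q\<^esub> L m)"
      using c Lc[of l] Lc[of m] by (simp add: a_minus_def P.minus_add P.a_ac)
    then have "norm2 Q ((a \<oplus>\<^bsub>Q\<^esub> b) \<ominus>\<^bsub>Q\<^esub> L (l @ m)) < e"
      using P.norm2_triangle[of "a \<ominus>\<^bsub>Q\<^esub> L l" "b \<ominus>\<^bsub>Q\<^esub> L m"] l m c Lc[of l] Lc[of m] by simp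
    then show "\<exists>l. lletters l \<subseteq> I \<and> norm2 Q (a \<oplus>\<^bsub>Q\<^esub> b \<ominus>\<^bsub>Q\<^esub> L l) < e" using l m by (intro exI[of _ "l @ m"]) simp
  qed
  have scal: "scal Q c a \<in> N" if a: "a \<in> N" for a c
    unfolding N_def
  proof (intro CollectI conjI allI impI)
    have ac: "a \<in> carrier Q" using a by (auto simp: N_def)
    then obtain x where x: "x \<in> bs" "a = cls x" by (rule carrierQ_E)
    show "scal Q c a \<in> carrier Q" using x by simp
    fix e :: real assume e: "e > 0"
    then have h: "e / (cmod c + 1) > 0" by (intro divide_pos_pos) (simp_all add: add_nonneg_pos)
    obtain l where l: "lletters l \<subseteq> I" "norm2 Q (a \<ominus>\<^bsub>Q\<^esub> L l) < e / (cmod c + 1)" using ap[OF a h] by blast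
    have "norm2 Q (scal Q c a \<ominus>\<^bsub>Q\<^esub> L (lscal c l)) \<le> cmod c * norm2 Q (a \<ominus>\<^bsub>Q\<^esub> L l)"
    proof -
      have s: "scal Q c a \<ominus>\<^bsub>Q\<^esub> L (lscal c l) = cls (\<lambda>n. c \<cdot>\<^sub>m x n - leval n (\<lambda>i. X i n) (lscal c l))"
        "a \<ominus>\<^bsub>Q\<^esub> L l = cls (\<lambda>n. x n - leval n (\<lambda>i. X i n) l)" using x Lb by (simp_all add: L_def)
      show ?thesis unfolding s
      proof (rule lim_le[OF norm2_Q tendsto_mult[OF tendsto_const norm2_Q]])
        fix n
        have "c \<cdot>\<^sub>m x n - leval n (\<lambda>i. X i n) (lscal c l) = c \<cdot>\<^sub>m (x n - leval n (\<lambda>i. X i n) l)"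
          unfolding leval_lscal[of "\<lambda>i. X i n" n c l, OF Xc] using bs_carrier[OF x(1), of n] bs_carrier[OF Lb, of n l]
          by (intro eq_matI) (auto simp: right_diff_distrib)
        then show "mn2 n (c \<cdot>\<^sub>m x n - leval n (\<lambda>i. X i n) (lscal c l)) \<le> cmod c * mn2 n (x n - leval n (\<lambda>i. X i n) l)"
          using mn2_smult[of "x n - leval n (\<lambda>i. X i n) l" n c] bs_carrier[OF x(1), of n] bs_carrier[OF Lb, of n l] by simp
      qed (use x Lb in simp_all)
    qed
    also have "\<dots> \<le> cmod c * (e / (cmod c + 1))" using l(2) by (intro mult_left_mono) simp_all
    also have "\<dots> < e" using e by (simp add: divide_less_eq add_nonneg_pos mult.commute distrib_left)
    finally show "\<exists>l. lletters l \<subseteq> I \<and> norm2 Q (scal Q c a \<ominus>\<^bsub>Q\<^esub> L l) < e" using l(1) by (intro exI[of _ "lscal c l"]) simp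
  qed
  have star: "star Q a \<in> N" if a: "a \<in> N" for a
    unfolding N_def
  proof (intro CollectI conjI allI impI)
    have ac: "a \<in> carrier Q" using a by (auto simp: N_def)
    then show "star Q a \<in> carrier Q" by (rule P.sclosed)
    fix e :: real assume "e > 0"
    then obtain l where l: "lletters l \<subseteq> I" "norm2 Q (a \<ominus>\<^bsub>Q\<^esub> L l) < e" using ap[OF a] by blast
    have "L (ladj l) = star Q (L l)" unfolding L_def using Lb by (simp add: leval_ladj[OF Xc])
    then have "norm2 Q (star Q a \<ominus>\<^bsub>Q\<^esub> L (ladj l)) = norm2 Q (a \<ominus>\<^bsub>Q\<^esub> L l)"
      using P.sminus[OF ac Lc[of l]] P.norm2_star[of "a \<ominus>\<^bsub>Q\<^esub> L l"] ac Lc[of l] by simp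
    then show "\<exists>l. lletters l \<subseteq> I \<and> norm2 Q (star Q a \<ominus>\<^bsub>Q\<^esub> L l) < e" using l by (intro exI[of _ "ladj l"]) simp
  qed
  have mult: "a \<otimes>\<^bsub>Q\<^esub> b \<in> N" if a: "a \<in> N" and b: "b \<in> N" for a b
    unfolding N_def
  proof (intro CollectI conjI allI impI)
    have c: "a \<in> carrier Q" "b \<in> carrier Q" using a b by (auto simp: N_def)
    then show "a \<otimes>\<^bsub>Q\<^esub> b \<in> carrier Q" by simp
    fix e :: real assume e: "e > 0"
    obtain x where x: "x \<in> bs" "a = cls x" using c(1) by (rule carrierQ_E)
    obtain y where y: "y \<in> bs" "b = cls y" using c(2) by (rule carrierQ_E)
    obtain B where B: "B \<ge> 0" "\<forall>n. mat_op_norm n (y n) \<le> B" using bs_bound[OF y(1)] by blast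
    have "e / 2 / (B + 1) > 0" using e B by simp
    then obtain l where l: "lletters l \<subseteq> I" "norm2 Q (a \<ominus>\<^bsub>Q\<^esub> L l) < e / 2 / (B + 1)" using ap[OF a] by blast
    \<comment> \<open>The approximant of \<open>a\<close> is fixed before that of \<open>b\<close>,
      because its norm bound \<open>A\<close> determines the precision required for
      \<open>b\<close>. Approximants of one element need not have a common norm bound.\<close>
    obtain A where A: "A \<ge> 0" "\<forall>n. mat_op_norm n (leval n (\<lambda>i. X i n) l) \<le> A" using bs_bound[OF Lb] by blast
    have "e / 2 / (A + 1) > 0" using e A by simp
    then obtain m where m: "lletters m \<subseteq> I" "norm2 Q (b \<ominus>\<^bsub>Q\<^esub> L m) < e / 2 / (A + 1)" using ap[OF b] by blast
    have s: "a \<otimes>\<^bsub>Q\<^esub> b \<ominus>\<^bsub>Q\<^esub> L (lmul l m) = cls (\<lambda>n. x n * y n - leval n (\<lambda>i. X i n) (lmul l m))"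
      "a \<ominus>\<^bsub>Q\<^esub> L l = cls (\<lambda>n. x n - leval n (\<lambda>i. X i n) l)" "b \<ominus>\<^bsub>Q\<^esub> L m = cls (\<lambda>n. y n - leval n (\<lambda>i. X i n) m)"
      using x y Lb by (simp_all add: L_def)
    have "norm2 Q (a \<otimes>\<^bsub>Q\<^esub> b \<ominus>\<^bsub>Q\<^esub> L (lmul l m)) \<le> norm2 Q (a \<ominus>\<^bsub>Q\<^esub> L l) * B + A * norm2 Q (b \<ominus>\<^bsub>Q\<^esub> L m)"
      unfolding s
    proof (rule lim_le[OF norm2_Q tendsto_add[OF tendsto_mult[OF norm2_Q tendsto_const] tendsto_mult[OF tendsto_const norm2_Q]]])
      fix n
      define u v where "u = leval n (\<lambda>i. X i n) l" and "v = leval n (\<lambda>i. X i n) m"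
      have k: "x n \<in> carrier_mat n n" "y n \<in> carrier_mat n n" "u \<in> carrier_mat n n" "v \<in> carrier_mat n n"
        using x y bs_carrier[OF Lb] by (simp_all add: u_def v_def)
      have "leval n (\<lambda>i. X i n) (lmul l m) = u * v" unfolding u_def v_def by (rule leval_lmul[OF Xc])
      then have "mn2 n (x n * y n - leval n (\<lambda>i. X i n) (lmul l m)) \<le> mn2 n (x n * y n - u * y n) + mn2 n (u * y n - u * v)"
        using mn2_triangle_minus[of "x n * y n" n "u * y n" "u * v"] k by simp
      also have "x n * y n - u * y n = (x n - u) * y n" using k by (intro minus_mult_distrib_mat[symmetric])
      also have "u * y n - u * v = u * (y n - v)" using k by (intro mult_minus_distrib_mat[symmetric])
      also have "mn2 n ((x n - u) * y n) + mn2 n (u * (y n - v)) \<le> mn2 n (x n - u) * B + A * mn2 n (y n - v)"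
      proof (rule add_mono)
        show "mn2 n ((x n - u) * y n) \<le> mn2 n (x n - u) * B"
          by (rule order_trans[OF mn2_mult_le' mult_left_mono]) (use k B in simp_all)
        show "mn2 n (u * (y n - v)) \<le> A * mn2 n (y n - v)"
          by (rule order_trans[OF mn2_mult_le mult_right_mono]) (use k A in \<open>simp_all add: u_def\<close>)
      qed
      finally show "mn2 n (x n * y n - leval n (\<lambda>i. X i n) (lmul l m)) \<le> mn2 n (x n - leval n (\<lambda>i. X i n) l) * B + A * mn2 n (y n - leval n (\<lambda>i. X i n) m)"
        by (simp add: u_def v_def)
    qed (use x y Lb in simp_all)
    moreover have "norm2 Q (a \<ominus>\<^bsub>Q\<^esub> L l) * B \<le> e / 2 / (B + 1) * B" using l(2) B(1) by (intro mult_right_mono) simp_all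
    moreover have "e / 2 / (B + 1) * B < e / 2" using e B(1) by (simp add: divide_less_eq)
    moreover have "A * norm2 Q (b \<ominus>\<^bsub>Q\<^esub> L m) \<le> A * (e / 2 / (A + 1))" using m(2) A(1) by (intro mult_left_mono) simp_all
    moreover have "A * (e / 2 / (A + 1)) < e / 2" using e A(1) by (simp add: divide_less_eq mult.commute distrib_left)
    ultimately have "norm2 Q (a \<otimes>\<^bsub>Q\<^esub> b \<ominus>\<^bsub>Q\<^esub> L (lmul l m)) < e" by linarith
    moreover have "lletters (lmul l m) \<subseteq> I" using lletters_lmul[of l m] l(1) m(1) by blast
    ultimately show "\<exists>l. lletters l \<subseteq> I \<and> norm2 Q (a \<otimes>\<^bsub>Q\<^esub> b \<ominus>\<^bsub>Q\<^esub> L l) < e" by blast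
  qed
  have one: "\<one>\<^bsub>Q\<^esub> \<in> N"
  proof -
    have "leval n (\<lambda>i. X i n) [(1, [])] = 1\<^sub>m n" for n by (simp add: one_smult_mat right_add_zero_mat[where nr=n and nc=n])
    then have "L [(1, [])] = \<one>\<^bsub>Q\<^esub>" by (simp add: L_def)
    then show ?thesis using NI[of "[(1, [])]"] by simp
  qed
  have gens: "cls (X i) \<in> N" if "i \<in> I" for i
  proof -
    have "leval n (\<lambda>i. X i n) [(1, [(i, False)])] = X i n" for n
      using Xc[of i n] by (simp add: one_smult_mat right_add_zero_mat[where nr=n and nc=n] right_mult_one_mat[where nr=n and nc=n])
    then have "L [(1, [(i, False)])] = cls (X i)" by (simp add: L_def)
    then show ?thesis using NI[of "[(1, [(i, False)])]"] that by simp
  qed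
  have closed: "a \<in> N" if a: "a \<in> carrier Q" and near: "\<forall>e>0. \<exists>b\<in>N. norm2 Q (a \<ominus>\<^bsub>Q\<^esub> b) < e" for a
    unfolding N_def
  proof (intro CollectI conjI allI impI a)
    fix e :: real assume "e > 0"
    then have h: "e / 2 > 0" by simp
    obtain b where b: "b \<in> N" "norm2 Q (a \<ominus>\<^bsub>Q\<^esub> b) < e / 2" using near h by blast
    obtain l where l: "lletters l \<subseteq> I" "norm2 Q (b \<ominus>\<^bsub>Q\<^esub> L l) < e / 2" using ap[OF b(1) h] by blast
    have "b \<in> carrier Q" using b(1) by (simp add: N_def)
    then have "norm2 Q (a \<ominus>\<^bsub>Q\<^esub> L l) < e"
      using P.norm2_triangle_minus[OF a _ Lc[of l], of b] b(2) l(2) by linarith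
    then show "\<exists>l. lletters l \<subseteq> I \<and> norm2 Q (a \<ominus>\<^bsub>Q\<^esub> L l) < e" using l(1) by blast
  qed
  have Nc: "N \<subseteq> carrier Q" by (auto simp: N_def)
  have "closedin (ultraweak Q) N" by (rule closedin_ultraweak[OF Nc _ add scal closed]) (use one in blast)
  then have "wstar_subalgebra Q N"
    unfolding wstar_subalgebra_def by (intro conjI ballI allI Nc one add mult scal star)
  moreover have "(\<lambda>i. cls (X i)) ` I \<subseteq> N" using gens by blast
  ultimately have "wstar_generated Q ((\<lambda>i. cls (X i)) ` I) \<subseteq> N"
    unfolding wstar_generated_def by blast
  then have "cls z \<in> N" unfolding gen using cls_carrier[OF z] by blast
  then obtain l where l: "lletters l \<subseteq> I" "norm2 Q (cls z \<ominus>\<^bsub>Q\<^esub> L l) < e" using ap e by blast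
  then have "norm2 Q (cls (\<lambda>n. z n - leval n (\<lambda>i. X i n) l)) < e" using z Lb by (simp add: L_def)
  from lim_less_eventually[OF norm2_Q this] show ?thesis using l(1) z Lb by auto
qed

lemma wstar_generated_carrier: "wstar_generated Q (carrier Q) = carrier Q"
proof -
  interpret P: pretracial Q by (rule pretracial_Q)
  have sc: "scal Q c a \<in> carrier Q" if "a \<in> carrier Q" for a c by (rule Q_inner(1)[OF that that])
  have one: "\<one>\<^bsub>Q\<^esub> \<in> carrier Q" by (rule P.one_closed)
  have "closedin (ultraweak Q) (carrier Q)"
    by (rule closedin_ultraweak[OF order_refl _ P.add.m_closed sc]) (use one in blast)
  then have "wstar_subalgebra Q (carrier Q)"
    unfolding wstar_subalgebra_def
    by (intro conjI ballI allI order_refl one P.add.m_closed P.m_closed sc P.sclosed)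
  then show ?thesis unfolding wstar_generated_def by (auto simp: wstar_subalgebra_def)
qed

end

section \<open>Lower bounds for orbital covering numbers\<close>

definition near_orbit :: "nat \<Rightarrow> nat \<Rightarrow> (nat \<Rightarrow> complex mat) \<Rightarrow> (nat \<Rightarrow> complex mat) \<Rightarrow> bool" where
  "near_orbit n m W W' \<longleftrightarrow> (\<exists>V\<in>unitaries n. \<forall>i<m. mn2 n (W i - conj_by V (W' i)) < 1 / 400)"

text \<open>Every cover of \<open>\<Omega>\<close> by sets of tuples with pairwise close unitary orbits has at least \<open>a\<close> members.
  Unlike a covering number this makes no reference to centers, so that it can be transported from the
  tuples in \<open>\<Omega>\<close> to microstates indexed differently.\<close>

definition packing :: "nat \<Rightarrow> nat \<Rightarrow> real \<Rightarrow> (nat \<Rightarrow> complex mat) set \<Rightarrow> bool" where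
  "packing n m a \<Omega> \<longleftrightarrow> (\<forall>P. finite P \<longrightarrow> \<Omega> \<subseteq> \<Union>P \<longrightarrow> (\<forall>p\<in>P. \<forall>W\<in>p. \<forall>W'\<in>p. near_orbit n m W W') \<longrightarrow>
     a \<le> real (card P))"

lemma packing_mono: "packing n m b \<Omega> \<Longrightarrow> a \<le> b \<Longrightarrow> packing n m a \<Omega>"
  unfolding packing_def by (intro allI impI, rule order_trans) auto

text \<open>Every center \<open>X\<close> of a cover of \<Xi> defines a cell, namely the tuples
  \<open>W\<close> related by \<open>G\<close> to some \<open>Y\<close> near the orbit of
  \<open>X\<close>. The cells cover \<Omega>, and \<open>sep\<close> makes the orbits of any two
  tuples in one cell close, so the packing bounds the number of centers.\<close>

lemma orbital_covering_packing:
  assumes pack: "packing n m a \<Omega>"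
    and lift: "\<And>W. W \<in> \<Omega> \<Longrightarrow> \<exists>Y\<in>\<Xi>. G W Y"
    and carrier: "\<And>Y i. Y \<in> \<Xi> \<Longrightarrow> i \<in> F \<Longrightarrow> Y i \<in> carrier_mat n n" and F: "F \<subseteq> I"
    and sep: "\<And>W W' Y Y' V. G W Y \<Longrightarrow> G W' Y' \<Longrightarrow> Y \<in> \<Xi> \<Longrightarrow> Y' \<in> \<Xi> \<Longrightarrow> V \<in> unitaries n \<Longrightarrow>
      (\<forall>i\<in>F. mn2 n (Y i - conj_by V (Y' i)) < 2 * \<epsilon>) \<Longrightarrow> near_orbit n m W W'"
    and k: "orbital_covering n I F \<epsilon> \<Xi> = enat k"
  shows "a \<le> real k"
proof -
  define S where "S = {enat (card \<Omega>') | \<Omega>'. finite \<Omega>' \<and> \<Omega>' \<subseteq> (\<Pi>\<^sub>E i\<in>I. carrier_mat n n) \<and>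
     (\<forall>Y\<in>\<Xi>. \<exists>V\<in>unitaries n. \<exists>X\<in>\<Omega>'. \<forall>i\<in>F. norm2 (mat_alg n) (Y i - V * X i * mat_adjoint V) < \<epsilon>)}"
  have eq: "Inf S = enat k" using k unfolding orbital_covering_def S_def .
  \<comment> \<open>An empty infimum in \<open>enat\<close> is infinite, so a finite value is
    attained and yields an actual cover.\<close>
  then have "S \<noteq> {}" by (auto simp: Inf_enat_def)
  then have "enat k \<in> S" using eq LeastI[of "\<lambda>x. x \<in> S"] unfolding Inf_enat_def by auto
  then obtain \<Omega>' where \<Omega>': "enat k = enat (card \<Omega>')" "finite \<Omega>'" "\<Omega>' \<subseteq> (\<Pi>\<^sub>E i\<in>I. carrier_mat n n)"
    and cover: "\<forall>Y\<in>\<Xi>. \<exists>V\<in>unitaries n. \<exists>X\<in>\<Omega>'. \<forall>i\<in>F. norm2 (mat_alg n) (Y i - V * X i * mat_adjoint V) < \<epsilon>"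
    unfolding S_def by blast
  have Xc: "X i \<in> carrier_mat n n" if "X \<in> \<Omega>'" "i \<in> F" for X i using \<Omega>'(3) F that by blast
  have conv: "norm2 (mat_alg n) (Y i - V * X i * mat_adjoint V) = mn2 n (Y i - conj_by V (X i))"
    if "Y \<in> \<Xi>" "X \<in> \<Omega>'" "i \<in> F" "V \<in> unitaries n" for Y X i V
    using norm2_mat_alg[of "Y i - conj_by V (X i)" n] carrier[OF that(1,3)] conj_by_carrier[OF that(4) Xc[OF that(2,3)]]
    by (simp add: conj_by_def)
  define cell where "cell X = {W. \<exists>Y\<in>\<Xi>. G W Y \<and> (\<exists>V\<in>unitaries n. \<forall>i\<in>F. mn2 n (Y i - conj_by V (X i)) < \<epsilon>)}" for X
  have "\<Omega> \<subseteq> \<Union>(cell ` \<Omega>')"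
  proof
    fix W assume "W \<in> \<Omega>"
    then obtain Y where Y: "Y \<in> \<Xi>" "G W Y" using lift by blast
    obtain V X where V: "V \<in> unitaries n" and X: "X \<in> \<Omega>'"
      and near: "\<forall>i\<in>F. norm2 (mat_alg n) (Y i - V * X i * mat_adjoint V) < \<epsilon>" using cover Y(1) by blast
    have "\<forall>i\<in>F. mn2 n (Y i - conj_by V (X i)) < \<epsilon>" using near conv[OF Y(1) X _ V] by simp
    then have "W \<in> cell X" unfolding cell_def using Y V by blast
    then show "W \<in> \<Union>(cell ` \<Omega>')" using X by blast
  qed
  moreover have "near_orbit n m W W'" if X: "X \<in> \<Omega>'" and W: "W \<in> cell X" and W': "W' \<in> cell X" for X W W'
  proof -
    obtain Y V where Y: "Y \<in> \<Xi>" "G W Y" "V \<in> unitaries n" "\<forall>i\<in>F. mn2 n (Y i - conj_by V (X i)) < \<epsilon>"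
      using W unfolding cell_def by blast
    obtain Y' V' where Y': "Y' \<in> \<Xi>" "G W' Y'" "V' \<in> unitaries n" "\<forall>i\<in>F. mn2 n (Y' i - conj_by V' (X i)) < \<epsilon>"
      using W' unfolding cell_def by blast
    \<comment> \<open>With Y near V X V* and Y' near V' X V'*, the unitary V V'* brings Y' to within
      2 \<epsilon> of Y.\<close>
    have u: "mat_adjoint V' \<in> unitaries n" "V * mat_adjoint V' \<in> unitaries n"
      using Y(3) Y'(3) by (auto intro: unitaries_mult unitaries_adjoint)
    have "mn2 n (Y i - conj_by (V * mat_adjoint V') (Y' i)) < 2 * \<epsilon>" if i: "i \<in> F" for i
    proof -
      have c: "Y i \<in> carrier_mat n n" "Y' i \<in> carrier_mat n n" "X i \<in> carrier_mat n n"
        using carrier[OF Y(1) i] carrier[OF Y'(1) i] Xc[OF X i] by simp_all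
      have "X i = conj_by (mat_adjoint V') (conj_by V' (X i))"
        using conj_by_inverse(1)[OF Y'(3) c(3)] by simp
      then have "conj_by V (X i) = conj_by (V * mat_adjoint V') (conj_by V' (X i))"
        using conj_by_conj_by[OF Y(3) u(1), of "conj_by V' (X i)"] c Y'(3) by simp
      then have "conj_by V (X i) - conj_by (V * mat_adjoint V') (Y' i) = conj_by (V * mat_adjoint V') (conj_by V' (X i) - Y' i)"
        using conj_by_minus[OF u(2), of "conj_by V' (X i)" "Y' i"] c Y'(3) by simp
      then have "mn2 n (conj_by V (X i) - conj_by (V * mat_adjoint V') (Y' i)) = mn2 n (Y' i - conj_by V' (X i))"
        using mn2_conj[OF u(2), of "conj_by V' (X i) - Y' i"] mn2_minus_commute[of "conj_by V' (X i)" n "Y' i"] c Y'(3) by simp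
      then show ?thesis
        using mn2_triangle_minus[of "Y i" n "conj_by V (X i)" "conj_by (V * mat_adjoint V') (Y' i)"] c Y(3,4) Y'(4) u i by fastforce
    qed
    then show ?thesis using sep[OF Y(2) Y'(2) Y(1) Y'(1) u(2)] by blast
  qed
  then have "\<forall>p\<in>cell ` \<Omega>'. \<forall>W\<in>p. \<forall>W'\<in>p. near_orbit n m W W'" by blast
  ultimately have "a \<le> real (card (cell ` \<Omega>'))"
    using pack[unfolded packing_def, rule_format, of "cell ` \<Omega>'"] finite_imageI[OF \<Omega>'(2)] by blast
  also have "\<dots> \<le> real (card \<Omega>')" using card_image_le[OF \<Omega>'(2)] by simp
  finally show ?thesis using \<Omega>'(1) by simp
qed

definition embed_tuple :: "nat \<Rightarrow> nat \<Rightarrow> (nat \<Rightarrow> (nat \<times> nat) set) \<Rightarrow> nat \<Rightarrow> complex mat" where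
  "embed_tuple n m S = (\<lambda>j. if j < m then sign_mat n (S j) else 0\<^sub>m n n)"

lemma embed_tuple_unit_tuples: "n > 0 \<Longrightarrow> S \<in> packed n m \<Longrightarrow> embed_tuple n m S \<in> unit_tuples n"
  using sign_mat_norm[of n] by (auto simp: unit_tuples_def embed_tuple_def op_ball_mat_alg packed_def zero_op_ball)

text \<open>A member of the cover lies near the orbit of any one of its elements, so
  \<open>card_near_orbit\<close> bounds how many tuples it contains; summing over the cover gives
  the quotient.\<close>

lemma packing_embed_tuple:
  assumes n: "n > 0" and A: "A \<subseteq> packed n m"
  shows "packing n m (real (card A) / (2 ^ (1206 * (n * n)) * (sqrt 2 ^ (n * n)) ^ m)) (embed_tuple n m ` A)"
  unfolding packing_def
proof (intro allI impI)
  fix P assume P: "finite P" and cover: "embed_tuple n m ` A \<subseteq> \<Union>P" and near: "\<forall>p\<in>P. \<forall>W\<in>p. \<forall>W'\<in>p. near_orbit n m W W'"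
  define K :: real where "K = 2 ^ (1206 * (n * n)) * (sqrt 2 ^ (n * n)) ^ m"
  have K: "K > 0" by (simp add: K_def)
  have Af: "finite A" using A finite_packed finite_subset by blast
  have cell: "real (card {S \<in> A. embed_tuple n m S \<in> p}) \<le> K" if p: "p \<in> P" for p
  proof (cases "{S \<in> A. embed_tuple n m S \<in> p} = {}")
    case False
    then obtain S0 where S0: "S0 \<in> A" "embed_tuple n m S0 \<in> p" by blast
    have "{S \<in> A. embed_tuple n m S \<in> p} \<subseteq> {S \<in> packed n m. \<exists>V\<in>unitaries n. \<forall>i<m. mn2 n (sign_mat n (S i) - conj_by V (sign_mat n (S0 i))) < 1/400}"
    proof
      fix S assume S: "S \<in> {S \<in> A. embed_tuple n m S \<in> p}"
      then have "near_orbit n m (embed_tuple n m S) (embed_tuple n m S0)" using near p S0 by blast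
      then obtain V where V: "V \<in> unitaries n" "\<forall>i<m. mn2 n (embed_tuple n m S i - conj_by V (embed_tuple n m S0 i)) < 1 / 400"
        unfolding near_orbit_def by blast
      have "mn2 n (sign_mat n (S i) - conj_by V (sign_mat n (S0 i))) < 1/400" if "i < m" for i
        using V(2)[rule_format, OF that] that by (simp add: embed_tuple_def)
      then show "S \<in> {S \<in> packed n m. \<exists>V\<in>unitaries n. \<forall>i<m. mn2 n (sign_mat n (S i) - conj_by V (sign_mat n (S0 i))) < 1/400}"
        using V(1) S A by blast
    qed
    then have "card {S \<in> A. embed_tuple n m S \<in> p} \<le> card {S \<in> packed n m. \<exists>V\<in>unitaries n. \<forall>i<m. mn2 n (sign_mat n (S i) - conj_by V (sign_mat n (S0 i))) < 1/400}"
      by (rule card_mono[OF finite_subset[OF _ finite_packed], rotated]) blast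
    then have "real (card {S \<in> A. embed_tuple n m S \<in> p}) \<le> real (card {S \<in> packed n m. \<exists>V\<in>unitaries n. \<forall>i<m. mn2 n (sign_mat n (S i) - conj_by V (sign_mat n (S0 i))) < 1/400})"
      by (rule of_nat_mono)
    moreover have "S0 \<in> packed n m" using S0(1) A by blast
    ultimately show ?thesis unfolding K_def using order_trans[OF _ card_near_orbit[OF n, of S0 m]] by blast
  next
    case True
    show ?thesis unfolding True using K by simp
  qed
  have "A \<subseteq> (\<Union>p\<in>P. {S \<in> A. embed_tuple n m S \<in> p})"
  proof
    fix S assume S: "S \<in> A"
    obtain p where "p \<in> P" "embed_tuple n m S \<in> p" using subsetD[OF cover imageI[OF S]] by (rule UnionE)
    then show "S \<in> (\<Union>p\<in>P. {S \<in> A. embed_tuple n m S \<in> p})" using S by (intro UN_I CollectI conjI)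
  qed
  then have "card A \<le> card (\<Union>p\<in>P. {S \<in> A. embed_tuple n m S \<in> p})"
    by (rule card_mono[rotated]) (intro finite_UN_I P finite_Collect_conjI disjI1, use Af in simp)
  also have "\<dots> \<le> (\<Sum>p\<in>P. card {S \<in> A. embed_tuple n m S \<in> p})" by (rule card_UN_le[OF P])
  finally have "card A \<le> (\<Sum>p\<in>P. card {S \<in> A. embed_tuple n m S \<in> p})" .
  then have "real (card A) \<le> (\<Sum>p\<in>P. real (card {S \<in> A. embed_tuple n m S \<in> p}))" unfolding of_nat_sum[symmetric] by (rule of_nat_mono)
  also have "\<dots> \<le> (\<Sum>p\<in>P. K)" by (rule sum_mono[OF cell])
  also have "\<dots> = real (card P) * K" by simp
  finally have "real (card A) / K \<le> real (card P)" using K by (simp add: divide_le_eq)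
  then show "real (card A) / (2 ^ (1206 * (n * n)) * (sqrt 2 ^ (n * n)) ^ m) \<le> real (card P)"
    unfolding K_def .
qed

section \<open>Large classes of tuples with the same code\<close>

lemma large_fiber:
  fixes f :: "'a \<Rightarrow> nat"
  assumes A: "finite A" "A \<noteq> {}" and f: "\<And>x. x \<in> A \<Longrightarrow> f x < B"
  shows "\<exists>x\<in>A. card A \<le> B * card {y \<in> A. f y = f x}"
proof (rule ccontr)
  assume neg: "\<not> ?thesis"
  have B: "B > 0" using A f by (metis all_not_in_conv gr_zeroI not_less_zero)
  define c where "c v = card {y \<in> A. f y = v}" for v
  have c: "B * c v < card A" if "v < B" for v
  proof (cases "\<exists>x\<in>A. f x = v")
    case True
    then show ?thesis using neg by (auto simp: c_def not_le)
  next
    case False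
    then have e: "{y \<in> A. f y = v} = {}" by blast
    have "c v = 0" unfolding c_def e by simp
    then show ?thesis using A by (simp add: card_gt_0_iff)
  qed
  have "card A = card (\<Union>v\<in>{..<B}. {y \<in> A. f y = v})" by (rule arg_cong[of _ _ card]) (use f in blast)
  also have "\<dots> \<le> (\<Sum>v<B. c v)" unfolding c_def by (rule card_UN_le) simp
  finally have "B * card A \<le> (\<Sum>v<B. B * c v)" by (simp flip: sum_distrib_left)
  also have "\<dots> < (\<Sum>v<B. card A)" by (rule sum_strict_mono) (use B c in auto)
  finally show False by simp
qed

lemma ln_2_half: "1 / 2 \<le> ln (2::real)"
proof -
  have "exp (1::real) \<le> 2 * 2" using exp_le by simp
  then have "ln (exp (1::real)) \<le> ln (2 * 2)" by (subst ln_le_cancel_iff) simp_all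
  also have "ln (2 * 2 :: real) = ln 2 + ln 2" by (rule ln_mult_pos) simp_all
  finally show ?thesis by simp
qed

text \<open>With L = log 2, the logarithm of the quotient is at least (m/2 - 1206) L n^2 - m L - log
  n. As n \<ge> 2, the loss m L from the halved counts is at most m L n^2 / 4, and log n \<le> n^2.
  The condition on \<open>m\<close> says that (m/4 - 1206) L \<ge> C + 1, where 4824 = 4 * 1206 and
  L \<ge> 1/2.\<close>

lemma card_estimate:
  assumes C: "0 \<le> C" and m: "8 * (C + 1) + 4824 \<le> real m" and n: "2 \<le> n"
    and K: "(2 ^ (n * n) / 2) ^ m \<le> K"
  shows "exp (C * (real n)\<^sup>2) \<le> K / real n / (2 ^ (1206 * (n * n)) * (sqrt 2 ^ (n * n)) ^ m)"
proof -
  define q where "q = real n * real n"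
  define L where "L = ln (2::real)"
  have L: "1 / 2 \<le> L" using ln_2_half by (simp add: L_def)
  have q: "4 \<le> q" "real n \<le> q"
    using mult_mono[of 2 "real n" 2 "real n"] mult_right_mono[of 1 "real n" "real n"] n unfolding q_def by simp_all
  have e2: "2 ^ k = exp (real k * L)" for k by (simp add: exp_of_nat_mult L_def)
  have s2: "sqrt 2 = exp (L / 2)"
    by (rule real_sqrt_unique) (simp_all add: L_def flip: exp_of_nat_mult)
  have nn: "real (n * n) = q" by (simp add: q_def)
  define t :: real where "t = 2 ^ (1206 * (n * n)) * (sqrt 2 ^ (n * n)) ^ m"
  have t0: "t > 0" by (simp add: t_def)
  have 1: "(2 ^ (n * n) / 2) ^ m = exp (real m * (q * L - L))"
  proof -
    have "2 ^ (n * n) / 2 = exp (q * L - L)" unfolding e2 nn by (simp add: exp_diff L_def)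
    then show ?thesis by (simp add: exp_of_nat_mult)
  qed
  have 2: "t = exp (1206 * q * L + real m * (q * (L / 2)))"
  proof -
    have "sqrt 2 ^ (n * n) = exp (q * (L / 2))" unfolding s2 nn[symmetric] by (rule exp_of_nat_mult[symmetric])
    moreover have "(2::real) ^ (1206 * (n * n)) = exp (1206 * q * L)" unfolding e2 by (simp add: q_def)
    ultimately show ?thesis unfolding t_def by (simp only: exp_add exp_of_nat_mult)
  qed
  have 3: "real n \<le> exp q" using exp_ge_add_one_self[of q] q by linarith
  have "C * q + q + (1206 * q * L + real m * (q * (L / 2))) \<le> real m * (q * L - L)"
  proof -
    have "real m * L * 1 \<le> real m * L * (q / 4)" by (rule mult_left_mono) (use q(1) L in simp_all)
    moreover have "(C + 1) * q \<le> (real m / 4 - 1206) * L * q"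
    proof (rule mult_right_mono)
      have "2 * (C + 1) \<le> real m / 4 - 1206" using m by simp
      then have "2 * (C + 1) * (1 / 2) \<le> (real m / 4 - 1206) * L" using L C by (intro mult_mono) simp_all
      then show "C + 1 \<le> (real m / 4 - 1206) * L" by simp
    qed (use q in simp)
    ultimately show ?thesis by (simp add: algebra_simps)
  qed
  then have "exp (C * q) * exp q * t \<le> (2 ^ (n * n) / 2) ^ m" unfolding 1 2 by (simp flip: exp_add)
  moreover have "exp (C * q) * real n * t \<le> exp (C * q) * exp q * t"
    using 3 t0 by (intro mult_right_mono mult_left_mono) simp_all
  ultimately have "exp (C * q) * real n * t \<le> K" using K by linarith
  then have "exp (C * q) \<le> K / real n / t" using n t0 by (simp add: le_divide_eq mult_ac)
  then show ?thesis by (simp add: t_def q_def power2_eq_square)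
qed

context ultra
begin

text \<open>The limit exists because the extended reals are compact. Infinite covering numbers
  satisfy the bound trivially, so the assumption concerns finite ones only.\<close>

lemma growth_rate_ge:
  assumes "eventually (\<lambda>n. \<forall>k. K n = enat k \<longrightarrow> exp (C * (real n)\<^sup>2) \<le> real k) U"
  shows "ereal C \<le> growth_rate U K"
proof -
  obtain l where l: "((\<lambda>n. ereal (1 / (real n)\<^sup>2) * log_card (K n)) \<longlongrightarrow> l) U"
    using compact_lim[OF Extended_Real_Limits.compact_UNIV UNIV_I, of "\<lambda>n. ereal (1 / (real n)\<^sup>2) * log_card (K n)"] by (elim bexE)
  have "eventually (\<lambda>n. ereal C \<le> ereal (1 / (real n)\<^sup>2) * log_card (K n)) U"
    using assms U_ge[of 1]
  proof eventually_elim
    case (elim n)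
    show ?case
    proof (cases "K n")
      case (enat k)
      then have e: "exp (C * (real n)\<^sup>2) \<le> real k" using elim by blast
      then have k: "k > 0" by (metis exp_gt_zero not_le of_nat_0 gr_zeroI)
      have "C * (real n)\<^sup>2 \<le> ln (real k)" using e k by (simp add: ln_ge_iff)
      then have "C \<le> 1 / (real n)\<^sup>2 * ln (real k)" using elim(2) by (simp add: le_divide_eq)
      then show ?thesis using k enat by simp
    next
      case infinity
      then show ?thesis using elim(2) by simp
    qed
  qed
  then have "ereal C \<le> l" by (rule tendsto_lowerbound[OF l _ U_ne])
  then show ?thesis unfolding growth_rate_def Lim_eq[OF l] .
qed

text \<open>Both entropy bounds start from these data and differ in the microstates built over
  \<Omega> n.\<close>

lemma large_similarity_classes:
  assumes C: "0 \<le> C"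
  shows "\<exists>m \<kappa> Z \<Omega>. (\<forall>i. eventually (\<lambda>n. i \<le> \<kappa> n) U) \<and> (\<forall>n. Z n \<in> unit_tuples n) \<and>
    (\<forall>n. \<forall>W\<in>\<Omega> n. sim (\<kappa> n) (\<kappa> n) n W (Z n)) \<and>
    eventually (\<lambda>n. packing n m (exp (C * (real n)\<^sup>2)) (\<Omega> n)) U"
proof -
  have "\<forall>N. \<exists>B. \<forall>n. \<forall>X\<in>unit_tuples n. cl N N n X < B" using cl_bound by blast
  from choice[OF this] obtain B where "\<forall>N. \<forall>n. \<forall>X\<in>unit_tuples n. cl N N n X < B N" ..
  then have B: "cl N N n X < B N" if "X \<in> unit_tuples n" for N n X using that by blast
  obtain m where m: "8 * (C + 1) + 4824 \<le> real m" using real_arch_simple by blast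
  \<comment> \<open>Each \<open>B i\<close> is eventually at most \<open>n\<close>, so
    \<open>diagonal\<close> yields a precision that tends to infinity although at most
    \<open>n\<close> codes occur at size \<open>n\<close>.\<close>
  obtain \<kappa> where \<kappa>: "\<forall>i. eventually (\<lambda>n. i \<le> \<kappa> n) U" "eventually (\<lambda>n. B (\<kappa> n) \<le> n) U"
    using diagonal[of "\<lambda>i n. B i \<le> n", OF U_ge] by blast
  have "\<exists>Z \<Omega>. Z \<in> unit_tuples n \<and> (\<forall>W\<in>\<Omega>. sim (\<kappa> n) (\<kappa> n) n W Z) \<and>
    (B (\<kappa> n) \<le> n \<longrightarrow> 2 \<le> n \<longrightarrow> packing n m (exp (C * (real n)\<^sup>2)) \<Omega>)" for n
  proof (cases "B (\<kappa> n) \<le> n \<and> 2 \<le> n")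
    case False
    have "(\<lambda>_. 0\<^sub>m n n) \<in> unit_tuples n" by (simp add: unit_tuples_def zero_op_ball)
    then show ?thesis using False by blast
  next
    case True
    then have n: "n > 0" by simp
    define f where "f S = cl (\<kappa> n) (\<kappa> n) n (embed_tuple n m S)" for S
    have ne: "packed n m \<noteq> {}" 
    proof
      assume "packed n m = {}"
      then have "(2 ^ (n * n) / 2 :: real) ^ m \<le> 0" using card_packed[OF n, of m] by simp
      moreover have "(2 ^ (n * n) / 2 :: real) ^ m > 0" by simp
      ultimately show False by linarith
    qed
    obtain S0 where S0: "S0 \<in> packed n m" "card (packed n m) \<le> B (\<kappa> n) * card {S \<in> packed n m. f S = f S0}"
      using large_fiber[OF finite_packed ne, of f "B (\<kappa> n)"] B[OF embed_tuple_unit_tuples[OF n]] unfolding f_def by blast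
    define A where "A = {S \<in> packed n m. f S = f S0}"
    have A: "A \<subseteq> packed n m" by (auto simp: A_def)
    have "card (packed n m) \<le> n * card A"
      using S0(2) mult_le_mono1[of "B (\<kappa> n)" n "card A"] True unfolding A_def by linarith
    then have "real (card (packed n m)) \<le> real n * real (card A)" unfolding of_nat_mult[symmetric] by (rule of_nat_mono)
    then have le: "real (card (packed n m)) / real n \<le> real (card A)" using n by (simp add: pos_divide_le_eq mult.commute)
    have "exp (C * (real n)\<^sup>2) \<le> real (card (packed n m)) / real n / (2 ^ (1206 * (n * n)) * (sqrt 2 ^ (n * n)) ^ m)"
      by (rule card_estimate[OF C m _ card_packed[OF n]]) (use True in simp)
    also have "\<dots> \<le> real (card A) / (2 ^ (1206 * (n * n)) * (sqrt 2 ^ (n * n)) ^ m)"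
      by (intro divide_right_mono le) simp
    finally have "packing n m (exp (C * (real n)\<^sup>2)) (embed_tuple n m ` A)"
      by (rule packing_mono[OF packing_embed_tuple[OF n A]])
    moreover have "sim (\<kappa> n) (\<kappa> n) n (embed_tuple n m S) (embed_tuple n m S0)" if "S \<in> A" for S
      unfolding sim_def using embed_tuple_unit_tuples[OF n] that S0(1) by (auto simp: A_def f_def)
    ultimately show ?thesis using embed_tuple_unit_tuples[OF n S0(1)] by blast
  qed
  then have "\<forall>n. \<exists>Z \<Omega>. Z \<in> unit_tuples n \<and> (\<forall>W\<in>\<Omega>. sim (\<kappa> n) (\<kappa> n) n W Z) \<and>
    (B (\<kappa> n) \<le> n \<longrightarrow> 2 \<le> n \<longrightarrow> packing n m (exp (C * (real n)\<^sup>2)) \<Omega>)" ..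
  from choice[OF this] obtain Z where "\<forall>n. \<exists>\<Omega>. Z n \<in> unit_tuples n \<and> (\<forall>W\<in>\<Omega>. sim (\<kappa> n) (\<kappa> n) n W (Z n)) \<and>
    (B (\<kappa> n) \<le> n \<longrightarrow> 2 \<le> n \<longrightarrow> packing n m (exp (C * (real n)\<^sup>2)) \<Omega>)" ..
  from choice[OF this] obtain \<Omega> where Z: "\<forall>n. Z n \<in> unit_tuples n \<and> (\<forall>W\<in>\<Omega> n. sim (\<kappa> n) (\<kappa> n) n W (Z n)) \<and>
    (B (\<kappa> n) \<le> n \<longrightarrow> 2 \<le> n \<longrightarrow> packing n m (exp (C * (real n)\<^sup>2)) (\<Omega> n))" ..
  have "eventually (\<lambda>n. packing n m (exp (C * (real n)\<^sup>2)) (\<Omega> n)) U"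
    using \<kappa>(2) U_ge[of 2] by eventually_elim (use Z in blast)
  moreover have "\<forall>n. Z n \<in> unit_tuples n" "\<forall>n. \<forall>W\<in>\<Omega> n. sim (\<kappa> n) (\<kappa> n) n W (Z n)" using Z by blast+
  ultimately show ?thesis using \<kappa>(1) by blast
qed

end

section \<open>Covering entropy of types\<close>

text \<open>Basic open sets restrict finitely many coordinates, so one tolerance suffices. Points
  must be extensional because laws and types are functions restricted to polynomials and well-formed
  formulas.\<close>

lemma product_topology_neighborhood:
  fixes x :: "'i \<Rightarrow> 'b :: metric_space"
  assumes T: "openin (product_topology (\<lambda>_. euclidean) I) T" and x: "x \<in> T"
  shows "\<exists>\<Phi> d. finite \<Phi> \<and> \<Phi> \<subseteq> I \<and> d > 0 \<and> (\<forall>y\<in>extensional I. (\<forall>\<phi>\<in>\<Phi>. dist (y \<phi>) (x \<phi>) < d) \<longrightarrow> y \<in> T)"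
proof -
  obtain V where V: "finite {i \<in> I. V i \<noteq> UNIV}" "\<forall>i\<in>I. open (V i)" "x \<in> Pi\<^sub>E I V" "Pi\<^sub>E I V \<subseteq> T"
    using T x unfolding openin_product_topology_alt by auto
  define \<Phi> where "\<Phi> = {i \<in> I. V i \<noteq> UNIV}"
  have "\<exists>d>0. \<forall>y. dist y (x i) < d \<longrightarrow> y \<in> V i" if "i \<in> \<Phi>" for i
    using V(2,3) that unfolding \<Phi>_def open_dist by (metis (no_types, lifting) PiE_mem mem_Collect_eq)
  then obtain d where d: "\<And>i. i \<in> \<Phi> \<Longrightarrow> d i > 0" "\<And>i y. i \<in> \<Phi> \<Longrightarrow> dist y (x i) < d i \<Longrightarrow> y \<in> V i" by metis
  define e where "e = Min (insert 1 (d ` \<Phi>))"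
  have \<Phi>: "finite \<Phi>" using V(1) by (simp add: \<Phi>_def)
  have e: "e > 0" unfolding e_def using \<Phi> d(1) by (subst Min_gr_iff) auto
  have ed: "e \<le> d i" if "i \<in> \<Phi>" for i unfolding e_def using \<Phi> that by (intro Min_le) auto
  have "y \<in> T" if y: "y \<in> extensional I" and near: "\<forall>\<phi>\<in>\<Phi>. dist (y \<phi>) (x \<phi>) < e" for y
  proof -
    have "y i \<in> V i" if "i \<in> I" for i
    proof (cases "i \<in> \<Phi>")
      case True
      show ?thesis by (rule d(2)[OF True less_le_trans[OF near[rule_format, OF True] ed[OF True]]])
    next
      case False
      then show ?thesis using that by (simp add: \<Phi>_def)
    qed
    then have "y \<in> Pi\<^sub>E I V" using y by (simp add: PiE_iff)
    then show ?thesis using V(4) by blast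
  qed
  then show ?thesis using \<Phi> e
    by (intro exI[of _ \<Phi>] exI[of _ e] conjI ballI impI) (auto simp: \<Phi>_def)
qed

context ultra
begin

text \<open>Half of \<open>d\<close> covers the distance from \<open>W\<close> to
  \<open>Z n\<close>, through equal codes of sufficient depth, and half the distance from
  \<open>Z n\<close> to its limit, by Los's theorem.\<close>

lemma interp_near_eventually:
  assumes \<phi>: "well_formed \<phi>" and d: "d > 0"
    and \<kappa>: "\<forall>i. eventually (\<lambda>n. i \<le> \<kappa> n) U" and Z: "\<And>n. Z n \<in> unit_tuples n"
    and sim: "\<forall>n. \<forall>W\<in>\<Omega> n. sim (\<kappa> n) (\<kappa> n) n W (Z n)"
  shows "eventually (\<lambda>n. \<forall>W\<in>\<Omega> n. \<bar>interp (mat_alg n) \<phi> W - interp Q \<phi> (\<lambda>j. cls (\<lambda>n. Z n j))\<bar> < d) U"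
proof -
  have Zb: "(\<lambda>n. Z n j) \<in> bs" for j
    by (rule bsI[where C = 1]) (use unit_tuplesD[OF Z] in auto)
  obtain k N where kN: "\<And>n X Y. sim k N n X Y \<Longrightarrow> \<bar>interp (mat_alg n) \<phi> (scaled (\<lambda>_. 1) X) - interp (mat_alg n) \<phi> (scaled (\<lambda>_. 1) Y)\<bar> \<le> d / 2"
    using interp_near[OF \<phi>, of "d / 2" "\<lambda>_. 1"] d by auto
  have one: "scaled (\<lambda>_. 1) X = X" for X :: "nat \<Rightarrow> complex mat" by (simp add: one_smult_mat)
  have "((\<lambda>n. interp (mat_alg n) \<phi> (Z n)) \<longlongrightarrow> interp Q \<phi> (\<lambda>j. cls (\<lambda>n. Z n j))) U"
    using interp_Q[OF \<phi>, of "\<lambda>j n. Z n j", OF Zb] by simp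
  from tendstoD[OF this, of "d / 2"] have "eventually (\<lambda>n. dist (interp (mat_alg n) \<phi> (Z n)) (interp Q \<phi> (\<lambda>j. cls (\<lambda>n. Z n j))) < d / 2) U"
    using d by simp
  then show ?thesis
    using \<kappa>[rule_format, of "max k N"]
  proof eventually_elim
    case (elim n)
    show ?case
    proof
      fix W assume "W \<in> \<Omega> n"
      then have "sim k N n W (Z n)" using sim sim_mono elim(2) by (meson max.boundedE)
      from kN[OF this] have "\<bar>interp (mat_alg n) \<phi> W - interp (mat_alg n) \<phi> (Z n)\<bar> \<le> d / 2" unfolding one .
      then show "\<bar>interp (mat_alg n) \<phi> W - interp Q \<phi> (\<lambda>j. cls (\<lambda>n. Z n j))\<bar> < d" using elim(1) unfolding dist_real_def by linarith
    qed
  qed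
qed

lemma Ent_ge:
  assumes C: "0 \<le> C"
  shows "ereal C \<le> Ent U (carrier Q) Q"
proof -
  obtain m \<kappa> Z \<Omega> where \<kappa>: "\<forall>i. eventually (\<lambda>n. i \<le> \<kappa> n) U" and Z: "\<forall>n. Z n \<in> unit_tuples n"
    and sim: "\<forall>n. \<forall>W\<in>\<Omega> n. sim (\<kappa> n) (\<kappa> n) n W (Z n)"
    and pack: "eventually (\<lambda>n. packing n m (exp (C * (real n)\<^sup>2)) (\<Omega> n)) U"
    using large_similarity_classes[OF C] by blast
  define X where "X j = cls (\<lambda>n. Z n j)" for j
  have Zb: "(\<lambda>n. Z n j) \<in> bs" for j
    by (rule bsI[where C = 1]) (use unit_tuplesD[OF Z[rule_format]] in auto)
  have Xc: "\<forall>j. X j \<in> carrier Q" by (simp add: X_def Zb)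
  \<comment> \<open>If the type is realized over \<open>nat universe\<close>, the radii are taken
    from the norms of a realization, so that an open set containing the type also meets
    \<open>types_bounded r\<close> in it. Otherwise no open set contains the type and the infimum is
    over an empty family. Radii of at least 1 admit all contractions.\<close>
  have "\<exists>r. (\<forall>j. 1 \<le> r j) \<and> (tp Q X \<in> types \<longrightarrow> tp Q X \<in> types_bounded r)"
  proof (cases "tp Q X \<in> types")
    case True
    then obtain M :: "nat universe star_alg" and Y where M: "tracial_wstar_algebra M" "\<forall>j. Y j \<in> carrier M" "tp Q X = tp M Y"
      unfolding types_def by blast
    have "tp Q X \<in> types_bounded (\<lambda>j. max 1 (cnorm M (Y j)))"
      unfolding types_bounded_def using M by (intro CollectI exI[of _ M] exI[of _ Y]) (simp add: op_ball_def)
    then show ?thesis by (intro exI[of _ "\<lambda>j. max 1 (cnorm M (Y j))"]) simp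
  qed (auto intro: exI[of _ "\<lambda>_. 1"])
  then obtain r where r: "\<And>j. 1 \<le> r j" "tp Q X \<in> types \<Longrightarrow> tp Q X \<in> types_bounded r" by blast
  have rpos: "0 < r j" for j using r(1)[of j] by linarith
  have ball: "W j \<in> op_ball (mat_alg n) (r j)" if "W \<in> \<Omega> n" for W j n
  proof -
    have "W \<in> unit_tuples n" using sim[rule_format, OF that] by (simp add: sim_def)
    from unit_tuplesD[OF this, of j] show ?thesis using r(1)[of j] by (simp add: op_ball_mat_alg)
  qed
  \<comment> \<open>1/800 is half of the 1/400 in \<open>near_orbit\<close>, since two points near
    one center are within twice the tolerance.\<close>
  have "ereal C \<le> Ent_at U r {..<m} (1 / 800) {tp Q X}"
    unfolding Ent_at_def
  proof (rule INF_greatest, rule growth_rate_ge)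
    fix A assume "A \<in> {A. open_types A \<and> {tp Q X} \<subseteq> A}"
    then have "open_types A" and A: "A \<subseteq> types" "tp Q X \<in> A" by (auto simp: open_types_def)
    then have A3: "openin (type_topology r) (A \<inter> types_bounded r)" unfolding open_types_def using rpos by simp
    from A3 obtain T where T: "openin (product_topology (\<lambda>_. euclideanreal) {\<phi>. well_formed \<phi>}) T" "A \<inter> types_bounded r = T \<inter> types_bounded r"
      unfolding type_topology_def openin_subtopology by (elim exE conjE)
    have "tp Q X \<in> A \<inter> types_bounded r" using A r(2) by blast
    then have "tp Q X \<in> T" unfolding T(2) by blast
    from product_topology_neighborhood[OF T(1) this]
    obtain \<Phi> d where \<Phi>: "finite \<Phi>" "\<Phi> \<subseteq> {\<phi>. well_formed \<phi>}" and d: "d > 0"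
      and near: "\<forall>y\<in>extensional {\<phi>. well_formed \<phi>}. (\<forall>\<phi>\<in>\<Phi>. dist (y \<phi>) (tp Q X \<phi>) < d) \<longrightarrow> y \<in> T" by blast
    have "eventually (\<lambda>n. \<forall>\<phi>\<in>\<Phi>. \<forall>W\<in>\<Omega> n. \<bar>interp (mat_alg n) \<phi> W - interp Q \<phi> X\<bar> < d) U"
      unfolding X_def
      by (rule eventually_ball_finite[OF \<Phi>(1)], rule ballI, rule interp_near_eventually[OF _ d \<kappa> Z[rule_format] sim])
        (use \<Phi>(2) in blast)
    then show "eventually (\<lambda>n. \<forall>k. orbital_covering n UNIV {..<m} (1 / 800) (type_microstates n r A) = enat k \<longrightarrow>
        exp (C * (real n)\<^sup>2) \<le> real k) U"
      using pack U_ge[of 1]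
    proof eventually_elim
      case (elim n)
      have sub: "W \<in> type_microstates n r A" if W: "W \<in> \<Omega> n" for W
      proof -
        have "dist (tp (mat_alg n) W \<phi>) (tp Q X \<phi>) < d" if "\<phi> \<in> \<Phi>" for \<phi>
          using elim(1) W that \<Phi>(2) by (auto simp: tp_def dist_real_def)
        moreover have "tp (mat_alg n) W \<in> extensional {\<phi>. well_formed \<phi>}" by (simp add: tp_def)
        ultimately have "tp (mat_alg n) W \<in> T" using near by blast
        moreover have "tp (mat_alg n) W \<in> types_bounded r"
          by (rule tp_mat_in_types_bounded) (use elim(3) ball[OF W] in auto)
        ultimately have "tp (mat_alg n) W \<in> A \<inter> types_bounded r" unfolding T(2) by blast
        then have "tp (mat_alg n) W \<in> A" by blast
        then show ?thesis unfolding type_microstates_def using ball[OF W] by blast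
      qed
      show ?case
      proof (intro allI impI)
        fix k assume k: "orbital_covering n UNIV {..<m} (1 / 800) (type_microstates n r A) = enat k"
        show "exp (C * (real n)\<^sup>2) \<le> real k"
        \<comment> \<open>The tuples in \<Omega> n are themselves microstates, so the relation
          between the two families is equality.\<close>
        proof (rule orbital_covering_packing[OF elim(2) _ _ _ _ k, where G = "(=)"])
          show "\<exists>Y\<in>type_microstates n r A. W = Y" if "W \<in> \<Omega> n" for W using sub[OF that] by blast
          show "Y i \<in> carrier_mat n n" if "Y \<in> type_microstates n r A" for Y i
            using that by (auto simp: type_microstates_def op_ball_mat_alg)
          show "near_orbit n m W W'" if "W = Y" "W' = Y'" "V \<in> unitaries n" "\<forall>i\<in>{..<m}. mn2 n (Y i - conj_by V (Y' i)) < 2 * (1 / 800)"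
            for W W' Y Y' V
            using that unfolding near_orbit_def by auto
        qed simp
      qed
    qed
  qed
  also have "\<dots> \<le> Ent_set U {tp Q X}"
    unfolding Ent_set_def
    by (rule SUP_upper2[of r], use rpos in simp, rule SUP_upper2[of "{..<m}"], simp, rule SUP_upper) simp
  also have "\<dots> \<le> Ent U (carrier Q) Q"
    unfolding Ent_def by (rule SUP_upper) (use Xc in blast)
  finally show ?thesis .
qed

end

section \<open>Stability of polynomials and transport of microstates\<close>

lemma mword_Lipschitz:
  "\<exists>L\<ge>0. \<forall>n X Y \<delta>. (\<forall>i\<in>letters w. X i \<in> op_ball (mat_alg n) (c i) \<and> Y i \<in> op_ball (mat_alg n) (c i) \<and>
      mn2 n (X i - Y i) \<le> \<delta>) \<longrightarrow> 0 \<le> \<delta> \<longrightarrow> mn2 n (mword n X w - mword n Y w) \<le> L * \<delta>"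
proof (induction w)
  case Nil
  have z: "1\<^sub>m n - 1\<^sub>m n = (0\<^sub>m n n :: complex mat)" for n by (intro eq_matI) auto
  show ?case by (intro exI[of _ 0]) (simp add: z)
next
  case (Cons ib w)
  then obtain L where L: "L \<ge> 0" and LI: "\<And>n X Y \<delta>. (\<forall>i\<in>letters w. X i \<in> op_ball (mat_alg n) (c i) \<and> Y i \<in> op_ball (mat_alg n) (c i) \<and>
      mn2 n (X i - Y i) \<le> \<delta>) \<Longrightarrow> 0 \<le> \<delta> \<Longrightarrow> mn2 n (mword n X w - mword n Y w) \<le> L * \<delta>" by blast
  show ?case
  proof (intro exI[of _ "\<bar>c (fst ib)\<bar> * L + \<bar>wcoef c w\<bar>"] conjI allI impI)
    show "0 \<le> \<bar>c (fst ib)\<bar> * L + \<bar>wcoef c w\<bar>" using L by simp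
    fix n X Y \<delta>
    assume h: "\<forall>i\<in>letters (ib # w). X i \<in> op_ball (mat_alg n) (c i) \<and> Y i \<in> op_ball (mat_alg n) (c i) \<and> mn2 n (X i - Y i) \<le> \<delta>"
      and \<delta>: "0 \<le> \<delta>"
    have c: "X i \<in> carrier_mat n n" "Y i \<in> carrier_mat n n" "mat_op_norm n (X i) \<le> c i" "mat_op_norm n (Y i) \<le> c i" "mn2 n (X i - Y i) \<le> \<delta>"
      if "i \<in> letters (ib # w)" for i
      using h[rule_format, OF that] by (simp_all add: op_ball_mat_alg)
    define A B P R where "A = (if snd ib then mat_adjoint (X (fst ib)) else X (fst ib))"
      and "B = (if snd ib then mat_adjoint (Y (fst ib)) else Y (fst ib))"
      and "P = mword n X w" and "R = mword n Y w"
    have cX: "X (fst ib) \<in> carrier_mat n n" and cY: "Y (fst ib) \<in> carrier_mat n n" using c(1,2)[of "fst ib"] by simp_all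
    have AB: "A \<in> carrier_mat n n" "B \<in> carrier_mat n n" using cX cY by (simp_all add: A_def B_def)
    have PR: "P \<in> carrier_mat n n" "R \<in> carrier_mat n n" using c(1,2) by (simp_all add: P_def R_def)
    have nA: "mat_op_norm n A \<le> \<bar>c (fst ib)\<bar>"
      using c(3)[of "fst ib"] cX by (simp add: A_def mat_op_norm_adjoint)
    have nR: "mat_op_norm n R \<le> \<bar>wcoef c w\<bar>"
    proof -
      have "mat_op_norm n R \<le> wcoef c w" unfolding R_def by (rule mword_norm) (simp_all add: c(2,4))
      then show ?thesis by linarith
    qed
    have nAB: "mn2 n (A - B) \<le> \<delta>"
    proof (cases "snd ib")
      case True
      have "mat_adjoint (X (fst ib)) - mat_adjoint (Y (fst ib)) = mat_adjoint (X (fst ib) - Y (fst ib))"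
        using cX cY by (intro eq_matI) auto
      then show ?thesis using True c(5)[of "fst ib"] mn2_adjoint[of "X (fst ib) - Y (fst ib)" n] cX cY by (simp add: A_def B_def)
    qed (use c(5)[of "fst ib"] in \<open>simp add: A_def B_def\<close>)
    have nPR: "mn2 n (P - R) \<le> L * \<delta>" unfolding P_def R_def by (rule LI) (use h \<delta> in auto)
    have "mn2 n (A * P - B * R) \<le> mn2 n (A * P - A * R) + mn2 n (A * R - B * R)"
      using mn2_triangle_minus[of "A * P" n "A * R" "B * R"] AB PR by simp
    also have "A * P - A * R = A * (P - R)" using AB PR by (intro mult_minus_distrib_mat[symmetric])
    also have "A * R - B * R = (A - B) * R" using AB PR by (intro minus_mult_distrib_mat[symmetric])
    also have "mn2 n (A * (P - R)) + mn2 n ((A - B) * R) \<le> \<bar>c (fst ib)\<bar> * (L * \<delta>) + \<delta> * \<bar>wcoef c w\<bar>"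
    proof (rule add_mono)
      show "mn2 n (A * (P - R)) \<le> \<bar>c (fst ib)\<bar> * (L * \<delta>)"
        by (rule order_trans[OF mn2_mult_le mult_mono]) (use AB PR nA nPR in simp_all)
      show "mn2 n ((A - B) * R) \<le> \<delta> * \<bar>wcoef c w\<bar>"
        by (rule order_trans[OF mn2_mult_le' mult_mono]) (use AB PR nAB nR \<delta> in simp_all)
    qed
    finally have "mn2 n (A * P - B * R) \<le> (\<bar>c (fst ib)\<bar> * L + \<bar>wcoef c w\<bar>) * \<delta>" by (simp add: algebra_simps)
    then show "mn2 n (mword n X (ib # w) - mword n Y (ib # w)) \<le> (\<bar>c (fst ib)\<bar> * L + \<bar>wcoef c w\<bar>) * \<delta>"
      by (simp only: eval_word_Cons mat_alg_simps A_def B_def P_def R_def)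
  qed
qed

text \<open>The constant depends on the polynomial and on the radii but not on \<open>n\<close>, so
  one tolerance serves all matrix sizes.\<close>

lemma leval_Lipschitz:
  "\<exists>L\<ge>0. \<forall>n X Y \<delta>. (\<forall>i\<in>lletters l. X i \<in> op_ball (mat_alg n) (c i) \<and> Y i \<in> op_ball (mat_alg n) (c i) \<and>
      mn2 n (X i - Y i) \<le> \<delta>) \<longrightarrow> 0 \<le> \<delta> \<longrightarrow> mn2 n (leval n X l - leval n Y l) \<le> L * \<delta>"
proof (induction l)
  case Nil
  have z: "0\<^sub>m n n - 0\<^sub>m n n = (0\<^sub>m n n :: complex mat)" for n by (intro eq_matI) auto
  show ?case by (intro exI[of _ 0]) (simp add: z)
next
  case (Cons cw l)
  then obtain L where L: "L \<ge> 0" and LI: "\<And>n X Y \<delta>. (\<forall>i\<in>lletters l. X i \<in> op_ball (mat_alg n) (c i) \<and> Y i \<in> op_ball (mat_alg n) (c i) \<and>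
      mn2 n (X i - Y i) \<le> \<delta>) \<Longrightarrow> 0 \<le> \<delta> \<Longrightarrow> mn2 n (leval n X l - leval n Y l) \<le> L * \<delta>" by blast
  obtain K where K: "K \<ge> 0" and KI: "\<And>n X Y \<delta>. (\<forall>i\<in>letters (snd cw). X i \<in> op_ball (mat_alg n) (c i) \<and> Y i \<in> op_ball (mat_alg n) (c i) \<and>
      mn2 n (X i - Y i) \<le> \<delta>) \<Longrightarrow> 0 \<le> \<delta> \<Longrightarrow> mn2 n (mword n X (snd cw) - mword n Y (snd cw)) \<le> K * \<delta>"
    using mword_Lipschitz[of "snd cw" c] by blast
  show ?case
  proof (intro exI[of _ "cmod (fst cw) * K + L"] conjI allI impI)
    show "0 \<le> cmod (fst cw) * K + L" using L K by simp
    fix n X Y \<delta>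
    assume h: "\<forall>i\<in>lletters (cw # l). X i \<in> op_ball (mat_alg n) (c i) \<and> Y i \<in> op_ball (mat_alg n) (c i) \<and> mn2 n (X i - Y i) \<le> \<delta>"
      and \<delta>: "0 \<le> \<delta>"
    have c: "X i \<in> carrier_mat n n" "Y i \<in> carrier_mat n n" if "i \<in> lletters (cw # l)" for i
      using h[rule_format, OF that] by (simp_all add: op_ball_mat_alg)
    define A B P R where "A = mword n X (snd cw)" and "B = mword n Y (snd cw)" and "P = leval n X l" and "R = leval n Y l"
    have cc: "A \<in> carrier_mat n n" "B \<in> carrier_mat n n" "P \<in> carrier_mat n n" "R \<in> carrier_mat n n"
      using c by (simp_all add: A_def B_def P_def R_def)
    have "(fst cw \<cdot>\<^sub>m A + P) - (fst cw \<cdot>\<^sub>m B + R) = fst cw \<cdot>\<^sub>m (A - B) + (P - R)"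
      using cc by (intro eq_matI) (auto simp: algebra_simps)
    then have "mn2 n ((fst cw \<cdot>\<^sub>m A + P) - (fst cw \<cdot>\<^sub>m B + R)) \<le> cmod (fst cw) * mn2 n (A - B) + mn2 n (P - R)"
      using mn2_triangle[of "fst cw \<cdot>\<^sub>m (A - B)" n "P - R"] mn2_smult[of "A - B" n "fst cw"] cc by simp
    also have "\<dots> \<le> cmod (fst cw) * (K * \<delta>) + L * \<delta>"
    proof (intro add_mono mult_left_mono)
      show "mn2 n (A - B) \<le> K * \<delta>" unfolding A_def B_def by (rule KI) (use h \<delta> in auto)
      show "mn2 n (P - R) \<le> L * \<delta>" unfolding P_def R_def by (rule LI) (use h \<delta> in auto)
    qed simp
    also have "\<dots> = (cmod (fst cw) * K + L) * \<delta>" by (simp add: algebra_simps)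
    finally show "mn2 n (leval n X (cw # l) - leval n Y (cw # l)) \<le> (cmod (fst cw) * K + L) * \<delta>"
      by (simp add: A_def B_def P_def R_def)
  qed
qed

text \<open>Turns a polynomial in variables of radii \<open>c\<close> into one in contractions at
  renamed positions: the scales go into the coefficients and \<open>f\<close> renames the letters.
  Generators indexed by \<open>I <+> J\<close> are thereby treated inside one sequence of
  contractions.\<close>

definition lrescale :: "('i \<Rightarrow> 'j) \<Rightarrow> ('i \<Rightarrow> real) \<Rightarrow> 'i lpoly \<Rightarrow> 'j lpoly" where
  "lrescale f c l = map (\<lambda>cw. (fst cw * complex_of_real (wcoef c (snd cw)), map (\<lambda>ib. (f (fst ib), snd ib)) (snd cw))) l"

lemma leval_lrescale:
  assumes "\<And>i. i \<in> lletters l \<Longrightarrow> X i = complex_of_real (c i) \<cdot>\<^sub>m Y (f i)" and Y: "\<And>j. Y j \<in> carrier_mat n n"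
  shows "leval n Y (lrescale f c l) = leval n X l"
  using assms(1)
proof (induction l)
  case (Cons cw l)
  have "mword n X (snd cw) = mword n (scaled c (\<lambda>i. Y (f i))) (snd cw)"
    by (rule eval_word_cong) (use Cons.prems in simp)
  also have "\<dots> = complex_of_real (wcoef c (snd cw)) \<cdot>\<^sub>m mword n Y (map (\<lambda>ib. (f (fst ib), snd ib)) (snd cw))"
    unfolding mword_scaled[of "\<lambda>i. Y (f i)" n c, OF Y] eval_word_relabel ..
  finally have w: "mword n X (snd cw) = \<dots>" .
  have "leval n Y (lrescale f c l) = leval n X l" by (rule Cons.IH, rule Cons.prems) simp
  then show ?case unfolding leval.simps(2) w by (simp add: lrescale_def smult_smult_mat)
qed (simp add: lrescale_def)

lemma ex_lpoly:
  "\<exists>l. lletters l = (\<Union>w\<in>Poly_Mapping.keys p. letters w) \<and> (\<forall>n X. (\<forall>i\<in>lletters l. X i \<in> carrier_mat n n) \<longrightarrow>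
    tr (mat_alg n) (eval_poly (mat_alg n) X p) = mtr n (leval n X l))"
proof -
  obtain ws where ws: "set ws = Poly_Mapping.keys p" "distinct ws" 
    using finite_distinct_list[OF finite_keys, of p] by (elim exE conjE)
  define l where "l = map (\<lambda>w. (Poly_Mapping.lookup p w, w)) ws"
  have l: "lletters l = (\<Union>w\<in>Poly_Mapping.keys p. letters w)" by (simp add: lletters_def l_def ws(1))
  have "tr (mat_alg n) (eval_poly (mat_alg n) X p) = mtr n (leval n X l)" if X: "\<forall>i\<in>lletters l. X i \<in> carrier_mat n n" for n X
  proof -
    have "tr (mat_alg n) (eval_poly (mat_alg n) X p) = (\<Sum>w\<in>Poly_Mapping.keys p. Poly_Mapping.lookup p w * mtr n (mword n X w))"
      by (rule tr_eval_poly_mat, rule X[rule_format]) (unfold l, rule UN_I)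
    also have "\<dots> = (\<Sum>w\<leftarrow>ws. Poly_Mapping.lookup p w * mtr n (mword n X w))"
      unfolding ws(1)[symmetric] by (rule sum_list_distinct_conv_sum_set[OF ws(2), symmetric])
    also have "\<dots> = mtr n (leval n X l)"
      using X by (subst mtr_leval) (simp_all add: l_def o_def)
    finally show ?thesis .
  qed
  then show ?thesis using l by (intro exI[of _ l] conjI allI impI)
qed

lemma lpoly_near:
  fixes l :: "nat lpoly"
  assumes d: "d > 0"
  shows "\<exists>N. \<forall>n X Y. sim 0 N n X Y \<longrightarrow> cmod (mtr n (leval n X l) - mtr n (leval n Y l)) \<le> d"
  using d
proof (induction l arbitrary: d)
  case (Cons cw l)
  obtain N1 where N1: "\<And>n X Y. sim 0 N1 n X Y \<Longrightarrow> cmod (mtr n (leval n X l) - mtr n (leval n Y l)) \<le> d / 2"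
    using Cons.IH[of "d / 2"] Cons.prems by auto
  obtain N2 where N2: "\<And>n X Y. sim 0 N2 n X Y \<Longrightarrow>
      cmod ((\<Sum>w\<in>{snd cw}. fst cw * mtr n (mword n X w)) - (\<Sum>w\<in>{snd cw}. fst cw * mtr n (mword n Y w))) \<le> d / 2"
    using sum_words_near[of "{snd cw}" "d / 2" "\<lambda>_. fst cw"] Cons.prems by auto
  have "cmod (mtr n (leval n X (cw # l)) - mtr n (leval n Y (cw # l))) \<le> d" if s: "sim 0 (max N1 N2) n X Y" for n X Y
  proof -
    have XY: "X i \<in> carrier_mat n n" "Y i \<in> carrier_mat n n" for i using s by (auto simp: sim_def dest: unit_tuplesD)
    have s1: "sim 0 N1 n X Y" and s2: "sim 0 N2 n X Y" using sim_mono[OF s order_refl] by simp_all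
    have "mtr n (leval n X (cw # l)) - mtr n (leval n Y (cw # l)) =
        (fst cw * mtr n (mword n X (snd cw)) - fst cw * mtr n (mword n Y (snd cw))) + (mtr n (leval n X l) - mtr n (leval n Y l))"
      using XY by (simp add: mtr_add mtr_smult)
    then show ?thesis
      using norm_triangle_ineq[of "fst cw * mtr n (mword n X (snd cw)) - fst cw * mtr n (mword n Y (snd cw))" "mtr n (leval n X l) - mtr n (leval n Y l)"]
        N1[OF s1] N2[OF s2] by simp
  qed
  then show ?case by blast
qed simp

lemma lpolys_near:
  fixes S :: "nat lpoly set"
  assumes "finite S" and d: "d > 0"
  shows "\<exists>N. \<forall>l\<in>S. \<forall>n X Y. sim 0 N n X Y \<longrightarrow> cmod (mtr n (leval n X l) - mtr n (leval n Y l)) \<le> d"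
  using assms(1)
proof (induction S rule: finite_induct)
  case (insert l S)
  obtain N1 where N1: "\<forall>n X Y. sim 0 N1 n X Y \<longrightarrow> cmod (mtr n (leval n X l) - mtr n (leval n Y l)) \<le> d"
    using lpoly_near[OF d] by blast
  obtain N2 where N2: "\<forall>l\<in>S. \<forall>n X Y. sim 0 N2 n X Y \<longrightarrow> cmod (mtr n (leval n X l) - mtr n (leval n Y l)) \<le> d"
    using insert.IH by blast
  have "sim 0 N1 n X Y" "sim 0 N2 n X Y" if "sim 0 (max N1 N2) n X Y" for n X Y
    using sim_mono[OF that order_refl] by simp_all
  then have "\<forall>k\<in>insert l S. \<forall>n X Y. sim 0 (max N1 N2) n X Y \<longrightarrow> cmod (mtr n (leval n X k) - mtr n (leval n Y k)) \<le> d"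
    using N1 N2 by simp
  then show ?case by blast
qed simp

text \<open>\<open>sim_extend\<close> applied \<open>g\<close> times, at the positions m, ..., m + g
  - 1; each application uses up one level of depth.\<close>

lemma sim_extend_block:
  assumes "sim (k + g) N n Z W" "m + g \<le> N" "\<And>i. i < g \<Longrightarrow> b i \<in> op_ball (mat_alg n) 1"
  shows "\<exists>W'. (\<forall>j<m. W' j = W j) \<and> sim k N n (\<lambda>j. if m \<le> j \<and> j < m + g then b (j - m) else Z j) W'"
  using assms
proof (induction g arbitrary: k)
  case 0
  have "(\<lambda>j. if m \<le> j \<and> j < m + 0 then b (j - m) else Z j) = Z" by (rule ext) auto
  then show ?case using 0(1) by (intro exI[of _ W]) simp
next
  case (Suc g)
  define E where "E = (\<lambda>j. if m \<le> j \<and> j < m + g then b (j - m) else Z j)"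
  obtain W' where W': "\<forall>j<m. W' j = W j" "sim (Suc k) N n E W'"
    using Suc.IH[of "Suc k"] Suc.prems unfolding E_def by auto
  have "m + g < N" "b g \<in> op_ball (mat_alg n) 1" using Suc.prems by simp_all
  from sim_extend[OF W'(2) this] obtain a where a: "sim k N n (E(m + g := b g)) (W'(m + g := a))" by blast
  have "E(m + g := b g) = (\<lambda>j. if m \<le> j \<and> j < m + Suc g then b (j - m) else Z j)"
    by (rule ext) (auto simp: E_def less_Suc_eq)
  then have "sim k N n (\<lambda>j. if m \<le> j \<and> j < m + Suc g then b (j - m) else Z j) (W'(m + g := a))" using a by (simp only:)
  moreover have "\<forall>j<m. (W'(m + g := a)) j = W j" using W'(1) by simp
  ultimately show ?case by blast
qed

text \<open>The matrices \<open>x i\<close>, rescaled to contractions, are written after the first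
  \<open>m\<close> entries of \<open>Z\<close>; this extended tuple is \<open>E\<close>. Equal codes
  of depth \<open>g\<close> then provide the corresponding extension \<open>W'\<close> of
  \<open>W\<close>.\<close>

lemma transport_tuple:
  assumes \<iota>: "bij_betw \<iota> G {m..<m + g}" and \<rho>: "\<And>i. i \<in> G \<Longrightarrow> 0 < \<rho> i" and x: "\<And>i. i \<in> G \<Longrightarrow> x i \<in> op_ball (mat_alg n) (\<rho> i)"
    and sim: "sim g N n Z W" and N: "m + g \<le> N"
  shows "\<exists>E W'. sim 0 N n E W' \<and> (\<forall>j<m. E j = Z j \<and> W' j = W j) \<and> (\<forall>i\<in>G. x i = complex_of_real (\<rho> i) \<cdot>\<^sub>m E (\<iota> i))"
proof -
  define h where "h = inv_into G \<iota>"
  have h: "h j \<in> G" "\<iota> (h j) = j" if "m \<le> j" "j < m + g" for j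
    using bij_betw_inv_into_right[OF \<iota>] bij_betwE[OF bij_betw_inv_into[OF \<iota>]] that by (auto simp: h_def)
  have hi: "h (\<iota> i) = i" "m \<le> \<iota> i" "\<iota> i < m + g" if "i \<in> G" for i
    using bij_betw_inv_into_left[OF \<iota> that] bij_betwE[OF \<iota>] that by (auto simp: h_def)
  define b where "b k = complex_of_real (1 / \<rho> (h (m + k))) \<cdot>\<^sub>m x (h (m + k))" for k
  have "b k \<in> op_ball (mat_alg n) 1" if "k < g" for k
  proof -
    have "h (m + k) \<in> G" using h that by simp
    then show ?thesis using \<rho>[of "h (m + k)"] x[of "h (m + k)"]
      by (simp add: b_def op_ball_mat_alg mat_op_norm_smult norm_divide)
  qed
  then obtain W' where W': "\<forall>j<m. W' j = W j" "sim 0 N n (\<lambda>j. if m \<le> j \<and> j < m + g then b (j - m) else Z j) W'"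
    using sim_extend_block[of 0 g N n Z W m b] sim N by auto
  have "x i = complex_of_real (\<rho> i) \<cdot>\<^sub>m (if m \<le> \<iota> i \<and> \<iota> i < m + g then b (\<iota> i - m) else Z (\<iota> i))" if i: "i \<in> G" for i
  proof -
    have "b (\<iota> i - m) = complex_of_real (1 / \<rho> i) \<cdot>\<^sub>m x i" using hi[OF i] by (simp add: b_def)
    moreover have "complex_of_real (\<rho> i) \<cdot>\<^sub>m (complex_of_real (1 / \<rho> i) \<cdot>\<^sub>m x i) = x i"
      using \<rho>[OF i] by (simp add: smult_smult_mat one_smult_mat)
    ultimately show ?thesis using hi[OF i] by simp
  qed
  then show ?thesis using W' by (intro exI[of _ "\<lambda>j. if m \<le> j \<and> j < m + g then b (j - m) else Z j"] exI[of _ W']) simp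
qed

text \<open>Turns a 2-norm distance into a trace of a polynomial, so that it is controlled by the code.\<close>

definition ldist :: "nat \<Rightarrow> nat lpoly \<Rightarrow> nat lpoly" where
  "ldist j l = (let d = (1, [(j, False)]) # lscal (-1) l in lmul (ladj d) d)"

lemma mtr_ldist:
  assumes X: "\<And>i. X i \<in> carrier_mat n n"
  shows "mtr n (leval n X (ldist j l)) = complex_of_real ((mn2 n (X j - leval n X l))\<^sup>2)"
proof -
  have "leval n X ((1, [(j, False)]) # lscal (-1) l) = X j + (-1) \<cdot>\<^sub>m leval n X l"
    using X by (simp add: leval_lscal[where n=n] one_smult_mat)
  also have "\<dots> = X j - leval n X l" using X[of j] leval_carrier[of l X n, OF X] by (intro eq_matI) auto
  finally have "leval n X ((1, [(j, False)]) # lscal (-1) l) = X j - leval n X l" .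
  then show ?thesis
    using mtr_adjoint_self[of "X j - leval n X l" n] X
    by (simp only: ldist_def Let_def leval_lmul[of X n, OF X] leval_ladj[of X n, OF X]) (simp add: X)
qed

lemma conj_by_op_ball:
  assumes V: "V \<in> unitaries n" and A: "A \<in> op_ball (mat_alg n) c"
  shows "conj_by V A \<in> op_ball (mat_alg n) c"
proof -
  have A': "A \<in> carrier_mat n n" "mat_op_norm n A \<le> c" using A by (simp_all add: op_ball_mat_alg)
  have Vc: "V \<in> carrier_mat n n" "mat_op_norm n V \<le> 1" using V unitaries_carrier unitaries_norm by auto
  have "mat_op_norm n (V * A * mat_adjoint V) \<le> mat_op_norm n (V * A) * mat_op_norm n (mat_adjoint V)"
    by (rule mat_op_norm_mult) (use Vc A' in simp_all)
  also have "\<dots> \<le> mat_op_norm n (V * A) * 1"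
    by (rule mult_left_mono) (use Vc A' in \<open>simp_all add: mat_op_norm_adjoint\<close>)
  also have "mat_op_norm n (V * A) \<le> mat_op_norm n V * mat_op_norm n A" by (rule mat_op_norm_mult) (use Vc A' in simp_all)
  also have "mat_op_norm n V * mat_op_norm n A \<le> 1 * mat_op_norm n A" by (rule mult_right_mono) (use Vc A' in simp_all)
  finally have "mat_op_norm n (conj_by V A) \<le> c" using A'(2) by (simp add: conj_by_def)
  then show ?thesis using V A'(1) by (simp add: op_ball_mat_alg)
qed

section \<open>1-bounded entropy\<close>

context ultra
begin

text \<open>Representatives are chosen for all indices, also outside \<open>K\<close>; a polynomial
  over \<open>K\<close> only evaluates entries with index in \<open>K\<close>.\<close>

lemma law_Q_cong:
  assumes X: "\<And>i. X i \<in> bs" and eq: "\<And>i. i \<in> K \<Longrightarrow> Y i = cls (X i)" and q: "q \<in> nc_polys K"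
  shows "law K Q Y q = tr Q (eval_poly Q (\<lambda>i. cls (X i)) q)"
proof -
  interpret P: pretracial Q by (rule pretracial_Q)
  have w: "eval_word Q Y w = eval_word Q (\<lambda>i. cls (X i)) w" if "w \<in> Poly_Mapping.keys q" for w
    by (rule eval_word_cong, rule eq) (use q that in \<open>auto simp: nc_polys_def\<close>)
  have c: "scal Q a (eval_word Q (\<lambda>i. cls (X i)) w) \<in> carrier Q" for a w
  proof (rule Q_inner(1))
    show "eval_word Q (\<lambda>i. cls (X i)) w \<in> carrier Q"
      using eval_word_Q[where Z = X and w = w, OF X] cls_carrier by presburger
  qed (rule P.zero_closed)
  have "eval_poly Q Y q = eval_poly Q (\<lambda>i. cls (X i)) q"
    unfolding eval_poly_def by (rule P.finsum_cong'[OF refl]) (use w c in simp_all)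
  then show ?thesis using q by (simp add: law_def)
qed

text \<open>The tuples in \<Omega> n become microstates of (X, Y): finitely many entries are
  transported from \<open>Z n\<close> to \<open>W\<close>, and the others are set to 0. Since fixed
  polynomials recover \<open>W\<close> from its microstate with a Lipschitz bound, close orbits of
  microstates force close orbits of the tuples \<open>W\<close>.\<close>

lemma h_tuple_ge:
  fixes X :: "'i \<Rightarrow> (nat \<Rightarrow> complex mat) set" and Y :: "'j \<Rightarrow> (nat \<Rightarrow> complex mat) set"
  assumes C: "0 \<le> C" and rX: "radii Q I X r" and rY: "radii Q J Y r'"
    and gen: "wstar_generated Q (X ` I) = carrier Q"
  shows "ereal C \<le> h_tuple U Q I J r r' X Y"
proof -
  define K \<rho> XX where "K = I <+> J" and "\<rho> = case_sum r r'" and "XX = case_sum X Y"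
  have \<rho>: "0 < \<rho> i" "XX i \<in> op_ball Q (\<rho> i)" if "i \<in> K" for i
    using that rX rY by (auto simp: K_def \<rho>_def XX_def radii_def)
  have "\<exists>x. x \<in> bs \<and> (i \<in> K \<longrightarrow> XX i = cls x \<and> (\<forall>n. mat_op_norm n (x n) \<le> \<rho> i))" for i
  proof (cases "i \<in> K")
    case True
    from op_ball_rep[OF \<rho>(2)[OF True] \<rho>(1)[OF True]] show ?thesis by blast
  next
    case False
    then show ?thesis using bs_const(2) by blast
  qed
  then have "\<forall>i. \<exists>x. x \<in> bs \<and> (i \<in> K \<longrightarrow> XX i = cls x \<and> (\<forall>n. mat_op_norm n (x n) \<le> \<rho> i))" ..
  from choice[OF this] obtain x where x: "\<forall>i. x i \<in> bs \<and> (i \<in> K \<longrightarrow> XX i = cls (x i) \<and> (\<forall>n. mat_op_norm n (x i n) \<le> \<rho> i))" ..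
  have xb: "x i \<in> bs" for i using x by blast
  have xXX: "XX i = cls (x i)" if "i \<in> K" for i using x that by blast
  have xball: "x i n \<in> op_ball (mat_alg n) (\<rho> i)" if "i \<in> K" for i n
    using x that bs_carrier[OF xb] by (simp add: op_ball_mat_alg)
  have InlK: "Inl i \<in> K" if "i \<in> I" for i using that unfolding K_def by (rule InlI)

  obtain m \<kappa> Z \<Omega> where \<kappa>: "\<forall>i. eventually (\<lambda>n. i \<le> \<kappa> n) U" and Z: "\<forall>n. Z n \<in> unit_tuples n"
    and sim: "\<forall>n. \<forall>W\<in>\<Omega> n. sim (\<kappa> n) (\<kappa> n) n W (Z n)"
    and pack: "eventually (\<lambda>n. packing n m (exp (C * (real n)\<^sup>2)) (\<Omega> n)) U"
    using large_similarity_classes[OF C] by blast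
  have Zb: "(\<lambda>n. Z n j) \<in> bs" for j
    by (rule bsI[where C = 1]) (use unit_tuplesD[OF Z[rule_format]] in auto)

  \<comment> \<open>Chosen with 5 \<eta> = 1/400: comparing two tuples costs 2 \<eta> for each
    recovery from a microstate and \<eta> for the distance between the microstates.\<close>
  define \<eta> :: real where "\<eta> = 1 / 2000"
  have \<eta>: "\<eta> > 0" by (simp add: \<eta>_def)
  have "(\<lambda>i. cls (x (Inl i))) ` I = X ` I"
    using xXX[OF InlK] by (intro image_cong refl) (simp add: XX_def)
  then have gen': "wstar_generated Q ((\<lambda>i. cls (x (Inl i))) ` I) = carrier Q" using gen by simp
  have "\<forall>j. \<exists>l. lletters l \<subseteq> I \<and> eventually (\<lambda>n. mn2 n (Z n j - leval n (\<lambda>i. x (Inl i) n) l) < \<eta>) U"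
    using generated_approx[OF xb gen' Zb \<eta>] by blast
  from choice[OF this] obtain l where l: "\<forall>j. lletters (l j) \<subseteq> I \<and> eventually (\<lambda>n. mn2 n (Z n j - leval n (\<lambda>i. x (Inl i) n) (l j)) < \<eta>) U" ..
  \<comment> \<open>\<open>F\<close> and \<epsilon> depend only on the polynomials
    \<open>l j\<close>, as they must be chosen before the neighborhood \<open>A\<close>.\<close>
  define F where "F = (\<Union>j<m. lletters (l j))"
  have F: "finite F" "F \<subseteq> I" unfolding F_def using l finite_lletters by auto
  have "\<forall>j. \<exists>L\<ge>0. \<forall>n A B \<delta>. (\<forall>i\<in>lletters (l j). A i \<in> op_ball (mat_alg n) (r i) \<and> B i \<in> op_ball (mat_alg n) (r i) \<and>
      mn2 n (A i - B i) \<le> \<delta>) \<longrightarrow> 0 \<le> \<delta> \<longrightarrow> mn2 n (leval n A (l j) - leval n B (l j)) \<le> L * \<delta>"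
    using leval_Lipschitz by blast
  from choice[OF this] obtain L where L: "\<forall>j. L j \<ge> 0 \<and> (\<forall>n A B \<delta>. (\<forall>i\<in>lletters (l j). A i \<in> op_ball (mat_alg n) (r i) \<and> B i \<in> op_ball (mat_alg n) (r i) \<and>
      mn2 n (A i - B i) \<le> \<delta>) \<longrightarrow> 0 \<le> \<delta> \<longrightarrow> mn2 n (leval n A (l j) - leval n B (l j)) \<le> L j * \<delta>)" ..
  define S where "S = 1 + (\<Sum>j<m. L j)"
  have S: "S > 0" unfolding S_def using L sum_nonneg[of "{..<m}" L] by (simp add: add_pos_nonneg)
  \<comment> \<open>\<open>S\<close> exceeds all Lipschitz constants, so microstates within 2
    \<epsilon> have values of \<open>l j\<close> within \<eta>. The summand 1 in \<open>S\<close>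
    keeps the denominator positive.\<close>
  define \<epsilon> where "\<epsilon> = \<eta> / (2 * S)"
  have \<epsilon>: "\<epsilon> > 0" using \<eta> S by (simp add: \<epsilon>_def)
  have L\<epsilon>: "L j * (2 * \<epsilon>) \<le> \<eta>" if "j < m" for j
  proof -
    have "L j \<le> (\<Sum>j<m. L j)" by (rule member_le_sum) (use that L in auto)
    then have "L j \<le> S" by (simp add: S_def)
    then have "L j * (2 * \<epsilon>) \<le> S * (2 * \<epsilon>)" using \<epsilon> by (intro mult_right_mono) simp_all
    also have "\<dots> = \<eta>" using S by (simp add: \<epsilon>_def)
    finally show ?thesis .
  qed

  have main: "ereal C \<le> growth_rate U (\<lambda>n. orbital_covering n I F \<epsilon> ((\<lambda>Z. \<lambda>i\<in>I. Z (Inl i)) ` law_microstates n K \<rho> A))"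
    if A: "A \<in> neighborhoods (law_topology K \<rho>) (law K Q XX)" for A
  proof (rule growth_rate_ge)
    obtain V where V: "openin (law_topology K \<rho>) V" "law K Q XX \<in> V" "V \<subseteq> A"
      using A unfolding neighborhoods_def by blast
    from V(1) obtain T where T: "openin (product_topology (\<lambda>_. euclidean) (nc_polys K)) T" "V = T \<inter> laws K \<rho>"
      unfolding law_topology_def openin_subtopology by (elim exE conjE)
    have "law K Q XX \<in> T" using V(2) T(2) by blast
    from product_topology_neighborhood[OF T(1) this] obtain \<Phi> d where \<Phi>: "finite \<Phi>" "\<Phi> \<subseteq> nc_polys K" and d: "d > 0"
      and near: "\<forall>y\<in>extensional (nc_polys K). (\<forall>q\<in>\<Phi>. dist (y q) (law K Q XX q) < d) \<longrightarrow> y \<in> T" by blast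
    have "\<forall>q :: ('i + 'j) nc_poly. \<exists>l. lletters l = (\<Union>w\<in>Poly_Mapping.keys q. letters w) \<and> (\<forall>n X. (\<forall>i\<in>lletters l. X i \<in> carrier_mat n n) \<longrightarrow>
        tr (mat_alg n) (eval_poly (mat_alg n) X q) = mtr n (leval n X l))"
      by (rule allI, rule ex_lpoly)
    from choice[OF this] obtain lq where lq: "\<forall>q :: ('i + 'j) nc_poly. lletters (lq q) = (\<Union>w\<in>Poly_Mapping.keys q. letters w) \<and>
        (\<forall>n X. (\<forall>i\<in>lletters (lq q). X i \<in> carrier_mat n n) \<longrightarrow> tr (mat_alg n) (eval_poly (mat_alg n) X q) = mtr n (leval n X (lq q)))" ..
    \<comment> \<open>All indices whose entries must be transported: those in the polynomials
      recovering \<open>Z\<close> and those in the polynomials that test membership in the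
      neighborhood.\<close>
    define G where "G = Inl ` F \<union> (\<Union>q\<in>\<Phi>. lletters (lq q))"
    have G: "finite G" unfolding G_def using F(1) \<Phi>(1) finite_lletters by auto
    have lqK: "lletters (lq q) \<subseteq> K" if "q \<in> \<Phi>" for q
      using lq \<Phi>(2) that unfolding nc_polys_def by blast
    have GK: "G \<subseteq> K" unfolding G_def using F(2) InlK lqK by blast
    define g where "g = card G"
    obtain h where h: "bij_betw h G {0..<g}" using ex_bij_betw_finite_nat[OF G] unfolding g_def by blast
    have "bij_betw (\<lambda>k. m + k) {0..<g} {m..<m + g}"
      by (rule bij_betw_byWitness[where f' = "\<lambda>k. k - m"]) auto
    from bij_betw_trans[OF h this] have bij: "bij_betw ((\<lambda>k. m + k) \<circ> h) G {m..<m + g}" .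
    define \<iota> where "\<iota> = (\<lambda>k. m + k) \<circ> h"
    define D where "D j = ldist j (lrescale (\<lambda>i. \<iota> (Inl i)) r (l j))" for j
    define R where "R q = lrescale \<iota> \<rho> (lq q)" for q
    \<comment> \<open>Squared 2-norm distances have to be preserved up to \<eta>^2 and the tested
      moments up to d / 2; the other half of \<open>d\<close> covers the passage to the
      limit.\<close>
    define \<delta> where "\<delta> = min (\<eta>\<^sup>2) (d / 2)"
    have \<delta>: "\<delta> > 0" "\<delta> \<le> \<eta>\<^sup>2" "\<delta> \<le> d / 2" using \<eta> d by (simp_all add: \<delta>_def)
    obtain N0 where N0: "\<forall>k\<in>D ` {..<m} \<union> R ` \<Phi>. \<forall>n X Y. sim 0 N0 n X Y \<longrightarrow> cmod (mtr n (leval n X k) - mtr n (leval n Y k)) \<le> \<delta>"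
      using lpolys_near[of "D ` {..<m} \<union> R ` \<Phi>", OF _ \<delta>(1)] \<Phi>(1) by blast
    define N where "N = max N0 (m + g)"
    have ev1: "eventually (\<lambda>n. \<forall>q\<in>\<Phi>. cmod (tr (mat_alg n) (eval_poly (mat_alg n) (\<lambda>i. x i n) q) - law K Q XX q) < d / 2) U"
    proof (rule eventually_ball_finite[OF \<Phi>(1)], rule ballI)
      fix q assume q: "q \<in> \<Phi>"
      have "law K Q XX q = tr Q (eval_poly Q (\<lambda>i. cls (x i)) q)"
        by (rule law_Q_cong[OF xb xXX]) (use q \<Phi>(2) in auto)
      then have "((\<lambda>n. tr (mat_alg n) (eval_poly (mat_alg n) (\<lambda>i. x i n) q)) \<longlongrightarrow> law K Q XX q) U"
        using tr_eval_poly_Q[of x q, OF xb] by simp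
      from tendstoD[OF this, of "d / 2"] d
      show "eventually (\<lambda>n. cmod (tr (mat_alg n) (eval_poly (mat_alg n) (\<lambda>i. x i n) q) - law K Q XX q) < d / 2) U"
        by (simp add: dist_norm)
    qed
    have ev2: "eventually (\<lambda>n. \<forall>j\<in>{..<m}. mn2 n (Z n j - leval n (\<lambda>i. x (Inl i) n) (l j)) < \<eta>) U"
      by (rule eventually_ball_finite) (use l in auto)
    show "eventually (\<lambda>n. \<forall>k. orbital_covering n I F \<epsilon> ((\<lambda>Z. \<lambda>i\<in>I. Z (Inl i)) ` law_microstates n K \<rho> A) = enat k \<longrightarrow>
        exp (C * (real n)\<^sup>2) \<le> real k) U"
      \<comment> \<open>Depth \<open>g\<close> allows \<open>g\<close> added entries; precision
        \<open>N\<close> covers the positions below \<open>m + g\<close> and the polynomials in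
        \<open>D\<close> and \<open>R\<close>.\<close>
      using pack ev1 ev2 U_ge[of 1] \<kappa>[rule_format, of "max g N"]
    proof eventually_elim
      case (elim n)
      define \<Xi> where "\<Xi> = (\<lambda>Z. \<lambda>i\<in>I. Z (Inl i)) ` law_microstates n K \<rho> A"
      \<comment> \<open>The relation for \<open>orbital_covering_packing\<close>: the polynomials
        \<open>l j\<close> recover \<open>W\<close> approximately from the microstate.\<close>
      define Gr where "Gr W y \<longleftrightarrow> W \<in> unit_tuples n \<and> (\<forall>j<m. mn2 n (W j - leval n y (l j)) < 2 * \<eta>)" for W y
      have lift: "\<exists>y\<in>\<Xi>. Gr W y" if W: "W \<in> \<Omega> n" for W
      proof -
        have "sim g N n (Z n) W"
          using sim_sym[OF sim_mono[OF sim[rule_format, OF W]]] elim(5) by simp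
        moreover have "0 < \<rho> i" "x i n \<in> op_ball (mat_alg n) (\<rho> i)" if "i \<in> G" for i
          using \<rho>(1) xball GK that by auto
        moreover have "m + g \<le> N" by (simp add: N_def)
        ultimately obtain E W' where s: "sim 0 N n E W'" and EW: "\<forall>j<m. E j = Z n j \<and> W' j = W j"
          and xE: "\<forall>i\<in>G. x i n = complex_of_real (\<rho> i) \<cdot>\<^sub>m E (\<iota> i)"
          using transport_tuple[OF bij, of \<rho> "\<lambda>i. x i n" n N "Z n" W] unfolding \<iota>_def by blast
        have s0: "sim 0 N0 n E W'" by (rule sim_mono[OF s]) (simp_all add: N_def)
        have ub: "E \<in> unit_tuples n" "W' \<in> unit_tuples n" using s by (auto simp: sim_def)
        have Ec: "E j \<in> carrier_mat n n" and Wc: "W' j \<in> carrier_mat n n" for j using unit_tuplesD(1)[OF ub(1)] unit_tuplesD(1)[OF ub(2)] by simp_all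
        \<comment> \<open>A microstate has entries at all indices in \<open>K\<close>, but indices
          outside \<open>G\<close> occur in none of the relevant polynomials; zeros are put
          there.\<close>
        define y where "y = (\<lambda>i\<in>K. if i \<in> G then complex_of_real (\<rho> i) \<cdot>\<^sub>m W' (\<iota> i) else 0\<^sub>m n n)"
        have yG: "y i = complex_of_real (\<rho> i) \<cdot>\<^sub>m W' (\<iota> i)" if "i \<in> G" for i
          using that GK by (auto simp: y_def)
        have yball: "y i \<in> op_ball (mat_alg n) (\<rho> i)" if i: "i \<in> K" for i
        proof (cases "i \<in> G")
          case True
          then show ?thesis unfolding yG[OF True] using \<rho>(1)[OF i] unit_tuplesD[OF ub(2)]
            by (simp add: op_ball_mat_alg mat_op_norm_smult mult_left_le)
        next
          case False
          then show ?thesis using i \<rho>(1)[OF i] by (simp add: y_def zero_op_ball)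
        qed
        have yc: "y i \<in> carrier_mat n n" if "i \<in> K" for i using yball[OF that] by (simp add: op_ball_mat_alg)
        have "law K (mat_alg n) y \<in> laws K \<rho>"
          by (rule law_mat_in_laws) (use elim(4) yball in auto)
        moreover have "law K (mat_alg n) y \<in> T"
        proof (rule near[rule_format])
          show "law K (mat_alg n) y \<in> extensional (nc_polys K)" by (simp add: law_def)
          fix q assume q: "q \<in> \<Phi>"
          then have qG: "lletters (lq q) \<subseteq> G" by (auto simp: G_def)
          have "law K (mat_alg n) y q = tr (mat_alg n) (eval_poly (mat_alg n) y q)"
            using q \<Phi>(2) by (auto simp: law_def)
          also have "\<dots> = mtr n (leval n y (lq q))" 
            by (rule lq[rule_format, THEN conjunct2, rule_format], rule yc, rule subsetD[OF lqK[OF q]])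
          also have "leval n y (lq q) = leval n W' (R q)"
            unfolding R_def by (rule leval_lrescale[symmetric]) (use yG qG Wc in auto)
          finally have 1: "law K (mat_alg n) y q = mtr n (leval n W' (R q))" .
          have "tr (mat_alg n) (eval_poly (mat_alg n) (\<lambda>i. x i n) q) = mtr n (leval n (\<lambda>i. x i n) (lq q))"
            by (rule lq[rule_format, THEN conjunct2, rule_format]) (rule bs_carrier[OF xb])
          also have "leval n (\<lambda>i. x i n) (lq q) = leval n E (R q)"
            unfolding R_def by (rule leval_lrescale[symmetric]) (use xE qG Ec in auto)
          finally have 2: "tr (mat_alg n) (eval_poly (mat_alg n) (\<lambda>i. x i n) q) = mtr n (leval n E (R q))" .
          have "cmod (mtr n (leval n E (R q)) - mtr n (leval n W' (R q))) \<le> \<delta>" using N0 s0 q by blast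
          moreover have "cmod (mtr n (leval n E (R q)) - law K Q XX q) < d / 2" using elim(2)[rule_format, OF q] unfolding 2 .
          moreover have "dist (law K (mat_alg n) y q) (law K Q XX q) \<le>
              dist (mtr n (leval n W' (R q))) (mtr n (leval n E (R q))) + dist (mtr n (leval n E (R q))) (law K Q XX q)"
            unfolding 1 by (rule dist_triangle)
          ultimately show "dist (law K (mat_alg n) y q) (law K Q XX q) < d"
            using \<delta>(3) unfolding dist_norm by (simp add: norm_minus_commute)
        qed
        ultimately have "law K (mat_alg n) y \<in> V" unfolding T(2) by blast
        moreover have "y \<in> (\<Pi>\<^sub>E i\<in>K. op_ball (mat_alg n) (\<rho> i))" using yball by (simp add: PiE_iff y_def)
        ultimately have "y \<in> law_microstates n K \<rho> A" unfolding law_microstates_def using V(3) by blast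
        then have "(\<lambda>i\<in>I. y (Inl i)) \<in> \<Xi>" unfolding \<Xi>_def by (rule imageI)
        moreover have "mn2 n (W j - leval n (\<lambda>i\<in>I. y (Inl i)) (l j)) < 2 * \<eta>" if j: "j < m" for j
        proof -
          have lj: "Inl i \<in> G" "i \<in> I" if "i \<in> lletters (l j)" for i
            using that j l unfolding G_def F_def by blast+
          have r: "\<rho> (Inl i) = r i" for i by (simp add: \<rho>_def)
          have "leval n (\<lambda>i\<in>I. y (Inl i)) (l j) = leval n W' (lrescale (\<lambda>i. \<iota> (Inl i)) r (l j))"
            by (rule leval_lrescale[symmetric]) (use lj yG Wc r in auto)
          then have 1: "complex_of_real ((mn2 n (W j - leval n (\<lambda>i\<in>I. y (Inl i)) (l j)))\<^sup>2) = mtr n (leval n W' (D j))"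
            unfolding D_def mtr_ldist[of W' n, OF Wc] using EW j by simp
          have "leval n (\<lambda>i. x (Inl i) n) (l j) = leval n E (lrescale (\<lambda>i. \<iota> (Inl i)) r (l j))"
            by (rule leval_lrescale[symmetric]) (use lj xE Ec r in auto)
          then have 2: "complex_of_real ((mn2 n (Z n j - leval n (\<lambda>i. x (Inl i) n) (l j)))\<^sup>2) = mtr n (leval n E (D j))"
            unfolding D_def mtr_ldist[of E n, OF Ec] using EW j by simp
          \<comment> \<open>Codes control the squares: a^2 \<le> b^2 + \<delta> \<le> 2 \<eta>^2,
            which is less than (2 \<eta>)^2.\<close>
          define a b where "a = mn2 n (W j - leval n (\<lambda>i\<in>I. y (Inl i)) (l j))" and "b = mn2 n (Z n j - leval n (\<lambda>i. x (Inl i) n) (l j))"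
          have "cmod (mtr n (leval n E (D j)) - mtr n (leval n W' (D j))) \<le> \<delta>" using N0 s0 j by blast
          then have "cmod (complex_of_real (b\<^sup>2) - complex_of_real (a\<^sup>2)) \<le> \<delta>" unfolding 1[symmetric] 2[symmetric] a_def b_def .
          then have "\<bar>b\<^sup>2 - a\<^sup>2\<bar> \<le> \<delta>" by (simp only: norm_of_real flip: of_real_diff)
          moreover have "b < \<eta>" "0 \<le> b" using elim(3) j by (simp_all add: b_def)
          then have "b\<^sup>2 \<le> \<eta>\<^sup>2" by (intro power_mono) simp_all
          moreover have "(2 * \<eta>)\<^sup>2 = 4 * \<eta>\<^sup>2" "\<eta>\<^sup>2 > 0" using \<eta> by (simp_all add: power_mult_distrib)
          ultimately have "a\<^sup>2 < (2 * \<eta>)\<^sup>2" using \<delta>(2) by linarith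
          then show ?thesis unfolding a_def[symmetric] by (rule power2_less_imp_less) (use \<eta> in simp)
        qed
        moreover have "W \<in> unit_tuples n" using sim[rule_format, OF W] by (simp add: sim_def)
        ultimately show ?thesis unfolding Gr_def by blast
      qed
      have \<Xi>ball: "y i \<in> op_ball (mat_alg n) (r i)" if "y \<in> \<Xi>" "i \<in> I" for y i
      proof -
        obtain z where z: "z \<in> law_microstates n K \<rho> A" "y = (\<lambda>i\<in>I. z (Inl i))" using \<open>y \<in> \<Xi>\<close> unfolding \<Xi>_def by blast
        have "z (Inl i) \<in> op_ball (mat_alg n) (\<rho> (Inl i))" using z(1) InlK[OF that(2)] unfolding law_microstates_def by blast
        then show ?thesis using z(2) that(2) by (simp add: \<rho>_def)
      qed
      have \<Xi>c: "y i \<in> carrier_mat n n" if "y \<in> \<Xi>" "i \<in> I" for y i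
        using \<Xi>ball[OF that] by (simp add: op_ball_mat_alg)
      have sep: "near_orbit n m W W'"
        if W: "Gr W y" and W': "Gr W' y'" and y: "y \<in> \<Xi>" and y': "y' \<in> \<Xi>" and V: "V \<in> unitaries n"
          and close: "\<forall>i\<in>F. mn2 n (y i - conj_by V (y' i)) < 2 * \<epsilon>" for W W' y y' V
      proof -
        have "mn2 n (W j - conj_by V (W' j)) < 1 / 400" if j: "j < m" for j
        proof -
          have lF: "i \<in> F" "i \<in> I" if "i \<in> lletters (l j)" for i using that j l unfolding F_def by blast+
          have c: "W j \<in> carrier_mat n n" "W' j \<in> carrier_mat n n" using W W' unit_tuplesD(1) by (auto simp: Gr_def)
          have lc: "leval n y (l j) \<in> carrier_mat n n" "leval n y' (l j) \<in> carrier_mat n n"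
            using \<Xi>c[OF y lF(2)] \<Xi>c[OF y' lF(2)] by simp_all
          have vball: "conj_by V (y' i) \<in> op_ball (mat_alg n) (r i)" if "i \<in> I" for i
            using conj_by_op_ball[OF V \<Xi>ball[OF y' that]] .
          have "mn2 n (leval n y (l j) - leval n (\<lambda>i. conj_by V (y' i)) (l j)) \<le> L j * (2 * \<epsilon>)"
          proof (rule L[rule_format, THEN conjunct2, rule_format])
            fix i assume i: "i \<in> lletters (l j)"
            show "y i \<in> op_ball (mat_alg n) (r i) \<and> conj_by V (y' i) \<in> op_ball (mat_alg n) (r i) \<and> mn2 n (y i - conj_by V (y' i)) \<le> 2 * \<epsilon>"
              using \<Xi>ball[OF y lF(2)[OF i]] vball[OF lF(2)[OF i]] close lF(1)[OF i] by fastforce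
          qed (use \<epsilon> in simp)
          also have "\<dots> \<le> \<eta>" by (rule L\<epsilon>[OF j])
          also have "leval n (\<lambda>i. conj_by V (y' i)) (l j) = conj_by V (leval n y' (l j))"
            by (rule leval_conj[OF V \<Xi>c[OF y' lF(2)]])
          finally have 1: "mn2 n (leval n y (l j) - conj_by V (leval n y' (l j))) \<le> \<eta>" .
          have "mn2 n (conj_by V (leval n y' (l j)) - conj_by V (W' j)) = mn2 n (leval n y' (l j) - W' j)"
            using conj_by_minus[OF V lc(2) c(2)] mn2_conj[OF V, of "leval n y' (l j) - W' j"] lc c by simp
          also have "\<dots> < 2 * \<eta>" using W' j mn2_minus_commute[OF lc(2) c(2)] by (simp add: Gr_def)
          finally have 2: "mn2 n (conj_by V (leval n y' (l j)) - conj_by V (W' j)) < 2 * \<eta>" .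
          have 3: "mn2 n (W j - leval n y (l j)) < 2 * \<eta>" using W j by (simp add: Gr_def)
          have vc: "conj_by V (leval n y' (l j)) \<in> carrier_mat n n" "conj_by V (W' j) \<in> carrier_mat n n" using V lc c by simp_all
          have "mn2 n (W j - conj_by V (W' j)) < 5 * \<eta>"
            using mn2_triangle_minus[OF c(1) lc(1) vc(2)] mn2_triangle_minus[OF lc(1) vc(1) vc(2)] 1 2 3 by linarith
          then show ?thesis by (simp add: \<eta>_def)
        qed
        then show ?thesis unfolding near_orbit_def using V by blast
      qed
      show ?case
      proof (intro allI impI)
        fix k assume k: "orbital_covering n I F \<epsilon> ((\<lambda>Z. \<lambda>i\<in>I. Z (Inl i)) ` law_microstates n K \<rho> A) = enat k"
        show "exp (C * (real n)\<^sup>2) \<le> real k"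
        proof (rule orbital_covering_packing[where G = Gr, OF elim(1) _ _ F(2) _ k[folded \<Xi>_def]])
          show "\<exists>y\<in>\<Xi>. Gr W y" if "W \<in> \<Omega> n" for W by (rule lift[OF that])
          show "y i \<in> carrier_mat n n" if "y \<in> \<Xi>" "i \<in> F" for y i by (rule \<Xi>c[OF that(1) subsetD[OF F(2) that(2)]])
          show "near_orbit n m W W'" if "Gr W y" "Gr W' y'" "y \<in> \<Xi>" "y' \<in> \<Xi>" "V \<in> unitaries n"
            "\<forall>i\<in>F. mn2 n (y i - conj_by V (y' i)) < 2 * \<epsilon>" for W W' y y' V
            by (rule sep[OF that])
        qed
      qed
    qed
  qed
  have "ereal C \<le> (INF A\<in>neighborhoods (law_topology K \<rho>) (law K Q XX).
      growth_rate U (\<lambda>n. orbital_covering n I F \<epsilon> ((\<lambda>Z. \<lambda>i\<in>I. Z (Inl i)) ` law_microstates n K \<rho> A)))"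
    by (rule INF_greatest) (rule main)
  then show ?thesis
    unfolding h_tuple_def K_def[symmetric] \<rho>_def[symmetric] XX_def[symmetric]
    by (intro SUP_upper2[of \<epsilon>] SUP_upper2[of F]) (use \<epsilon> F in simp_all)
qed

section \<open>Infinite entropy of the ultraproduct\<close>

lemma h_tuple_infinite:
  assumes "radii Q I X r" "radii Q J Y r'" "wstar_generated Q (X ` I) = carrier Q"
  shows "h_tuple U Q I J r r' X Y = \<infinity>"
proof (rule ereal_top)
  fix B
  have "ereal B \<le> ereal (max 0 B)" by simp
  also have "\<dots> \<le> h_tuple U Q I J r r' X Y" by (rule h_tuple_ge) (use assms in simp_all)
  finally show "ereal B \<le> h_tuple U Q I J r r' X Y" .
qed

lemma Ent_infinite: "Ent U (carrier Q) Q = \<infinity>"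
proof (rule ereal_top)
  fix B
  have "ereal B \<le> ereal (max 0 B)" by simp
  also have "\<dots> \<le> Ent U (carrier Q) Q" by (rule Ent_ge) simp
  finally show "ereal B \<le> Ent U (carrier Q) Q" .
qed

text \<open>Every admissible choice of generators has the value \<infinity>. For the description to
  single it out, at least one admissible choice must exist: both families are taken to be all
  elements of the algebra, indexed by themselves.\<close>

lemma h_presence_infinite: "h_presence U (carrier Q) Q = \<infinity>"
  unfolding h_presence_def
proof (rule the_equality)
  show "\<forall>I J X Y r r'. radii Q I X r \<and> radii Q J Y r' \<and> wstar_generated Q (X ` I) = carrier Q \<and>
      wstar_generated Q (X ` I \<union> Y ` J) = carrier Q \<longrightarrow> h_tuple U Q I J r r' X Y = \<infinity>"
    using h_tuple_infinite by blast
next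
  fix v
  assume v: "\<forall>(I :: (nat \<Rightarrow> complex mat) set set) (J :: (nat \<Rightarrow> complex mat) set set) X Y r r'.
      radii Q I X r \<and> radii Q J Y r' \<and> wstar_generated Q (X ` I) = carrier Q \<and>
      wstar_generated Q (X ` I \<union> Y ` J) = carrier Q \<longrightarrow> h_tuple U Q I J r r' X Y = v"
  \<comment> \<open>The summand 1 makes the radius positive also for the zero element.\<close>
  define r where "r a = cnorm Q a + 1" for a
  have rad: "radii Q (carrier Q) (\<lambda>a. a) r"
    unfolding radii_def
  proof
    fix a assume a: "a \<in> carrier Q"
    then obtain x where x: "x \<in> bs" "a = cls x" by (rule carrierQ_E)
    then show "0 < r a \<and> a \<in> op_ball Q (r a)" using cnorm_Q_nonneg[OF x(1)] a by (simp add: r_def op_ball_def)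
  qed
  have "h_tuple U Q (carrier Q) (carrier Q) r r (\<lambda>a. a) (\<lambda>a. a) = v"
    using v rad wstar_generated_carrier by simp
  moreover have "h_tuple U Q (carrier Q) (carrier Q) r r (\<lambda>a. a) (\<lambda>a. a) = \<infinity>"
    by (rule h_tuple_infinite[OF rad rad]) (simp add: wstar_generated_carrier)
  ultimately show "v = \<infinity>" by simp
qed

end

theorem corollary1p2:
  fixes U :: "nat filter"
  assumes "free_ultrafilter U"
  shows "h_presence U (carrier (matrix_ultraproduct U)) (matrix_ultraproduct U) = \<infinity> \<and>
    Ent U (carrier (matrix_ultraproduct U)) (matrix_ultraproduct U) = \<infinity> \<and>
    \<not> strongly_1_bounded (matrix_ultraproduct U)"
proof -
  interpret ultra U by standard (rule assms)
  have "h_presence U (carrier Q) Q \<le> h_total Q"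
    unfolding h_total_def by (rule SUP_upper) (use assms in simp)
  then have "\<not> strongly_1_bounded Q" by (simp add: strongly_1_bounded_def h_presence_infinite)
  then show ?thesis using h_presence_infinite Ent_infinite by blast
qed

end
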